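(* Let $\mathcal T$ be an essentially small triangulated category and let $\mathcal U,\mathcal V\in\mathrm{Thick}\,\mathcal T$ be commuting. Then there are canonical long exact sequences of functors $\mathrm{Coh}\,\mathcal T\to\mathrm{Coh}\,\mathcal T$ $$\cdots\to\Sigma^{-1}L_{\mathcal U\vee\mathcal V}\to L_{\mathcal U\wedge\mathcal V}\xrightarrow{(1)} L_{\mathcal U}\oplus L_{\mathcal V}\to L_{\mathcal U\vee\mathcal V}\to\Sigma L_{\mathcal U\wedge\mathcal V}\to\cdots$$ and $$\cdots\to\Sigma^{-1}\Gamma_{\mathcal U\vee\mathcal V}\to \Gamma_{\mathcal U\wedge\mathcal V}\xrightarrow{(2)} \Gamma_{\mathcal U}\oplus \Gamma_{\mathcal V}\to \Gamma_{\mathcal U\vee\mathcal V}\to\Sigma \Gamma_{\mathcal U\wedge\mathcal V}\to\cdots$$ where $(1)$ and $(2)$ are induced by the inclusions $\mathcal U\wedge\mathcal V\subseteq\mathcal U$ and $\mathcal U\wedge\mathcal V\subseteq\mathcal V$.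
   Context: $\mathrm{Thick}\,\mathcal T$ is the lattice of thick subcategories (full triangulated, closed under direct summands); $\mathcal U\wedge\mathcal V$ is the intersection and $\mathcal U\vee\mathcal V$ the smallest thick subcategory containing both. The pair $\mathcal U,\mathcal V$ is commuting if every morphism between an object of $\mathcal U$ and an object of $\mathcal V$ (in either direction) factors through an object of $\mathcal U\wedge\mathcal V$. $\mathrm{Coh}\,\mathcal T$ is the category of cohomological functors $\mathcal T^{\mathrm{op}}\to\mathrm{Ab}$ (taking exact triangles to exact sequences), with $\Sigma F=F\circ\Sigma^{-1}$; it has filtered colimits, computed pointwise, and every object is a filtered colimit of representables $H_X=\mathrm{Hom}_{\mathcal T}(-,X)$. An exact functor $f\colon\mathcal A\to\mathcal B$ gives $f_*\colon\mathrm{Coh}\,\mathcal B\to\mathrm{Coh}\,\mathcal A$, $G\mapsto G\circ f$, with left adjoint $f^*(F)=\mathrm{colim}_{H_X\to F}H_{f(X)}$. For a triangulated subcategory $\mathcal S\subseteq\mathcal T$ with inclusion $i$ and Verdier quotient functor $q\colon\mathcal T\to\mathcal T/\mathcal S$, set $\Gamma_{\mathcal S}=i^*\circ i_*$ and $L_{\mathcal S}=q_*\circ q^*$, with counit $\Gamma_{\mathcal S}\to\mathrm{Id}$ and unit $\mathrm{Id}\to L_{\mathcal S}$. An inclusion $\mathcal S_1\subseteq\mathcal S_2$ induces canonical morphisms $\Gamma_{\mathcal S_1}\to\Gamma_{\mathcal S_2}$ and $L_{\mathcal S_1}\to L_{\mathcal S_2}$ compatible with these. A sequence of functors $\mathrm{Coh}\,\mathcal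 T\to\mathrm{Coh}\,\mathcal T$ is exact if it is exact after evaluation at every $F\in\mathrm{Coh}\,\mathcal T$ and every object of $\mathcal T$. *)

theory Defs
  imports "HOL-Algebra.Coset"
begin

section \<open>Preadditive categories and additive functors\<close>

text \<open>
  Hom-sets are abelian groups (commutative groups of HOL-Algebra, hence written multiplicatively).
  They need not be disjoint, so composition \<open>Cmp C X Y Z g f\<close> of \<open>f : X \<rightarrow> Y\<close> and
  \<open>g : Y \<rightarrow> Z\<close> is indexed by the objects.
\<close>

record ('o, 'm) acat =
  Obj :: "'o set"
  Hom :: "'o \<Rightarrow> 'o \<Rightarrow> 'm monoid"
  Idt :: "'o \<Rightarrow> 'm"
  Cmp :: "'o \<Rightarrow> 'o \<Rightarrow> 'o \<Rightarrow> 'm \<Rightarrow> 'm \<Rightarrow> 'm"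

abbreviation Mor :: "('o, 'm, 'z) acat_scheme \<Rightarrow> 'o \<Rightarrow> 'o \<Rightarrow> 'm set" where
  "Mor C X Y \<equiv> carrier (Hom C X Y)"

locale preadditive_category =
  fixes C :: "('o, 'm, 'z) acat_scheme"
  assumes hom_group: "\<lbrakk>X \<in> Obj C; Y \<in> Obj C\<rbrakk> \<Longrightarrow> comm_group (Hom C X Y)"
    and idt_in: "X \<in> Obj C \<Longrightarrow> Idt C X \<in> Mor C X X"
    and cmp_in: "\<lbrakk>X \<in> Obj C; Y \<in> Obj C; Z \<in> Obj C; f \<in> Mor C X Y; g \<in> Mor C Y Z\<rbrakk>
        \<Longrightarrow> Cmp C X Y Z g f \<in> Mor C X Z"
    and idt_left: "\<lbrakk>X \<in> Obj C; Y \<in> Obj C; f \<in> Mor C X Y\<rbrakk> \<Longrightarrow> Cmp C X Y Y (Idt C Y) f = f"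
    and idt_right: "\<lbrakk>X \<in> Obj C; Y \<in> Obj C; f \<in> Mor C X Y\<rbrakk> \<Longrightarrow> Cmp C X X Y f (Idt C X) = f"
    and cmp_assoc: "\<lbrakk>W \<in> Obj C; X \<in> Obj C; Y \<in> Obj C; Z \<in> Obj C;
        f \<in> Mor C W X; g \<in> Mor C X Y; h \<in> Mor C Y Z\<rbrakk>
        \<Longrightarrow> Cmp C W X Z (Cmp C X Y Z h g) f = Cmp C W Y Z h (Cmp C W X Y g f)"
    and cmp_add_left: "\<lbrakk>X \<in> Obj C; Y \<in> Obj C; Z \<in> Obj C; f \<in> Mor C X Y; g \<in> Mor C Y Z; g' \<in> Mor C Y Z\<rbrakk>
        \<Longrightarrow> Cmp C X Y Z (g \<otimes>\<^bsub>Hom C Y Z\<^esub> g') f = Cmp C X Y Z g f \<otimes>\<^bsub>Hom C X Z\<^esub> Cmp C X Y Z g' f"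
    and cmp_add_right: "\<lbrakk>X \<in> Obj C; Y \<in> Obj C; Z \<in> Obj C; f \<in> Mor C X Y; f' \<in> Mor C X Y; g \<in> Mor C Y Z\<rbrakk>
        \<Longrightarrow> Cmp C X Y Z g (f \<otimes>\<^bsub>Hom C X Y\<^esub> f') = Cmp C X Y Z g f \<otimes>\<^bsub>Hom C X Z\<^esub> Cmp C X Y Z g f'"

definition inverse_mors :: "('o, 'm, 'z) acat_scheme \<Rightarrow> 'o \<Rightarrow> 'o \<Rightarrow> 'm \<Rightarrow> 'm \<Rightarrow> bool" where
  "inverse_mors C X Y f g \<longleftrightarrow> f \<in> Mor C X Y \<and> g \<in> Mor C Y X \<and>
     Cmp C X Y X g f = Idt C X \<and> Cmp C Y X Y f g = Idt C Y"

definition iso_mor :: "('o, 'm, 'z) acat_scheme \<Rightarrow> 'o \<Rightarrow> 'o \<Rightarrow> 'm \<Rightarrow> bool" where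
  "iso_mor C X Y f \<longleftrightarrow> (\<exists>g. inverse_mors C X Y f g)"

definition zero_object :: "('o, 'm, 'z) acat_scheme \<Rightarrow> 'o \<Rightarrow> bool" where
  "zero_object C Z \<longleftrightarrow> Z \<in> Obj C \<and> (\<forall>X\<in>Obj C. (\<exists>!f. f \<in> Mor C X Z) \<and> (\<exists>!f. f \<in> Mor C Z X))"

definition biproduct ::
  "('o, 'm, 'z) acat_scheme \<Rightarrow> 'o \<Rightarrow> 'o \<Rightarrow> 'o \<Rightarrow> 'm \<Rightarrow> 'm \<Rightarrow> 'm \<Rightarrow> 'm \<Rightarrow> bool" where
  "biproduct C A B P i j p q \<longleftrightarrow>
     i \<in> Mor C A P \<and> j \<in> Mor C B P \<and> p \<in> Mor C P A \<and> q \<in> Mor C P B \<and>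
     Cmp C A P A p i = Idt C A \<and> Cmp C B P B q j = Idt C B \<and>
     Cmp C P A P i p \<otimes>\<^bsub>Hom C P P\<^esub> Cmp C P B P j q = Idt C P"

record ('a, 'm, 'b, 'n) func =
  fob :: "'a \<Rightarrow> 'b"
  fmor :: "'a \<Rightarrow> 'a \<Rightarrow> 'm \<Rightarrow> 'n"

locale additive_functor =
  C: preadditive_category C + D: preadditive_category D
  for C :: "('a, 'm, 'z) acat_scheme" and D :: "('b, 'n, 'w) acat_scheme" +
  fixes f :: "('a, 'm, 'b, 'n) func"
  assumes fob_in: "X \<in> Obj C \<Longrightarrow> fob f X \<in> Obj D"
    and fmor_hom: "\<lbrakk>X \<in> Obj C; Y \<in> Obj C\<rbrakk> \<Longrightarrow> fmor f X Y \<in> hom (Hom C X Y) (Hom D (fob f X) (fob f Y))"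
    and fmor_idt: "X \<in> Obj C \<Longrightarrow> fmor f X X (Idt C X) = Idt D (fob f X)"
    and fmor_cmp: "\<lbrakk>X \<in> Obj C; Y \<in> Obj C; Z \<in> Obj C; u \<in> Mor C X Y; v \<in> Mor C Y Z\<rbrakk>
        \<Longrightarrow> fmor f X Z (Cmp C X Y Z v u)
          = Cmp D (fob f X) (fob f Y) (fob f Z) (fmor f Y Z v) (fmor f X Y u)"

definition fid :: "('a, 'm, 'a, 'm) func" where
  "fid = \<lparr>fob = (\<lambda>X. X), fmor = (\<lambda>X Y u. u)\<rparr>"

definition fcomp :: "('b, 'n, 'c, 'k) func \<Rightarrow> ('a, 'm, 'b, 'n) func \<Rightarrow> ('a, 'm, 'c, 'k) func" where
  "fcomp g f = \<lparr>fob = (\<lambda>X. fob g (fob f X)),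
     fmor = (\<lambda>X Y u. fmor g (fob f X) (fob f Y) (fmor f X Y u))\<rparr>"

primrec fpow :: "nat \<Rightarrow> ('a, 'm, 'a, 'm) func \<Rightarrow> ('a, 'm, 'a, 'm) func" where
  "fpow 0 f = fid"
| "fpow (Suc k) f = fcomp (fpow k f) f"

definition nat_transf ::
  "('a, 'm, 'z) acat_scheme \<Rightarrow> ('b, 'n, 'w) acat_scheme \<Rightarrow> ('a, 'm, 'b, 'n) func \<Rightarrow> ('a, 'm, 'b, 'n) func
    \<Rightarrow> ('a \<Rightarrow> 'n) \<Rightarrow> bool" where
  "nat_transf C D f g \<tau> \<longleftrightarrow> additive_functor C D f \<and> additive_functor C D g \<and>
     (\<forall>X\<in>Obj C. \<tau> X \<in> Mor D (fob f X) (fob g X)) \<and>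
     (\<forall>X\<in>Obj C. \<forall>Y\<in>Obj C. \<forall>u\<in>Mor C X Y.
        Cmp D (fob f X) (fob f Y) (fob g Y) (\<tau> Y) (fmor f X Y u)
        = Cmp D (fob f X) (fob g X) (fob g Y) (fmor g X Y u) (\<tau> X))"

definition nat_iso ::
  "('a, 'm, 'z) acat_scheme \<Rightarrow> ('b, 'n, 'w) acat_scheme \<Rightarrow> ('a, 'm, 'b, 'n) func \<Rightarrow> ('a, 'm, 'b, 'n) func
    \<Rightarrow> ('a \<Rightarrow> 'n) \<Rightarrow> bool" where
  "nat_iso C D f g \<tau> \<longleftrightarrow> nat_transf C D f g \<tau> \<and> (\<forall>X\<in>Obj C. iso_mor D (fob f X) (fob g X) (\<tau> X))"

section \<open>Triangulated categories\<close>

text \<open>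
  The suspension is an equivalence, not necessarily an automorphism. A quasi-inverse \<open>Des\<close>
  (the functor \<open>\<Sigma>\<^sup>-\<^sup>1\<close>) is part of the data, together with the isomorphisms
  \<open>X \<cong> \<Sigma>\<^sup>-\<^sup>1\<Sigma>X\<close> and \<open>\<Sigma>\<Sigma>\<^sup>-\<^sup>1X \<cong> X\<close>. An element \<open>(X, Y, Z, f, g, h)\<close> of \<open>Tri\<close> is an exact
  triangle \<open>X \<rightarrow> Y \<rightarrow> Z \<rightarrow> \<Sigma>X\<close>.
\<close>

record ('o, 'm) tcat = "('o, 'm) acat" +
  Sus :: "('o, 'm, 'o, 'm) func"
  Des :: "('o, 'm, 'o, 'm) func"
  Unit :: "'o \<Rightarrow> 'm"
  Counit :: "'o \<Rightarrow> 'm"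
  Tri :: "('o \<times> 'o \<times> 'o \<times> 'm \<times> 'm \<times> 'm) set"

locale triangulated_category = preadditive_category T
  for T :: "('o, 'm) tcat" +
  assumes zero_ex: "\<exists>Z. zero_object T Z"
    and biproduct_ex: "\<lbrakk>A \<in> Obj T; B \<in> Obj T\<rbrakk> \<Longrightarrow> \<exists>P\<in>Obj T. \<exists>i j p q. biproduct T A B P i j p q"
    and Sus_functor: "additive_functor T T (Sus T)"
    and Des_functor: "additive_functor T T (Des T)"
    and Unit_iso: "nat_iso T T fid (fcomp (Des T) (Sus T)) (Unit T)"
    and Counit_iso: "nat_iso T T (fcomp (Sus T) (Des T)) fid (Counit T)"
    and Tri_typed: "(X, Y, Z, f, g, h) \<in> Tri T \<Longrightarrow>
        X \<in> Obj T \<and> Y \<in> Obj T \<and> Z \<in> Obj T \<and>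
        f \<in> Mor T X Y \<and> g \<in> Mor T Y Z \<and> h \<in> Mor T Z (fob (Sus T) X)"
    and TR1_iso: "\<lbrakk>(X, Y, Z, f, g, h) \<in> Tri T;
        X' \<in> Obj T; Y' \<in> Obj T; Z' \<in> Obj T;
        f' \<in> Mor T X' Y'; g' \<in> Mor T Y' Z'; h' \<in> Mor T Z' (fob (Sus T) X');
        iso_mor T X X' a; iso_mor T Y Y' b; iso_mor T Z Z' c;
        Cmp T X Y Y' b f = Cmp T X X' Y' f' a;
        Cmp T Y Z Z' c g = Cmp T Y Y' Z' g' b;
        Cmp T Z (fob (Sus T) X) (fob (Sus T) X') (fmor (Sus T) X X' a) h
          = Cmp T Z Z' (fob (Sus T) X') h' c\<rbrakk>
        \<Longrightarrow> (X', Y', Z', f', g', h') \<in> Tri T"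
    and TR1_idt: "\<lbrakk>X \<in> Obj T; zero_object T Z; g \<in> Mor T X Z; h \<in> Mor T Z (fob (Sus T) X)\<rbrakk>
        \<Longrightarrow> (X, X, Z, Idt T X, g, h) \<in> Tri T"
    and TR1_cone: "\<lbrakk>X \<in> Obj T; Y \<in> Obj T; f \<in> Mor T X Y\<rbrakk> \<Longrightarrow> \<exists>Z g h. (X, Y, Z, f, g, h) \<in> Tri T"
    and TR2: "\<lbrakk>X \<in> Obj T; Y \<in> Obj T; Z \<in> Obj T;
        f \<in> Mor T X Y; g \<in> Mor T Y Z; h \<in> Mor T Z (fob (Sus T) X)\<rbrakk> \<Longrightarrow>
        (X, Y, Z, f, g, h) \<in> Tri T \<longleftrightarrow>
        (Y, Z, fob (Sus T) X, g, h,
          inv\<^bsub>Hom T (fob (Sus T) X) (fob (Sus T) Y)\<^esub> (fmor (Sus T) X Y f)) \<in> Tri T"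
    and TR3: "\<lbrakk>(X, Y, Z, f, g, h) \<in> Tri T; (X', Y', Z', f', g', h') \<in> Tri T;
        a \<in> Mor T X X'; b \<in> Mor T Y Y'; Cmp T X Y Y' b f = Cmp T X X' Y' f' a\<rbrakk> \<Longrightarrow>
        \<exists>c\<in>Mor T Z Z'. Cmp T Y Z Z' c g = Cmp T Y Y' Z' g' b \<and>
          Cmp T Z (fob (Sus T) X) (fob (Sus T) X') (fmor (Sus T) X X' a) h
            = Cmp T Z Z' (fob (Sus T) X') h' c"
    and TR4: "\<lbrakk>(X, Y, A, f, f', f'') \<in> Tri T; (Y, Z, B, g, g', g'') \<in> Tri T;
        (X, Z, E, Cmp T X Y Z g f, h', h'') \<in> Tri T\<rbrakk> \<Longrightarrow>
        \<exists>u v. (A, E, B, u, v, Cmp T B (fob (Sus T) Y) (fob (Sus T) A) (fmor (Sus T) Y A f') g'') \<in> Tri T \<and>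
          Cmp T Y A E u f' = Cmp T Y Z E h' g \<and>
          Cmp T A E (fob (Sus T) X) h'' u = f'' \<and>
          Cmp T Z E B v h' = g' \<and>
          Cmp T E B (fob (Sus T) Y) g'' v
            = Cmp T E (fob (Sus T) X) (fob (Sus T) Y) (fmor (Sus T) X Y f) h''"

text \<open>
  The type \<open>'x\<close> plays the role of the universe: a set is small if it injects into \<open>'x\<close>, and \<open>Ab\<close>
  is the category of abelian groups whose carrier is a set of elements of \<open>'x\<close>.
\<close>

definition small :: "'x itself \<Rightarrow> 'a set \<Rightarrow> bool" where
  "small _ A \<longleftrightarrow> (\<exists>e :: 'a \<Rightarrow> 'x. inj_on e A)"

definition essentially_small :: "'x itself \<Rightarrow> ('o, 'm, 'z) acat_scheme \<Rightarrow> bool" where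
  "essentially_small u C \<longleftrightarrow>
     (\<exists>R \<subseteq> Obj C. small u R \<and> (\<forall>X\<in>R. \<forall>Y\<in>R. small u (Mor C X Y)) \<and>
        (\<forall>X\<in>Obj C. \<exists>Y\<in>R. \<exists>f. iso_mor C X Y f))"

text \<open>Full subcategories are given by their sets of objects.\<close>

definition full_sub :: "('o, 'm, 'z) acat_scheme \<Rightarrow> 'o set \<Rightarrow> ('o, 'm) acat" where
  "full_sub C S = \<lparr>Obj = S, Hom = Hom C, Idt = Idt C, Cmp = Cmp C\<rparr>"

definition triangulated_sub :: "('o, 'm) tcat \<Rightarrow> 'o set \<Rightarrow> bool" where
  "triangulated_sub T S \<longleftrightarrow> S \<subseteq> Obj T \<and> S \<noteq> {} \<and>
     (\<forall>X\<in>S. fob (Sus T) X \<in> S \<and> fob (Des T) X \<in> S) \<and>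
     (\<forall>X Y Z f g h. (X, Y, Z, f, g, h) \<in> Tri T \<longrightarrow>
        (X \<in> S \<and> Y \<in> S \<longrightarrow> Z \<in> S) \<and> (Y \<in> S \<and> Z \<in> S \<longrightarrow> X \<in> S) \<and> (X \<in> S \<and> Z \<in> S \<longrightarrow> Y \<in> S))"

definition thick :: "('o, 'm) tcat \<Rightarrow> 'o set \<Rightarrow> bool" where
  "thick T S \<longleftrightarrow> triangulated_sub T S \<and>
     (\<forall>A\<in>Obj T. \<forall>B\<in>Obj T. \<forall>P\<in>S. (\<exists>i j p q. biproduct T A B P i j p q) \<longrightarrow> A \<in> S)"

definition thick_meet :: "('o, 'm) tcat \<Rightarrow> 'o set \<Rightarrow> 'o set \<Rightarrow> 'o set" where
  "thick_meet T U V = U \<inter> V"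

definition thick_join :: "('o, 'm) tcat \<Rightarrow> 'o set \<Rightarrow> 'o set \<Rightarrow> 'o set" where
  "thick_join T U V = \<Inter>{W. thick T W \<and> U \<subseteq> W \<and> V \<subseteq> W}"

definition commuting_pair :: "('o, 'm) tcat \<Rightarrow> 'o set \<Rightarrow> 'o set \<Rightarrow> bool" where
  "commuting_pair T U V \<longleftrightarrow>
     (\<forall>X Y. (X \<in> U \<and> Y \<in> V \<or> X \<in> V \<and> Y \<in> U) \<longrightarrow>
        (\<forall>f\<in>Mor T X Y. \<exists>W\<in>thick_meet T U V. \<exists>g\<in>Mor T X W. \<exists>h\<in>Mor T W Y. f = Cmp T X W Y h g))"

section \<open>Verdier quotients\<close>

text \<open>
  The Verdier quotient by \<open>S\<close> has the same objects; a morphism \<open>X \<rightarrow> Y\<close> is an equivalence class of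
  roofs \<open>(Z, s, f)\<close>, i.e. \<open>X \<leftarrow> Z \<rightarrow> Y\<close> with \<open>s : Z \<rightarrow> X\<close> having its cone in \<open>S\<close>.
\<close>

definition cone_in :: "('o, 'm) tcat \<Rightarrow> 'o set \<Rightarrow> 'o \<Rightarrow> 'o \<Rightarrow> 'm set" where
  "cone_in T S X Y = {s. \<exists>Z\<in>S. \<exists>g h. (X, Y, Z, s, g, h) \<in> Tri T}"

definition roofs :: "('o, 'm) tcat \<Rightarrow> 'o set \<Rightarrow> 'o \<Rightarrow> 'o \<Rightarrow> ('o \<times> 'm \<times> 'm) set" where
  "roofs T S X Y = {(Z, s, f). Z \<in> Obj T \<and> s \<in> cone_in T S Z X \<and> f \<in> Mor T Z Y}"

definition roof_rel :: "('o, 'm) tcat \<Rightarrow> 'o set \<Rightarrow> 'o \<Rightarrow> 'o \<Rightarrow> (('o \<times> 'm \<times> 'm) \<times> ('o \<times> 'm \<times> 'm)) set" where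
  "roof_rel T S X Y = {((Z, s, f), (Z', s', f')).
     (Z, s, f) \<in> roofs T S X Y \<and> (Z', s', f') \<in> roofs T S X Y \<and>
     (\<exists>W\<in>Obj T. \<exists>u\<in>Mor T W Z. \<exists>v\<in>Mor T W Z'.
        Cmp T W Z X s u \<in> cone_in T S W X \<and>
        Cmp T W Z X s u = Cmp T W Z' X s' v \<and> Cmp T W Z Y f u = Cmp T W Z' Y f' v)}"

text \<open>
  Addition uses representatives with a common denominator; composition completes
  \<open>X' \<rightarrow> Y \<leftarrow> Y'\<close> to a commutative square (right Ore condition).
\<close>

definition verdier :: "('o, 'm) tcat \<Rightarrow> 'o set \<Rightarrow> ('o, ('o \<times> 'm \<times> 'm) set) acat" where
  "verdier T S = \<lparr>
     Obj = Obj T,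
     Hom = (\<lambda>X Y. \<lparr>
       carrier = roofs T S X Y // roof_rel T S X Y,
       mult = (\<lambda>a b. roof_rel T S X Y ``
         {(Z, s, f \<otimes>\<^bsub>Hom T Z Y\<^esub> g) | Z s f g. (Z, s, f) \<in> a \<and> (Z, s, g) \<in> b}),
       one = roof_rel T S X Y `` {(X, Idt T X, \<one>\<^bsub>Hom T X Y\<^esub>)}\<rparr>),
     Idt = (\<lambda>X. roof_rel T S X X `` {(X, Idt T X, Idt T X)}),
     Cmp = (\<lambda>X Y Z b a. roof_rel T S X Z ``
       {(W, Cmp T W X' X s s', Cmp T W Y' Z g f') | W X' s f Y' t g s' f'.
          (X', s, f) \<in> a \<and> (Y', t, g) \<in> b \<and> W \<in> Obj T \<and>
          s' \<in> cone_in T S W X' \<and> f' \<in> Mor T W Y' \<and>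
          Cmp T W X' Y f s' = Cmp T W Y' Y t f'})\<rparr>"

definition quot :: "('o, 'm) tcat \<Rightarrow> 'o set \<Rightarrow> ('o, 'm, 'o, ('o \<times> 'm \<times> 'm) set) func" where
  "quot T S = \<lparr>fob = (\<lambda>X. X), fmor = (\<lambda>X Y f. roof_rel T S X Y `` {(X, Idt T X, f)})\<rparr>"

definition incl :: "('o, 'm, 'o, 'm) func" where
  "incl = fid"

section \<open>Presheaves of abelian groups and cohomological functors\<close>

record ('o, 'm, 'x) presheaf =
  val :: "'o \<Rightarrow> 'x monoid"
  act :: "'o \<Rightarrow> 'o \<Rightarrow> 'm \<Rightarrow> 'x \<Rightarrow> 'x"

text \<open>For \<open>f : X \<rightarrow> Y\<close>, the map \<open>F(f) : F(Y) \<rightarrow> F(X)\<close> is \<open>act F X Y f\<close>.\<close>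

definition additive_presheaf :: "('o, 'm, 'z) acat_scheme \<Rightarrow> ('o, 'm, 'x) presheaf \<Rightarrow> bool" where
  "additive_presheaf C F \<longleftrightarrow>
     (\<forall>X\<in>Obj C. comm_group (val F X)) \<and>
     (\<forall>X\<in>Obj C. \<forall>Y\<in>Obj C. \<forall>f\<in>Mor C X Y. act F X Y f \<in> hom (val F Y) (val F X)) \<and>
     (\<forall>X\<in>Obj C. \<forall>x\<in>carrier (val F X). act F X X (Idt C X) x = x) \<and>
     (\<forall>X\<in>Obj C. \<forall>Y\<in>Obj C. \<forall>Z\<in>Obj C. \<forall>f\<in>Mor C X Y. \<forall>g\<in>Mor C Y Z. \<forall>x\<in>carrier (val F Z).
        act F X Z (Cmp C X Y Z g f) x = act F X Y f (act F Y Z g x)) \<and>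
     (\<forall>X\<in>Obj C. \<forall>Y\<in>Obj C. \<forall>f\<in>Mor C X Y. \<forall>g\<in>Mor C X Y. \<forall>x\<in>carrier (val F Y).
        act F X Y (f \<otimes>\<^bsub>Hom C X Y\<^esub> g) x = act F X Y f x \<otimes>\<^bsub>val F X\<^esub> act F X Y g x)"

text \<open>Exactness of \<open>A \<rightarrow> B \<rightarrow> C\<close> at \<open>B\<close>.\<close>

definition exact_at :: "'a monoid \<Rightarrow> 'b monoid \<Rightarrow> 'c monoid \<Rightarrow> ('a \<Rightarrow> 'b) \<Rightarrow> ('b \<Rightarrow> 'c) \<Rightarrow> bool" where
  "exact_at A B C f g \<longleftrightarrow> f \<in> hom A B \<and> g \<in> hom B C \<and> f ` carrier A = kernel B C g"

definition cohomological :: "('o, 'm) tcat \<Rightarrow> ('o, 'm, 'x) presheaf \<Rightarrow> bool" where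
  "cohomological T F \<longleftrightarrow> additive_presheaf T F \<and>
     (\<forall>X Y Z f g h. (X, Y, Z, f, g, h) \<in> Tri T \<longrightarrow>
        exact_at (val F Z) (val F Y) (val F X) (act F Y Z g) (act F X Y f))"

text \<open>
  Natural transformations of presheaves; extensionality makes equality of functions agree with
  equality of natural transformations. The two presheaves may take values over different types
  because the representable presheaves take values in the type of morphisms.
\<close>

definition transf ::
  "('o, 'm, 'z) acat_scheme \<Rightarrow> ('o, 'm, 'x) presheaf \<Rightarrow> ('o, 'm, 'y) presheaf \<Rightarrow> ('o \<Rightarrow> 'x \<Rightarrow> 'y) set" where
  "transf C F G = {\<alpha> \<in> extensional (Obj C).
     (\<forall>X\<in>Obj C. \<alpha> X \<in> hom (val F X) (val G X) \<inter> extensional (carrier (val F X))) \<and>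
     (\<forall>X\<in>Obj C. \<forall>Y\<in>Obj C. \<forall>f\<in>Mor C X Y. \<forall>x\<in>carrier (val F Y).
        \<alpha> X (act F X Y f x) = act G X Y f (\<alpha> Y x))}"

definition transf_comp ::
  "('o, 'm, 'z) acat_scheme \<Rightarrow> ('o, 'm, 'x) presheaf \<Rightarrow> ('o \<Rightarrow> 'y \<Rightarrow> 'w) \<Rightarrow> ('o \<Rightarrow> 'x \<Rightarrow> 'y) \<Rightarrow> 'o \<Rightarrow> 'x \<Rightarrow> 'w" where
  "transf_comp C F \<beta> \<alpha> = (\<lambda>X\<in>Obj C. \<lambda>x\<in>carrier (val F X). \<beta> X (\<alpha> X x))"

definition Coh :: "('o, 'm) tcat \<Rightarrow> (('o, 'm, 'x) presheaf, 'o \<Rightarrow> 'x \<Rightarrow> 'x) acat" where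
  "Coh T = \<lparr>
     Obj = {F. cohomological T F},
     Hom = (\<lambda>F G. \<lparr>
       carrier = transf T F G,
       mult = (\<lambda>\<alpha> \<beta>. \<lambda>X\<in>Obj T. \<lambda>x\<in>carrier (val F X). \<alpha> X x \<otimes>\<^bsub>val G X\<^esub> \<beta> X x),
       one = (\<lambda>X\<in>Obj T. \<lambda>x\<in>carrier (val F X). \<one>\<^bsub>val G X\<^esub>)\<rparr>),
     Idt = (\<lambda>F. \<lambda>X\<in>Obj T. \<lambda>x\<in>carrier (val F X). x),
     Cmp = (\<lambda>F G H \<beta> \<alpha>. transf_comp T F \<beta> \<alpha>)\<rparr>"

definition representable :: "('o, 'm, 'z) acat_scheme \<Rightarrow> 'o \<Rightarrow> ('o, 'm, 'm) presheaf" where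
  "representable C X = \<lparr>val = (\<lambda>Y. Hom C Y X), act = (\<lambda>Y Z f g. Cmp C Y Z X g f)\<rparr>"

section \<open>Realising small groups over the universe\<close>

text \<open>
  A group with small carrier is replaced by an isomorphic group over \<open>'x\<close>, so that colimits and
  direct sums of groups in the universe again lie in the universe; \<open>lift_map\<close> is the
  corresponding transport of maps.
\<close>

definition encode :: "'a set \<Rightarrow> 'a \<Rightarrow> 'x" where
  "encode A = (SOME e. inj_on e A)"

definition decode :: "'a set \<Rightarrow> 'x \<Rightarrow> 'a" where
  "decode A = inv_into A (encode A)"

definition shrink :: "'a monoid \<Rightarrow> 'x monoid" where
  "shrink G = \<lparr>
     carrier = encode (carrier G) ` carrier G,
     mult = (\<lambda>x y. encode (carrier G) (decode (carrier G) x \<otimes>\<^bsub>G\<^esub> decode (carrier G) y)),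
     one = encode (carrier G) \<one>\<^bsub>G\<^esub>\<rparr>"

definition lift_map :: "'a monoid \<Rightarrow> 'b monoid \<Rightarrow> ('a \<Rightarrow> 'b) \<Rightarrow> 'x \<Rightarrow> 'x" where
  "lift_map G H h = (\<lambda>x \<in> encode (carrier G) ` carrier G. encode (carrier H) (h (decode (carrier G) x)))"

section \<open>The adjoint functors between categories of presheaves\<close>

text \<open>
  Filtered colimit of a diagram of abelian groups: objects \<open>J\<close>, morphisms \<open>M i j\<close>, groups \<open>D i\<close>
  and transition maps \<open>t i j u : D i \<rightarrow> D j\<close> for \<open>u \<in> M i j\<close>.
\<close>

definition fcolim_rel ::
  "'j set \<Rightarrow> ('j \<Rightarrow> 'j \<Rightarrow> 'k set) \<Rightarrow> ('j \<Rightarrow> 'g monoid) \<Rightarrow> ('j \<Rightarrow> 'j \<Rightarrow> 'k \<Rightarrow> 'g \<Rightarrow> 'g)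
    \<Rightarrow> (('j \<times> 'g) \<times> ('j \<times> 'g)) set" where
  "fcolim_rel J M D t = {((i, a), (j, b)).
     i \<in> J \<and> a \<in> carrier (D i) \<and> j \<in> J \<and> b \<in> carrier (D j) \<and>
     (\<exists>k\<in>J. \<exists>u\<in>M i k. \<exists>v\<in>M j k. t i k u a = t j k v b)}"

definition fcolim ::
  "'j set \<Rightarrow> ('j \<Rightarrow> 'j \<Rightarrow> 'k set) \<Rightarrow> ('j \<Rightarrow> 'g monoid) \<Rightarrow> ('j \<Rightarrow> 'j \<Rightarrow> 'k \<Rightarrow> 'g \<Rightarrow> 'g)
    \<Rightarrow> ('j \<times> 'g) set monoid" where
  "fcolim J M D t = \<lparr>
     carrier = (SIGMA i:J. carrier (D i)) // fcolim_rel J M D t,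
     mult = (\<lambda>p q. fcolim_rel J M D t ``
       {(k, t i k u a \<otimes>\<^bsub>D k\<^esub> t j k v b) | i a j b k u v.
          (i, a) \<in> p \<and> (j, b) \<in> q \<and> k \<in> J \<and> u \<in> M i k \<and> v \<in> M j k}),
     one = fcolim_rel J M D t `` {(i, \<one>\<^bsub>D i\<^esub>) | i. i \<in> J}\<rparr>"

text \<open>
  The category of morphisms \<open>H\<^sub>X \<rightarrow> F\<close> from representable presheaves, and the diagram sending
  \<open>H\<^sub>X \<rightarrow> F\<close> to \<open>H\<^bsub>f(X)\<^esub>(Y)\<close>. If \<open>F\<close> is cohomological, the index category is filtered.
\<close>

definition slice_ob :: "('a, 'm, 'z) acat_scheme \<Rightarrow> ('a, 'm, 'x) presheaf \<Rightarrow> ('a \<times> ('a \<Rightarrow> 'm \<Rightarrow> 'x)) set" where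
  "slice_ob A F = {(X, \<eta>). X \<in> Obj A \<and> \<eta> \<in> transf A (representable A X) F}"

definition slice_mor ::
  "('a, 'm, 'z) acat_scheme \<Rightarrow> 'a \<times> ('a \<Rightarrow> 'm \<Rightarrow> 'x) \<Rightarrow> 'a \<times> ('a \<Rightarrow> 'm \<Rightarrow> 'x) \<Rightarrow> 'm set" where
  "slice_mor A = (\<lambda>(X, \<eta>) (X', \<eta>'). {u \<in> Mor A X X'.
     \<forall>Y\<in>Obj A. \<forall>g\<in>Mor A Y X. \<eta> Y g = \<eta>' Y (Cmp A Y X X' u g)})"

definition pull_rel ::
  "('a, 'm, 'z) acat_scheme \<Rightarrow> ('b, 'n, 'w) acat_scheme \<Rightarrow> ('a, 'm, 'b, 'n) func \<Rightarrow> ('a, 'm, 'x) presheaf \<Rightarrow> 'b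
    \<Rightarrow> ((('a \<times> ('a \<Rightarrow> 'm \<Rightarrow> 'x)) \<times> 'n) \<times> (('a \<times> ('a \<Rightarrow> 'm \<Rightarrow> 'x)) \<times> 'n)) set" where
  "pull_rel A B f F Y = fcolim_rel (slice_ob A F) (slice_mor A)
     (\<lambda>(X, \<eta>). val (representable B (fob f X)) Y)
     (\<lambda>(X, \<eta>) (X', \<eta>') u g. Cmp B Y (fob f X) (fob f X') (fmor f X X' u) g)"

definition pull_val ::
  "('a, 'm, 'z) acat_scheme \<Rightarrow> ('b, 'n, 'w) acat_scheme \<Rightarrow> ('a, 'm, 'b, 'n) func \<Rightarrow> ('a, 'm, 'x) presheaf \<Rightarrow> 'b
    \<Rightarrow> (('a \<times> ('a \<Rightarrow> 'm \<Rightarrow> 'x)) \<times> 'n) set monoid" where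
  "pull_val A B f F Y = fcolim (slice_ob A F) (slice_mor A)
     (\<lambda>(X, \<eta>). val (representable B (fob f X)) Y)
     (\<lambda>(X, \<eta>) (X', \<eta>') u g. Cmp B Y (fob f X) (fob f X') (fmor f X X' u) g)"

text \<open>\<open>pull A B f\<close> is \<open>f\<^sup>*\<close>, from presheaves on \<open>A\<close> to presheaves on \<open>B\<close>.\<close>

definition pull ::
  "('a, 'm, 'z) acat_scheme \<Rightarrow> ('b, 'n, 'w) acat_scheme \<Rightarrow> ('a, 'm, 'b, 'n) func
    \<Rightarrow> (('a, 'm, 'x) presheaf, 'a \<Rightarrow> 'x \<Rightarrow> 'x, ('b, 'n, 'x) presheaf, 'b \<Rightarrow> 'x \<Rightarrow> 'x) func" where
  "pull A B f = \<lparr>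
     fob = (\<lambda>F. \<lparr>
       val = (\<lambda>Y. shrink (pull_val A B f F Y)),
       act = (\<lambda>Y Y' m. lift_map (pull_val A B f F Y') (pull_val A B f F Y)
         (\<lambda>c. pull_rel A B f F Y ``
            {((X, \<eta>), act (representable B (fob f X)) Y Y' m g) | X \<eta> g. ((X, \<eta>), g) \<in> c}))\<rparr>),
     fmor = (\<lambda>F G \<alpha>. \<lambda>Y\<in>Obj B. lift_map (pull_val A B f F Y) (pull_val A B f G Y)
       (\<lambda>c. pull_rel A B f G Y ``
          {((X, transf_comp A (representable A X) \<alpha> \<eta>), g) | X \<eta> g. ((X, \<eta>), g) \<in> c}))\<rparr>"

text \<open>\<open>push A f\<close> is \<open>f\<^sub>*\<close>, the restriction along \<open>f\<close> of presheaves to presheaves on \<open>A\<close>.\<close>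

definition push ::
  "('a, 'm, 'z) acat_scheme \<Rightarrow> ('a, 'm, 'b, 'n) func
    \<Rightarrow> (('b, 'n, 'x) presheaf, 'b \<Rightarrow> 'x \<Rightarrow> 'x, ('a, 'm, 'x) presheaf, 'a \<Rightarrow> 'x \<Rightarrow> 'x) func" where
  "push A f = \<lparr>
     fob = (\<lambda>G. \<lparr>val = (\<lambda>X. val G (fob f X)),
                 act = (\<lambda>X X' u. act G (fob f X) (fob f X') (fmor f X X' u))\<rparr>),
     fmor = (\<lambda>G H \<alpha>. \<lambda>X\<in>Obj A. \<alpha> (fob f X))\<rparr>"

type_synonym ('o, 'm, 'x) coh_endo =
  "(('o, 'm, 'x) presheaf, 'o \<Rightarrow> 'x \<Rightarrow> 'x, ('o, 'm, 'x) presheaf, 'o \<Rightarrow> 'x \<Rightarrow> 'x) func"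

type_synonym ('o, 'm, 'x) coh_transf = "('o, 'm, 'x) presheaf \<Rightarrow> 'o \<Rightarrow> 'x \<Rightarrow> 'x"

definition Gam :: "('o, 'm) tcat \<Rightarrow> 'o set \<Rightarrow> ('o, 'm, 'x) coh_endo" where
  "Gam T S = fcomp (pull (full_sub T S) T incl) (push (full_sub T S) incl)"

definition Loc :: "('o, 'm) tcat \<Rightarrow> 'o set \<Rightarrow> ('o, 'm, 'x) coh_endo" where
  "Loc T S = fcomp (push T (quot T S)) (pull T (verdier T S) (quot T S))"

section \<open>Canonical morphisms for an inclusion\<close>

text \<open>
  Let \<open>S1 \<subseteq> S2\<close>. The class of \<open>g : Y \<rightarrow> X\<close> at \<open>\<eta> : H\<^sub>X \<rightarrow> F|S1\<close>, \<open>X \<in> S1\<close>, is sent to the class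
  of \<open>g\<close> at the morphism \<open>H\<^sub>X \<rightarrow> F|S2\<close> restricting to \<open>\<eta>\<close> (unique by the Yoneda lemma).
  The counit sends either class to the image in \<open>F(Y)\<close> under \<open>F(g)\<close> of the element of \<open>F(X)\<close>
  corresponding to \<open>\<eta>\<close>, so this is compatible with the counits.
\<close>

definition Gam_can :: "('o, 'm) tcat \<Rightarrow> 'o set \<Rightarrow> 'o set \<Rightarrow> ('o, 'm, 'x) coh_transf" where
  "Gam_can T S1 S2 F = (\<lambda>Y\<in>Obj T.
     lift_map
       (pull_val (full_sub T S1) T incl (fob (push (full_sub T S1) incl) F) Y)
       (pull_val (full_sub T S2) T incl (fob (push (full_sub T S2) incl) F) Y)
       (\<lambda>c. pull_rel (full_sub T S2) T incl (fob (push (full_sub T S2) incl) F) Y ``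
          {((X, \<eta>), g) | X \<eta> g.
             (X, \<eta>) \<in> slice_ob (full_sub T S2) (fob (push (full_sub T S2) incl) F) \<and>
             ((X, restrict \<eta> S1), g) \<in> c}))"

text \<open>
  The class of \<open>Y \<rightarrow> X\<close> in \<open>T/S1\<close> at \<open>\<eta> : H\<^sub>X \<rightarrow> F\<close> is sent to the class at \<open>\<eta>\<close> of its image
  under the functor \<open>T/S1 \<rightarrow> T/S2\<close>, which is given by the same roofs. The unit sends the element
  of \<open>F(X)\<close> corresponding to \<open>\<eta>\<close> to the class of the identity of \<open>X\<close> at \<open>\<eta>\<close>, so this is
  compatible with the units.
\<close>

definition Loc_can :: "('o, 'm) tcat \<Rightarrow> 'o set \<Rightarrow> 'o set \<Rightarrow> ('o, 'm, 'x) coh_transf" where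
  "Loc_can T S1 S2 F = (\<lambda>Y\<in>Obj T.
     lift_map
       (pull_val T (verdier T S1) (quot T S1) F Y)
       (pull_val T (verdier T S2) (quot T S2) F Y)
       (\<lambda>c. pull_rel T (verdier T S2) (quot T S2) F Y ``
          {((X, \<eta>), roof_rel T S2 Y X `` r) | X \<eta> r. ((X, \<eta>), r) \<in> c}))"

section \<open>Direct sums and long exact sequences of endofunctors\<close>

definition sum_presheaf ::
  "('o, 'm, 'x) presheaf \<Rightarrow> ('o, 'm, 'x) presheaf \<Rightarrow> ('o, 'm, 'x) presheaf" where
  "sum_presheaf F G = \<lparr>
     val = (\<lambda>Y. shrink (val F Y \<times>\<times> val G Y)),
     act = (\<lambda>Y Y' m. lift_map (val F Y' \<times>\<times> val G Y') (val F Y \<times>\<times> val G Y)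
       (\<lambda>(x, y). (act F Y Y' m x, act G Y Y' m y)))\<rparr>"

definition sum_func ::
  "('o, 'm) tcat \<Rightarrow> ('o, 'm, 'x) coh_endo \<Rightarrow> ('o, 'm, 'x) coh_endo \<Rightarrow> ('o, 'm, 'x) coh_endo" where
  "sum_func T A B = \<lparr>
     fob = (\<lambda>F. sum_presheaf (fob A F) (fob B F)),
     fmor = (\<lambda>F G \<alpha>. \<lambda>Y\<in>Obj T.
       lift_map (val (fob A F) Y \<times>\<times> val (fob B F) Y) (val (fob A G) Y \<times>\<times> val (fob B G) Y)
         (\<lambda>(x, y). (fmor A F G \<alpha> Y x, fmor B F G \<alpha> Y y)))\<rparr>"

text \<open>\<open>E \<rightarrow> A \<oplus> B\<close> with components \<open>\<sigma>\<close>, \<open>\<tau>\<close>.\<close>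

definition pair_transf ::
  "('o, 'm) tcat \<Rightarrow> ('o, 'm, 'x) coh_endo \<Rightarrow> ('o, 'm, 'x) coh_endo \<Rightarrow> ('o, 'm, 'x) coh_endo
    \<Rightarrow> ('o, 'm, 'x) coh_transf \<Rightarrow> ('o, 'm, 'x) coh_transf \<Rightarrow> ('o, 'm, 'x) coh_transf" where
  "pair_transf T E A B \<sigma> \<tau> F = (\<lambda>Y\<in>Obj T. \<lambda>x\<in>carrier (val (fob E F) Y).
     encode (carrier (val (fob A F) Y \<times>\<times> val (fob B F) Y)) (\<sigma> F Y x, \<tau> F Y x))"

text \<open>\<open>A \<oplus> B \<rightarrow> E\<close>, the difference of \<open>\<sigma> : A \<rightarrow> E\<close> and \<open>\<tau> : B \<rightarrow> E\<close>.\<close>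

definition diff_transf ::
  "('o, 'm) tcat \<Rightarrow> ('o, 'm, 'x) coh_endo \<Rightarrow> ('o, 'm, 'x) coh_endo \<Rightarrow> ('o, 'm, 'x) coh_endo
    \<Rightarrow> ('o, 'm, 'x) coh_transf \<Rightarrow> ('o, 'm, 'x) coh_transf \<Rightarrow> ('o, 'm, 'x) coh_transf" where
  "diff_transf T A B E \<sigma> \<tau> F = (\<lambda>Y\<in>Obj T. \<lambda>z\<in>carrier (val (fob (sum_func T A B) F) Y).
     (case decode (carrier (val (fob A F) Y \<times>\<times> val (fob B F) Y)) z of
        (x, y) \<Rightarrow> \<sigma> F Y x \<otimes>\<^bsub>val (fob E F) Y\<^esub> inv\<^bsub>val (fob E F) Y\<^esub> (\<tau> F Y y)))"

text \<open>On \<open>Coh T\<close>: \<open>\<Sigma>F = F \<circ> \<Sigma>\<^sup>-\<^sup>1\<close>, with quasi-inverse \<open>F \<mapsto> F \<circ> \<Sigma>\<close>.\<close>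

definition Sigma_coh :: "('o, 'm) tcat \<Rightarrow> int \<Rightarrow> ('o, 'm, 'x) coh_endo" where
  "Sigma_coh T n = (if 0 \<le> n then fpow (nat n) (push T (Des T)) else fpow (nat (- n)) (push T (Sus T)))"

text \<open>
  The identification \<open>\<Sigma>\<^sup>n\<Sigma>F \<cong> \<Sigma>\<^sup>n\<^sup>+\<^sup>1F\<close>: an equality for \<open>n \<ge> 0\<close>, and induced by
  \<open>X \<cong> \<Sigma>\<^sup>-\<^sup>1\<Sigma>X\<close> for \<open>n < 0\<close>.
\<close>

definition shift_iso :: "('o, 'm) tcat \<Rightarrow> int \<Rightarrow> ('o, 'm, 'x) coh_transf" where
  "shift_iso T n F =
     (if 0 \<le> n then Idt (Coh T) (fob (Sigma_coh T (n + 1)) F)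
      else fmor (Sigma_coh T (n + 1)) (fob (push T (Sus T)) (fob (push T (Des T)) F)) F
        (\<lambda>X\<in>Obj T. \<lambda>x\<in>carrier (val F (fob (Des T) (fob (Sus T) X))).
           act F X (fob (Des T) (fob (Sus T) X)) (Unit T X) x))"

text \<open>
  Endofunctors \<open>A\<close>, \<open>B\<close>, \<open>E\<close> of \<open>Coh T\<close> and natural transformations \<open>\<alpha> : A \<rightarrow> B\<close>,
  \<open>\<beta> : B \<rightarrow> E\<close>, \<open>\<delta> : E \<rightarrow> \<Sigma>A\<close> such that the sequence
  \<open>\<dots> \<rightarrow> \<Sigma>\<^sup>nA \<rightarrow> \<Sigma>\<^sup>nB \<rightarrow> \<Sigma>\<^sup>nE \<rightarrow> \<Sigma>\<^sup>n\<^sup>+\<^sup>1A \<rightarrow> \<dots>\<close>, infinite in both directions, is exact.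
\<close>

definition long_exact ::
  "('o, 'm) tcat \<Rightarrow> ('o, 'm, 'x) coh_endo \<Rightarrow> ('o, 'm, 'x) coh_endo \<Rightarrow> ('o, 'm, 'x) coh_endo
    \<Rightarrow> ('o, 'm, 'x) coh_transf \<Rightarrow> ('o, 'm, 'x) coh_transf \<Rightarrow> ('o, 'm, 'x) coh_transf \<Rightarrow> bool" where
  "long_exact T A B E \<alpha> \<beta> \<delta> \<longleftrightarrow>
     nat_transf (Coh T) (Coh T) A B \<alpha> \<and>
     nat_transf (Coh T) (Coh T) B E \<beta> \<and>
     nat_transf (Coh T) (Coh T) E (fcomp (Sigma_coh T 1) A) \<delta> \<and>
     (\<forall>n. \<forall>F\<in>Obj (Coh T). \<forall>Y\<in>Obj T.
        let S = Sigma_coh T;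
            A' = (\<lambda>k. fob (S k) (fob A F));
            B' = (\<lambda>k. fob (S k) (fob B F));
            E' = (\<lambda>k. fob (S k) (fob E F));
            \<alpha>' = (\<lambda>k. fmor (S k) (fob A F) (fob B F) (\<alpha> F));
            \<beta>' = (\<lambda>k. fmor (S k) (fob B F) (fob E F) (\<beta> F));
            \<delta>' = (\<lambda>k. Cmp (Coh T) (E' k) (fob (S k) (fob (S 1) (fob A F))) (A' (k + 1))
                      (shift_iso T k (fob A F))
                      (fmor (S k) (fob E F) (fob (S 1) (fob A F)) (\<delta> F)))
        in exact_at (val (A' n) Y) (val (B' n) Y) (val (E' n) Y) (\<alpha>' n Y) (\<beta>' n Y) \<and>
           exact_at (val (B' n) Y) (val (E' n) Y) (val (A' (n + 1)) Y) (\<beta>' n Y) (\<delta>' n Y) \<and>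
           exact_at (val (E' n) Y) (val (A' (n + 1)) Y) (val (B' (n + 1)) Y) (\<delta>' n Y) (\<alpha>' (n + 1) Y))"

end

theory Submission
  imports Defs
begin

text \<open>
  Write \<open>W = U \<and> V\<close> and \<open>J = U \<or> V\<close>. Every element of \<open>\<Gamma>\<^sub>S F(Y)\<close> is given by a morphism
  \<open>Y \<rightarrow> X\<close> with \<open>X \<in> S\<close> and an element of \<open>F(X)\<close>, and every element of \<open>L\<^sub>S F(Y)\<close> by a morphism
  \<open>Z \<rightarrow> Y\<close> with cone in \<open>S\<close> and an element of \<open>F(Z)\<close>. Let \<open>K \<rightarrow> N \<rightarrow> P\<close> be a complex of
  cohomological functors that is short exact on a triangulated subcategory \<open>S\<close>, and short exact
  locally, that is, up to restriction along morphisms with cone in \<open>S\<close>. A diagram chase then gives a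
  connecting morphism \<open>P \<rightarrow> \<Sigma>K\<close> and the long exact sequence.

  For \<open>L\<close> this applies with \<open>S = J\<close>. On \<open>J\<close> one has \<open>L\<^sub>J F = 0\<close>, and \<open>L\<^sub>W F \<rightarrow> L\<^sub>U F \<oplus> L\<^sub>V F\<close> is an
  isomorphism there: the objects all of whose shifts are sent to isomorphisms by a given morphism
  form a thick subcategory, so that \<open>U\<close> and \<open>V\<close> suffice. On \<open>U\<close>, \<open>L\<^sub>U F\<close> vanishes and, since
  morphisms from \<open>U\<close> to \<open>V\<close> factor through \<open>W\<close>, \<open>L\<^sub>W F \<rightarrow> L\<^sub>V F\<close> is an isomorphism.

  For \<open>\<Gamma>\<close> it applies with \<open>S = W\<close>, where all four functors agree with \<open>F\<close>. Local exactness follows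
  from the fact that \<open>\<Gamma>\<^sub>U F \<oplus> \<Gamma>\<^sub>V F \<rightarrow> F\<close> becomes an isomorphism on \<open>J\<close> after applying \<open>L\<^sub>W\<close>, again
  because this is so on \<open>U\<close> and on \<open>V\<close>.
\<close>

section \<open>Small sets and groups\<close>

text \<open>Morphisms with cone in \<open>S\<close> behave like coverings: they compose, they pull
  back along every morphism, and two morphisms that become equal after a covering of their target
  agree on a covering of their source. In this language \<open>L_S F(Y)\<close> is the colimit of
  \<open>F(Z)\<close> over the coverings \<open>Z \<rightarrow> Y\<close>, and "locally" means "on
  some covering". The connecting morphism measures the difference between local and global lifts.
  The obstacle is that objects of the join have no explicit description in terms of \<open>U\<close>
  and \<open>V\<close>. The join is accessible only through its minimality, so whatever is needed
  about it is phrased as the claim that some morphism of cohomological functors is an isomorphism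
  there. For \<open>\<Gamma>\<close> this forces a detour: at an object of \<open>U\<close> the
  summand \<open>\<Gamma>_V F\<close> need not vanish, so the comparison with \<open>F\<close> is
  not an isomorphism. That summand vanishes locally for the meet, however, and localising at the
  meet turns the local statement into an isomorphism, to which the minimality argument
  applies.\<close>

lemma inj_on_encode:
  assumes "small TYPE('x) A" shows "inj_on (encode A :: 'a \<Rightarrow> 'x) A"
  using assms someI_ex[of "\<lambda>e :: 'a \<Rightarrow> 'x. inj_on e A"] by (auto simp: small_def encode_def)

lemma decode_encode [simp]:
  assumes "small TYPE('x) A" "a \<in> A" shows "decode A (encode A a :: 'x) = a"
  using inj_on_encode[OF assms(1)] assms(2) by (simp add: decode_def)

lemma small_image: assumes "small TYPE('x) A" shows "small TYPE('x) (f ` A)"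
proof -
  obtain e :: "'a \<Rightarrow> 'x" where e: "inj_on e A" using assms by (auto simp: small_def)
  have "inv_into A f ` (f ` A) \<subseteq> A" by (auto intro: inv_into_into)
  then have "inj_on (e \<circ> inv_into A f) (f ` A)"
    by (intro comp_inj_on inj_on_inv_into inj_on_subset[OF e]) simp_all
  then show ?thesis unfolding small_def by (rule exI[of "\<lambda>e. inj_on e (f ` A)"])
qed

lemma small_subset: "small TYPE('x) A \<Longrightarrow> B \<subseteq> A \<Longrightarrow> small TYPE('x) B"
  unfolding small_def by (meson inj_on_subset)

lemma small_self: "small TYPE('x) (A :: 'x set)"
  unfolding small_def by (rule exI[of _ "\<lambda>x. x"]) simp

text \<open>An infinite universe absorbs its square, so a pairing \<open>p\<close> on it combines an
  injection of the base with one injection for each fibre.\<close>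

lemma small_Sigma:
  assumes inf: "infinite (UNIV :: 'x set)" and A: "small TYPE('x) A"
    and B: "\<And>a. a \<in> A \<Longrightarrow> small TYPE('x) (B a)"
  shows "small TYPE('x) (Sigma A B)"
proof -
  have c: "(card_of (UNIV :: ('x \<times> 'x) set), card_of (UNIV :: 'x set)) \<in> ordIso"
    using card_of_Times_same_infinite[OF inf] by (simp only: UNIV_Times_UNIV)
  obtain p :: "'x \<times> 'x \<Rightarrow> 'x" where "bij_betw p UNIV UNIV"
    using iffD2[OF card_of_ordIso c] by (rule exE)
  then have p: "inj p" by (simp add: bij_betw_def)
  obtain e :: "'a \<Rightarrow> 'x" where e: "inj_on e A" using A by (auto simp: small_def)
  have "\<forall>a\<in>A. \<exists>e :: 'b \<Rightarrow> 'x. inj_on e (B a)" using B by (simp add: small_def)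
  from bchoice[OF this] obtain h :: "'a \<Rightarrow> 'b \<Rightarrow> 'x" where h: "\<And>a. a \<in> A \<Longrightarrow> inj_on (h a) (B a)"
    by blast
  have "inj_on (\<lambda>(a, b). p (e a, h a b)) (Sigma A B)"
  proof (rule inj_onI, clarify)
    fix a b a' b' assume ab: "a \<in> A" "b \<in> B a" "a' \<in> A" "b' \<in> B a'"
      and eq: "p (e a, h a b) = p (e a', h a' b')"
    from injD[OF p eq] have 1: "e a = e a'" "h a b = h a' b'" by simp_all
    from inj_onD[OF e 1(1) ab(1,3)] have 2: "a = a'" .
    from inj_onD[OF h[OF ab(1)], of b b'] 1 2 ab show "a = a' \<and> b = b'" by simp
  qed
  then show ?thesis unfolding small_def by (rule exI[of "\<lambda>e. inj_on e (Sigma A B)"])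
qed

text \<open>Each group axiom involves at most three elements. If any three of them lie in the image
  of a homomorphism from a commutative group, the axioms transfer, although no single group need
  cover everything. Shrunk groups, filtered colimits and groups of roofs are all handled in this
  way.\<close>

lemma comm_group_directed:
  fixes G :: "'g monoid"
  assumes one: "\<one>\<^bsub>G\<^esub> \<in> carrier G"
    and dir: "\<And>x y z. \<lbrakk>x \<in> carrier G; y \<in> carrier G; z \<in> carrier G\<rbrakk> \<Longrightarrow>
      \<exists>(D :: 'd monoid) h. comm_group D \<and> h \<in> hom D G \<and> h \<one>\<^bsub>D\<^esub> = \<one>\<^bsub>G\<^esub> \<and> {x, y, z} \<subseteq> h ` carrier D"
  shows "comm_group G"
proof (rule comm_groupI)
  show "\<one>\<^bsub>G\<^esub> \<in> carrier G" by fact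
next
  fix x y assume xy: "x \<in> carrier G" "y \<in> carrier G"
  from dir[OF xy(1) xy] obtain D :: "'d monoid" and h where D: "comm_group D" "h \<in> hom D G"
    "h \<one>\<^bsub>D\<^esub> = \<one>\<^bsub>G\<^esub>" "{x, x, y} \<subseteq> h ` carrier D" by blast
  then obtain a b where ab: "a \<in> carrier D" "b \<in> carrier D" "x = h a" "y = h b" by auto
  interpret D: comm_group D by fact
  show "x \<otimes>\<^bsub>G\<^esub> y \<in> carrier G" "x \<otimes>\<^bsub>G\<^esub> y = y \<otimes>\<^bsub>G\<^esub> x"
    using ab D(2) by (auto simp: hom_mult[symmetric] hom_in_carrier D.m_comm)
next
  fix x y z assume xyz: "x \<in> carrier G" "y \<in> carrier G" "z \<in> carrier G"
  from dir[OF this] obtain D :: "'d monoid" and h where D: "comm_group D" "h \<in> hom D G"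
    "h \<one>\<^bsub>D\<^esub> = \<one>\<^bsub>G\<^esub>" "{x, y, z} \<subseteq> h ` carrier D" by blast
  then obtain a b c where ab: "a \<in> carrier D" "b \<in> carrier D" "c \<in> carrier D" "x = h a" "y = h b" "z = h c"
    by auto
  interpret D: comm_group D by fact
  show "x \<otimes>\<^bsub>G\<^esub> y \<otimes>\<^bsub>G\<^esub> z = x \<otimes>\<^bsub>G\<^esub> (y \<otimes>\<^bsub>G\<^esub> z)"
    using ab D(2) by (simp add: hom_mult[symmetric] D.m_assoc)
next
  fix x assume x: "x \<in> carrier G"
  from dir[OF x x x] obtain D :: "'d monoid" and h where D: "comm_group D" "h \<in> hom D G"
    "h \<one>\<^bsub>D\<^esub> = \<one>\<^bsub>G\<^esub>" "{x, x, x} \<subseteq> h ` carrier D" by blast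
  then obtain a where ab: "a \<in> carrier D" "x = h a" by auto
  interpret D: comm_group D by fact
  show "\<one>\<^bsub>G\<^esub> \<otimes>\<^bsub>G\<^esub> x = x" using ab D(2) unfolding D(3)[symmetric] by (simp add: hom_mult[symmetric])
  have "h (inv\<^bsub>D\<^esub> a) \<otimes>\<^bsub>G\<^esub> x = \<one>\<^bsub>G\<^esub>" "h (inv\<^bsub>D\<^esub> a) \<in> carrier G"
    using ab D(2) unfolding D(3)[symmetric] by (simp_all add: hom_mult[symmetric] hom_in_carrier)
  then show "\<exists>y\<in>carrier G. y \<otimes>\<^bsub>G\<^esub> x = \<one>\<^bsub>G\<^esub>" by blast
qed

lemma (in group) div_eq_one_iff:
  "\<lbrakk>x \<in> carrier G; y \<in> carrier G\<rbrakk> \<Longrightarrow> x \<otimes> inv y = \<one> \<longleftrightarrow> x = y"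
  using inv_equality inv_inv by (metis inv_closed r_inv)

lemma (in group) idem_one: "\<lbrakk>x = x \<otimes> x; x \<in> carrier G\<rbrakk> \<Longrightarrow> x = \<one>"
  using l_cancel_one'[of x x] by simp

lemma (in group) div_mult_cancel: "\<lbrakk>x \<in> carrier G; y \<in> carrier G\<rbrakk> \<Longrightarrow> (x \<otimes> inv y) \<otimes> y = x"
  by (simp add: m_assoc)

lemma (in comm_group) mult_div_cancel: "\<lbrakk>x \<in> carrier G; y \<in> carrier G\<rbrakk> \<Longrightarrow> y \<otimes> (x \<otimes> inv y) = x"
  by (metis div_mult_cancel inv_closed m_closed m_comm)

lemma (in comm_group) mult_mult_swap:
  "\<lbrakk>a \<in> carrier G; b \<in> carrier G; c \<in> carrier G; d \<in> carrier G\<rbrakk> \<Longrightarrow>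
    (a \<otimes> b) \<otimes> (c \<otimes> d) = (a \<otimes> c) \<otimes> (b \<otimes> d)"
  by (simp add: m_ac)

lemma hom_inv:
  "\<lbrakk>group G; group H; h \<in> hom G H; x \<in> carrier G\<rbrakk> \<Longrightarrow> h (inv\<^bsub>G\<^esub> x) = inv\<^bsub>H\<^esub> (h x)"
  by (intro group_hom.hom_inv) (auto simp: group_hom_def group_hom_axioms_def)

lemma shrink_simps [simp]:
  "carrier (shrink G) = encode (carrier G) ` carrier G"
  "\<one>\<^bsub>shrink G\<^esub> = encode (carrier G) \<one>\<^bsub>G\<^esub>"
  by (auto simp: shrink_def)

lemma shrink_mult:
  assumes "small TYPE('x) (carrier G)" "a \<in> carrier G" "b \<in> carrier G"
  shows "(encode (carrier G) a :: 'x) \<otimes>\<^bsub>shrink G\<^esub> encode (carrier G) b = encode (carrier G) (a \<otimes>\<^bsub>G\<^esub> b)"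
  using assms by (simp add: shrink_def)

lemma encode_hom:
  assumes "small TYPE('x) (carrier G)"
  shows "encode (carrier G) \<in> hom G (shrink G :: 'x monoid)"
  using assms by (auto simp: hom_def shrink_mult)

lemma comm_group_shrink:
  fixes G :: "'g monoid"
  assumes "small TYPE('x) (carrier G)" "comm_group G"
  shows "comm_group (shrink G :: 'x monoid)"
proof (rule comm_group_directed)
  interpret comm_group G by fact
  show "\<one>\<^bsub>shrink G\<^esub> \<in> carrier (shrink G :: 'x monoid)" by simp
  show "\<exists>(D :: 'g monoid) h. comm_group D \<and> h \<in> hom D (shrink G :: 'x monoid) \<and> h \<one>\<^bsub>D\<^esub> = \<one>\<^bsub>shrink G\<^esub> \<and> {x, y, z} \<subseteq> h ` carrier D"
    if "x \<in> carrier (shrink G)" "y \<in> carrier (shrink G)" "z \<in> carrier (shrink G)" for x y z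
    using that assms by (intro exI[of _ G] exI[of _ "encode (carrier G)"]) (auto simp: encode_hom)
qed

lemma lift_map_encode:
  assumes "small TYPE('x) (carrier G)" "a \<in> carrier G"
  shows "lift_map G H h (encode (carrier G) a :: 'x) = encode (carrier H) (h a)"
  using assms by (simp add: lift_map_def)

section \<open>Preadditive categories\<close>

context preadditive_category
begin

lemma hom_group' [simp]: "\<lbrakk>X \<in> Obj C; Y \<in> Obj C\<rbrakk> \<Longrightarrow> group (Hom C X Y)"
  using hom_group comm_group.axioms(2) by blast

lemma mult_in [simp, intro]: "\<lbrakk>X \<in> Obj C; Y \<in> Obj C; f \<in> Mor C X Y; g \<in> Mor C X Y\<rbrakk> \<Longrightarrow>
    f \<otimes>\<^bsub>Hom C X Y\<^esub> g \<in> Mor C X Y"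
  using monoid.m_closed group.is_monoid hom_group' by metis

lemma zero_in [simp, intro]: "\<lbrakk>X \<in> Obj C; Y \<in> Obj C\<rbrakk> \<Longrightarrow> \<one>\<^bsub>Hom C X Y\<^esub> \<in> Mor C X Y"
  using monoid.one_closed group.is_monoid hom_group' by metis

lemma inv_in [simp, intro]: "\<lbrakk>X \<in> Obj C; Y \<in> Obj C; f \<in> Mor C X Y\<rbrakk> \<Longrightarrow> inv\<^bsub>Hom C X Y\<^esub> f \<in> Mor C X Y"
  using group.inv_closed hom_group' by metis

declare idt_in [simp, intro] cmp_in [simp, intro] idt_left [simp] idt_right [simp]

lemma cmp_left_hom: "\<lbrakk>X \<in> Obj C; Y \<in> Obj C; Z \<in> Obj C; f \<in> Mor C X Y\<rbrakk> \<Longrightarrow>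
    (\<lambda>g. Cmp C X Y Z g f) \<in> hom (Hom C Y Z) (Hom C X Z)"
  by (auto simp: hom_def cmp_add_left)

lemma cmp_right_hom: "\<lbrakk>X \<in> Obj C; Y \<in> Obj C; Z \<in> Obj C; g \<in> Mor C Y Z\<rbrakk> \<Longrightarrow>
    Cmp C X Y Z g \<in> hom (Hom C X Y) (Hom C X Z)"
  by (auto simp: hom_def cmp_add_right)

lemma cmp_zero_left [simp]: "\<lbrakk>X \<in> Obj C; Y \<in> Obj C; Z \<in> Obj C; f \<in> Mor C X Y\<rbrakk> \<Longrightarrow>
    Cmp C X Y Z \<one>\<^bsub>Hom C Y Z\<^esub> f = \<one>\<^bsub>Hom C X Z\<^esub>"
  using hom_one[OF cmp_left_hom] by simp

lemma cmp_zero_right [simp]: "\<lbrakk>X \<in> Obj C; Y \<in> Obj C; Z \<in> Obj C; g \<in> Mor C Y Z\<rbrakk> \<Longrightarrow>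
    Cmp C X Y Z g \<one>\<^bsub>Hom C X Y\<^esub> = \<one>\<^bsub>Hom C X Z\<^esub>"
  using hom_one[OF cmp_right_hom] by simp

lemma cmp_inv_left: "\<lbrakk>X \<in> Obj C; Y \<in> Obj C; Z \<in> Obj C; f \<in> Mor C X Y; g \<in> Mor C Y Z\<rbrakk> \<Longrightarrow>
    Cmp C X Y Z (inv\<^bsub>Hom C Y Z\<^esub> g) f = inv\<^bsub>Hom C X Z\<^esub> (Cmp C X Y Z g f)"
  using hom_inv[OF _ _ cmp_left_hom] by simp

lemma cmp_inv_right: "\<lbrakk>X \<in> Obj C; Y \<in> Obj C; Z \<in> Obj C; f \<in> Mor C X Y; g \<in> Mor C Y Z\<rbrakk> \<Longrightarrow>
    Cmp C X Y Z g (inv\<^bsub>Hom C X Y\<^esub> f) = inv\<^bsub>Hom C X Z\<^esub> (Cmp C X Y Z g f)"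
  using hom_inv[OF _ _ cmp_right_hom] by simp

lemma div_eq_zero_iff: "\<lbrakk>X \<in> Obj C; Y \<in> Obj C; f \<in> Mor C X Y; g \<in> Mor C X Y\<rbrakk> \<Longrightarrow>
    f \<otimes>\<^bsub>Hom C X Y\<^esub> inv\<^bsub>Hom C X Y\<^esub> g = \<one>\<^bsub>Hom C X Y\<^esub> \<longleftrightarrow> f = g"
  using group.div_eq_one_iff hom_group' by metis

lemma inverse_mors_in: "inverse_mors C X Y f g \<Longrightarrow> f \<in> Mor C X Y" "inverse_mors C X Y f g \<Longrightarrow> g \<in> Mor C Y X"
  by (auto simp: inverse_mors_def)

lemma inverse_mors_sym: "inverse_mors C X Y f g \<Longrightarrow> inverse_mors C Y X g f"
  by (auto simp: inverse_mors_def)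

lemma inverse_mors_cancel:
  assumes "inverse_mors C X Y f g" "W \<in> Obj C" "X \<in> Obj C" "Y \<in> Obj C" "u \<in> Mor C W X"
  shows "Cmp C W Y X g (Cmp C W X Y f u) = u"
  using assms cmp_assoc[of W X Y X u f g] by (simp add: inverse_mors_def)

lemma inverse_mors_cancel':
  assumes "inverse_mors C X Y f g" "Z \<in> Obj C" "X \<in> Obj C" "Y \<in> Obj C" "u \<in> Mor C Y Z"
  shows "Cmp C Y X Z (Cmp C X Y Z u f) g = u"
  using assms cmp_assoc[of Y X Y Z g f u] by (simp add: inverse_mors_def)

lemma iso_idt: "X \<in> Obj C \<Longrightarrow> inverse_mors C X X (Idt C X) (Idt C X)"
  by (simp add: inverse_mors_def)

lemma biproduct_orth:
  assumes "biproduct C A B P i j p q" "A \<in> Obj C" "B \<in> Obj C" "P \<in> Obj C"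
  shows "Cmp C A P B q i = \<one>\<^bsub>Hom C A B\<^esub>" "Cmp C B P A p j = \<one>\<^bsub>Hom C B A\<^esub>"
proof -
  have b: "i \<in> Mor C A P" "j \<in> Mor C B P" "p \<in> Mor C P A" "q \<in> Mor C P B"
     "Cmp C A P A p i = Idt C A" "Cmp C B P B q j = Idt C B"
     "Cmp C P A P i p \<otimes>\<^bsub>Hom C P P\<^esub> Cmp C P B P j q = Idt C P"
    using assms(1) by (auto simp: biproduct_def)
  interpret AP: group "Hom C A P" using assms by simp
  interpret BP: group "Hom C B P" using assms by simp
  \<comment> \<open>Composing \<open>i p + j q = 1\<close> with \<open>i\<close> gives
    \<open>i + j q i = i\<close>; after cancelling \<open>i\<close>, composition with
    \<open>q\<close> removes \<open>j\<close>.\<close>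
  have "i = Cmp C A P P (Cmp C P A P i p \<otimes>\<^bsub>Hom C P P\<^esub> Cmp C P B P j q) i"
    using b assms by simp
  also have "\<dots> = i \<otimes>\<^bsub>Hom C A P\<^esub> Cmp C A B P j (Cmp C A P B q i)"
    using b(1-6) assms(2-) by (simp add: cmp_add_left cmp_assoc)
  finally have "Cmp C A B P j (Cmp C A P B q i) = \<one>\<^bsub>Hom C A P\<^esub>"
    by (rule AP.l_cancel_one'[THEN iffD1, rotated 2]) (use b(1-4) assms in auto)
  then have "Cmp C A P B q (Cmp C A B P j (Cmp C A P B q i)) = \<one>\<^bsub>Hom C A B\<^esub>"
    using b assms by simp
  then show "Cmp C A P B q i = \<one>\<^bsub>Hom C A B\<^esub>"
    using b assms cmp_assoc[of A B P B "Cmp C A P B q i" j q] by simp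
  have "j = Cmp C B P P (Cmp C P A P i p \<otimes>\<^bsub>Hom C P P\<^esub> Cmp C P B P j q) j"
    using b assms by simp
  also have "\<dots> = Cmp C B A P i (Cmp C B P A p j) \<otimes>\<^bsub>Hom C B P\<^esub> j"
    using b(1-6) assms(2-) by (simp add: cmp_add_left cmp_assoc)
  finally have "Cmp C B A P i (Cmp C B P A p j) = \<one>\<^bsub>Hom C B P\<^esub>"
    by (rule BP.r_cancel_one'[THEN iffD1, rotated 2]) (use b(1-4) assms in auto)
  then have "Cmp C B P A p (Cmp C B A P i (Cmp C B P A p j)) = \<one>\<^bsub>Hom C B A\<^esub>"
    using b assms by simp
  then show "Cmp C B P A p j = \<one>\<^bsub>Hom C B A\<^esub>"
    using b assms cmp_assoc[of B A P A "Cmp C B P A p j" i p] by simp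
qed

end

context additive_functor
begin

lemma fmor_in [simp, intro]: "\<lbrakk>X \<in> Obj C; Y \<in> Obj C; u \<in> Mor C X Y\<rbrakk> \<Longrightarrow> fmor f X Y u \<in> Mor D (fob f X) (fob f Y)"
  by (rule hom_in_carrier[OF fmor_hom])

declare fob_in [simp, intro] fmor_idt [simp]

lemma fmor_mult: "\<lbrakk>X \<in> Obj C; Y \<in> Obj C; u \<in> Mor C X Y; v \<in> Mor C X Y\<rbrakk> \<Longrightarrow>
    fmor f X Y (u \<otimes>\<^bsub>Hom C X Y\<^esub> v) = fmor f X Y u \<otimes>\<^bsub>Hom D (fob f X) (fob f Y)\<^esub> fmor f X Y v"
  by (rule hom_mult[OF fmor_hom])

lemma fmor_zero [simp]: "\<lbrakk>X \<in> Obj C; Y \<in> Obj C\<rbrakk> \<Longrightarrow>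
    fmor f X Y \<one>\<^bsub>Hom C X Y\<^esub> = \<one>\<^bsub>Hom D (fob f X) (fob f Y)\<^esub>"
  by (rule hom_one[OF fmor_hom]) auto

lemma fmor_inv: "\<lbrakk>X \<in> Obj C; Y \<in> Obj C; u \<in> Mor C X Y\<rbrakk> \<Longrightarrow>
    fmor f X Y (inv\<^bsub>Hom C X Y\<^esub> u) = inv\<^bsub>Hom D (fob f X) (fob f Y)\<^esub> fmor f X Y u"
  by (rule hom_inv[OF _ _ fmor_hom]) auto

end

section \<open>Presheaves\<close>

locale psh = preadditive_category C for C :: "('o, 'm, 'z) acat_scheme" +
  fixes F :: "('o, 'm, 'x) presheaf"
  assumes additive: "additive_presheaf C F"
begin

lemma val_comm_group: "X \<in> Obj C \<Longrightarrow> comm_group (val F X)"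
  using additive by (simp add: additive_presheaf_def)

lemma val_group [simp]: "X \<in> Obj C \<Longrightarrow> group (val F X)"
  using val_comm_group comm_group.axioms(2) by blast

lemma val_mult [simp, intro]: "\<lbrakk>X \<in> Obj C; x \<in> carrier (val F X); y \<in> carrier (val F X)\<rbrakk> \<Longrightarrow>
    x \<otimes>\<^bsub>val F X\<^esub> y \<in> carrier (val F X)"
  using monoid.m_closed group.is_monoid val_group by metis

lemma val_one [simp, intro]: "X \<in> Obj C \<Longrightarrow> \<one>\<^bsub>val F X\<^esub> \<in> carrier (val F X)"
  using monoid.one_closed group.is_monoid val_group by metis

lemma val_div_eq_one_iff: "\<lbrakk>X \<in> Obj C; x \<in> carrier (val F X); y \<in> carrier (val F X)\<rbrakk> \<Longrightarrow>
    x \<otimes>\<^bsub>val F X\<^esub> inv\<^bsub>val F X\<^esub> y = \<one>\<^bsub>val F X\<^esub> \<longleftrightarrow> x = y"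
  using group.div_eq_one_iff val_group by metis

lemma act_hom: "\<lbrakk>X \<in> Obj C; Y \<in> Obj C; f \<in> Mor C X Y\<rbrakk> \<Longrightarrow> act F X Y f \<in> hom (val F Y) (val F X)"
  using additive by (simp add: additive_presheaf_def)

lemma act_in [simp, intro]: "\<lbrakk>X \<in> Obj C; Y \<in> Obj C; f \<in> Mor C X Y; x \<in> carrier (val F Y)\<rbrakk> \<Longrightarrow>
    act F X Y f x \<in> carrier (val F X)"
  by (rule hom_in_carrier[OF act_hom])

lemma act_mult: "\<lbrakk>X \<in> Obj C; Y \<in> Obj C; f \<in> Mor C X Y; x \<in> carrier (val F Y); y \<in> carrier (val F Y)\<rbrakk> \<Longrightarrow>
    act F X Y f (x \<otimes>\<^bsub>val F Y\<^esub> y) = act F X Y f x \<otimes>\<^bsub>val F X\<^esub> act F X Y f y"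
  by (rule hom_mult[OF act_hom])

lemma act_one [simp]: "\<lbrakk>X \<in> Obj C; Y \<in> Obj C; f \<in> Mor C X Y\<rbrakk> \<Longrightarrow> act F X Y f \<one>\<^bsub>val F Y\<^esub> = \<one>\<^bsub>val F X\<^esub>"
  by (rule hom_one[OF act_hom]) auto

lemma act_inv: "\<lbrakk>X \<in> Obj C; Y \<in> Obj C; f \<in> Mor C X Y; x \<in> carrier (val F Y)\<rbrakk> \<Longrightarrow>
    act F X Y f (inv\<^bsub>val F Y\<^esub> x) = inv\<^bsub>val F X\<^esub> (act F X Y f x)"
  by (rule hom_inv[OF _ _ act_hom]) auto

lemma act_idt [simp]: "\<lbrakk>X \<in> Obj C; x \<in> carrier (val F X)\<rbrakk> \<Longrightarrow> act F X X (Idt C X) x = x"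
  using additive by (simp add: additive_presheaf_def)

lemma act_cmp: "\<lbrakk>X \<in> Obj C; Y \<in> Obj C; Z \<in> Obj C; f \<in> Mor C X Y; g \<in> Mor C Y Z; x \<in> carrier (val F Z)\<rbrakk> \<Longrightarrow>
    act F X Z (Cmp C X Y Z g f) x = act F X Y f (act F Y Z g x)"
  using additive by (simp add: additive_presheaf_def)

lemma act_add: "\<lbrakk>X \<in> Obj C; Y \<in> Obj C; f \<in> Mor C X Y; g \<in> Mor C X Y; x \<in> carrier (val F Y)\<rbrakk> \<Longrightarrow>
    act F X Y (f \<otimes>\<^bsub>Hom C X Y\<^esub> g) x = act F X Y f x \<otimes>\<^bsub>val F X\<^esub> act F X Y g x"
  using additive by (simp add: additive_presheaf_def)

lemma act_left_hom: "\<lbrakk>X \<in> Obj C; Y \<in> Obj C; x \<in> carrier (val F Y)\<rbrakk> \<Longrightarrow>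
    (\<lambda>f. act F X Y f x) \<in> hom (Hom C X Y) (val F X)"
  by (auto simp: hom_def act_add)

lemma act_zero [simp]: "\<lbrakk>X \<in> Obj C; Y \<in> Obj C; x \<in> carrier (val F Y)\<rbrakk> \<Longrightarrow>
    act F X Y \<one>\<^bsub>Hom C X Y\<^esub> x = \<one>\<^bsub>val F X\<^esub>"
  using hom_one[OF act_left_hom] by simp

lemma act_neg: "\<lbrakk>X \<in> Obj C; Y \<in> Obj C; f \<in> Mor C X Y; x \<in> carrier (val F Y)\<rbrakk> \<Longrightarrow>
    act F X Y (inv\<^bsub>Hom C X Y\<^esub> f) x = inv\<^bsub>val F X\<^esub> (act F X Y f x)"
  using hom_inv[OF _ _ act_left_hom] by simp

lemma act_square:
  assumes "Cmp C W X Z g f = Cmp C W Y Z g' f'" "W \<in> Obj C" "X \<in> Obj C" "Y \<in> Obj C" "Z \<in> Obj C"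
    "f \<in> Mor C W X" "g \<in> Mor C X Z" "f' \<in> Mor C W Y" "g' \<in> Mor C Y Z" "x \<in> carrier (val F Z)"
  shows "act F W X f (act F X Z g x) = act F W Y f' (act F Y Z g' x)"
  using assms(2-) by (simp add: act_cmp[symmetric] assms(1))

lemma act_inverse:
  assumes "inverse_mors C X Y f g" "X \<in> Obj C" "Y \<in> Obj C" "x \<in> carrier (val F X)"
  shows "act F X Y f (act F Y X g x) = x"
  using assms act_cmp[of X Y X f g x] by (auto simp: inverse_mors_def)

end

lemma transfD:
  assumes "\<phi> \<in> transf C F G"
  shows "X \<in> Obj C \<Longrightarrow> \<phi> X \<in> hom (val F X) (val G X)"
    and "X \<in> Obj C \<Longrightarrow> \<phi> X \<in> extensional (carrier (val F X))"
    and "\<phi> \<in> extensional (Obj C)"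
    and "\<lbrakk>X \<in> Obj C; Y \<in> Obj C; f \<in> Mor C X Y; x \<in> carrier (val F Y)\<rbrakk> \<Longrightarrow>
        \<phi> X (act F X Y f x) = act G X Y f (\<phi> Y x)"
  using assms by (auto simp: transf_def)

lemma transf_eqI:
  assumes "\<phi> \<in> transf C F G" "\<psi> \<in> transf C F G"
    and "\<And>X x. X \<in> Obj C \<Longrightarrow> x \<in> carrier (val F X) \<Longrightarrow> \<phi> X x = \<psi> X x"
  shows "\<phi> = \<psi>"
proof (rule extensionalityI)
  show "\<phi> \<in> extensional (Obj C)" "\<psi> \<in> extensional (Obj C)"
    by (rule transfD(3)[OF assms(1)], rule transfD(3)[OF assms(2)])
  fix X assume X: "X \<in> Obj C"
  show "\<phi> X = \<psi> X"
    by (rule extensionalityI[OF transfD(2)[OF assms(1) X] transfD(2)[OF assms(2) X] assms(3)[OF X]])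
qed

locale pstr = F: psh C F + G: psh C G for C :: "('o, 'm, 'z) acat_scheme"
    and F :: "('o, 'm, 'x) presheaf" and G :: "('o, 'm, 'y) presheaf" +
  fixes \<phi> :: "'o \<Rightarrow> 'x \<Rightarrow> 'y"
  assumes transf: "\<phi> \<in> transf C F G"
begin

lemmas tr_hom = transfD(1)[OF transf] and tr_act = transfD(4)[OF transf]

lemma tr_in [simp, intro]: "\<lbrakk>X \<in> Obj C; x \<in> carrier (val F X)\<rbrakk> \<Longrightarrow> \<phi> X x \<in> carrier (val G X)"
  by (rule hom_in_carrier[OF tr_hom])

lemma tr_mult: "\<lbrakk>X \<in> Obj C; x \<in> carrier (val F X); y \<in> carrier (val F X)\<rbrakk> \<Longrightarrow>
    \<phi> X (x \<otimes>\<^bsub>val F X\<^esub> y) = \<phi> X x \<otimes>\<^bsub>val G X\<^esub> \<phi> X y"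
  by (rule hom_mult[OF tr_hom])

lemma tr_one [simp]: "X \<in> Obj C \<Longrightarrow> \<phi> X \<one>\<^bsub>val F X\<^esub> = \<one>\<^bsub>val G X\<^esub>"
  by (rule hom_one[OF tr_hom]) auto

lemma tr_inv: "\<lbrakk>X \<in> Obj C; x \<in> carrier (val F X)\<rbrakk> \<Longrightarrow> \<phi> X (inv\<^bsub>val F X\<^esub> x) = inv\<^bsub>val G X\<^esub> (\<phi> X x)"
  by (rule hom_inv[OF _ _ tr_hom]) auto

lemma tr_div: "\<lbrakk>X \<in> Obj C; x \<in> carrier (val F X); y \<in> carrier (val F X)\<rbrakk> \<Longrightarrow>
    \<phi> X (x \<otimes>\<^bsub>val F X\<^esub> inv\<^bsub>val F X\<^esub> y) = \<phi> X x \<otimes>\<^bsub>val G X\<^esub> inv\<^bsub>val G X\<^esub> \<phi> X y"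
  by (simp add: tr_mult tr_inv)

end

lemma transfI:
  assumes "\<And>X x. \<lbrakk>X \<in> Obj C; x \<in> carrier (val F X)\<rbrakk> \<Longrightarrow> \<phi> X x \<in> carrier (val G X)"
    and "\<And>X x y. \<lbrakk>X \<in> Obj C; x \<in> carrier (val F X); y \<in> carrier (val F X)\<rbrakk> \<Longrightarrow>
      \<phi> X (x \<otimes>\<^bsub>val F X\<^esub> y) = \<phi> X x \<otimes>\<^bsub>val G X\<^esub> \<phi> X y"
    and "\<And>X Y f x. \<lbrakk>X \<in> Obj C; Y \<in> Obj C; f \<in> Mor C X Y; x \<in> carrier (val F Y)\<rbrakk> \<Longrightarrow>
        \<phi> X (act F X Y f x) = act G X Y f (\<phi> Y x)"
    and "\<phi> \<in> extensional (Obj C)" "\<And>X. X \<in> Obj C \<Longrightarrow> \<phi> X \<in> extensional (carrier (val F X))"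
  shows "\<phi> \<in> transf C F G"
  using assms by (simp add: transf_def hom_def Pi_def)

text \<open>The Yoneda correspondence from elements of \<open>F(X)\<close> to morphisms
  \<open>H_X \<rightarrow> F\<close>. It replaces the index category of the colimits by the category
  of elements of \<open>F\<close>.\<close>

definition yo :: "('o, 'm, 'z) acat_scheme \<Rightarrow> ('o, 'm, 'x) presheaf \<Rightarrow> 'o \<Rightarrow> 'x \<Rightarrow> 'o \<Rightarrow> 'm \<Rightarrow> 'x" where
  "yo C F X x = (\<lambda>Y\<in>Obj C. \<lambda>g\<in>Mor C Y X. act F Y X g x)"

lemma representable_simps [simp]:
  "val (representable C X) Y = Hom C Y X" "act (representable C X) Y Z f g = Cmp C Y Z X g f"
  by (auto simp: representable_def)

context psh
begin

lemma yo_transf: "\<lbrakk>X \<in> Obj C; x \<in> carrier (val F X)\<rbrakk> \<Longrightarrow> yo C F X x \<in> transf C (representable C X) F"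
  by (rule transfI) (auto simp: yo_def act_add act_cmp)

lemma yo_idt [simp]: "\<lbrakk>X \<in> Obj C; x \<in> carrier (val F X)\<rbrakk> \<Longrightarrow> yo C F X x X (Idt C X) = x"
  by (simp add: yo_def)

lemma transf_representable:
  assumes X: "X \<in> Obj C" and \<eta>: "\<eta> \<in> transf C (representable C X) F"
  shows "\<eta> X (Idt C X) \<in> carrier (val F X)" "\<eta> = yo C F X (\<eta> X (Idt C X))"
proof -
  show e: "\<eta> X (Idt C X) \<in> carrier (val F X)"
    using transfD(1)[OF \<eta> X] X by (auto simp: hom_def)
  show "\<eta> = yo C F X (\<eta> X (Idt C X))"
  proof (rule transf_eqI[OF \<eta> yo_transf[OF X e]])
    fix Y g assume Y: "Y \<in> Obj C" "g \<in> carrier (val (representable C X) Y)"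
    then show "\<eta> Y g = yo C F X (\<eta> X (Idt C X)) Y g"
      using transfD(4)[OF \<eta>, of Y X g "Idt C X"] X by (simp add: yo_def)
  qed
qed

lemma slice_ob_eq: "slice_ob C F = {(X, yo C F X x) | X x. X \<in> Obj C \<and> x \<in> carrier (val F X)}"
  unfolding slice_ob_def using yo_transf transf_representable by fast

lemma slice_mor_yo:
  assumes "X \<in> Obj C" "x \<in> carrier (val F X)" "X' \<in> Obj C" "x' \<in> carrier (val F X')"
  shows "slice_mor C (X, yo C F X x) (X', yo C F X' x') = {u \<in> Mor C X X'. act F X X' u x' = x}"
proof -
  have "(\<forall>Y\<in>Obj C. \<forall>g\<in>Mor C Y X. act F Y X g x = act F Y X' (Cmp C Y X X' u g) x') \<longleftrightarrow> act F X X' u x' = x"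
    (is "?l \<longleftrightarrow> ?r") if u: "u \<in> Mor C X X'" for u
  proof
    assume ?l
    from this[rule_format, of X "Idt C X"] u assms show ?r by simp
  next
    assume ?r
    with u assms show ?l by (simp add: act_cmp)
  qed
  then show ?thesis using assms by (auto simp: slice_mor_def yo_def)
qed

end

section \<open>Filtered colimits of representable presheaves\<close>

text \<open>The operations on colimits and quotients are defined as the class of the set of all
  results over all representatives. To evaluate one, it is enough that this set is nonempty and
  contained in a single class.\<close>

lemma Image_eq_class:
  assumes "equiv B R" "S \<subseteq> R `` {b}" "S \<noteq> {}"
  shows "R `` S = R `` {b}"
proof -
  have "R `` {s} = R `` {b}" if "s \<in> S" for s
    using that assms equiv_class_eq[of B R b s] by auto
  moreover have "R `` S = (\<Union>s\<in>S. R `` {s})" by auto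
  ultimately show ?thesis using assms(3) by auto
qed

text \<open>Together with nonemptiness, the two conditions make the category of elements of
  \<open>F\<close> filtered: biproducts give upper bounds, and \<open>weak\<close> makes parallel
  morphisms equal. For a cohomological functor, \<open>weak\<close> is exactness at a triangle on
  \<open>u\<close>.\<close>

locale flat_presheaf = psh A F
  for A :: "('a, 'm, 'z) acat_scheme" and F :: "('a, 'm, 'x) presheaf" +
  assumes biproduct_ex: "\<lbrakk>X \<in> Obj A; X' \<in> Obj A\<rbrakk> \<Longrightarrow> \<exists>P\<in>Obj A. \<exists>i j p q. biproduct A X X' P i j p q"
    and weak: "\<lbrakk>X \<in> Obj A; Y \<in> Obj A; u \<in> Mor A X Y; y \<in> carrier (val F Y); act F X Y u y = \<one>\<^bsub>val F X\<^esub>\<rbrakk> \<Longrightarrow>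
      \<exists>Z\<in>Obj A. \<exists>w\<in>Mor A Y Z. \<exists>z\<in>carrier (val F Z). Cmp A X Y Z w u = \<one>\<^bsub>Hom A X Z\<^esub> \<and> act F Y Z w z = y"
begin

lemma upper_bound:
  assumes "X \<in> Obj A" "X' \<in> Obj A" "x \<in> carrier (val F X)" "x' \<in> carrier (val F X')"
  obtains P i j p q z where "P \<in> Obj A" "biproduct A X X' P i j p q" "z \<in> carrier (val F P)"
    "act F X P i z = x" "act F X' P j z = x'"
proof -
  obtain P i j p q where P: "P \<in> Obj A" and b: "biproduct A X X' P i j p q"
    using biproduct_ex assms by blast
  note b' = b[unfolded biproduct_def]
  note o = biproduct_orth[OF b assms(1,2) P]
  let ?z = "act F P X p x \<otimes>\<^bsub>val F P\<^esub> act F P X' q x'"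
  have 1: "act F X P i ?z = x"
    using b' P assms o group.is_monoid[OF val_group] by (simp add: act_mult act_cmp[symmetric] monoid.r_one)
  have 2: "act F X' P j ?z = x'"
    using b' P assms o group.is_monoid[OF val_group] by (simp add: act_mult act_cmp[symmetric] monoid.l_one)
  from that[OF P b _ 1 2] b' P assms show ?thesis by simp
qed

text \<open>Apply \<open>weak\<close> to the difference of \<open>u\<close> and
  \<open>v\<close>.\<close>

lemma coequalize:
  assumes "X \<in> Obj A" "X' \<in> Obj A" "u \<in> Mor A X X'" "v \<in> Mor A X X'" "x \<in> carrier (val F X')"
    "act F X X' u x = act F X X' v x"
  obtains Z w z where "Z \<in> Obj A" "w \<in> Mor A X' Z" "z \<in> carrier (val F Z)"
    "Cmp A X X' Z w u = Cmp A X X' Z w v" "act F X' Z w z = x"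
proof -
  let ?d = "u \<otimes>\<^bsub>Hom A X X'\<^esub> inv\<^bsub>Hom A X X'\<^esub> v"
  have "act F X X' ?d x = \<one>\<^bsub>val F X\<^esub>"
    using assms by (simp add: act_add act_neg val_div_eq_one_iff)
  then obtain Z w z where Z: "Z \<in> Obj A" "w \<in> Mor A X' Z" "z \<in> carrier (val F Z)"
    "Cmp A X X' Z w ?d = \<one>\<^bsub>Hom A X Z\<^esub>" "act F X' Z w z = x"
    using weak[of X X' ?d x] assms by auto
  then have "Cmp A X X' Z w u = Cmp A X X' Z w v"
    using assms by (simp add: cmp_add_right cmp_inv_right div_eq_zero_iff)
  with Z that show ?thesis by blast
qed

text \<open>An upper bound of \<open>Z\<close> and \<open>Z'\<close> need not make the square from
  \<open>X\<close> commute; coequalising the two composites into it does.\<close>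

lemma amalgamate:
  assumes "X \<in> Obj A" "Z \<in> Obj A" "Z' \<in> Obj A" "u \<in> Mor A X Z" "v \<in> Mor A X Z'"
    "z \<in> carrier (val F Z)" "z' \<in> carrier (val F Z')" "act F X Z u z = act F X Z' v z'"
  obtains Q w w' y where "Q \<in> Obj A" "w \<in> Mor A Z Q" "w' \<in> Mor A Z' Q" "y \<in> carrier (val F Q)"
    "Cmp A X Z Q w u = Cmp A X Z' Q w' v" "act F Z Q w y = z" "act F Z' Q w' y = z'"
proof -
  obtain P i j p q e where P: "P \<in> Obj A" "biproduct A Z Z' P i j p q" "e \<in> carrier (val F P)"
    "act F Z P i e = z" "act F Z' P j e = z'"
    using upper_bound[OF assms(2,3,6,7)] .
  then have ij: "i \<in> Mor A Z P" "j \<in> Mor A Z' P" by (auto simp: biproduct_def)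
  obtain Q r y where Q: "Q \<in> Obj A" "r \<in> Mor A P Q" "y \<in> carrier (val F Q)"
    "Cmp A X P Q r (Cmp A X Z P i u) = Cmp A X P Q r (Cmp A X Z' P j v)" "act F P Q r y = e"
    by (rule coequalize[of X P "Cmp A X Z P i u" "Cmp A X Z' P j v" e])
      (use P ij assms in \<open>simp_all add: act_cmp\<close>)
  show ?thesis
    by (rule that[of Q "Cmp A Z P Q r i" "Cmp A Z' P Q r j" y])
      (use P ij Q assms in \<open>simp_all add: act_cmp cmp_assoc\<close>)
qed

end

locale pull_data = flat_presheaf A F + Fu: additive_functor A B f
  for A :: "('a, 'm, 'z) acat_scheme" and F :: "('a, 'm, 'x) presheaf"
    and B :: "('b, 'n, 'w) acat_scheme" and f
begin

abbreviation mv where "mv Y X Z u g \<equiv> Cmp B Y (fob f X) (fob f Z) (fmor f X Z u) g"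

lemma mv_cmp: "\<lbrakk>Y \<in> Obj B; X \<in> Obj A; Z \<in> Obj A; Q \<in> Obj A; u \<in> Mor A X Z; w \<in> Mor A Z Q; g \<in> Mor B Y (fob f X)\<rbrakk>
    \<Longrightarrow> mv Y X Q (Cmp A X Z Q w u) g = mv Y Z Q w (mv Y X Z u g)"
  by (simp add: Fu.fmor_cmp Fu.D.cmp_assoc)

abbreviation el_ok where "el_ok Y X x g \<equiv> X \<in> Obj A \<and> x \<in> carrier (val F X) \<and> g \<in> Mor B Y (fob f X)"

text \<open>Equality in the filtered colimit: \<open>g\<close> at the index \<open>(X, x)\<close>
  and \<open>g'\<close> at \<open>(X', x')\<close> become equal at a later index
  \<open>(Z, z)\<close>. It is \<open>pull_rel\<close> with morphisms
  \<open>H_X \<rightarrow> F\<close> replaced by elements of \<open>F(X)\<close>.\<close>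

definition el_rel where
  "el_rel Y X x g X' x' g' \<longleftrightarrow> (\<exists>Z\<in>Obj A. \<exists>u\<in>Mor A X Z. \<exists>v\<in>Mor A X' Z. \<exists>z\<in>carrier (val F Z).
     act F X Z u z = x \<and> act F X' Z v z = x' \<and> mv Y X Z u g = mv Y X' Z v g')"

lemma el_rel_push:
  assumes "Y \<in> Obj B" "X \<in> Obj A" "Z \<in> Obj A" "u \<in> Mor A X Z" "z \<in> carrier (val F Z)" "g \<in> Mor B Y (fob f X)"
  shows "el_rel Y X (act F X Z u z) g Z z (mv Y X Z u g)"
  unfolding el_rel_def using assms
  by (intro bexI[of _ Z] bexI[of _ u] bexI[of _ "Idt A Z"] bexI[of _ z]) auto

lemma el_rel_refl: "\<lbrakk>Y \<in> Obj B; el_ok Y X x g\<rbrakk> \<Longrightarrow> el_rel Y X x g X x g"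
  using el_rel_push[of Y X X "Idt A X" x g] by simp

lemma el_rel_sym: "el_rel Y X x g X' x' g' \<Longrightarrow> el_rel Y X' x' g' X x g"
  unfolding el_rel_def by metis

lemma el_rel_trans:
  assumes "el_rel Y X1 x1 g1 X2 x2 g2" "el_rel Y X2 x2 g2 X3 x3 g3" "Y \<in> Obj B"
    "el_ok Y X1 x1 g1" "el_ok Y X2 x2 g2" "el_ok Y X3 x3 g3"
  shows "el_rel Y X1 x1 g1 X3 x3 g3"
proof -
  obtain Z u v z where Z: "Z \<in> Obj A" "u \<in> Mor A X1 Z" "v \<in> Mor A X2 Z" "z \<in> carrier (val F Z)"
    "act F X1 Z u z = x1" "act F X2 Z v z = x2" "mv Y X1 Z u g1 = mv Y X2 Z v g2"
    using assms(1) unfolding el_rel_def by blast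
  obtain Z' u' v' z' where Z': "Z' \<in> Obj A" "u' \<in> Mor A X2 Z'" "v' \<in> Mor A X3 Z'" "z' \<in> carrier (val F Z')"
    "act F X2 Z' u' z' = x2" "act F X3 Z' v' z' = x3" "mv Y X2 Z' u' g2 = mv Y X3 Z' v' g3"
    using assms(2) unfolding el_rel_def by blast
  obtain Q w w' y where Q: "Q \<in> Obj A" "w \<in> Mor A Z Q" "w' \<in> Mor A Z' Q" "y \<in> carrier (val F Q)"
    "Cmp A X2 Z Q w v = Cmp A X2 Z' Q w' u'" "act F Z Q w y = z" "act F Z' Q w' y = z'"
    by (rule amalgamate[of X2 Z Z' v u' z z']) (use Z Z' assms in simp_all)
  have "mv Y X1 Q (Cmp A X1 Z Q w u) g1 = mv Y X3 Q (Cmp A X3 Z' Q w' v') g3"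
  proof -
    have "mv Y X1 Q (Cmp A X1 Z Q w u) g1 = mv Y X2 Q (Cmp A X2 Z Q w v) g2"
      using Z Q(1-4) assms by (simp add: mv_cmp)
    also have "\<dots> = mv Y X3 Q (Cmp A X3 Z' Q w' v') g3"
      unfolding Q(5) using Z Z' Q(1-4,6,7) assms by (simp add: mv_cmp)
    finally show ?thesis .
  qed
  then show ?thesis unfolding el_rel_def
    using Z Z' Q assms by (intro bexI[of _ Q] bexI[of _ "Cmp A X1 Z Q w u"] bexI[of _ "Cmp A X3 Z' Q w' v'"] bexI[of _ y])
      (auto simp: act_cmp)
qed

text \<open>The two relations may be witnessed by different morphisms out of \<open>Z\<close> and
  out of \<open>X\<close>. Amalgamation makes the morphisms out of \<open>Z\<close> equal, and a
  further coequaliser those out of \<open>X\<close>; then bilinearity of composition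
  applies.\<close>

lemma el_rel_add:
  assumes r: "el_rel Y Z z a X x g" "el_rel Y Z z b X x h" and Y: "Y \<in> Obj B"
    and ok: "el_ok Y Z z a" "el_ok Y Z z b" "el_ok Y X x g" "el_ok Y X x h"
  shows "el_rel Y Z z (a \<otimes>\<^bsub>Hom B Y (fob f Z)\<^esub> b) X x (g \<otimes>\<^bsub>Hom B Y (fob f X)\<^esub> h)"
proof -
  obtain Q1 w1 v1 y1 where 1: "Q1 \<in> Obj A" "w1 \<in> Mor A Z Q1" "v1 \<in> Mor A X Q1" "y1 \<in> carrier (val F Q1)"
    "act F Z Q1 w1 y1 = z" "act F X Q1 v1 y1 = x" "mv Y Z Q1 w1 a = mv Y X Q1 v1 g"
    using r(1) unfolding el_rel_def by blast
  obtain Q2 w2 v2 y2 where 2: "Q2 \<in> Obj A" "w2 \<in> Mor A Z Q2" "v2 \<in> Mor A X Q2" "y2 \<in> carrier (val F Q2)"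
    "act F Z Q2 w2 y2 = z" "act F X Q2 v2 y2 = x" "mv Y Z Q2 w2 b = mv Y X Q2 v2 h"
    using r(2) unfolding el_rel_def by blast
  obtain R r1 r2 y where R: "R \<in> Obj A" "r1 \<in> Mor A Q1 R" "r2 \<in> Mor A Q2 R" "y \<in> carrier (val F R)"
    "Cmp A Z Q1 R r1 w1 = Cmp A Z Q2 R r2 w2" "act F Q1 R r1 y = y1" "act F Q2 R r2 y = y2"
    by (rule amalgamate[of Z Q1 Q2 w1 w2 y1 y2]) (use 1 2 ok in simp_all)
  obtain S s t where S: "S \<in> Obj A" "s \<in> Mor A R S" "t \<in> carrier (val F S)"
    "Cmp A X R S s (Cmp A X Q1 R r1 v1) = Cmp A X R S s (Cmp A X Q2 R r2 v2)" "act F R S s t = y"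
    by (rule coequalize[of X R "Cmp A X Q1 R r1 v1" "Cmp A X Q2 R r2 v2" y])
      (use 1 2 R ok in \<open>simp_all add: act_cmp\<close>)
  let ?w = "Cmp A Z R S s (Cmp A Z Q1 R r1 w1)" and ?v = "Cmp A X R S s (Cmp A X Q1 R r1 v1)"
  have wv: "?w \<in> Mor A Z S" "?v \<in> Mor A X S" using 1(1-3) R(1-3) S(1,2) ok by simp_all
  have a: "mv Y Z S ?w a = mv Y X S ?v g"
    using 1 R(1-4) S(1-3) ok Y by (simp add: mv_cmp)
  have b: "mv Y Z S ?w b = mv Y X S ?v h"
    unfolding R(5) S(4) using 2 R(1-4) S(1-3) ok Y by (simp add: mv_cmp)
  have "mv Y Z S ?w (a \<otimes>\<^bsub>Hom B Y (fob f Z)\<^esub> b) = mv Y X S ?v (g \<otimes>\<^bsub>Hom B Y (fob f X)\<^esub> h)"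
    using a b wv ok Y S(1) by (simp add: Fu.D.cmp_add_right)
  moreover have "act F Z S ?w t = z" "act F X S ?v t = x"
    using 1 R(1-4,6) S(1-3,5) ok by (simp_all add: act_cmp)
  ultimately show ?thesis unfolding el_rel_def using wv S by blast
qed

definition "el_base Y = {((X, yo A F X x), g) | X x g. el_ok Y X x g}"

lemma carrier_pull_val: "carrier (pull_val A B f F Y) = el_base Y // pull_rel A B f F Y"
proof -
  have "(SIGMA i:slice_ob A F. carrier ((\<lambda>(X, \<eta>). val (representable B (fob f X)) Y) i)) = el_base Y"
    by (auto simp: slice_ob_eq el_base_def)
  then show ?thesis by (simp add: pull_val_def pull_rel_def fcolim_def)
qed

lemma yo_inj: "\<lbrakk>yo A F X x = yo A F X x'; X \<in> Obj A; x \<in> carrier (val F X); x' \<in> carrier (val F X)\<rbrakk> \<Longrightarrow> x = x'"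
  using yo_idt by metis

lemma pull_relD:
  assumes "(a, b) \<in> pull_rel A B f F Y"
  obtains X x g X' x' g' where "a = ((X, yo A F X x), g)" "b = ((X', yo A F X' x'), g')"
    "el_ok Y X x g" "el_ok Y X' x' g'" "el_rel Y X x g X' x' g'"
proof -
  obtain X x g X' x' g' Z z u v where *: "a = ((X, yo A F X x), g)" "b = ((X', yo A F X' x'), g')"
    "el_ok Y X x g" "el_ok Y X' x' g'" "Z \<in> Obj A" "z \<in> carrier (val F Z)"
    "u \<in> slice_mor A (X, yo A F X x) (Z, yo A F Z z)" "v \<in> slice_mor A (X', yo A F X' x') (Z, yo A F Z z)"
    "mv Y X Z u g = mv Y X' Z v g'"
    using assms by (auto simp: pull_rel_def fcolim_rel_def slice_ob_eq)
  then have "el_rel Y X x g X' x' g'" unfolding el_rel_def by (auto simp: slice_mor_yo)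
  with * that show ?thesis by blast
qed

lemma pull_rel_iff:
  assumes "el_ok Y X x g" "el_ok Y X' x' g'"
  shows "(((X, yo A F X x), g), ((X', yo A F X' x'), g')) \<in> pull_rel A B f F Y \<longleftrightarrow> el_rel Y X x g X' x' g'"
proof
  assume "(((X, yo A F X x), g), ((X', yo A F X' x'), g')) \<in> pull_rel A B f F Y"
  then show "el_rel Y X x g X' x' g'"
  proof (rule pull_relD)
    fix X1 x1 g1 X2 x2 g2
    assume *: "((X, yo A F X x), g) = ((X1, yo A F X1 x1), g1)" "((X', yo A F X' x'), g') = ((X2, yo A F X2 x2), g2)"
      "el_ok Y X1 x1 g1" "el_ok Y X2 x2 g2" "el_rel Y X1 x1 g1 X2 x2 g2"
    then have "x = x1" "x' = x2" using yo_inj assms by auto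
    with * show ?thesis by simp
  qed
next
  assume "el_rel Y X x g X' x' g'"
  then obtain Z u v z where *: "Z \<in> Obj A" "u \<in> Mor A X Z" "v \<in> Mor A X' Z" "z \<in> carrier (val F Z)"
     "act F X Z u z = x" "act F X' Z v z = x'" "mv Y X Z u g = mv Y X' Z v g'" unfolding el_rel_def by blast
  then have "u \<in> slice_mor A (X, yo A F X x) (Z, yo A F Z z)" "v \<in> slice_mor A (X', yo A F X' x') (Z, yo A F Z z)"
    using assms by (auto simp: slice_mor_yo)
  moreover have "(Z, yo A F Z z) \<in> slice_ob A F" using * by (auto simp: slice_ob_eq)
  ultimately show "(((X, yo A F X x), g), ((X', yo A F X' x'), g')) \<in> pull_rel A B f F Y"
    unfolding pull_rel_def fcolim_rel_def using assms *(7) by (force simp: slice_ob_eq)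
qed

lemma equiv_pull_rel:
  assumes Y: "Y \<in> Obj B" shows "equiv (el_base Y) (pull_rel A B f F Y)"
proof (rule equivI)
  show "pull_rel A B f F Y \<subseteq> el_base Y \<times> el_base Y"
    by (auto elim!: pull_relD simp: el_base_def)
  show "refl_on (el_base Y) (pull_rel A B f F Y)"
    by (auto simp: refl_on_def el_base_def pull_rel_iff el_rel_refl Y)
  show "sym (pull_rel A B f F Y)"
    by (rule symI, erule pull_relD) (auto simp: pull_rel_iff el_rel_sym)
  show "trans (pull_rel A B f F Y)"
  proof (rule transI)
    fix a b c assume "(a, b) \<in> pull_rel A B f F Y" "(b, c) \<in> pull_rel A B f F Y"
    then obtain X x g X' x' g' X2 x2 g2 X3 x3 g3 where *: "a = ((X, yo A F X x), g)" "b = ((X', yo A F X' x'), g')"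
      "el_ok Y X x g" "el_ok Y X' x' g'" "el_rel Y X x g X' x' g'"
      "b = ((X2, yo A F X2 x2), g2)" "c = ((X3, yo A F X3 x3), g3)"
      "el_ok Y X2 x2 g2" "el_ok Y X3 x3 g3" "el_rel Y X2 x2 g2 X3 x3 g3"
      by (elim pull_relD) blast
    then have "X2 = X'" "x2 = x'" "g2 = g'" using yo_inj by auto
    with * show "(a, c) \<in> pull_rel A B f F Y" using Y by (auto simp: pull_rel_iff intro: el_rel_trans)
  qed
qed

definition "el_cls Y X x g = pull_rel A B f F Y `` {((X, yo A F X x), g)}"

lemma in_el_cls:
  assumes "a \<in> el_cls Y X x g" "el_ok Y X x g"
  obtains X' x' g' where "a = ((X', yo A F X' x'), g')" "el_ok Y X' x' g'" "el_rel Y X x g X' x' g'"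
proof -
  from assms(1) have "(((X, yo A F X x), g), a) \<in> pull_rel A B f F Y" by (simp add: el_cls_def)
  then show ?thesis
  proof (rule pull_relD)
    fix X1 x1 g1 X' x' g'
    assume *: "((X, yo A F X x), g) = ((X1, yo A F X1 x1), g1)" "a = ((X', yo A F X' x'), g')"
      "el_ok Y X1 x1 g1" "el_ok Y X' x' g'" "el_rel Y X1 x1 g1 X' x' g'"
    then have "X1 = X" "x1 = x" "g1 = g" using yo_inj assms(2) by auto
    with * that show ?thesis by blast
  qed
qed

lemma el_cls_self: "\<lbrakk>Y \<in> Obj B; el_ok Y X x g\<rbrakk> \<Longrightarrow> ((X, yo A F X x), g) \<in> el_cls Y X x g"
  by (simp add: el_cls_def pull_rel_iff el_rel_refl)

lemma el_cls_eq_iff: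
  assumes "Y \<in> Obj B" "el_ok Y X x g" "el_ok Y X' x' g'"
  shows "el_cls Y X x g = el_cls Y X' x' g' \<longleftrightarrow> el_rel Y X x g X' x' g'"
  unfolding el_cls_def
  using eq_equiv_class_iff[OF equiv_pull_rel[OF assms(1)], of "((X, yo A F X x), g)" "((X', yo A F X' x'), g')"] assms
  by (auto simp: el_base_def pull_rel_iff)

lemma el_cls_in: "\<lbrakk>Y \<in> Obj B; el_ok Y X x g\<rbrakk> \<Longrightarrow> el_cls Y X x g \<in> carrier (pull_val A B f F Y)"
  unfolding carrier_pull_val el_cls_def by (rule quotientI) (auto simp: el_base_def)

lemma el_cls_ex:
  assumes "c \<in> carrier (pull_val A B f F Y)"
  obtains X x g where "el_ok Y X x g" "c = el_cls Y X x g"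
  using assms unfolding carrier_pull_val el_cls_def by (auto elim!: quotientE simp: el_base_def)

lemma Image_el_cls:
  assumes Y: "Y \<in> Obj B" and ok: "el_ok Y X x g" and ne: "S \<noteq> {}"
    and S: "\<And>a. a \<in> S \<Longrightarrow> \<exists>X' x' g'. a = ((X', yo A F X' x'), g') \<and> el_ok Y X' x' g' \<and> el_rel Y X x g X' x' g'"
  shows "pull_rel A B f F Y `` S = el_cls Y X x g"
  unfolding el_cls_def using ne S ok
  by (intro Image_eq_class[OF equiv_pull_rel[OF Y]]) (fastforce simp: pull_rel_iff)+

text \<open>At a fixed index the class map is additive, so it is the canonical homomorphism into the
  colimit. All the sums in the definition, formed at arbitrary later indices, fall into one class by
  \<open>el_rel_add\<close>.\<close>

lemma el_cls_mult:
  assumes Y: "Y \<in> Obj B" and ok: "el_ok Y X x g" "el_ok Y X x h"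
  shows "el_cls Y X x g \<otimes>\<^bsub>pull_val A B f F Y\<^esub> el_cls Y X x h = el_cls Y X x (g \<otimes>\<^bsub>Hom B Y (fob f X)\<^esub> h)"
proof -
  let ?t = "\<lambda>(X, \<eta>) (X', \<eta>') u g. Cmp B Y (fob f X) (fob f X') (fmor f X X' u) g"
  let ?D = "\<lambda>(X, \<eta>). val (representable B (fob f X)) Y"
  let ?S = "{(k, ?t i k u a \<otimes>\<^bsub>?D k\<^esub> ?t j k v b) | i a j b k u v. (i, a) \<in> el_cls Y X x g \<and> (j, b) \<in> el_cls Y X x h
    \<and> k \<in> slice_ob A F \<and> u \<in> slice_mor A i k \<and> v \<in> slice_mor A j k}"
  have "el_cls Y X x g \<otimes>\<^bsub>pull_val A B f F Y\<^esub> el_cls Y X x h = pull_rel A B f F Y `` ?S"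
    by (simp add: pull_val_def fcolim_def pull_rel_def)
  also have "\<dots> = el_cls Y X x (g \<otimes>\<^bsub>Hom B Y (fob f X)\<^esub> h)"
  proof (rule Image_el_cls[OF Y])
    show "el_ok Y X x (g \<otimes>\<^bsub>Hom B Y (fob f X)\<^esub> h)" using ok Y by simp
    have "((X, yo A F X x), mv Y X X (Idt A X) g \<otimes>\<^bsub>Hom B Y (fob f X)\<^esub> mv Y X X (Idt A X) h) \<in> ?S"
      using el_cls_self[OF Y ok(1)] el_cls_self[OF Y ok(2)] ok
      by (intro CollectI exI[of _ "(X, yo A F X x)"] exI[of _ g] exI[of _ h] exI[of _ "Idt A X"])
        (auto simp: slice_ob_eq slice_mor_yo)
    then show "?S \<noteq> {}" by blast
    fix s assume "s \<in> ?S"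
    then obtain i a j b k u v where s: "s = (k, ?t i k u a \<otimes>\<^bsub>?D k\<^esub> ?t j k v b)"
      "(i, a) \<in> el_cls Y X x g" "(j, b) \<in> el_cls Y X x h"
      "k \<in> slice_ob A F" "u \<in> slice_mor A i k" "v \<in> slice_mor A j k" by blast
    obtain X1 x1 where i: "i = (X1, yo A F X1 x1)" "el_ok Y X1 x1 a" "el_rel Y X x g X1 x1 a"
      using in_el_cls[OF s(2) ok(1)] by blast
    obtain X2 x2 where j: "j = (X2, yo A F X2 x2)" "el_ok Y X2 x2 b" "el_rel Y X x h X2 x2 b"
      using in_el_cls[OF s(3) ok(2)] by blast
    obtain Z z where k: "k = (Z, yo A F Z z)" "Z \<in> Obj A" "z \<in> carrier (val F Z)"
      using s(4) by (auto simp: slice_ob_eq)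
    have u: "u \<in> Mor A X1 Z" "act F X1 Z u z = x1" and v: "v \<in> Mor A X2 Z" "act F X2 Z v z = x2"
      using s(5,6) i j k by (auto simp: slice_mor_yo)
    have "el_rel Y X1 x1 a Z z (mv Y X1 Z u a)" "el_rel Y X2 x2 b Z z (mv Y X2 Z v b)"
      using el_rel_push[of Y X1 Z u z a] el_rel_push[of Y X2 Z v z b] u v i j k Y by auto
    then have "el_rel Y X x g Z z (mv Y X1 Z u a)" "el_rel Y X x h Z z (mv Y X2 Z v b)"
      using i j k u v ok Y by (auto intro: el_rel_trans)
    then have "el_rel Y X x (g \<otimes>\<^bsub>Hom B Y (fob f X)\<^esub> h) Z z (mv Y X1 Z u a \<otimes>\<^bsub>Hom B Y (fob f Z)\<^esub> mv Y X2 Z v b)"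
      using i j k u v ok Y by (intro el_rel_add) auto
    then show "\<exists>X' x' g'. s = ((X', yo A F X' x'), g') \<and> el_ok Y X' x' g' \<and> el_rel Y X x (g \<otimes>\<^bsub>Hom B Y (fob f X)\<^esub> h) X' x' g'"
      using s(1) i(1,2) j(1,2) k u v Y by auto
  qed
  finally show ?thesis .
qed

lemma el_cls_push:
  assumes "Y \<in> Obj B" "X \<in> Obj A" "Z \<in> Obj A" "u \<in> Mor A X Z" "z \<in> carrier (val F Z)" "g \<in> Mor B Y (fob f X)"
  shows "el_cls Y X (act F X Z u z) g = el_cls Y Z z (mv Y X Z u g)"
  using assms by (subst el_cls_eq_iff) (auto intro: el_rel_push)

lemma el_cls_zero:
  assumes Y: "Y \<in> Obj B" and "X \<in> Obj A" "x \<in> carrier (val F X)" "X' \<in> Obj A" "x' \<in> carrier (val F X')"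
  shows "el_rel Y X x \<one>\<^bsub>Hom B Y (fob f X)\<^esub> X' x' \<one>\<^bsub>Hom B Y (fob f X')\<^esub>"
proof -
  obtain P i j p q z where P: "P \<in> Obj A" "biproduct A X X' P i j p q" "z \<in> carrier (val F P)"
    "act F X P i z = x" "act F X' P j z = x'"
    using upper_bound assms by metis
  then have ij: "i \<in> Mor A X P" "j \<in> Mor A X' P" by (auto simp: biproduct_def)
  show ?thesis unfolding el_rel_def
    by (intro bexI[of _ P] bexI[of _ i] bexI[of _ j] bexI[of _ z]) (use P ij Y assms in auto)
qed

lemma el_cls_one:
  assumes Y: "Y \<in> Obj B" and X: "X \<in> Obj A" "x \<in> carrier (val F X)"
  shows "el_cls Y X x \<one>\<^bsub>Hom B Y (fob f X)\<^esub> = \<one>\<^bsub>pull_val A B f F Y\<^esub>"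
proof -
  let ?D = "\<lambda>(X, \<eta>). val (representable B (fob f X)) Y"
  have "\<one>\<^bsub>pull_val A B f F Y\<^esub> = pull_rel A B f F Y `` {(i, \<one>\<^bsub>?D i\<^esub>) | i. i \<in> slice_ob A F}"
    by (simp add: pull_val_def fcolim_def pull_rel_def)
  also have "\<dots> = el_cls Y X x \<one>\<^bsub>Hom B Y (fob f X)\<^esub>"
    by (rule Image_el_cls) (use assms in \<open>auto simp: slice_ob_eq intro!: el_cls_zero\<close>)
  finally show ?thesis by simp
qed

text \<open>The last clause moves every further element at the index of the first one to the new
  index, so that a third element can be brought in afterwards, as \<open>comm_group_directed\<close>
  demands.\<close>

lemma el_cls_common:
  assumes Y: "Y \<in> Obj B" and ok: "el_ok Y X x g" "el_ok Y X' x' g'"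
  obtains Z z h h' where "el_ok Y Z z h" "el_ok Y Z z h'" "el_cls Y X x g = el_cls Y Z z h"
    "el_cls Y X' x' g' = el_cls Y Z z h'"
    "\<And>k. k \<in> Mor B Y (fob f X) \<Longrightarrow> \<exists>l. el_ok Y Z z l \<and> el_cls Y X x k = el_cls Y Z z l"
proof -
  obtain P i j p q z where P: "P \<in> Obj A" "biproduct A X X' P i j p q" "z \<in> carrier (val F P)"
    "act F X P i z = x" "act F X' P j z = x'"
    using upper_bound ok by metis
  then have ij: "i \<in> Mor A X P" "j \<in> Mor A X' P" by (auto simp: biproduct_def)
  have 1: "el_cls Y X x k = el_cls Y P z (mv Y X P i k)" if "k \<in> Mor B Y (fob f X)" for k
    using el_cls_push[of Y X P i z k] that P ij Y ok by simp
  have 2: "el_cls Y X' x' g' = el_cls Y P z (mv Y X' P j g')"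
    using el_cls_push[of Y X' P j z g'] P ij Y ok by simp
  show ?thesis
  proof (rule that[OF _ _ 1 2])
    show "el_ok Y P z (mv Y X P i g)" "el_ok Y P z (mv Y X' P j g')" "g \<in> Mor B Y (fob f X)"
      using P ij Y ok by auto
    show "\<exists>l. el_ok Y P z l \<and> el_cls Y X x k = el_cls Y P z l" if "k \<in> Mor B Y (fob f X)" for k
      using 1[OF that] P ij Y ok that by (intro exI[of _ "mv Y X P i k"]) auto
  qed
qed

lemma comm_group_pull_val:
  assumes Y: "Y \<in> Obj B" and ne: "Obj A \<noteq> {}" shows "comm_group (pull_val A B f F Y)"
proof (rule comm_group_directed)
  obtain X where "X \<in> Obj A" using ne by blast
  then show "\<one>\<^bsub>pull_val A B f F Y\<^esub> \<in> carrier (pull_val A B f F Y)"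
    using el_cls_one[OF Y, of X "\<one>\<^bsub>val F X\<^esub>"] el_cls_in[OF Y, of X "\<one>\<^bsub>val F X\<^esub>" "\<one>\<^bsub>Hom B Y (fob f X)\<^esub>"] Y by simp
next
  fix a b c assume "a \<in> carrier (pull_val A B f F Y)" "b \<in> carrier (pull_val A B f F Y)" "c \<in> carrier (pull_val A B f F Y)"
  then obtain X x g X' x' g' X'' x'' g'' where a: "el_ok Y X x g" "a = el_cls Y X x g"
    and b: "el_ok Y X' x' g'" "b = el_cls Y X' x' g'" and c: "el_ok Y X'' x'' g''" "c = el_cls Y X'' x'' g''"
    by (meson el_cls_ex)
  obtain Z z h h' where Z: "el_ok Y Z z h" "el_ok Y Z z h'" "a = el_cls Y Z z h" "b = el_cls Y Z z h'"
    using el_cls_common[OF Y a(1) b(1)] a b by metis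
  obtain Q q k k'' where Q: "el_ok Y Q q k" "el_ok Y Q q k''" "a = el_cls Y Q q k" "c = el_cls Y Q q k''"
    and l: "\<And>k. k \<in> Mor B Y (fob f Z) \<Longrightarrow> \<exists>l. el_ok Y Q q l \<and> el_cls Y Z z k = el_cls Y Q q l"
    using el_cls_common[OF Y Z(1) c(1)] Z c by metis
  obtain k' where k': "el_ok Y Q q k'" "b = el_cls Y Q q k'" using l[of h'] Z by auto
  show "\<exists>(D :: 'n monoid) h. comm_group D \<and> h \<in> hom D (pull_val A B f F Y) \<and> h \<one>\<^bsub>D\<^esub> = \<one>\<^bsub>pull_val A B f F Y\<^esub> \<and> {a, b, c} \<subseteq> h ` carrier D"
    using Q k' Y by (intro exI[of _ "Hom B Y (fob f Q)"] exI[of _ "el_cls Y Q q"])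
      (auto simp: Fu.D.hom_group hom_def el_cls_mult el_cls_one el_cls_in)
qed


lemma el_rel_pre:
  assumes "el_rel Y' X x g X' x' g'" "Y \<in> Obj B" "Y' \<in> Obj B" "m \<in> Mor B Y Y'"
    "el_ok Y' X x g" "el_ok Y' X' x' g'"
  shows "el_rel Y X x (Cmp B Y Y' (fob f X) g m) X' x' (Cmp B Y Y' (fob f X') g' m)"
proof -
  obtain Z u v z where *: "Z \<in> Obj A" "u \<in> Mor A X Z" "v \<in> Mor A X' Z" "z \<in> carrier (val F Z)"
     "act F X Z u z = x" "act F X' Z v z = x'" "mv Y' X Z u g = mv Y' X' Z v g'"
    using assms(1) unfolding el_rel_def by blast
  have "mv Y X Z u (Cmp B Y Y' (fob f X) g m) = Cmp B Y Y' (fob f Z) (mv Y' X Z u g) m"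
    using *(1-6) assms by (simp add: Fu.D.cmp_assoc)
  also have "\<dots> = mv Y X' Z v (Cmp B Y Y' (fob f X') g' m)"
    unfolding *(7) using *(1-6) assms by (simp add: Fu.D.cmp_assoc)
  finally show ?thesis unfolding el_rel_def using * by blast
qed

text \<open>Additivity in the element of \<open>F\<close>: glue \<open>x\<close> and
  \<open>x'\<close> to one \<open>z\<close> over the biproduct of \<open>X\<close> with itself. They
  are its restrictions along \<open>i\<close> and \<open>j\<close>, and their sum is its restriction
  along \<open>i + j\<close>.\<close>

lemma el_cls_add:
  assumes Y: "Y \<in> Obj B" and ok: "X \<in> Obj A" "x \<in> carrier (val F X)" "x' \<in> carrier (val F X)" "g \<in> Mor B Y (fob f X)"
  shows "el_cls Y X (x \<otimes>\<^bsub>val F X\<^esub> x') g = el_cls Y X x g \<otimes>\<^bsub>pull_val A B f F Y\<^esub> el_cls Y X x' g"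
proof -
  obtain P i j p q z where P: "P \<in> Obj A" "biproduct A X X P i j p q" "z \<in> carrier (val F P)"
    and z: "act F X P i z = x" "act F X P j z = x'"
    using upper_bound ok by metis
  then have ij: "i \<in> Mor A X P" "j \<in> Mor A X P" by (auto simp: biproduct_def)
  have e: "el_cls Y X (act F X P u z) g = el_cls Y P z (mv Y X P u g)" if "u \<in> Mor A X P" for u
    using el_cls_push that P ok Y by simp
  have "el_cls Y X x g \<otimes>\<^bsub>pull_val A B f F Y\<^esub> el_cls Y X x' g
      = el_cls Y P z (mv Y X P i g \<otimes>\<^bsub>Hom B Y (fob f P)\<^esub> mv Y X P j g)"
    unfolding z[symmetric] using P ij ok Y by (simp add: e el_cls_mult)
  also have "\<dots> = el_cls Y P z (mv Y X P (i \<otimes>\<^bsub>Hom A X P\<^esub> j) g)"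
    using P ij ok Y by (simp add: Fu.fmor_mult Fu.D.cmp_add_left)
  also have "\<dots> = el_cls Y X (x \<otimes>\<^bsub>val F X\<^esub> x') g"
    unfolding z[symmetric] using P ij ok Y by (simp add: e[symmetric] act_add)
  finally show ?thesis by simp
qed

text \<open>Transport along an isomorphism brings every index into the small set \<open>R\<close> of
  representatives, and over \<open>R\<close> the triples \<open>(X, x, g)\<close> form a small
  set.\<close>

lemma small_pull_val:
  assumes inf: "infinite (UNIV :: 'x set)" and Y: "Y \<in> Obj B"
    and R: "R \<subseteq> Obj A" "small TYPE('x) R" "\<And>X. X \<in> Obj A \<Longrightarrow> \<exists>X'\<in>R. \<exists>u. iso_mor A X X' u"
    and H: "\<And>X. X \<in> R \<Longrightarrow> small TYPE('x) (Mor B Y (fob f X))"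
  shows "small TYPE('x) (carrier (pull_val A B f F Y))"
proof (rule small_subset[OF small_image])
  show "small TYPE('x) (SIGMA X:R. carrier (val F X) \<times> Mor B Y (fob f X))"
    by (intro small_Sigma inf R(2) small_self H)
  show "carrier (pull_val A B f F Y) \<subseteq> (\<lambda>(X, x, g). el_cls Y X x g) ` (SIGMA X:R. carrier (val F X) \<times> Mor B Y (fob f X))"
  proof
    fix c assume "c \<in> carrier (pull_val A B f F Y)"
    then obtain X x g where c: "el_ok Y X x g" "c = el_cls Y X x g" by (rule el_cls_ex)
    obtain X' u v where X': "X' \<in> R" and uv: "inverse_mors A X X' u v"
      using R(3) c unfolding iso_mor_def by blast
    have u: "u \<in> Mor A X X'" "v \<in> Mor A X' X" using uv by (auto simp: inverse_mors_def)
    have X'o: "X' \<in> Obj A" using X' R(1) by blast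
    have "c = el_cls Y X (act F X X' u (act F X' X v x)) g" using c uv X'o by (simp add: act_inverse)
    also have "\<dots> = el_cls Y X' (act F X' X v x) (mv Y X X' u g)"
      using c u X'o Y by (intro el_cls_push) auto
    finally show "c \<in> (\<lambda>(X, x, g). el_cls Y X x g) ` (SIGMA X:R. carrier (val F X) \<times> Mor B Y (fob f X))"
      using c u X'o X' Y by (intro image_eqI[of _ _ "(X', act F X' X v x, mv Y X X' u g)"]) auto
  qed
qed

end

definition pull_el ::
  "('a, 'm, 'z) acat_scheme \<Rightarrow> ('b, 'n, 'w) acat_scheme \<Rightarrow> ('a, 'm, 'b, 'n) func \<Rightarrow> ('a, 'm, 'x) presheaf \<Rightarrow> 'b
    \<Rightarrow> 'a \<Rightarrow> 'x \<Rightarrow> 'n \<Rightarrow> 'x" where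
  "pull_el A B f F Y X x g = encode (carrier (pull_val A B f F Y)) (pull_rel A B f F Y `` {((X, yo A F X x), g)})"

locale small_pull = pull_data A F B f
  for A :: "('a, 'm, 'z) acat_scheme" and F :: "('a, 'm, 'x) presheaf"
    and B :: "('b, 'n, 'w) acat_scheme" and f +
  assumes nonempty: "Obj A \<noteq> {}"
    and small: "Y \<in> Obj B \<Longrightarrow> small TYPE('x) (carrier (pull_val A B f F Y))"
begin

abbreviation P where "P \<equiv> fob (pull A B f) F"
abbreviation el where "el \<equiv> pull_el A B f F"

lemma val_P: "val P Y = shrink (pull_val A B f F Y)"
  by (simp add: pull_def)

lemma el_conv: "el Y X x g = encode (carrier (pull_val A B f F Y)) (el_cls Y X x g)"
  by (simp add: pull_el_def el_cls_def)

lemma el_in [simp, intro]: "\<lbrakk>Y \<in> Obj B; X \<in> Obj A; x \<in> carrier (val F X); g \<in> Mor B Y (fob f X)\<rbrakk> \<Longrightarrow> el Y X x g \<in> carrier (val P Y)"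
  by (simp add: val_P el_conv el_cls_in)

lemma el_ex:
  assumes "c \<in> carrier (val P Y)"
  obtains X x g where "X \<in> Obj A" "x \<in> carrier (val F X)" "g \<in> Mor B Y (fob f X)" "c = el Y X x g"
  using assms unfolding val_P el_conv by (auto elim: el_cls_ex)

lemma el_eq_iff:
  assumes "Y \<in> Obj B" "el_ok Y X x g" "el_ok Y X' x' g'"
  shows "el Y X x g = el Y X' x' g' \<longleftrightarrow> el_rel Y X x g X' x' g'"
  using inj_on_eq_iff[OF inj_on_encode[OF small[OF assms(1)]]] assms
  by (simp add: el_conv el_cls_in el_cls_eq_iff)

lemma el_mult: "\<lbrakk>Y \<in> Obj B; el_ok Y X x g; el_ok Y X x h\<rbrakk> \<Longrightarrow>
    el Y X x g \<otimes>\<^bsub>val P Y\<^esub> el Y X x h = el Y X x (g \<otimes>\<^bsub>Hom B Y (fob f X)\<^esub> h)"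
  by (simp add: val_P el_conv shrink_mult small el_cls_in el_cls_mult)

lemma el_add: "\<lbrakk>Y \<in> Obj B; X \<in> Obj A; x \<in> carrier (val F X); x' \<in> carrier (val F X); g \<in> Mor B Y (fob f X)\<rbrakk> \<Longrightarrow>
    el Y X (x \<otimes>\<^bsub>val F X\<^esub> x') g = el Y X x g \<otimes>\<^bsub>val P Y\<^esub> el Y X x' g"
  by (simp add: val_P el_conv shrink_mult small el_cls_in el_cls_add)

lemma el_zero: "\<lbrakk>Y \<in> Obj B; X \<in> Obj A; x \<in> carrier (val F X)\<rbrakk> \<Longrightarrow> el Y X x \<one>\<^bsub>Hom B Y (fob f X)\<^esub> = \<one>\<^bsub>val P Y\<^esub>"
  by (simp add: val_P el_conv el_cls_one)

lemma el_push:
  "\<lbrakk>Y \<in> Obj B; X \<in> Obj A; Z \<in> Obj A; u \<in> Mor A X Z; z \<in> carrier (val F Z); g \<in> Mor B Y (fob f X)\<rbrakk> \<Longrightarrow>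
    el Y X (act F X Z u z) g = el Y Z z (mv Y X Z u g)"
  by (simp add: el_conv el_cls_push)

lemma group_P: "Y \<in> Obj B \<Longrightarrow> comm_group (val P Y)"
  unfolding val_P by (intro comm_group_shrink small comm_group_pull_val nonempty)

text \<open>Comparing with zero at the same index \<open>(X, x)\<close> leaves one transition map to
  consider, since the other one sends zero to zero.\<close>

lemma el_eq_one_iff:
  assumes "Y \<in> Obj B" "el_ok Y X x g"
  shows "el Y X x g = \<one>\<^bsub>val P Y\<^esub> \<longleftrightarrow>
    (\<exists>Z\<in>Obj A. \<exists>u\<in>Mor A X Z. \<exists>z\<in>carrier (val F Z). act F X Z u z = x \<and> mv Y X Z u g = \<one>\<^bsub>Hom B Y (fob f Z)\<^esub>)"
proof
  assume "el Y X x g = \<one>\<^bsub>val P Y\<^esub>"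
  then have "el_rel Y X x g X x \<one>\<^bsub>Hom B Y (fob f X)\<^esub>"
    using assms by (simp add: el_zero[of Y X x, symmetric] el_eq_iff)
  then show "\<exists>Z\<in>Obj A. \<exists>u\<in>Mor A X Z. \<exists>z\<in>carrier (val F Z). act F X Z u z = x \<and> mv Y X Z u g = \<one>\<^bsub>Hom B Y (fob f Z)\<^esub>"
    unfolding el_rel_def using assms by fastforce
next
  assume "\<exists>Z\<in>Obj A. \<exists>u\<in>Mor A X Z. \<exists>z\<in>carrier (val F Z). act F X Z u z = x \<and> mv Y X Z u g = \<one>\<^bsub>Hom B Y (fob f Z)\<^esub>"
  then obtain Z u z where "Z \<in> Obj A" "u \<in> Mor A X Z" "z \<in> carrier (val F Z)" "act F X Z u z = x"
    "mv Y X Z u g = \<one>\<^bsub>Hom B Y (fob f Z)\<^esub>" by blast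
  then show "el Y X x g = \<one>\<^bsub>val P Y\<^esub>" using el_push[of Y X Z u z g] assms by (simp add: el_zero)
qed

lemma el_act:
  assumes "Y \<in> Obj B" "Y' \<in> Obj B" "m \<in> Mor B Y Y'" "X \<in> Obj A" "x \<in> carrier (val F X)" "g \<in> Mor B Y' (fob f X)"
  shows "act P Y Y' m (el Y' X x g) = el Y X x (Cmp B Y Y' (fob f X) g m)"
proof -
  let ?S = "\<lambda>c. {((X, \<eta>), act (representable B (fob f X)) Y Y' m g) | X \<eta> g. ((X, \<eta>), g) \<in> c}" and ?t = "el_cls Y' X x g"
  let ?h = "\<lambda>c. pull_rel A B f F Y `` ?S c"
  have "?h (el_cls Y' X x g) = el_cls Y X x (Cmp B Y Y' (fob f X) g m)"
  proof (rule Image_el_cls)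
    show "?S ?t \<noteq> {}"
      using el_cls_self[of Y' X x g] assms by auto
    fix a assume "a \<in> ?S ?t"
    then obtain X1 \<eta> g1 where a: "a = ((X1, \<eta>), Cmp B Y Y' (fob f X1) g1 m)" "((X1, \<eta>), g1) \<in> el_cls Y' X x g"
      by auto
    obtain X' x' g' where "((X1, \<eta>), g1) = ((X', yo A F X' x'), g')" "el_ok Y' X' x' g'" "el_rel Y' X x g X' x' g'"
      using in_el_cls[OF a(2)] assms by metis
    then show "\<exists>X' x' g'. a = ((X', yo A F X' x'), g') \<and> el_ok Y X' x' g' \<and> el_rel Y X x (Cmp B Y Y' (fob f X) g m) X' x' g'"
      using a(1) assms el_rel_pre[of Y' X x g X' x' g' Y m] by auto
  qed (use assms in auto)
  then show ?thesis
    using lift_map_encode[OF small[OF assms(2)] el_cls_in, of X x g "pull_val A B f F Y" ?h] assms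
    by (simp add: el_conv pull_def)
qed

lemma el_common:
  assumes Y: "Y \<in> Obj B" and "c \<in> carrier (val P Y)" "d \<in> carrier (val P Y)"
  obtains X x g h where "X \<in> Obj A" "x \<in> carrier (val F X)" "g \<in> Mor B Y (fob f X)" "h \<in> Mor B Y (fob f X)"
    "c = el Y X x g" "d = el Y X x h"
proof -
  obtain X x g where c: "el_ok Y X x g" "c = el Y X x g" using el_ex[OF assms(2)] by metis
  obtain X' x' g' where d: "el_ok Y X' x' g'" "d = el Y X' x' g'" using el_ex[OF assms(3)] by metis
  show ?thesis
    by (rule el_cls_common[OF Y c(1) d(1)]) (use that c d in \<open>auto simp: el_conv\<close>)
qed

lemma psh_P: "psh B P"
proof
  show "additive_presheaf B P" unfolding additive_presheaf_def
  proof (intro conjI ballI)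
    show "comm_group (val P X)" if "X \<in> Obj B" for X using that by (rule group_P)
  next
    fix Y Y' m assume Y: "Y \<in> Obj B" "Y' \<in> Obj B" "m \<in> Mor B Y Y'"
    show "act P Y Y' m \<in> hom (val P Y') (val P Y)"
    proof (rule homI)
      fix c assume "c \<in> carrier (val P Y')"
      then show "act P Y Y' m c \<in> carrier (val P Y)" by (rule el_ex) (use Y in \<open>simp add: el_act\<close>)
    next
      fix c d assume "c \<in> carrier (val P Y')" "d \<in> carrier (val P Y')"
      then show "act P Y Y' m (c \<otimes>\<^bsub>val P Y'\<^esub> d) = act P Y Y' m c \<otimes>\<^bsub>val P Y\<^esub> act P Y Y' m d"
        by (rule el_common[OF Y(2)]) (use Y in \<open>simp add: el_act el_mult Fu.D.cmp_add_left\<close>)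
    qed
  next
    fix Y c assume Y: "Y \<in> Obj B" and "c \<in> carrier (val P Y)"
    from this(2) show "act P Y Y (Idt B Y) c = c" by (rule el_ex) (use Y in \<open>simp add: el_act\<close>)
  next
    fix X Y Z g h c assume Y: "X \<in> Obj B" "Y \<in> Obj B" "Z \<in> Obj B" "g \<in> Mor B X Y" "h \<in> Mor B Y Z"
      and "c \<in> carrier (val P Z)"
    from this(6) show "act P X Z (Cmp B X Y Z h g) c = act P X Y g (act P Y Z h c)"
      by (rule el_ex) (use Y in \<open>simp add: el_act Fu.D.cmp_assoc\<close>)
  next
    fix X Y g h c assume Y: "X \<in> Obj B" "Y \<in> Obj B" "g \<in> Mor B X Y" "h \<in> Mor B X Y"
      and "c \<in> carrier (val P Y)"
    from this(5) show "act P X Y (g \<otimes>\<^bsub>Hom B X Y\<^esub> h) c = act P X Y g c \<otimes>\<^bsub>val P X\<^esub> act P X Y h c"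
      by (rule el_ex) (use Y in \<open>simp add: el_act el_mult Fu.D.cmp_add_right\<close>)
  qed
qed

end

locale pull_mor = F: small_pull A F B f + G: small_pull A G B f + pstr A F G \<alpha>
  for A :: "('a, 'm, 'z) acat_scheme" and F G :: "('a, 'm, 'x) presheaf"
    and B :: "('b, 'n, 'w) acat_scheme" and f and \<alpha>
begin

lemma el_rel_mor: "F.el_ok Y X x g \<Longrightarrow> F.el_ok Y X' x' g' \<Longrightarrow> F.el_rel Y X x g X' x' g' \<Longrightarrow> G.el_rel Y X (\<alpha> X x) g X' (\<alpha> X' x') g'"
  unfolding F.el_rel_def G.el_rel_def using tr_act tr_in by metis

lemma transf_comp_yo: "\<lbrakk>X \<in> Obj A; x \<in> carrier (val F X)\<rbrakk> \<Longrightarrow>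
    transf_comp A (representable A X) \<alpha> (yo A F X x) = yo A G X (\<alpha> X x)"
  by (auto simp: transf_comp_def yo_def tr_act intro!: restrict_ext)

lemma mor_el:
  assumes "Y \<in> Obj B" "X \<in> Obj A" "x \<in> carrier (val F X)" "g \<in> Mor B Y (fob f X)"
  shows "fmor (pull A B f) F G \<alpha> Y (F.el Y X x g) = G.el Y X (\<alpha> X x) g"
proof -
  let ?S = "\<lambda>c. {((X, transf_comp A (representable A X) \<alpha> \<eta>), g) | X \<eta> g. ((X, \<eta>), g) \<in> c}" and ?t = "F.el_cls Y X x g"
  let ?h = "\<lambda>c. pull_rel A B f G Y `` ?S c"
  have "?h (F.el_cls Y X x g) = G.el_cls Y X (\<alpha> X x) g"
  proof (rule G.Image_el_cls)
    show "?S ?t \<noteq> {}"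
      using F.el_cls_self[of Y X x g] assms by auto
    fix a assume "a \<in> ?S ?t"
    then obtain X1 \<eta> g1 where a: "a = ((X1, transf_comp A (representable A X1) \<alpha> \<eta>), g1)" "((X1, \<eta>), g1) \<in> F.el_cls Y X x g"
      by auto
    obtain X' x' g' where "((X1, \<eta>), g1) = ((X', yo A F X' x'), g')" "F.el_ok Y X' x' g'" "F.el_rel Y X x g X' x' g'"
      using F.in_el_cls[OF a(2)] assms by metis
    then show "\<exists>X' x' g'. a = ((X', yo A G X' x'), g') \<and> G.el_ok Y X' x' g' \<and> G.el_rel Y X (\<alpha> X x) g X' x' g'"
      using a(1) assms by (auto simp: transf_comp_yo intro: el_rel_mor)
  qed (use assms in auto)
  then show ?thesis
    using lift_map_encode[OF F.small[OF assms(1)] F.el_cls_in, of X x g "pull_val A B f G Y" ?h] assms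
    by (simp add: F.el_conv G.el_conv pull_def)
qed

lemma mor_transf: "fmor (pull A B f) F G \<alpha> \<in> transf B F.P G.P"
proof (rule transfI)
  fix Y c assume Y: "Y \<in> Obj B" and "c \<in> carrier (val F.P Y)"
  from this(2) show "fmor (pull A B f) F G \<alpha> Y c \<in> carrier (val G.P Y)"
    by (rule F.el_ex) (use Y in \<open>simp add: mor_el\<close>)
next
  fix Y c d assume Y: "Y \<in> Obj B" and "c \<in> carrier (val F.P Y)" "d \<in> carrier (val F.P Y)"
  from this(2,3) show "fmor (pull A B f) F G \<alpha> Y (c \<otimes>\<^bsub>val F.P Y\<^esub> d) =
      fmor (pull A B f) F G \<alpha> Y c \<otimes>\<^bsub>val G.P Y\<^esub> fmor (pull A B f) F G \<alpha> Y d"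
    by (rule F.el_common[OF Y]) (use Y in \<open>simp add: mor_el F.el_mult G.el_mult\<close>)
next
  fix Y Y' m c assume Y: "Y \<in> Obj B" "Y' \<in> Obj B" "m \<in> Mor B Y Y'" and "c \<in> carrier (val F.P Y')"
  from this(4) show "fmor (pull A B f) F G \<alpha> Y (act F.P Y Y' m c) = act G.P Y Y' m (fmor (pull A B f) F G \<alpha> Y' c)"
    by (rule F.el_ex) (use Y in \<open>simp add: mor_el F.el_act G.el_act\<close>)
qed (auto simp: pull_def lift_map_def)

end

section \<open>Triangulated categories\<close>

context preadditive_category
begin

lemma zero_object_iff: "zero_object C Z \<longleftrightarrow> Z \<in> Obj C \<and> Idt C Z = \<one>\<^bsub>Hom C Z Z\<^esub>"
proof
  assume z: "zero_object C Z"
  then have "Z \<in> Obj C" "\<exists>!f. f \<in> Mor C Z Z" by (auto simp: zero_object_def)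
  moreover from this have "Idt C Z \<in> Mor C Z Z" "\<one>\<^bsub>Hom C Z Z\<^esub> \<in> Mor C Z Z" by auto
  ultimately show "Z \<in> Obj C \<and> Idt C Z = \<one>\<^bsub>Hom C Z Z\<^esub>" by metis
next
  assume Z: "Z \<in> Obj C \<and> Idt C Z = \<one>\<^bsub>Hom C Z Z\<^esub>"
  have "f = \<one>\<^bsub>Hom C X Z\<^esub>" if "X \<in> Obj C" "f \<in> Mor C X Z" for X f
    using idt_left[of X Z f] cmp_zero_left[of X Z Z f] Z that by simp
  moreover have "f = \<one>\<^bsub>Hom C Z X\<^esub>" if "X \<in> Obj C" "f \<in> Mor C Z X" for X f
    using idt_right[of Z X f] cmp_zero_right[of Z Z X f] Z that by simp
  ultimately show "zero_object C Z" unfolding zero_object_def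
    using Z zero_in by (metis (no_types))
qed

lemma zero_object_mor:
  assumes "zero_object C Z" "X \<in> Obj C"
  shows "f \<in> Mor C X Z \<Longrightarrow> f = \<one>\<^bsub>Hom C X Z\<^esub>" "g \<in> Mor C Z X \<Longrightarrow> g = \<one>\<^bsub>Hom C Z X\<^esub>"
proof -
  have "Z \<in> Obj C" "\<exists>!f. f \<in> Mor C X Z" "\<exists>!f. f \<in> Mor C Z X"
    using assms by (auto simp: zero_object_def)
  moreover from this have "\<one>\<^bsub>Hom C X Z\<^esub> \<in> Mor C X Z" "\<one>\<^bsub>Hom C Z X\<^esub> \<in> Mor C Z X"
    using assms by auto
  ultimately show "f \<in> Mor C X Z \<Longrightarrow> f = \<one>\<^bsub>Hom C X Z\<^esub>" "g \<in> Mor C Z X \<Longrightarrow> g = \<one>\<^bsub>Hom C Z X\<^esub>"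
    by blast+
qed

lemma inverse_mors_mono:
  assumes "inverse_mors C X Y f g" "W \<in> Obj C" "X \<in> Obj C" "Y \<in> Obj C" "u \<in> Mor C W X" "v \<in> Mor C W X"
    "Cmp C W X Y f u = Cmp C W X Y f v"
  shows "u = v"
  by (metis inverse_mors_cancel[OF assms(1-5)] inverse_mors_cancel[OF assms(1-4,6)] assms(7))

lemma inverse_mors_epi:
  assumes "inverse_mors C X Y f g" "Z \<in> Obj C" "X \<in> Obj C" "Y \<in> Obj C" "u \<in> Mor C Y Z" "v \<in> Mor C Y Z"
    "Cmp C X Y Z u f = Cmp C X Y Z v f"
  shows "u = v"
  by (metis inverse_mors_cancel'[OF assms(1-5)] inverse_mors_cancel'[OF assms(1-4,6)] assms(7))

end

context triangulated_category
begin

sublocale S: additive_functor T T "Sus T" by (rule Sus_functor)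
sublocale Ds: additive_functor T T "Des T" by (rule Des_functor)

abbreviation Sg where "Sg \<equiv> fob (Sus T)"
abbreviation sg where "sg \<equiv> fmor (Sus T)"
abbreviation Dg where "Dg \<equiv> fob (Des T)"
abbreviation dg where "dg \<equiv> fmor (Des T)"

section \<open>The suspension is fully faithful\<close>

definition "unit_inv X = (SOME g. inverse_mors T X (Dg (Sg X)) (Unit T X) g)"
definition "counit_inv X = (SOME g. inverse_mors T (Sg (Dg X)) X (Counit T X) g)"

lemma unit_inverse: "X \<in> Obj T \<Longrightarrow> inverse_mors T X (Dg (Sg X)) (Unit T X) (unit_inv X)"
  using Unit_iso someI_ex[of "inverse_mors T X (Dg (Sg X)) (Unit T X)"]
  by (simp add: unit_inv_def nat_iso_def iso_mor_def fid_def fcomp_def)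

lemma counit_inverse: "X \<in> Obj T \<Longrightarrow> inverse_mors T (Sg (Dg X)) X (Counit T X) (counit_inv X)"
  using Counit_iso someI_ex[of "inverse_mors T (Sg (Dg X)) X (Counit T X)"]
  by (simp add: counit_inv_def nat_iso_def iso_mor_def fid_def fcomp_def)

lemma unit_in [simp, intro]: "X \<in> Obj T \<Longrightarrow> Unit T X \<in> Mor T X (Dg (Sg X))"
  and unit_inv_in [simp, intro]: "X \<in> Obj T \<Longrightarrow> unit_inv X \<in> Mor T (Dg (Sg X)) X"
  and counit_in [simp, intro]: "X \<in> Obj T \<Longrightarrow> Counit T X \<in> Mor T (Sg (Dg X)) X"
  and counit_inv_in [simp, intro]: "X \<in> Obj T \<Longrightarrow> counit_inv X \<in> Mor T X (Sg (Dg X))"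
  using inverse_mors_in[OF unit_inverse] inverse_mors_in[OF counit_inverse] by simp_all

lemma unit_natural: "\<lbrakk>X \<in> Obj T; Y \<in> Obj T; u \<in> Mor T X Y\<rbrakk> \<Longrightarrow>
    Cmp T X Y (Dg (Sg Y)) (Unit T Y) u
    = Cmp T X (Dg (Sg X)) (Dg (Sg Y)) (dg (Sg X) (Sg Y) (sg X Y u)) (Unit T X)"
  using Unit_iso by (auto simp: nat_iso_def nat_transf_def fid_def fcomp_def)

lemma counit_natural: "\<lbrakk>X \<in> Obj T; Y \<in> Obj T; u \<in> Mor T X Y\<rbrakk> \<Longrightarrow>
    Cmp T (Sg (Dg X)) (Sg (Dg Y)) Y (Counit T Y) (sg (Dg X) (Dg Y) (dg X Y u))
    = Cmp T (Sg (Dg X)) X Y u (Counit T X)"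
  using Counit_iso by (auto simp: nat_iso_def nat_transf_def fid_def fcomp_def)

lemma sus_faithful:
  assumes "X \<in> Obj T" "Y \<in> Obj T" "u \<in> Mor T X Y" "v \<in> Mor T X Y" "sg X Y u = sg X Y v"
  shows "u = v"
  using inverse_mors_mono[OF unit_inverse, of Y X u v] unit_natural[of X Y u] unit_natural[of X Y v] assms by simp

lemma des_faithful:
  assumes "X \<in> Obj T" "Y \<in> Obj T" "u \<in> Mor T X Y" "v \<in> Mor T X Y" "dg X Y u = dg X Y v"
  shows "u = v"
  using inverse_mors_epi[OF counit_inverse, of X Y u v] counit_natural[of X Y u] counit_natural[of X Y v] assms by simp

text \<open>The preimage is \<open>Des b\<close> conjugated by the unit. Naturality of the unit
  shows that \<open>Des\<close> does not distinguish its suspension from \<open>b\<close>, and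
  \<open>Des\<close> is faithful by naturality of the counit.\<close>

lemma sus_full:
  assumes X: "X \<in> Obj T" "Y \<in> Obj T" and b: "b \<in> Mor T (Sg X) (Sg Y)"
  obtains a where "a \<in> Mor T X Y" "sg X Y a = b"
proof -
  let ?c = "Cmp T X (Dg (Sg X)) (Dg (Sg Y)) (dg (Sg X) (Sg Y) b) (Unit T X)"
  let ?a = "Cmp T X (Dg (Sg Y)) Y (unit_inv Y) ?c"
  have c: "?c \<in> Mor T X (Dg (Sg Y))" and a: "?a \<in> Mor T X Y" using assms by auto
  have "Cmp T X Y (Dg (Sg Y)) (Unit T Y) ?a = ?c"
    by (rule inverse_mors_cancel[OF inverse_mors_sym[OF unit_inverse]]) (use X c in auto)
  then have "Cmp T X (Dg (Sg X)) (Dg (Sg Y)) (dg (Sg X) (Sg Y) (sg X Y ?a)) (Unit T X) = ?c"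
    using unit_natural[of X Y ?a] X a by simp
  then have "dg (Sg X) (Sg Y) (sg X Y ?a) = dg (Sg X) (Sg Y) b"
    by (rule inverse_mors_epi[OF unit_inverse, rotated -1]) (use X a b in auto)
  then have "sg X Y ?a = b" by (rule des_faithful[rotated -1]) (use X a b in auto)
  with a that show ?thesis by blast
qed

lemma tri_rot: "(X, Y, Z, f, g, h) \<in> Tri T \<Longrightarrow>
    (Y, Z, Sg X, g, h, inv\<^bsub>Hom T (Sg X) (Sg Y)\<^esub> (sg X Y f)) \<in> Tri T"
  using TR2 Tri_typed by blast

text \<open>Compare with the triangle on the identity of \<open>X\<close>, whose third object is
  zero.\<close>

lemma tri_zero:
  assumes t: "(X, Y, Z, f, g, h) \<in> Tri T" shows "Cmp T X Y Z g f = \<one>\<^bsub>Hom T X Z\<^esub>"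
proof -
  note ty = Tri_typed[OF t]
  obtain N where N: "zero_object T N" using zero_ex by blast
  then have Oo: "N \<in> Obj T" by (simp add: zero_object_def)
  have "(X, X, N, Idt T X, \<one>\<^bsub>Hom T X N\<^esub>, \<one>\<^bsub>Hom T N (Sg X)\<^esub>) \<in> Tri T"
    using TR1_idt N Oo ty by simp
  from TR3[OF this t, of "Idt T X" f] ty Oo
  obtain c where "c \<in> Mor T N Z" "Cmp T X N Z c \<one>\<^bsub>Hom T X N\<^esub> = Cmp T X Y Z g f" by auto
  then show ?thesis using ty Oo by simp
qed

lemma tri_zero':
  assumes t: "(X, Y, Z, f, g, h) \<in> Tri T"
  shows "Cmp T Y Z (Sg X) h g = \<one>\<^bsub>Hom T Y (Sg X)\<^esub>" "Cmp T Z (Sg X) (Sg Y) (sg X Y f) h = \<one>\<^bsub>Hom T Z (Sg Y)\<^esub>"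
proof -
  note ty = Tri_typed[OF t]
  note r = tri_rot[OF t]
  show "Cmp T Y Z (Sg X) h g = \<one>\<^bsub>Hom T Y (Sg X)\<^esub>" by (rule tri_zero[OF r])
  have "inv\<^bsub>Hom T Z (Sg Y)\<^esub> (Cmp T Z (Sg X) (Sg Y) (sg X Y f) h) = \<one>\<^bsub>Hom T Z (Sg Y)\<^esub>"
    using tri_zero[OF tri_rot[OF t]] tri_zero[OF tri_rot[OF r]] ty by (simp add: cmp_inv_left)
  then show "Cmp T Z (Sg X) (Sg Y) (sg X Y f) h = \<one>\<^bsub>Hom T Z (Sg Y)\<^esub>"
    using ty group.inv_eq_1_iff[of "Hom T Z (Sg Y)"] by simp
qed

lemma Sg_zero_object: "zero_object T N \<Longrightarrow> zero_object T (Sg N)"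
  using S.fmor_idt[of N] S.fmor_zero[of N N] by (auto simp: zero_object_iff)

lemma weak_cokernel:
  assumes t: "(X, Y, Z, f, g, h) \<in> Tri T" and u: "W \<in> Obj T" "u \<in> Mor T Y W" "Cmp T X Y W u f = \<one>\<^bsub>Hom T X W\<^esub>"
  obtains v where "v \<in> Mor T Z W" "Cmp T Y Z W v g = u"
proof -
  note ty = Tri_typed[OF t]
  obtain N where N: "zero_object T N" using zero_ex by blast
  then have Oo: "N \<in> Obj T" by (simp add: zero_object_def)
  \<comment> \<open>The zero object is written as \<open>Sg N\<close> so that the triangle on the
    identity rotates back to \<open>N \<rightarrow> W \<rightarrow> W\<close>; a morphism of
    triangles into it yields a factorisation of \<open>u\<close>.\<close>
  have "(W, W, Sg N, Idt T W, \<one>\<^bsub>Hom T W (Sg N)\<^esub>, inv\<^bsub>Hom T (Sg N) (Sg W)\<^esub> (sg N W \<one>\<^bsub>Hom T N W\<^esub>)) \<in> Tri T"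
    using TR1_idt Sg_zero_object[OF N] u(1) Oo by simp
  then have "(N, W, W, \<one>\<^bsub>Hom T N W\<^esub>, Idt T W, \<one>\<^bsub>Hom T W (Sg N)\<^esub>) \<in> Tri T"
    using TR2[of N W W "\<one>\<^bsub>Hom T N W\<^esub>" "Idt T W" "\<one>\<^bsub>Hom T W (Sg N)\<^esub>"] u(1) Oo by simp
  from TR3[OF t this, of "\<one>\<^bsub>Hom T X N\<^esub>" u] ty Oo u
  obtain c where "c \<in> Mor T Z W" "Cmp T Y Z W c g = u" by auto
  with that show ?thesis by blast
qed

text \<open>TR3 fills in third morphisms only, so both triangles are rotated first. The result is a
  morphism between suspensions, and it comes down because the suspension is full and
  faithful.\<close>

lemma weak_kernel:
  assumes t: "(X, Y, Z, f, g, h) \<in> Tri T" and u: "W \<in> Obj T" "u \<in> Mor T W Y" "Cmp T W Y Z g u = \<one>\<^bsub>Hom T W Z\<^esub>"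
  obtains v where "v \<in> Mor T W X" "Cmp T W X Y f v = u"
proof -
  note ty = Tri_typed[OF t]
  obtain N where N: "zero_object T N" using zero_ex by blast
  then have Oo: "N \<in> Obj T" by (simp add: zero_object_def)
  have "(W, W, N, Idt T W, \<one>\<^bsub>Hom T W N\<^esub>, \<one>\<^bsub>Hom T N (Sg W)\<^esub>) \<in> Tri T"
    using TR1_idt N u(1) Oo by simp
  from TR3[OF tri_rot[OF this] tri_rot[OF t], of u "\<one>\<^bsub>Hom T N Z\<^esub>"] ty Oo u
  obtain c where c: "c \<in> Mor T (Sg W) (Sg X)"
     "Cmp T (Sg W) (Sg W) (Sg Y) (sg W Y u) (inv\<^bsub>Hom T (Sg W) (Sg W)\<^esub> (sg W W (Idt T W)))
       = Cmp T (Sg W) (Sg X) (Sg Y) (inv\<^bsub>Hom T (Sg X) (Sg Y)\<^esub> (sg X Y f)) c" by auto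
  obtain v where v: "v \<in> Mor T W X" "sg W X v = c" using sus_full c u(1) ty by metis
  have "inv\<^bsub>Hom T (Sg W) (Sg Y)\<^esub> sg W Y u = inv\<^bsub>Hom T (Sg W) (Sg Y)\<^esub> sg W Y (Cmp T W X Y f v)"
    using c v ty u by (simp add: cmp_inv_left cmp_inv_right S.fmor_cmp)
  then have "sg W Y u = sg W Y (Cmp T W X Y f v)"
    using ty u v group.inv_inv[of "Hom T (Sg W) (Sg Y)"] by (metis S.fmor_in S.fob_in cmp_in hom_group')
  then have "u = Cmp T W X Y f v" by (rule sus_faithful[rotated -1]) (use ty u v in auto)
  with v that show ?thesis by blast
qed

text \<open>TR2 can be read backwards only if the third object is a suspension. Hence
  \<open>Z\<close> is replaced by the isomorphic \<open>Sg (Dg Z)\<close>, and \<open>a\<close> is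
  the desuspension of the negative of \<open>h\<close>, corrected by the counit.\<close>

lemma left_rot:
  assumes t: "(X, Y, Z, f, g, h) \<in> Tri T"
  obtains a where "a \<in> Mor T (Dg Z) X" "(Dg Z, X, Y, a, f, Cmp T Y Z (Sg (Dg Z)) (counit_inv Z) g) \<in> Tri T"
    "sg (Dg Z) X a = inv\<^bsub>Hom T (Sg (Dg Z)) (Sg X)\<^esub> (Cmp T (Sg (Dg Z)) Z (Sg X) h (Counit T Z))"
proof -
  have ty: "X \<in> Obj T" "Y \<in> Obj T" "Z \<in> Obj T" "f \<in> Mor T X Y" "g \<in> Mor T Y Z" "h \<in> Mor T Z (Sg X)"
    using Tri_typed[OF t] by auto
  let ?b = "Cmp T (Sg (Dg Z)) Z (Sg X) h (Counit T Z)"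
  have b: "?b \<in> Mor T (Sg (Dg Z)) (Sg X)" using ty by auto
  obtain a where a: "a \<in> Mor T (Dg Z) X" "sg (Dg Z) X a = inv\<^bsub>Hom T (Sg (Dg Z)) (Sg X)\<^esub> ?b"
    using sus_full[of "Dg Z" X] b ty by (metis Ds.fob_in S.fob_in inv_in)
  let ?g = "Cmp T Y Z (Sg (Dg Z)) (counit_inv Z) g"
  have g: "?g \<in> Mor T Y (Sg (Dg Z))" using ty by auto
  have ib: "inv\<^bsub>Hom T (Sg (Dg Z)) (Sg X)\<^esub> (sg (Dg Z) X a) = ?b"
    using a b ty group.inv_inv[of "Hom T (Sg (Dg Z)) (Sg X)"] by simp
  have "(X, Y, Sg (Dg Z), f, ?g, ?b) \<in> Tri T"
  proof (rule TR1_iso[OF t])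
    show "iso_mor T X X (Idt T X)" "iso_mor T Y Y (Idt T Y)" using ty iso_idt by (auto simp: iso_mor_def)
    show "iso_mor T Z (Sg (Dg Z)) (counit_inv Z)"
      using inverse_mors_sym[OF counit_inverse] ty by (auto simp: iso_mor_def)
    show "Cmp T Z (Sg X) (Sg X) (sg X X (Idt T X)) h = Cmp T Z (Sg (Dg Z)) (Sg X) ?b (counit_inv Z)"
      using ty inverse_mors_cancel'[OF counit_inverse, of Z "Sg X" h] by simp
  qed (use ty b g in auto)
  then have "(Dg Z, X, Y, a, f, ?g) \<in> Tri T"
    using TR2[of "Dg Z" X Y a f ?g] ib ty a g by simp
  with a that show ?thesis by blast
qed

lemma fibre_ex:
  assumes "Y \<in> Obj T" "Z \<in> Obj T" "g \<in> Mor T Y Z"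
  obtains X f h where "(X, Y, Z, f, g, h) \<in> Tri T"
  using TR1_cone[OF assms] left_rot by metis

lemma iso_triangle:
  assumes "X \<in> Obj T" "Y \<in> Obj T" "inverse_mors T X Y f g" "zero_object T N"
  shows "(X, Y, N, f, \<one>\<^bsub>Hom T Y N\<^esub>, \<one>\<^bsub>Hom T N (Sg X)\<^esub>) \<in> Tri T"
proof (rule TR1_iso)
  have Oo: "N \<in> Obj T" using assms(4) by (simp add: zero_object_def)
  note fg = inverse_mors_in[OF assms(3)]
  show "(X, X, N, Idt T X, \<one>\<^bsub>Hom T X N\<^esub>, \<one>\<^bsub>Hom T N (Sg X)\<^esub>) \<in> Tri T"
    using TR1_idt assms Oo by simp
  show "iso_mor T X X (Idt T X)" "iso_mor T X Y f" "iso_mor T N N (Idt T N)"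
    using iso_idt assms Oo by (auto simp: iso_mor_def)
qed (use assms inverse_mors_in[OF assms(3)] in \<open>auto simp: zero_object_def\<close>)

text \<open>The cone of the inclusion of one summand is the other summand. Since \<open>i\<close>
  splits, \<open>h\<close> vanishes; and an endomorphism of \<open>E\<close> whose composite with
  \<open>g\<close> is zero factors through \<open>h\<close>. This applies to
  \<open>w v - 1\<close>.\<close>

lemma biproduct_triangle:
  assumes b: "biproduct T A B P i j p q" and o: "A \<in> Obj T" "B \<in> Obj T" "P \<in> Obj T"
  obtains E g h v w where "(A, P, E, i, g, h) \<in> Tri T" "inverse_mors T E B v w"
proof -
  have b': "i \<in> Mor T A P" "j \<in> Mor T B P" "p \<in> Mor T P A" "q \<in> Mor T P B"
     "Cmp T A P A p i = Idt T A" "Cmp T B P B q j = Idt T B"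
     "Cmp T P A P i p \<otimes>\<^bsub>Hom T P P\<^esub> Cmp T P B P j q = Idt T P"
    using b by (auto simp: biproduct_def)
  obtain E g h where t: "(A, P, E, i, g, h) \<in> Tri T" using TR1_cone[OF o(1,3) b'(1)] by blast
  have ty: "E \<in> Obj T" "g \<in> Mor T P E" "h \<in> Mor T E (Sg A)" using Tri_typed[OF t] by auto
  obtain v where v: "v \<in> Mor T E B" "Cmp T P E B v g = q"
    using weak_cokernel[OF t o(2) b'(4)] biproduct_orth[OF b o] by metis
  let ?w = "Cmp T B P E g j"
  have w: "?w \<in> Mor T B E" using b' o ty by auto
  have vw: "Cmp T B E B v ?w = Idt T B"
    using cmp_assoc[of B P E B j g v] v b' o ty by simp
  have "Cmp T E (Sg A) (Sg A) (sg A A (Idt T A)) h = Cmp T E (Sg P) (Sg A) (sg P A p) (Cmp T E (Sg A) (Sg P) (sg A P i) h)"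
    unfolding b'(5)[symmetric] using b'(1-4) o ty by (simp add: S.fmor_cmp cmp_assoc)
  then have h0: "h = \<one>\<^bsub>Hom T E (Sg A)\<^esub>" using tri_zero'(2)[OF t] b' o ty by simp
  have "g = Cmp T P P E g (Cmp T P A P i p \<otimes>\<^bsub>Hom T P P\<^esub> Cmp T P B P j q)"
    unfolding b'(7) using o ty by simp
  also have "\<dots> = Cmp T P A E (Cmp T A P E g i) p \<otimes>\<^bsub>Hom T P E\<^esub> Cmp T P B E ?w q"
    using b'(1-4) o ty by (simp add: cmp_add_right cmp_assoc)
  also have "\<dots> = Cmp T P E E (Cmp T E B E ?w v) g"
    using tri_zero[OF t] v b'(1-4) o ty w
    by (simp add: cmp_assoc[of P E B E] monoid.l_one group.is_monoid)
  finally have g: "Cmp T P E E (Cmp T E B E ?w v) g = g" by simp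
  let ?d = "Cmp T E B E ?w v \<otimes>\<^bsub>Hom T E E\<^esub> inv\<^bsub>Hom T E E\<^esub> (Idt T E)"
  have "Cmp T P E E ?d g = \<one>\<^bsub>Hom T P E\<^esub>"
    using g ty o w v by (simp add: cmp_add_left cmp_inv_left group.r_inv)
  then obtain k where "k \<in> Mor T (Sg A) E" "Cmp T E (Sg A) E k h = ?d"
    using weak_cokernel[OF tri_rot[OF t], of E ?d] ty o w v by auto
  then have "?d = \<one>\<^bsub>Hom T E E\<^esub>" using h0 ty o by simp
  then have "Cmp T E B E ?w v = Idt T E" using ty o w v by (simp add: div_eq_zero_iff)
  with vw v w t that show ?thesis by (auto simp: inverse_mors_def)
qed

end

locale tri_sub = triangulated_category T for T :: "('o, 'm) tcat" +
  fixes S :: "'o set"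
  assumes sub: "triangulated_sub T S"
begin

lemma sub_Obj [simp, intro]: "X \<in> S \<Longrightarrow> X \<in> Obj T"
  using sub by (auto simp: triangulated_sub_def)

lemma sub_Sg [simp, intro]: "X \<in> S \<Longrightarrow> Sg X \<in> S" and sub_Dg [simp, intro]: "X \<in> S \<Longrightarrow> Dg X \<in> S"
  using sub by (auto simp: triangulated_sub_def)

lemma sub_tri:
  assumes "(X, Y, Z, f, g, h) \<in> Tri T"
  shows "X \<in> S \<Longrightarrow> Y \<in> S \<Longrightarrow> Z \<in> S" "Y \<in> S \<Longrightarrow> Z \<in> S \<Longrightarrow> X \<in> S" "X \<in> S \<Longrightarrow> Z \<in> S \<Longrightarrow> Y \<in> S"
  using sub assms unfolding triangulated_sub_def by blast+

lemma sub_zero: assumes "zero_object T N" shows "N \<in> S"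
proof -
  obtain X where "X \<in> S" using sub by (auto simp: triangulated_sub_def)
  then show ?thesis
    using TR1_idt[OF _ assms, of X "\<one>\<^bsub>Hom T X N\<^esub>" "\<one>\<^bsub>Hom T N (Sg X)\<^esub>"] assms sub_tri(1)
    by (force simp: zero_object_def)
qed

lemma sub_iso: assumes "X \<in> S" "Y \<in> Obj T" "inverse_mors T X Y f g" shows "Y \<in> S"
proof -
  obtain N where N: "zero_object T N" using zero_ex by blast
  show ?thesis using iso_triangle[OF _ assms(2,3) N] sub_tri(3) sub_zero[OF N] assms(1) by blast
qed

lemma sub_biproduct: assumes "A \<in> S" "B \<in> S" "P \<in> Obj T" "biproduct T A B P i j p q" shows "P \<in> S"
proof -
  obtain E g h v w where "(A, P, E, i, g, h) \<in> Tri T" "inverse_mors T E B v w"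
    using biproduct_triangle[OF assms(4)] assms by blast
  moreover have "E \<in> S" using sub_iso[OF assms(2) _ inverse_mors_sym[OF calculation(2)]] Tri_typed[OF calculation(1)] by blast
  ultimately show ?thesis using sub_tri(3) assms(1) by blast
qed

section \<open>Morphisms with cone in S as coverings\<close>

abbreviation cov where "cov \<equiv> cone_in T S"

lemma cov_typed:
  assumes "s \<in> cov X Y" shows "X \<in> Obj T" "Y \<in> Obj T" "s \<in> Mor T X Y"
  using assms Tri_typed unfolding cone_in_def by blast+

lemma covI: "(X, Y, Z, s, g, h) \<in> Tri T \<Longrightarrow> Z \<in> S \<Longrightarrow> s \<in> cov X Y"
  unfolding cone_in_def by blast

lemma covE:
  assumes "s \<in> cov X Y" obtains Z g h where "Z \<in> S" "(X, Y, Z, s, g, h) \<in> Tri T"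
  using assms unfolding cone_in_def by blast

lemma cov_iso: assumes "X \<in> Obj T" "Y \<in> Obj T" "inverse_mors T X Y f g" shows "f \<in> cov X Y"
  using zero_ex iso_triangle[OF assms] sub_zero covI by blast

lemma cov_idt: "X \<in> Obj T \<Longrightarrow> Idt T X \<in> cov X X"
  using cov_iso iso_idt by blast

text \<open>By the octahedral axiom the cone of the composite is an extension of the two
  cones.\<close>

lemma cov_cmp:
  assumes "s \<in> cov X Y" "t \<in> cov Y Z" shows "Cmp T X Y Z t s \<in> cov X Z"
proof -
  obtain A g h where 1: "A \<in> S" "(X, Y, A, s, g, h) \<in> Tri T" using assms(1) by (rule covE)
  obtain B g' h' where 2: "B \<in> S" "(Y, Z, B, t, g', h') \<in> Tri T" using assms(2) by (rule covE)
  have "Cmp T X Y Z t s \<in> Mor T X Z"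
    using cov_typed[OF assms(1)] cov_typed[OF assms(2)] by simp
  then obtain E k l where E: "(X, Z, E, Cmp T X Y Z t s, k, l) \<in> Tri T"
    using TR1_cone cov_typed[OF assms(1)] cov_typed[OF assms(2)] by blast
  from TR4[OF 1(2) 2(2) E] obtain u v w where "(A, E, B, u, v, w) \<in> Tri T" by blast
  then have "E \<in> S" using sub_tri(3) 1 2 by blast
  with E show ?thesis by (rule covI)
qed

text \<open>A morphism into \<open>c\<close> vanishes on its fibre, and the morphism from the fibre
  to \<open>X\<close> has cone \<open>c\<close>.\<close>

lemma cov_kill:
  assumes "f \<in> Mor T X c" "X \<in> Obj T" "c \<in> S"
  obtains X' t h where "(X', X, c, t, f, h) \<in> Tri T" "t \<in> cov X' X" "X' \<in> Obj T" "t \<in> Mor T X' X"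
    "Cmp T X' X c f t = \<one>\<^bsub>Hom T X' c\<^esub>"
proof -
  obtain X' t h where t: "(X', X, c, t, f, h) \<in> Tri T" using fibre_ex assms by blast
  with that[OF t covI[OF t assms(3)]] Tri_typed[OF t] tri_zero[OF t] show ?thesis by blast
qed

lemma cov_fibre:
  assumes "s \<in> cov X Y" obtains c d k where "c \<in> S" "d \<in> Mor T c X" "(c, X, Y, d, s, k) \<in> Tri T"
proof -
  obtain Z g h where 1: "Z \<in> S" "(X, Y, Z, s, g, h) \<in> Tri T" using assms by (rule covE)
  obtain a where "a \<in> Mor T (Dg Z) X" "(Dg Z, X, Y, a, s, Cmp T Y Z (Sg (Dg Z)) (counit_inv Z) g) \<in> Tri T"
    using left_rot[OF 1(2)] .
  with that[of "Dg Z"] 1(1) show ?thesis by simp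
qed

text \<open>Take the fibre of \<open>X \<rightarrow> Y \<rightarrow> Z\<close>, where
  \<open>Z\<close> is the cone of \<open>s\<close>: on it the morphism into the cone is zero, so the
  morphism to \<open>Y\<close> lifts to \<open>Y'\<close>.\<close>

lemma cov_pull:
  assumes s: "s \<in> cov Y' Y" and f: "f \<in> Mor T X Y" "X \<in> Obj T"
  obtains X' t f' where "X' \<in> Obj T" "t \<in> cov X' X" "t \<in> Mor T X' X" "f' \<in> Mor T X' Y'" "Cmp T X' Y' Y s f' = Cmp T X' X Y f t"
proof -
  obtain Z g h where Z: "Z \<in> S" "(Y', Y, Z, s, g, h) \<in> Tri T" using s by (rule covE)
  have ty: "Y' \<in> Obj T" "Y \<in> Obj T" "g \<in> Mor T Y Z" "s \<in> Mor T Y' Y" using Tri_typed[OF Z(2)] by auto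
  obtain X' t h where t: "(X', X, Z, t, Cmp T X Y Z g f, h) \<in> Tri T" "t \<in> cov X' X" "X' \<in> Obj T" "t \<in> Mor T X' X"
    "Cmp T X' X Z (Cmp T X Y Z g f) t = \<one>\<^bsub>Hom T X' Z\<^esub>"
    using cov_kill[of "Cmp T X Y Z g f" X Z] ty f Z(1) by auto
  have "Cmp T X' Y Z g (Cmp T X' X Y f t) = \<one>\<^bsub>Hom T X' Z\<^esub>"
    using t(5) cmp_assoc[of X' X Y Z t f g] ty f Z(1) t(3,4) by simp
  then obtain f' where "f' \<in> Mor T X' Y'" "Cmp T X' Y' Y s f' = Cmp T X' X Y f t"
    using weak_kernel[OF Z(2), of X' "Cmp T X' X Y f t"] ty f t(3,4) by auto
  with t that show ?thesis by blast
qed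

lemma cov_zero_kill:
  assumes s: "s \<in> cov Y Z" and f: "f \<in> Mor T X Y" "X \<in> Obj T" "Cmp T X Y Z s f = \<one>\<^bsub>Hom T X Z\<^esub>"
  obtains c v d where "c \<in> S" "v \<in> Mor T X c" "d \<in> Mor T c Y" "Cmp T c Y Z s d = \<one>\<^bsub>Hom T c Z\<^esub>" "Cmp T X c Y d v = f"
proof -
  obtain c d k where c: "c \<in> S" "d \<in> Mor T c Y" "(c, Y, Z, d, s, k) \<in> Tri T" using cov_fibre[OF s] by blast
  obtain v where "v \<in> Mor T X c" "Cmp T X c Y d v = f" using weak_kernel[OF c(3) f(2,1,3)] by blast
  with c that tri_zero[OF c(3)] show ?thesis by blast
qed

text \<open>The difference of \<open>f\<close> and \<open>g\<close> factors through the fibre of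
  \<open>s\<close>, an object of \<open>S\<close>, and is therefore killed on a covering of
  \<open>X\<close>.\<close>

lemma cov_cancel:
  assumes s: "s \<in> cov Y Z" and f: "f \<in> Mor T X Y" "g \<in> Mor T X Y" "X \<in> Obj T"
    "Cmp T X Y Z s f = Cmp T X Y Z s g"
  obtains X' t where "X' \<in> Obj T" "t \<in> cov X' X" "t \<in> Mor T X' X" "Cmp T X' X Y f t = Cmp T X' X Y g t"
proof -
  have ty: "Y \<in> Obj T" "Z \<in> Obj T" "s \<in> Mor T Y Z" using cov_typed[OF s] by auto
  let ?d = "f \<otimes>\<^bsub>Hom T X Y\<^esub> inv\<^bsub>Hom T X Y\<^esub> g"
  have d: "?d \<in> Mor T X Y" using f ty by auto
  have "Cmp T X Y Z s ?d = \<one>\<^bsub>Hom T X Z\<^esub>"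
    using f ty by (simp add: cmp_add_right cmp_inv_right group.r_inv)
  from cov_zero_kill[OF s d f(3) this] obtain c v e where c: "c \<in> S" "v \<in> Mor T X c" "e \<in> Mor T c Y" "Cmp T X c Y e v = ?d" .
  obtain X' t h where t: "t \<in> cov X' X" "X' \<in> Obj T" "t \<in> Mor T X' X" "Cmp T X' X c v t = \<one>\<^bsub>Hom T X' c\<^esub>"
    using cov_kill[of v X c] c f by metis
  have "Cmp T X' X Y ?d t = \<one>\<^bsub>Hom T X' Y\<^esub>"
    unfolding c(4)[symmetric] using c(1-3) t f ty by (simp add: cmp_assoc)
  then have "Cmp T X' X Y f t = Cmp T X' X Y g t"
    using t f ty by (simp add: cmp_add_left cmp_inv_left div_eq_zero_iff)
  with t that show ?thesis by blast
qed

lemma cov_cotri: "(c, X, Z, e, t, k) \<in> Tri T \<Longrightarrow> c \<in> S \<Longrightarrow> t \<in> cov X Z"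
  using covI[OF tri_rot] by blast

text \<open>Dual to \<open>cov_pull\<close>: \<open>Z\<close> is the cone of
  \<open>c \<rightarrow> W \<rightarrow> X\<close>, where \<open>c\<close> is the fibre of
  \<open>s\<close>.\<close>

lemma cov_push:
  assumes s: "s \<in> cov W Y" and g: "g \<in> Mor T W X" "X \<in> Obj T"
  obtains Z t g' where "Z \<in> Obj T" "t \<in> cov X Z" "t \<in> Mor T X Z" "g' \<in> Mor T Y Z" "Cmp T W Y Z g' s = Cmp T W X Z t g"
proof -
  have ty: "W \<in> Obj T" "Y \<in> Obj T" "s \<in> Mor T W Y" using cov_typed[OF s] by auto
  obtain c d k where c: "c \<in> S" "d \<in> Mor T c W" "(c, W, Y, d, s, k) \<in> Tri T" using cov_fibre[OF s] by blast
  then have "Cmp T c W X g d \<in> Mor T c X" using g ty by auto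
  then obtain Z t l where Z: "(c, X, Z, Cmp T c W X g d, t, l) \<in> Tri T" using TR1_cone[of c X] c g by blast
  have tz: "Z \<in> Obj T" "t \<in> Mor T X Z" using Tri_typed[OF Z] by auto
  obtain g' where "g' \<in> Mor T Y Z" "Cmp T W Y Z g' s = Cmp T W X Z t g"
    using TR3[OF c(3) Z, of "Idt T c" g] c(1,2) g ty by auto
  with that tz cov_cotri[OF Z c(1)] show ?thesis by blast
qed

lemma cov_src: assumes "s \<in> cov X Y" "Y \<in> S" shows "X \<in> S"
  using assms sub_tri(2) covE by metis

text \<open>Here \<open>c\<close> is the fibre of \<open>h\<close>, and the remaining morphism
  \<open>Sg X \<rightarrow> Sg c\<close> desuspends, up to the sign in TR2, to \<open>f\<close>.
  These triangles carry the connecting morphism.\<close>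

lemma cov_shift_triangle:
  assumes h: "h \<in> cov Y (Sg X)" and X: "X \<in> Obj T"
  obtains c f g where "c \<in> S" "(X, c, Y, f, g, h) \<in> Tri T"
proof -
  obtain c g k where c: "c \<in> S" "g \<in> Mor T c Y" "(c, Y, Sg X, g, h, k) \<in> Tri T" using cov_fibre[OF h] by blast
  have k: "k \<in> Mor T (Sg X) (Sg c)" "h \<in> Mor T Y (Sg X)" "Y \<in> Obj T" using Tri_typed[OF c(3)] by auto
  obtain f where f: "f \<in> Mor T X c" "sg X c f = inv\<^bsub>Hom T (Sg X) (Sg c)\<^esub> k"
    using sus_full[of X c "inv\<^bsub>Hom T (Sg X) (Sg c)\<^esub> k"] X c k by auto
  then have "k = inv\<^bsub>Hom T (Sg X) (Sg c)\<^esub> (sg X c f)"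
    using group.inv_inv[of "Hom T (Sg X) (Sg c)" k] c X k by simp
  then have "(X, c, Y, f, g, h) \<in> Tri T"
    using TR2[of X c Y f g h] c f k X by simp
  with c that show ?thesis by blast
qed

end

lemma cone_in_mono: "S1 \<subseteq> S2 \<Longrightarrow> cone_in T S1 X Y \<subseteq> cone_in T S2 X Y"
  by (auto simp: cone_in_def)

locale coh = triangulated_category T for T :: "('o, 'm) tcat" +
  fixes F :: "('o, 'm, 'x) presheaf"
  assumes coh: "cohomological T F"
begin

sublocale psh T F
  by unfold_locales (use coh in \<open>simp add: cohomological_def\<close>)

lemma exact:
  assumes "(X, Y, Z, f, g, h) \<in> Tri T" "y \<in> carrier (val F Y)" "act F X Y f y = \<one>\<^bsub>val F X\<^esub>"
  obtains z where "z \<in> carrier (val F Z)" "act F Y Z g z = y"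
proof -
  have "act F Y Z g ` carrier (val F Z) = kernel (val F Y) (val F X) (act F X Y f)"
    using coh assms(1) unfolding cohomological_def exact_at_def by blast
  then have "y \<in> act F Y Z g ` carrier (val F Z)" using assms by (simp add: kernel_def)
  with that show ?thesis by auto
qed

lemma act_cmp_zero:
  assumes "Cmp T X Y Z g f = \<one>\<^bsub>Hom T X Z\<^esub>" "X \<in> Obj T" "Y \<in> Obj T" "Z \<in> Obj T" "f \<in> Mor T X Y" "g \<in> Mor T Y Z" "z \<in> carrier (val F Z)"
  shows "act F X Y f (act F Y Z g z) = \<one>\<^bsub>val F X\<^esub>"
  using assms by (simp add: act_cmp[symmetric])

end

lemma coh_Obj_iff: "F \<in> Obj (Coh T) \<longleftrightarrow> cohomological T F"
  by (simp add: Coh_def)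

text \<open>Consecutive morphisms of a triangle compose to zero, so only the lifting half of
  exactness has to be checked.\<close>

lemma (in triangulated_category) cohI:
  assumes "psh T F" and "\<And>X Y Z f g h y. \<lbrakk>(X, Y, Z, f, g, h) \<in> Tri T; y \<in> carrier (val F Y); act F X Y f y = \<one>\<^bsub>val F X\<^esub>\<rbrakk>
    \<Longrightarrow> \<exists>z\<in>carrier (val F Z). act F Y Z g z = y"
  shows "coh T F"
proof
  interpret psh T F by fact
  show "cohomological T F" unfolding cohomological_def exact_at_def
  proof (intro conjI allI impI)
    show "additive_presheaf T F" by (rule additive)
    fix X Y Z f g h assume t: "(X, Y, Z, f, g, h) \<in> Tri T"
    note ty = Tri_typed[OF t]
    show "act F Y Z g \<in> hom (val F Z) (val F Y)" "act F X Y f \<in> hom (val F Y) (val F X)"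
      using ty act_hom by blast+
    show "act F Y Z g ` carrier (val F Z) = kernel (val F Y) (val F X) (act F X Y f)"
    proof
      show "act F Y Z g ` carrier (val F Z) \<subseteq> kernel (val F Y) (val F X) (act F X Y f)"
        using ty tri_zero[OF t] by (auto simp: kernel_def act_cmp[symmetric])
      show "kernel (val F Y) (val F X) (act F X Y f) \<subseteq> act F Y Z g ` carrier (val F Z)"
        using assms(2)[OF t] by (force simp: kernel_def)
    qed
  qed
qed

section \<open>Verdier quotients\<close>

lemma (in preadditive_category) square_pre:
  assumes "Cmp C X Y Z g f = Cmp C X Y' Z g' f'" "W \<in> Obj C" "X \<in> Obj C" "Y \<in> Obj C" "Y' \<in> Obj C" "Z \<in> Obj C"
    "f \<in> Mor C X Y" "g \<in> Mor C Y Z" "f' \<in> Mor C X Y'" "g' \<in> Mor C Y' Z" "w \<in> Mor C W X"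
  shows "Cmp C W Y Z g (Cmp C W X Y f w) = Cmp C W Y' Z g' (Cmp C W X Y' f' w)"
  using assms(2-) by (simp add: cmp_assoc[symmetric] assms(1))

context tri_sub
begin

section \<open>Roofs and their equivalence\<close>

lemma cov_common:
  assumes "r1 \<in> cov W1 X" "r2 \<in> cov W2 X"
  obtains M a b where "M \<in> Obj T" "a \<in> Mor T M W1" "a \<in> cov M W1" "b \<in> Mor T M W2" "Cmp T M W1 X r1 a = Cmp T M W2 X r2 b"
    "Cmp T M W1 X r1 a \<in> cov M X"
proof -
  note ty = cov_typed[OF assms(1)] cov_typed[OF assms(2)]
  obtain M a b where *: "M \<in> Obj T" "a \<in> cov M W1" "a \<in> Mor T M W1" "b \<in> Mor T M W2" "Cmp T M W2 X r2 b = Cmp T M W1 X r1 a"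
    using cov_pull[OF assms(2), of r1 W1] ty by metis
  with that[of M a b] cov_cmp[OF *(2) assms(1)] show ?thesis by simp
qed

definition roof_cls where "roof_cls X Y Z s f = roof_rel T S X Y `` {(Z, s, f)}"

definition roof_eq where
  "roof_eq X Y Z s f Z' s' f' \<longleftrightarrow> (\<exists>W\<in>Obj T. \<exists>u\<in>Mor T W Z. \<exists>v\<in>Mor T W Z'.
     Cmp T W Z X s u \<in> cov W X \<and> Cmp T W Z X s u = Cmp T W Z' X s' v \<and> Cmp T W Z Y f u = Cmp T W Z' Y f' v)"

abbreviation roof where "roof X Y Z s f \<equiv> Z \<in> Obj T \<and> s \<in> cov Z X \<and> f \<in> Mor T Z Y"

lemma roof_rel_iff: "((Z, s, f), (Z', s', f')) \<in> roof_rel T S X Y \<longleftrightarrow>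
    roof X Y Z s f \<and> roof X Y Z' s' f' \<and> roof_eq X Y Z s f Z' s' f'"
  by (auto simp: roof_rel_def roofs_def roof_eq_def)

lemma roof_eqI:
  assumes "W \<in> Obj T" "u \<in> Mor T W Z" "v \<in> Mor T W Z'" "Cmp T W Z X s u \<in> cov W X"
    "Cmp T W Z X s u = Cmp T W Z' X s' v" "Cmp T W Z Y f u = Cmp T W Z' Y f' v"
  shows "roof_eq X Y Z s f Z' s' f'"
  using assms unfolding roof_eq_def by blast

lemma roof_eqE:
  assumes "roof_eq X Y Z s f Z' s' f'"
  obtains W u v where "W \<in> Obj T" "u \<in> Mor T W Z" "v \<in> Mor T W Z'" "Cmp T W Z X s u \<in> cov W X"
    "Cmp T W Z X s u = Cmp T W Z' X s' v" "Cmp T W Z Y f u = Cmp T W Z' Y f' v"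
  using assms unfolding roof_eq_def by blast

lemma roof_eq_sym: "roof_eq X Y Z s f Z' s' f' \<Longrightarrow> roof_eq X Y Z' s' f' Z s f"
  unfolding roof_eq_def by metis

lemma roof_eq_refine:
  assumes "roof X Y Z s f" "Y \<in> Obj T" "W \<in> Obj T" "u \<in> Mor T W Z" "Cmp T W Z X s u \<in> cov W X"
  shows "roof_eq X Y Z s f W (Cmp T W Z X s u) (Cmp T W Z Y f u)"
proof -
  have "X \<in> Obj T" "s \<in> Mor T Z X" using cov_typed assms(1) by blast+
  then show ?thesis using assms by (intro roof_eqI[of W u Z "Idt T W" W]) auto
qed

lemma roof_eq_refl: "roof X Y Z s f \<Longrightarrow> Y \<in> Obj T \<Longrightarrow> roof_eq X Y Z s f Z s f"
  using roof_eqI[of Z "Idt T Z" Z "Idt T Z" Z X s s Y f f] cov_typed[of s Z X] by simp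

text \<open>Over a common refinement of the two witnesses, the two morphisms into the middle apex
  agree only after \<open>s2\<close>. A further covering makes them agree outright.\<close>

lemma roof_eq_trans:
  assumes r: "roof X Y Z1 s1 f1" "roof X Y Z2 s2 f2" "roof X Y Z3 s3 f3" and Y: "Y \<in> Obj T"
    and e: "roof_eq X Y Z1 s1 f1 Z2 s2 f2" "roof_eq X Y Z2 s2 f2 Z3 s3 f3"
  shows "roof_eq X Y Z1 s1 f1 Z3 s3 f3"
proof -
  have X: "X \<in> Obj T" "s1 \<in> Mor T Z1 X" "s2 \<in> Mor T Z2 X" "s3 \<in> Mor T Z3 X" using cov_typed r by blast+
  obtain W1 u1 v1 where 1: "W1 \<in> Obj T" "u1 \<in> Mor T W1 Z1" "v1 \<in> Mor T W1 Z2" "Cmp T W1 Z1 X s1 u1 \<in> cov W1 X"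
    "Cmp T W1 Z1 X s1 u1 = Cmp T W1 Z2 X s2 v1" "Cmp T W1 Z1 Y f1 u1 = Cmp T W1 Z2 Y f2 v1" using e(1) by (rule roof_eqE)
  obtain W2 u2 v2 where 2: "W2 \<in> Obj T" "u2 \<in> Mor T W2 Z2" "v2 \<in> Mor T W2 Z3" "Cmp T W2 Z2 X s2 u2 \<in> cov W2 X"
    "Cmp T W2 Z2 X s2 u2 = Cmp T W2 Z3 X s3 v2" "Cmp T W2 Z2 Y f2 u2 = Cmp T W2 Z3 Y f3 v2" using e(2) by (rule roof_eqE)
  obtain M a b where M: "M \<in> Obj T" "a \<in> Mor T M W1" "a \<in> cov M W1" "b \<in> Mor T M W2"
    "Cmp T M W1 X (Cmp T W1 Z1 X s1 u1) a = Cmp T M W2 X (Cmp T W2 Z2 X s2 u2) b"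
    using cov_common[OF 1(4) 2(4)] .
  have "Cmp T M Z2 X s2 (Cmp T M W1 Z2 v1 a) = Cmp T M Z2 X s2 (Cmp T M W2 Z2 u2 b)"
    using M(5) unfolding 1(5) using M(1-4) 1(1-3) 2(1-3) r X by (simp add: cmp_assoc)
  then obtain N t where N: "N \<in> Obj T" "t \<in> cov N M" "t \<in> Mor T N M"
    "Cmp T N M Z2 (Cmp T M W1 Z2 v1 a) t = Cmp T N M Z2 (Cmp T M W2 Z2 u2 b) t"
    using cov_cancel[of s2 Z2 X "Cmp T M W1 Z2 v1 a" M "Cmp T M W2 Z2 u2 b"] M(1-4) 1(1-3) 2(1-3) r by auto
  let ?a = "Cmp T N M W1 a t" and ?b = "Cmp T N M W2 b t"
  have ab: "?a \<in> Mor T N W1" "?b \<in> Mor T N W2" "?a \<in> cov N W1" using M 1(1) 2(1) N cov_cmp by auto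
  have vu: "Cmp T N W1 Z2 v1 ?a = Cmp T N W2 Z2 u2 ?b" using N M(1-4) 1(1-3) 2(1-3) r by (simp add: cmp_assoc)
  show ?thesis
  proof (rule roof_eqI)
    show "Cmp T N W1 Z1 u1 ?a \<in> Mor T N Z1" "Cmp T N W2 Z3 v2 ?b \<in> Mor T N Z3" using ab 1(1,2) 2(1,3) N(1) r by auto
    show "Cmp T N Z1 X s1 (Cmp T N W1 Z1 u1 ?a) \<in> cov N X"
      using cov_cmp[OF ab(3) 1(4)] ab 1(1,2) N(1) r X by (simp add: cmp_assoc)
    have "Cmp T N Z1 X s1 (Cmp T N W1 Z1 u1 ?a) = Cmp T N Z2 X s2 (Cmp T N W1 Z2 v1 ?a)"
      by (rule square_pre[OF 1(5)]) (use ab 1(1-3) N(1) r X in auto)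
    also have "\<dots> = Cmp T N Z3 X s3 (Cmp T N W2 Z3 v2 ?b)"
      unfolding vu by (rule square_pre[OF 2(5)]) (use ab 2(1-3) N(1) r X in auto)
    finally show "Cmp T N Z1 X s1 (Cmp T N W1 Z1 u1 ?a) = Cmp T N Z3 X s3 (Cmp T N W2 Z3 v2 ?b)" .
    have "Cmp T N Z1 Y f1 (Cmp T N W1 Z1 u1 ?a) = Cmp T N Z2 Y f2 (Cmp T N W1 Z2 v1 ?a)"
      by (rule square_pre[OF 1(6)]) (use ab 1(1-3) N(1) r Y in auto)
    also have "\<dots> = Cmp T N Z3 Y f3 (Cmp T N W2 Z3 v2 ?b)"
      unfolding vu by (rule square_pre[OF 2(6)]) (use ab 2(1-3) N(1) r Y in auto)
    finally show "Cmp T N Z1 Y f1 (Cmp T N W1 Z1 u1 ?a) = Cmp T N Z3 Y f3 (Cmp T N W2 Z3 v2 ?b)" .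
  qed (rule N(1))
qed

lemma equiv_roof_rel: "Y \<in> Obj T \<Longrightarrow> equiv (roofs T S X Y) (roof_rel T S X Y)"
proof (rule equivI)
  assume Y: "Y \<in> Obj T"
  show "roof_rel T S X Y \<subseteq> roofs T S X Y \<times> roofs T S X Y" by (auto simp: roof_rel_def)
  show "refl_on (roofs T S X Y) (roof_rel T S X Y)"
    using Y by (auto simp: refl_on_def roof_rel_iff roofs_def intro: roof_eq_refl)
  show "sym (roof_rel T S X Y)" by (auto simp: sym_def roof_rel_iff intro: roof_eq_sym)
  show "trans (roof_rel T S X Y)"
    by (rule transI) (use Y in \<open>auto simp: roof_rel_iff intro: roof_eq_trans\<close>)
qed

lemma in_roof_cls: "(Z', s', f') \<in> roof_cls X Y Z s f \<longleftrightarrow> roof X Y Z s f \<and> roof X Y Z' s' f' \<and> roof_eq X Y Z s f Z' s' f'"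
  by (simp add: roof_cls_def roof_rel_iff)

lemma roof_cls_eq_iff:
  assumes "Y \<in> Obj T" "roof X Y Z s f" "roof X Y Z' s' f'"
  shows "roof_cls X Y Z s f = roof_cls X Y Z' s' f' \<longleftrightarrow> roof_eq X Y Z s f Z' s' f'"
  using eq_equiv_class_iff[OF equiv_roof_rel[OF assms(1), of X], of "(Z, s, f)" "(Z', s', f')"] assms
  by (simp add: roofs_def roof_cls_def roof_rel_iff)

lemma roof_cls_refine:
  assumes "roof X Y Z s f" "Y \<in> Obj T" "W \<in> Obj T" "u \<in> Mor T W Z" "Cmp T W Z X s u \<in> cov W X"
  shows "roof_cls X Y Z s f = roof_cls X Y W (Cmp T W Z X s u) (Cmp T W Z Y f u)"
  using assms roof_eq_refine[OF assms] by (subst roof_cls_eq_iff) auto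

lemma Image_roof_cls:
  assumes Y: "Y \<in> Obj T" and ne: "A \<noteq> {}"
    and A: "\<And>Z' s' f'. (Z', s', f') \<in> A \<Longrightarrow> (Z', s', f') \<in> roof_cls X Y Z s f"
  shows "roof_rel T S X Y `` A = roof_cls X Y Z s f"
  unfolding roof_cls_def using ne A
  by (intro Image_eq_class[OF equiv_roof_rel[OF Y]]) (auto simp: roof_cls_def)

abbreviation V where "V \<equiv> verdier T S"

lemma verdier_Obj [simp]: "Obj V = Obj T" and verdier_Idt: "Idt V X = roof_cls X X X (Idt T X) (Idt T X)"
  by (simp_all add: verdier_def roof_cls_def)

lemma carrier_verdier: "Mor V X Y = roofs T S X Y // roof_rel T S X Y"
  by (simp add: verdier_def)

lemma roof_cls_in [intro]: "roof X Y Z s f \<Longrightarrow> roof_cls X Y Z s f \<in> Mor V X Y"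
  unfolding carrier_verdier roof_cls_def by (rule quotientI) (auto simp: roofs_def)

lemma verdier_cases:
  assumes "a \<in> Mor V X Y" obtains Z s f where "roof X Y Z s f" "a = roof_cls X Y Z s f"
  using assms unfolding carrier_verdier roof_cls_def by (auto elim!: quotientE simp: roofs_def)

text \<open>\<open>f\<close> and \<open>g\<close> are compared with \<open>f'\<close> and
  \<open>g'\<close> over two unrelated refinements. After passing to a common one, a covering makes
  the morphisms into \<open>Z\<close> equal and another one those into \<open>Z'\<close>, so that
  the two comparisons can be added.\<close>

lemma roof_cls_mult:
  assumes X: "Y \<in> Obj T" and r: "roof X Y Z s f" "roof X Y Z s g"
  shows "roof_cls X Y Z s f \<otimes>\<^bsub>Hom V X Y\<^esub> roof_cls X Y Z s g = roof_cls X Y Z s (f \<otimes>\<^bsub>Hom T Z Y\<^esub> g)"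
proof -
  let ?A = "{(Z', s', f' \<otimes>\<^bsub>Hom T Z' Y\<^esub> g') | Z' s' f' g'. (Z', s', f') \<in> roof_cls X Y Z s f \<and> (Z', s', g') \<in> roof_cls X Y Z s g}"
  have "roof_rel T S X Y `` ?A = roof_cls X Y Z s (f \<otimes>\<^bsub>Hom T Z Y\<^esub> g)"
  proof (rule Image_roof_cls[OF X])
    have "(Z, s, f) \<in> roof_cls X Y Z s f" "(Z, s, g) \<in> roof_cls X Y Z s g"
      using r X by (auto simp: in_roof_cls roof_eq_refl)
    then show "?A \<noteq> {}" by blast
    fix Z' s' h assume "(Z', s', h) \<in> ?A"
    then obtain f' g' where h: "h = f' \<otimes>\<^bsub>Hom T Z' Y\<^esub> g'" and r': "roof X Y Z' s' f'" "roof X Y Z' s' g'"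
      and e: "roof_eq X Y Z s f Z' s' f'" "roof_eq X Y Z s g Z' s' g'" by (auto simp: in_roof_cls)
    have ty: "X \<in> Obj T" "s \<in> Mor T Z X" "s' \<in> Mor T Z' X" using cov_typed r r' by blast+
    obtain W1 u1 v1 where 1: "W1 \<in> Obj T" "u1 \<in> Mor T W1 Z" "v1 \<in> Mor T W1 Z'" "Cmp T W1 Z X s u1 \<in> cov W1 X"
      "Cmp T W1 Z X s u1 = Cmp T W1 Z' X s' v1" "Cmp T W1 Z Y f u1 = Cmp T W1 Z' Y f' v1" using e(1) by (rule roof_eqE)
    obtain W2 u2 v2 where 2: "W2 \<in> Obj T" "u2 \<in> Mor T W2 Z" "v2 \<in> Mor T W2 Z'" "Cmp T W2 Z X s u2 \<in> cov W2 X"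
      "Cmp T W2 Z X s u2 = Cmp T W2 Z' X s' v2" "Cmp T W2 Z Y g u2 = Cmp T W2 Z' Y g' v2" using e(2) by (rule roof_eqE)
    obtain M a b where M: "M \<in> Obj T" "a \<in> Mor T M W1" "a \<in> cov M W1" "b \<in> Mor T M W2"
      "Cmp T M W1 X (Cmp T W1 Z X s u1) a = Cmp T M W2 X (Cmp T W2 Z X s u2) b"
      using cov_common[OF 1(4) 2(4)] by metis
    have "Cmp T M Z X s (Cmp T M W1 Z u1 a) = Cmp T M Z X s (Cmp T M W2 Z u2 b)"
      using M 1(1-3) 2(1-3) r ty by (simp add: cmp_assoc)
    then obtain M1 t where M1: "M1 \<in> Obj T" "t \<in> cov M1 M" "t \<in> Mor T M1 M"
      "Cmp T M1 M Z (Cmp T M W1 Z u1 a) t = Cmp T M1 M Z (Cmp T M W2 Z u2 b) t"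
      using cov_cancel[of s Z X "Cmp T M W1 Z u1 a" M "Cmp T M W2 Z u2 b"] M(1-4) 1(1-3) 2(1-3) r by auto
    have "Cmp T M Z' X s' (Cmp T M W1 Z' v1 a) = Cmp T M Z' X s' (Cmp T M W2 Z' v2 b)"
      using M(5) unfolding 1(5) 2(5) using M(1-4) 1(1-3) 2(1-3) r' ty by (simp add: cmp_assoc)
    then have "Cmp T M1 Z' X s' (Cmp T M1 M Z' (Cmp T M W1 Z' v1 a) t) = Cmp T M1 Z' X s' (Cmp T M1 M Z' (Cmp T M W2 Z' v2 b) t)"
      by (rule square_pre) (use M(1-4) M1(1-3) 1(1-3) 2(1-3) r' ty in auto)
    then obtain N t' where N: "N \<in> Obj T" "t' \<in> cov N M1" "t' \<in> Mor T N M1"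
      "Cmp T N M1 Z' (Cmp T M1 M Z' (Cmp T M W1 Z' v1 a) t) t' = Cmp T N M1 Z' (Cmp T M1 M Z' (Cmp T M W2 Z' v2 b) t) t'"
      using cov_cancel[of s' Z' X "Cmp T M1 M Z' (Cmp T M W1 Z' v1 a) t" M1 "Cmp T M1 M Z' (Cmp T M W2 Z' v2 b) t"]
        M(1-4) M1(1-3) 1(1-3) 2(1-3) r' by auto
    let ?t = "Cmp T N M1 M t t'"
    let ?a = "Cmp T N M W1 a ?t" and ?b = "Cmp T N M W2 b ?t"
    have ab: "?a \<in> Mor T N W1" "?b \<in> Mor T N W2" "?a \<in> cov N W1"
      using M(1-4) M1(1-3) N(1-3) 1(1) 2(1) cov_cmp by auto
    have u: "Cmp T N W1 Z u1 ?a = Cmp T N W2 Z u2 ?b"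
    proof -
      have "Cmp T N M1 Z (Cmp T M1 M Z (Cmp T M W1 Z u1 a) t) t' = Cmp T N M1 Z (Cmp T M1 M Z (Cmp T M W2 Z u2 b) t) t'"
        by (simp only: M1(4))
      then show ?thesis using M(1-4) M1(1-3) N(1-3) 1(1-3) 2(1-3) r by (simp add: cmp_assoc)
    qed
    have v: "Cmp T N W1 Z' v1 ?a = Cmp T N W2 Z' v2 ?b"
      using N(4) M(1-4) M1(1-3) N(1-3) 1(1-3) 2(1-3) r' by (simp add: cmp_assoc)
    have "roof_eq X Y Z s (f \<otimes>\<^bsub>Hom T Z Y\<^esub> g) Z' s' h"
    proof (rule roof_eqI)
      show "Cmp T N W1 Z u1 ?a \<in> Mor T N Z" "Cmp T N W1 Z' v1 ?a \<in> Mor T N Z'" using ab 1(1-3) N(1) r r' by auto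
      show "Cmp T N Z X s (Cmp T N W1 Z u1 ?a) \<in> cov N X"
        using cov_cmp[OF ab(3) 1(4)] ab 1(1,2) N(1) r ty by (simp add: cmp_assoc)
      show "Cmp T N Z X s (Cmp T N W1 Z u1 ?a) = Cmp T N Z' X s' (Cmp T N W1 Z' v1 ?a)"
        by (rule square_pre[OF 1(5)]) (use ab 1(1-3) N(1) r r' ty in auto)
      have "Cmp T N Z Y f (Cmp T N W1 Z u1 ?a) = Cmp T N Z' Y f' (Cmp T N W1 Z' v1 ?a)"
        by (rule square_pre[OF 1(6)]) (use ab 1(1-3) N(1) r r' X in auto)
      moreover have "Cmp T N Z Y g (Cmp T N W1 Z u1 ?a) = Cmp T N Z' Y g' (Cmp T N W1 Z' v1 ?a)"
        unfolding u v by (rule square_pre[OF 2(6)]) (use ab 2(1-3) N(1) r r' X in auto)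
      ultimately show "Cmp T N Z Y (f \<otimes>\<^bsub>Hom T Z Y\<^esub> g) (Cmp T N W1 Z u1 ?a) = Cmp T N Z' Y h (Cmp T N W1 Z' v1 ?a)"
        unfolding h using ab 1(1-3) N(1) r r' X by (simp add: cmp_add_left)
    qed (rule N(1))
    then show "(Z', s', h) \<in> roof_cls X Y Z s (f \<otimes>\<^bsub>Hom T Z Y\<^esub> g)"
      using r r' X h by (auto simp: in_roof_cls)
  qed
  then show ?thesis by (simp add: verdier_def)
qed

lemma roof_cls_common:
  assumes Y: "Y \<in> Obj T" and r: "roof X Y Z s f" "roof X Y Z' s' f'"
  obtains M t g g' a where "roof X Y M t g" "roof X Y M t g'" "roof_cls X Y Z s f = roof_cls X Y M t g"
    "roof_cls X Y Z' s' f' = roof_cls X Y M t g'" "a \<in> Mor T M Z" "t = Cmp T M Z X s a"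
proof -
  have ty: "X \<in> Obj T" "s \<in> Mor T Z X" "s' \<in> Mor T Z' X" using cov_typed r by blast+
  obtain M a b where M: "M \<in> Obj T" "a \<in> Mor T M Z" "b \<in> Mor T M Z'" "Cmp T M Z X s a = Cmp T M Z' X s' b"
    "Cmp T M Z X s a \<in> cov M X"
    using cov_common[of s Z X s' Z'] r by metis
  show ?thesis
  proof (rule that[of M "Cmp T M Z X s a" "Cmp T M Z Y f a" "Cmp T M Z' Y f' b" a])
    show "roof_cls X Y Z s f = roof_cls X Y M (Cmp T M Z X s a) (Cmp T M Z Y f a)"
      by (rule roof_cls_refine) (use M r Y in auto)
    show "roof_cls X Y Z' s' f' = roof_cls X Y M (Cmp T M Z X s a) (Cmp T M Z' Y f' b)"
      unfolding M(4) by (rule roof_cls_refine) (use M(1-3) M(5)[unfolded M(4)] r Y in auto)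
  qed (use M(1,2,3,5) r Y in auto)
qed

lemma verdier_one: "\<lbrakk>Y \<in> Obj T; roof X Y Z s \<one>\<^bsub>Hom T Z Y\<^esub>\<rbrakk> \<Longrightarrow> \<one>\<^bsub>Hom V X Y\<^esub> = roof_cls X Y Z s \<one>\<^bsub>Hom T Z Y\<^esub>"
proof -
  assume Y: "Y \<in> Obj T" and r: "roof X Y Z s \<one>\<^bsub>Hom T Z Y\<^esub>"
  have X: "X \<in> Obj T" "s \<in> Mor T Z X" using cov_typed r by blast+
  have "\<one>\<^bsub>Hom V X Y\<^esub> = roof_cls X Y X (Idt T X) \<one>\<^bsub>Hom T X Y\<^esub>"
    by (simp add: verdier_def roof_cls_def)
  also have "\<dots> = roof_cls X Y Z (Cmp T Z X X (Idt T X) s) (Cmp T Z X Y \<one>\<^bsub>Hom T X Y\<^esub> s)"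
    by (rule roof_cls_refine) (use X Y r cov_idt in auto)
  finally show ?thesis using X Y r by simp
qed

lemma comm_group_verdier: assumes X: "X \<in> Obj T" "Y \<in> Obj T" shows "comm_group (Hom V X Y)"
proof (rule comm_group_directed)
  have "roof X Y X (Idt T X) \<one>\<^bsub>Hom T X Y\<^esub>" using X cov_idt by auto
  then show "\<one>\<^bsub>Hom V X Y\<^esub> \<in> carrier (Hom V X Y)" using verdier_one[OF X(2)] roof_cls_in by simp
next
  fix a b c assume "a \<in> Mor V X Y" "b \<in> Mor V X Y" "c \<in> Mor V X Y"
  then obtain Z s f Z' s' f' Z'' s'' f'' where a: "roof X Y Z s f" "a = roof_cls X Y Z s f"
    and b: "roof X Y Z' s' f'" "b = roof_cls X Y Z' s' f'" and c: "roof X Y Z'' s'' f''" "c = roof_cls X Y Z'' s'' f''"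
    by (meson verdier_cases)
  obtain M t g g' where M: "roof X Y M t g" "roof X Y M t g'" "a = roof_cls X Y M t g" "b = roof_cls X Y M t g'"
    using roof_cls_common[OF X(2) a(1) b(1)] a b by metis
  obtain N r h h'' d where N: "roof X Y N r h" "roof X Y N r h''" "a = roof_cls X Y N r h" "c = roof_cls X Y N r h''"
    "d \<in> Mor T N M" "r = Cmp T N M X t d"
    using roof_cls_common[OF X(2) M(1) c(1)] M c by metis
  have b: "b = roof_cls X Y N r (Cmp T N M Y g' d)" "roof X Y N r (Cmp T N M Y g' d)"
    using roof_cls_refine[OF M(2) X(2), where W=N and u=d] N M X by auto
  show "\<exists>(D :: 'm monoid) h. comm_group D \<and> h \<in> hom D (Hom V X Y) \<and> h \<one>\<^bsub>D\<^esub> = \<one>\<^bsub>Hom V X Y\<^esub> \<and> {a, b, c} \<subseteq> h ` carrier D"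
  proof (intro exI[of _ "Hom T N Y"] exI[of _ "roof_cls X Y N r"] conjI)
    show "comm_group (Hom T N Y)" using hom_group N X by simp
    show "roof_cls X Y N r \<in> hom (Hom T N Y) (Hom V X Y)"
      using N X by (auto simp: hom_def roof_cls_mult)
    show "roof_cls X Y N r \<one>\<^bsub>Hom T N Y\<^esub> = \<one>\<^bsub>Hom V X Y\<^esub>" using verdier_one[where Y=Y and X=X and Z=N and s=r] N X by simp
    show "{a, b, c} \<subseteq> roof_cls X Y N r ` Mor T N Y" using N b by auto
  qed
qed


text \<open>The composite is independent of all choices: the representatives of both factors and the
  Ore square. The morphisms to be compared agree at first only after \<open>s1\<close>,
  \<open>s2\<close>, \<open>t1\<close> or \<open>t2\<close>; each of these is cancelled at the cost
  of one more covering, \<open>C\<close>, \<open>D\<close>, \<open>I\<close> and \<open>J\<close>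
  respectively.\<close>

lemma roof_cmp_unique:
  assumes o: "Y \<in> Obj T" "Z \<in> Obj T"
    and a: "roof X Y X1 s1 f1" "roof X Y X2 s2 f2" "roof_eq X Y X1 s1 f1 X2 s2 f2"
    and b: "roof Y Z Y1 t1 g1" "roof Y Z Y2 t2 g2" "roof_eq Y Z Y1 t1 g1 Y2 t2 g2"
    and W1: "W1 \<in> Obj T" "p1 \<in> cov W1 X1" "q1 \<in> Mor T W1 Y1" "Cmp T W1 X1 Y f1 p1 = Cmp T W1 Y1 Y t1 q1"
    and W2: "W2 \<in> Obj T" "p2 \<in> cov W2 X2" "q2 \<in> Mor T W2 Y2" "Cmp T W2 X2 Y f2 p2 = Cmp T W2 Y2 Y t2 q2"
  shows "roof_eq X Z W1 (Cmp T W1 X1 X s1 p1) (Cmp T W1 Y1 Z g1 q1) W2 (Cmp T W2 X2 X s2 p2) (Cmp T W2 Y2 Z g2 q2)"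
proof -
  have ty: "X \<in> Obj T" "X1 \<in> Obj T" "X2 \<in> Obj T" "Y1 \<in> Obj T" "Y2 \<in> Obj T" "s1 \<in> Mor T X1 X" "s2 \<in> Mor T X2 X"
    "t1 \<in> Mor T Y1 Y" "t2 \<in> Mor T Y2 Y" "p1 \<in> Mor T W1 X1" "p2 \<in> Mor T W2 X2"
    "f1 \<in> Mor T X1 Y" "f2 \<in> Mor T X2 Y" "g1 \<in> Mor T Y1 Z" "g2 \<in> Mor T Y2 Z"
    using cov_typed a b W1 W2 by blast+
  obtain E u v where E: "E \<in> Obj T" "u \<in> Mor T E X1" "v \<in> Mor T E X2" "Cmp T E X1 X s1 u \<in> cov E X"
    "Cmp T E X1 X s1 u = Cmp T E X2 X s2 v" "Cmp T E X1 Y f1 u = Cmp T E X2 Y f2 v" using a(3) by (rule roof_eqE)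
  obtain G p q where G: "G \<in> Obj T" "p \<in> Mor T G Y1" "q \<in> Mor T G Y2" "Cmp T G Y1 Y t1 p \<in> cov G Y"
    "Cmp T G Y1 Y t1 p = Cmp T G Y2 Y t2 q" "Cmp T G Y1 Z g1 p = Cmp T G Y2 Z g2 q" using b(3) by (rule roof_eqE)
  note [simp] = ty o E(1-3) G(1-3) W1(1,3) W2(1,3)
  have r1: "Cmp T W1 X1 X s1 p1 \<in> cov W1 X" and r2: "Cmp T W2 X2 X s2 p2 \<in> cov W2 X"
    using cov_cmp a(1,2) W1(2) W2(2) by blast+
  \<comment> \<open>\<open>A\<close> compares the two composite denominators; \<open>B\<close>
    compares them further with the refinement \<open>E\<close> that identifies the two first
    factors.\<close>
  obtain A a1 a2 where A: "A \<in> Obj T" "a1 \<in> Mor T A W1" "a2 \<in> Mor T A W2"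
    "Cmp T A W1 X (Cmp T W1 X1 X s1 p1) a1 = Cmp T A W2 X (Cmp T W2 X2 X s2 p2) a2"
    "Cmp T A W1 X (Cmp T W1 X1 X s1 p1) a1 \<in> cov A X"
    using cov_common[OF r1 r2] by metis
  note [simp] = A(1-3)
  obtain B b1 b2 where B: "B \<in> Obj T" "b1 \<in> Mor T B A" "b1 \<in> cov B A" "b2 \<in> Mor T B E"
    "Cmp T B A X (Cmp T A W1 X (Cmp T W1 X1 X s1 p1) a1) b1 = Cmp T B E X (Cmp T E X1 X s1 u) b2"
    using cov_common[OF A(5) E(4)] by metis
  note [simp] = B(1,2,4)
  let ?l1 = "Cmp T B W1 X1 p1 (Cmp T B A W1 a1 b1)" and ?l2 = "Cmp T B W2 X2 p2 (Cmp T B A W2 a2 b1)"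
  have "Cmp T B X1 X s1 ?l1 = Cmp T B X1 X s1 (Cmp T B E X1 u b2)"
    using B(5) by (simp add: cmp_assoc)
  then obtain C c where C: "C \<in> Obj T" "c \<in> cov C B" "c \<in> Mor T C B"
    "Cmp T C B X1 ?l1 c = Cmp T C B X1 (Cmp T B E X1 u b2) c"
    using cov_cancel[of s1 X1 X ?l1 B "Cmp T B E X1 u b2"] a(1) by auto
  note [simp] = C(1,3)
  have "Cmp T B X2 X s2 ?l2 = Cmp T B A X (Cmp T A W2 X (Cmp T W2 X2 X s2 p2) a2) b1"
    by (simp add: cmp_assoc)
  also have "\<dots> = Cmp T B E X (Cmp T E X2 X s2 v) b2" using B(5) unfolding A(4) E(5) .
  finally have "Cmp T B X2 X s2 ?l2 = Cmp T B X2 X s2 (Cmp T B E X2 v b2)" by (simp add: cmp_assoc)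
  then have "Cmp T C X2 X s2 (Cmp T C B X2 ?l2 c) = Cmp T C X2 X s2 (Cmp T C B X2 (Cmp T B E X2 v b2) c)"
    by (rule square_pre) auto
  then obtain D d where D: "D \<in> Obj T" "d \<in> cov D C" "d \<in> Mor T D C"
    "Cmp T D C X2 (Cmp T C B X2 ?l2 c) d = Cmp T D C X2 (Cmp T C B X2 (Cmp T B E X2 v b2) c) d"
    using cov_cancel[of s2 X2 X "Cmp T C B X2 ?l2 c" C "Cmp T C B X2 (Cmp T B E X2 v b2) c"] a(2) by auto
  note [simp] = D(1,3)
  let ?cd = "Cmp T D C B c d"
  let ?a = "Cmp T D A W1 a1 (Cmp T D B A b1 ?cd)" and ?b = "Cmp T D A W2 a2 (Cmp T D B A b1 ?cd)" and ?e = "Cmp T D B E b2 ?cd"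
  have "Cmp T D C X1 (Cmp T C B X1 ?l1 c) d = Cmp T D C X1 (Cmp T C B X1 (Cmp T B E X1 u b2) c) d"
    by (simp only: C(4))
  then have e1: "Cmp T D W1 X1 p1 ?a = Cmp T D E X1 u ?e" by (simp add: cmp_assoc)
  have e2: "Cmp T D W2 X2 p2 ?b = Cmp T D E X2 v ?e" using D(4) by (simp add: cmp_assoc)
  have "Cmp T D Y1 Y t1 (Cmp T D W1 Y1 q1 ?a) = Cmp T D X1 Y f1 (Cmp T D W1 X1 p1 ?a)"
    by (rule square_pre[OF W1(4)[symmetric]]) auto
  also have "\<dots> = Cmp T D X2 Y f2 (Cmp T D W2 X2 p2 ?b)"
    unfolding e1 e2 by (rule square_pre[OF E(6)]) auto
  also have "\<dots> = Cmp T D Y2 Y t2 (Cmp T D W2 Y2 q2 ?b)"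
    by (rule square_pre[OF W2(4)]) auto
  finally have tq: "Cmp T D Y1 Y t1 (Cmp T D W1 Y1 q1 ?a) = Cmp T D Y2 Y t2 (Cmp T D W2 Y2 q2 ?b)" .
  let ?k = "Cmp T D Y1 Y t1 (Cmp T D W1 Y1 q1 ?a)"
  have ab: "?a \<in> Mor T D W1" "?b \<in> Mor T D W2" by simp_all
  note [simp] = ab
  \<comment> \<open>From here on the second factors are compared: \<open>H\<close> covers
    \<open>D\<close> and maps to the refinement \<open>G\<close> that identifies the roofs from
    \<open>Y\<close> to \<open>Z\<close>.\<close>
  obtain H h m where H: "H \<in> Obj T" "h \<in> cov H D" "h \<in> Mor T H D" "m \<in> Mor T H G"
    "Cmp T H G Y (Cmp T G Y1 Y t1 p) m = Cmp T H D Y ?k h"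
    using cov_pull[OF G(4), of ?k D] by auto
  note [simp] = H(1,3,4)
  have "Cmp T H Y1 Y t1 (Cmp T H G Y1 p m) = Cmp T H Y1 Y t1 (Cmp T H D Y1 (Cmp T D W1 Y1 q1 ?a) h)"
    using H(5) by (simp add: cmp_assoc[of H _ _ Y] del: ab)
  then obtain I i where I: "I \<in> Obj T" "i \<in> cov I H" "i \<in> Mor T I H"
    "Cmp T I H Y1 (Cmp T H G Y1 p m) i = Cmp T I H Y1 (Cmp T H D Y1 (Cmp T D W1 Y1 q1 ?a) h) i"
    using cov_cancel[of t1 Y1 Y "Cmp T H G Y1 p m" H "Cmp T H D Y1 (Cmp T D W1 Y1 q1 ?a) h"] b(1) by auto
  note [simp] = I(1,3)
  have "Cmp T H Y2 Y t2 (Cmp T H G Y2 q m) = Cmp T H Y2 Y t2 (Cmp T H D Y2 (Cmp T D W2 Y2 q2 ?b) h)"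
    using H(5) unfolding G(5) tq by (simp add: cmp_assoc[of H _ _ Y] del: ab)
  then have "Cmp T I Y2 Y t2 (Cmp T I H Y2 (Cmp T H G Y2 q m) i) = Cmp T I Y2 Y t2 (Cmp T I H Y2 (Cmp T H D Y2 (Cmp T D W2 Y2 q2 ?b) h) i)"
    by (rule square_pre) auto
  then obtain J j where J: "J \<in> Obj T" "j \<in> cov J I" "j \<in> Mor T J I"
    "Cmp T J I Y2 (Cmp T I H Y2 (Cmp T H G Y2 q m) i) j = Cmp T J I Y2 (Cmp T I H Y2 (Cmp T H D Y2 (Cmp T D W2 Y2 q2 ?b) h) i) j"
    using cov_cancel[of t2 Y2 Y "Cmp T I H Y2 (Cmp T H G Y2 q m) i" I "Cmp T I H Y2 (Cmp T H D Y2 (Cmp T D W2 Y2 q2 ?b) h) i"] b(2) by auto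
  note [simp] = J(1,3)
  let ?z = "Cmp T J H D h (Cmp T J I H i j)"
  let ?y = "Cmp T J H G m (Cmp T J I H i j)"
  have "Cmp T J I Y1 (Cmp T I H Y1 (Cmp T H G Y1 p m) i) j = Cmp T J I Y1 (Cmp T I H Y1 (Cmp T H D Y1 (Cmp T D W1 Y1 q1 ?a) h) i) j"
    by (simp only: I(4))
  then have k1: "Cmp T J W1 Y1 q1 (Cmp T J D W1 ?a ?z) = Cmp T J G Y1 p ?y" by (simp add: cmp_assoc)
  have k2: "Cmp T J W2 Y2 q2 (Cmp T J D W2 ?b ?z) = Cmp T J G Y2 q ?y" using J(4) by (simp add: cmp_assoc)
  have cz: "?z \<in> cov J D" using cov_cmp[OF cov_cmp[OF J(2) I(2)] H(2)] .
  have cbd: "Cmp T D B A b1 ?cd \<in> cov D A" using cov_cmp[OF cov_cmp[OF D(2) C(2)] B(3)] .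
  show ?thesis
  proof (rule roof_eqI)
    show "Cmp T J D W1 ?a ?z \<in> Mor T J W1" "Cmp T J D W2 ?b ?z \<in> Mor T J W2" by simp_all
    have "Cmp T J A X (Cmp T A W1 X (Cmp T W1 X1 X s1 p1) a1) (Cmp T J D A (Cmp T D B A b1 ?cd) ?z) \<in> cov J X"
      using cov_cmp[OF cov_cmp[OF cz cbd] A(5)] .
    then show "Cmp T J W1 X (Cmp T W1 X1 X s1 p1) (Cmp T J D W1 ?a ?z) \<in> cov J X" by (simp add: cmp_assoc)
    have "Cmp T J A X (Cmp T A W1 X (Cmp T W1 X1 X s1 p1) a1) (Cmp T J D A (Cmp T D B A b1 ?cd) ?z)
       = Cmp T J A X (Cmp T A W2 X (Cmp T W2 X2 X s2 p2) a2) (Cmp T J D A (Cmp T D B A b1 ?cd) ?z)"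
      by (simp only: A(4))
    then show "Cmp T J W1 X (Cmp T W1 X1 X s1 p1) (Cmp T J D W1 ?a ?z) = Cmp T J W2 X (Cmp T W2 X2 X s2 p2) (Cmp T J D W2 ?b ?z)"
      by (simp add: cmp_assoc)
    have "Cmp T J W1 Z (Cmp T W1 Y1 Z g1 q1) (Cmp T J D W1 ?a ?z) = Cmp T J Y1 Z g1 (Cmp T J W1 Y1 q1 (Cmp T J D W1 ?a ?z))"
      by (rule cmp_assoc) auto
    also have "\<dots> = Cmp T J Y2 Z g2 (Cmp T J W2 Y2 q2 (Cmp T J D W2 ?b ?z))"
      unfolding k1 k2 by (rule square_pre[OF G(6)]) auto
    also have "\<dots> = Cmp T J W2 Z (Cmp T W2 Y2 Z g2 q2) (Cmp T J D W2 ?b ?z)"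
      by (rule cmp_assoc[symmetric]) auto
    finally show "Cmp T J W1 Z (Cmp T W1 Y1 Z g1 q1) (Cmp T J D W1 ?a ?z) = Cmp T J W2 Z (Cmp T W2 Y2 Z g2 q2) (Cmp T J D W2 ?b ?z)" .
  qed simp
qed

text \<open>By \<open>roof_cmp_unique\<close> a single Ore square computes the composite.\<close>

lemma verdier_cmp:
  assumes o: "Y \<in> Obj T" "Z \<in> Obj T" and a: "roof X Y X' s f" and b: "roof Y Z Y' t g"
    and W: "W \<in> Obj T" "s' \<in> cov W X'" "f' \<in> Mor T W Y'" "Cmp T W X' Y f s' = Cmp T W Y' Y t f'"
  shows "Cmp V X Y Z (roof_cls Y Z Y' t g) (roof_cls X Y X' s f) =
    roof_cls X Z W (Cmp T W X' X s s') (Cmp T W Y' Z g f')"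
proof -
  let ?A = "{(W, Cmp T W X' X s s', Cmp T W Y' Z g f') | W X' s f Y' t g s' f'.
          (X', s, f) \<in> roof_cls X Y X' s f \<and> (Y', t, g) \<in> roof_cls Y Z Y' t g \<and> W \<in> Obj T \<and>
          s' \<in> cov W X' \<and> f' \<in> Mor T W Y' \<and> Cmp T W X' Y f s' = Cmp T W Y' Y t f'}"
  let ?B = "{(W, Cmp T W X1 X s1 s', Cmp T W Y1 Z g1 f') | W X1 s1 f1 Y1 t1 g1 s' f'.
          (X1, s1, f1) \<in> roof_cls X Y X' s f \<and> (Y1, t1, g1) \<in> roof_cls Y Z Y' t g \<and> W \<in> Obj T \<and>
          s' \<in> cov W X1 \<and> f' \<in> Mor T W Y1 \<and> Cmp T W X1 Y f1 s' = Cmp T W Y1 Y t1 f'}"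
  have ty: "X' \<in> Obj T" "X \<in> Obj T" "Y' \<in> Obj T" using cov_typed a b by blast+
  have r: "roof X Z W (Cmp T W X' X s s') (Cmp T W Y' Z g f')" using a b W ty o cov_cmp[OF W(2)] by auto
  have "roof_rel T S X Z `` ?B = roof_cls X Z W (Cmp T W X' X s s') (Cmp T W Y' Z g f')"
  proof (rule Image_roof_cls[OF o(2)])
    have "(X', s, f) \<in> roof_cls X Y X' s f" "(Y', t, g) \<in> roof_cls Y Z Y' t g"
      using a b o by (auto simp: in_roof_cls roof_eq_refl)
    then show "?B \<noteq> {}" using W by blast
    fix W1 k l assume "(W1, k, l) \<in> ?B"
    then obtain X1 s1 f1 Y1 t1 g1 p q where *: "k = Cmp T W1 X1 X s1 p" "l = Cmp T W1 Y1 Z g1 q"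
      "(X1, s1, f1) \<in> roof_cls X Y X' s f" "(Y1, t1, g1) \<in> roof_cls Y Z Y' t g" "W1 \<in> Obj T"
      "p \<in> cov W1 X1" "q \<in> Mor T W1 Y1" "Cmp T W1 X1 Y f1 p = Cmp T W1 Y1 Y t1 q" by blast
    then have 1: "roof X Y X1 s1 f1" "roof_eq X Y X' s f X1 s1 f1" "roof Y Z Y1 t1 g1" "roof_eq Y Z Y' t g Y1 t1 g1"
      by (auto simp: in_roof_cls)
    have "roof_eq X Z W (Cmp T W X' X s s') (Cmp T W Y' Z g f') W1 k l"
      unfolding *(1,2) by (rule roof_cmp_unique[OF o a 1(1,2) b 1(3,4) W *(5-8)])
    moreover have "roof X Z W1 k l" unfolding *(1,2) using * 1 o cov_cmp cov_typed[of t1 Y1 Y] by auto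
    ultimately show "(W1, k, l) \<in> roof_cls X Z W (Cmp T W X' X s s') (Cmp T W Y' Z g f')"
      using r by (simp add: in_roof_cls)
  qed
  then show ?thesis by (simp add: verdier_def)
qed

lemma roof_ore:
  assumes "roof X Y X' s f" "roof Y Z Y' t g"
  obtains W s' f' where "W \<in> Obj T" "s' \<in> cov W X'" "s' \<in> Mor T W X'" "f' \<in> Mor T W Y'" "Cmp T W X' Y f s' = Cmp T W Y' Y t f'"
  using cov_pull[of t Y' Y f X'] assms by metis

sublocale verdier: preadditive_category V
proof (rule preadditive_category.intro)
  show "comm_group (Hom V X Y)" if "X \<in> Obj V" "Y \<in> Obj V" for X Y using comm_group_verdier that by simp
  show "Idt V X \<in> Mor V X X" if "X \<in> Obj V" for X
    using that cov_idt by (auto simp: verdier_Idt intro!: roof_cls_in)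
next
  fix X Y Z a b assume o: "X \<in> Obj V" "Y \<in> Obj V" "Z \<in> Obj V" and "a \<in> Mor V X Y" "b \<in> Mor V Y Z"
  then obtain X' s f Y' t g where a: "roof X Y X' s f" "a = roof_cls X Y X' s f" and b: "roof Y Z Y' t g" "b = roof_cls Y Z Y' t g"
    by (meson verdier_cases)
  obtain W s' f' where W: "W \<in> Obj T" "s' \<in> cov W X'" "s' \<in> Mor T W X'" "f' \<in> Mor T W Y'" "Cmp T W X' Y f s' = Cmp T W Y' Y t f'"
    using roof_ore[OF a(1) b(1)] .
  show "Cmp V X Y Z b a \<in> Mor V X Z"
    unfolding a(2) b(2) verdier_cmp[OF o(2,3)[simplified] a(1) b(1) W(1,2,4,5)]
    by (rule roof_cls_in) (use o W a b cov_cmp[OF W(2)] in auto)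
next
  fix X Y a assume o: "X \<in> Obj V" "Y \<in> Obj V" and "a \<in> Mor V X Y"
  then obtain X' s f where a: "roof X Y X' s f" "a = roof_cls X Y X' s f" by (meson verdier_cases)
  have ty: "s \<in> Mor T X' X" using cov_typed a by blast
  have i: "roof X X X (Idt T X) (Idt T X)" "roof Y Y Y (Idt T Y) (Idt T Y)" using o cov_idt by auto
  show "Cmp V X Y Y (Idt V Y) a = a"
    unfolding a(2) verdier_Idt using verdier_cmp[OF _ _ a(1) i(2), of X' "Idt T X'" f] o a(1) ty cov_idt by simp
  show "Cmp V X X Y a (Idt V X) = a"
    unfolding a(2) verdier_Idt using verdier_cmp[OF _ _ i(1) a(1), of X' s "Idt T X'"] o a(1) ty by simp
next
  fix X Y Z W a b c assume o: "W \<in> Obj V" "X \<in> Obj V" "Y \<in> Obj V" "Z \<in> Obj V"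
    and "a \<in> Mor V W X" "b \<in> Mor V X Y" "c \<in> Mor V Y Z"
  then obtain W' s f X' t g Y' r h where a: "roof W X W' s f" "a = roof_cls W X W' s f"
    and b: "roof X Y X' t g" "b = roof_cls X Y X' t g" and c: "roof Y Z Y' r h" "c = roof_cls Y Z Y' r h"
    by (meson verdier_cases)
  have ty: "s \<in> Mor T W' W" "t \<in> Mor T X' X" "r \<in> Mor T Y' Y" using cov_typed a b c by blast+
  obtain W1 s1 f1 where W1: "W1 \<in> Obj T" "s1 \<in> cov W1 W'" "s1 \<in> Mor T W1 W'" "f1 \<in> Mor T W1 X'" "Cmp T W1 W' X f s1 = Cmp T W1 X' X t f1"
    using roof_ore[OF a(1) b(1)] .
  obtain X1 t1 g1 where X1: "X1 \<in> Obj T" "t1 \<in> cov X1 X'" "t1 \<in> Mor T X1 X'" "g1 \<in> Mor T X1 Y'" "Cmp T X1 X' Y g t1 = Cmp T X1 Y' Y r g1"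
    using roof_ore[OF b(1) c(1)] .
  obtain W2 s2 f2 where W2: "W2 \<in> Obj T" "s2 \<in> cov W2 W1" "s2 \<in> Mor T W2 W1" "f2 \<in> Mor T W2 X1" "Cmp T W2 X1 X' t1 f2 = Cmp T W2 W1 X' f1 s2"
    using cov_pull[OF X1(2), of f1 W1] W1 by metis
  have o': "W \<in> Obj T" "X \<in> Obj T" "Y \<in> Obj T" "Z \<in> Obj T" using o by auto
  note [simp] = ty o' W1(1,3,4) X1(1,3,4) W2(1,3,4)
  have m [simp]: "W' \<in> Obj T" "X' \<in> Obj T" "Y' \<in> Obj T" "f \<in> Mor T W' X" "g \<in> Mor T X' Y" "h \<in> Mor T Y' Z" using a b c by auto
  have cb: "Cmp V X Y Z c b = roof_cls X Z X1 (Cmp T X1 X' X t t1) (Cmp T X1 Y' Z h g1)"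
    unfolding b(2) c(2) by (rule verdier_cmp) (use b c X1 in auto)
  have ba: "Cmp V W X Y b a = roof_cls W Y W1 (Cmp T W1 W' W s s1) (Cmp T W1 X' Y g f1)"
    unfolding a(2) b(2) by (rule verdier_cmp) (use a b W1 in auto)
  have e1: "Cmp T W2 W' X f (Cmp T W2 W1 W' s1 s2) = Cmp T W2 X' X t (Cmp T W2 W1 X' f1 s2)"
    by (rule square_pre[OF W1(5)]) auto
  have "Cmp V W X Z (Cmp V X Y Z c b) a = roof_cls W Z W2 (Cmp T W2 W' W s (Cmp T W2 W1 W' s1 s2)) (Cmp T W2 X1 Z (Cmp T X1 Y' Z h g1) f2)"
    unfolding cb a(2)
    by (rule verdier_cmp) (use a b c X1(2) e1 W2(5) cov_cmp[OF X1(2)] cov_cmp[OF W2(2) W1(2)] in \<open>auto simp: cmp_assoc\<close>)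
  moreover have "Cmp T W2 X' Y g (Cmp T W2 W1 X' f1 s2) = Cmp T W2 Y' Y r (Cmp T W2 X1 Y' g1 f2)"
    unfolding W2(5)[symmetric] by (rule square_pre[OF X1(5)]) auto
  then have "Cmp V W Y Z c (Cmp V W X Y b a) = roof_cls W Z W2 (Cmp T W2 W1 W (Cmp T W1 W' W s s1) s2) (Cmp T W2 Y' Z h (Cmp T W2 X1 Y' g1 f2))"
    unfolding ba c(2)
    by (intro verdier_cmp) (use a b c W2(2) cov_cmp[OF W1(2)] in \<open>auto simp: cmp_assoc\<close>)
  ultimately show "Cmp V W X Z (Cmp V X Y Z c b) a = Cmp V W Y Z c (Cmp V W X Y b a)" by (simp add: cmp_assoc)
next
  fix X Y Z a b b' assume o: "X \<in> Obj V" "Y \<in> Obj V" "Z \<in> Obj V" and "a \<in> Mor V X Y" "b \<in> Mor V Y Z" "b' \<in> Mor V Y Z"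
  then obtain X' s f where a: "roof X Y X' s f" "a = roof_cls X Y X' s f"
    by (meson verdier_cases)
  have o': "X \<in> Obj T" "Y \<in> Obj T" "Z \<in> Obj T" using o by auto
  \<comment> \<open>With a common denominator \<open>t\<close>, a single Ore square serves
    \<open>b\<close>, \<open>b'\<close> and their sum.\<close>
  obtain Y' t g g' where b: "roof Y Z Y' t g" "roof Y Z Y' t g'" "b = roof_cls Y Z Y' t g" "b' = roof_cls Y Z Y' t g'"
    using \<open>b \<in> Mor V Y Z\<close> \<open>b' \<in> Mor V Y Z\<close> by (metis verdier_cases roof_cls_common[OF o'(3)])
  obtain W s' f' where W: "W \<in> Obj T" "s' \<in> cov W X'" "s' \<in> Mor T W X'" "f' \<in> Mor T W Y'" "Cmp T W X' Y f s' = Cmp T W Y' Y t f'"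
    using roof_ore[OF a(1) b(1)] .
  have c: "Cmp V X Y Z (roof_cls Y Z Y' t k) a = roof_cls X Z W (Cmp T W X' X s s') (Cmp T W Y' Z k f')" if "k \<in> Mor T Y' Z" for k
    unfolding a(2) by (rule verdier_cmp) (use o' a b W that in auto)
  show "Cmp V X Y Z (b \<otimes>\<^bsub>Hom V Y Z\<^esub> b') a = Cmp V X Y Z b a \<otimes>\<^bsub>Hom V X Z\<^esub> Cmp V X Y Z b' a"
    unfolding b(3,4) using o' a(1) b(1,2) W cov_cmp[OF W(2)] by (simp add: roof_cls_mult c cmp_add_left)
next
  fix X Y Z a a' b assume o: "X \<in> Obj V" "Y \<in> Obj V" "Z \<in> Obj V" and "a \<in> Mor V X Y" "a' \<in> Mor V X Y" "b \<in> Mor V Y Z"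
  then obtain Y' t g where b: "roof Y Z Y' t g" "b = roof_cls Y Z Y' t g"
    by (meson verdier_cases)
  have o': "X \<in> Obj T" "Y \<in> Obj T" "Z \<in> Obj T" using o by auto
  obtain X' s f f' where a: "roof X Y X' s f" "roof X Y X' s f'" "a = roof_cls X Y X' s f" "a' = roof_cls X Y X' s f'"
    using \<open>a \<in> Mor V X Y\<close> \<open>a' \<in> Mor V X Y\<close> by (metis verdier_cases roof_cls_common[OF o'(2)])
  have ty: "s \<in> Mor T X' X" "t \<in> Mor T Y' Y" using cov_typed a b by blast+
  obtain W1 s1 f1 where W1: "W1 \<in> Obj T" "s1 \<in> cov W1 X'" "s1 \<in> Mor T W1 X'" "f1 \<in> Mor T W1 Y'" "Cmp T W1 X' Y f s1 = Cmp T W1 Y' Y t f1"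
    using roof_ore[OF a(1) b(1)] .
  obtain W2 s2 f2 where W2: "W2 \<in> Obj T" "s2 \<in> cov W2 X'" "s2 \<in> Mor T W2 X'" "f2 \<in> Mor T W2 Y'" "Cmp T W2 X' Y f' s2 = Cmp T W2 Y' Y t f2"
    using roof_ore[OF a(2) b(1)] .
  \<comment> \<open>The Ore squares of \<open>f\<close> and \<open>f'\<close> have different
    denominators; on the common refinement \<open>M\<close> they can be added.\<close>
  obtain M p q where M: "M \<in> Obj T" "p \<in> Mor T M W1" "q \<in> Mor T M W2" "Cmp T M W1 X' s1 p = Cmp T M W2 X' s2 q" "Cmp T M W1 X' s1 p \<in> cov M X'"
    using cov_common[OF W1(2) W2(2)] by metis
  let ?s = "Cmp T M W1 X' s1 p" and ?f = "Cmp T M W1 Y' f1 p" and ?f' = "Cmp T M W2 Y' f2 q"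
  have m: "?s \<in> Mor T M X'" "?f \<in> Mor T M Y'" "?f' \<in> Mor T M Y'" using M(1-3) W1(1,3,4) W2(1,3,4) a b by auto
  have 1: "Cmp T M X' Y f ?s = Cmp T M Y' Y t ?f"
    by (rule square_pre[OF W1(5)]) (use M(1-3) W1(1,3,4) W2(1,3,4) a b ty o' in auto)
  have 2: "Cmp T M X' Y f' ?s = Cmp T M Y' Y t ?f'"
    unfolding M(4) by (rule square_pre[OF W2(5)]) (use M(1-3) W1(1,3,4) W2(1,3,4) a b ty o' in auto)
  have c: "Cmp V X Y Z b (roof_cls X Y X' s k) = roof_cls X Z M (Cmp T M X' X s ?s) (Cmp T M Y' Z g l)"
    if "k \<in> Mor T X' Y" "l \<in> Mor T M Y'" "Cmp T M X' Y k ?s = Cmp T M Y' Y t l" for k l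
    unfolding b(2) by (rule verdier_cmp) (use o' a b M(1,5) that in auto)
  have 3: "Cmp T M X' Y (f \<otimes>\<^bsub>Hom T X' Y\<^esub> f') ?s = Cmp T M Y' Y t (?f \<otimes>\<^bsub>Hom T M Y'\<^esub> ?f')"
    using 1 2 m M(1) a b ty o' by (simp add: cmp_add_left cmp_add_right)
  have "Cmp V X Y Z b (a \<otimes>\<^bsub>Hom V X Y\<^esub> a') = roof_cls X Z M (Cmp T M X' X s ?s) (Cmp T M Y' Z g (?f \<otimes>\<^bsub>Hom T M Y'\<^esub> ?f'))"
    unfolding a(3,4) using c[OF _ _ 3] o' a(1,2) b(1) m M(1) by (simp add: roof_cls_mult)
  also have "\<dots> = roof_cls X Z M (Cmp T M X' X s ?s) (Cmp T M Y' Z g ?f) \<otimes>\<^bsub>Hom V X Z\<^esub> roof_cls X Z M (Cmp T M X' X s ?s) (Cmp T M Y' Z g ?f')"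
    using o' a(1,2) b(1) m M(1) cov_cmp[OF M(5)] by (simp add: roof_cls_mult cmp_add_right)
  also have "\<dots> = Cmp V X Y Z b a \<otimes>\<^bsub>Hom V X Z\<^esub> Cmp V X Y Z b a'"
    unfolding a(3,4) using c[of f ?f] c[of f' ?f'] 1 2 a m by simp
  finally show "Cmp V X Y Z b (a \<otimes>\<^bsub>Hom V X Y\<^esub> a') = Cmp V X Y Z b a \<otimes>\<^bsub>Hom V X Z\<^esub> Cmp V X Y Z b a'" .
qed

lemma quot_simps [simp]: "fob (quot T S) X = X" "fmor (quot T S) X Y f = roof_cls X Y X (Idt T X) f"
  by (simp_all add: quot_def roof_cls_def)

lemma quot_roof: "X \<in> Obj T \<Longrightarrow> f \<in> Mor T X Y \<Longrightarrow> roof X Y X (Idt T X) f"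
  using cov_idt by blast

lemma quot_cmp_cls:
  assumes "Y \<in> Obj T" "Z \<in> Obj T" "roof X Y X' s f" "u \<in> Mor T Y Z"
  shows "Cmp V X Y Z (roof_cls Y Z Y (Idt T Y) u) (roof_cls X Y X' s f) = roof_cls X Z X' s (Cmp T X' Y Z u f)"
proof -
  have "s \<in> Mor T X' X" "X \<in> Obj T" using cov_typed assms by blast+
  then show ?thesis
    using verdier_cmp[OF assms(1,2,3) quot_roof[OF assms(1,4)], of X' "Idt T X'" f] assms cov_idt by simp
qed

lemma cls_cmp_quot:
  assumes "X \<in> Obj T" "Y \<in> Obj T" "Z \<in> Obj T" "roof Y Z Y' t g" "m \<in> Mor T X Y"
    "W \<in> Obj T" "s' \<in> cov W X" "m' \<in> Mor T W Y'" "Cmp T W X Y m s' = Cmp T W Y' Y t m'"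
  shows "Cmp V X Y Z (roof_cls Y Z Y' t g) (roof_cls X Y X (Idt T X) m) = roof_cls X Z W s' (Cmp T W Y' Z g m')"
  using verdier_cmp[OF assms(2,3) quot_roof[OF assms(1,5)] assms(4,6,7,8,9)] cov_typed[OF assms(7)] by simp

sublocale quot: additive_functor T V "quot T S"
proof unfold_locales
  fix X Y assume o: "X \<in> Obj T" "Y \<in> Obj T"
  show "fmor (quot T S) X Y \<in> hom (Hom T X Y) (Hom V (fob (quot T S) X) (fob (quot T S) Y))"
    using o cov_idt by (auto simp: hom_def roof_cls_mult intro!: roof_cls_in)
next
  fix X Y Z u v assume o: "X \<in> Obj T" "Y \<in> Obj T" "Z \<in> Obj T" "u \<in> Mor T X Y" "v \<in> Mor T Y Z"
  show "fmor (quot T S) X Z (Cmp T X Y Z v u) = Cmp V (fob (quot T S) X) (fob (quot T S) Y) (fob (quot T S) Z)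
    (fmor (quot T S) Y Z v) (fmor (quot T S) X Y u)"
    using quot_cmp_cls[OF o(2,3) quot_roof[OF o(1,4)] o(5)] by simp
qed (simp_all add: verdier_Idt)

end

lemma (in triangulated_category) small_Mor:
  assumes ess: "R \<subseteq> Obj T" "\<forall>X\<in>R. \<forall>Y\<in>R. small TYPE('x) (Mor T X Y)" "\<forall>X\<in>Obj T. \<exists>Y\<in>R. \<exists>f. iso_mor T X Y f"
    and X: "X \<in> Obj T" "Y \<in> Obj T"
  shows "small TYPE('x) (Mor T X Y)"
proof -
  obtain X0 Y0 f f' g g' where R: "X0 \<in> R" "Y0 \<in> R" and i: "inverse_mors T X X0 f f'" "inverse_mors T Y Y0 g g'"
    using ess(3) X unfolding iso_mor_def by meson
  have o: "X0 \<in> Obj T" "Y0 \<in> Obj T" using R ess(1) by auto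
  note m = inverse_mors_in[OF i(1)] inverse_mors_in[OF i(2)]
  show ?thesis
  proof (rule small_subset[OF small_image])
    show "small TYPE('x) (Mor T X0 Y0)" using ess(2) R by blast
    show "Mor T X Y \<subseteq> (\<lambda>k. Cmp T X X0 Y (Cmp T X0 Y0 Y g' k) f) ` Mor T X0 Y0"
    proof
      fix k assume k: "k \<in> Mor T X Y"
      let ?k = "Cmp T X0 Y Y0 g (Cmp T X0 X Y k f')"
      have kf: "Cmp T X0 X Y k f' \<in> Mor T X0 Y" using k m o X by auto
      have "Cmp T X X0 Y (Cmp T X0 Y0 Y g' ?k) f = k"
        using inverse_mors_cancel[OF i(2) o(1) X(2) o(2) kf]
          inverse_mors_cancel'[OF inverse_mors_sym[OF i(1)] X(2) o(1) X(1) k] by simp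
      moreover have "?k \<in> Mor T X0 Y0" using k m o X by auto
      ultimately show "k \<in> (\<lambda>k. Cmp T X X0 Y (Cmp T X0 Y0 Y g' k) f) ` Mor T X0 Y0" by force
    qed
  qed
qed

text \<open>Every roof is equivalent to one whose apex lies in \<open>R\<close>, and such roofs are
  parametrised by a small set of pairs of legs.\<close>

lemma (in tri_sub) small_verdier:
  assumes inf: "infinite (UNIV :: 'x set)"
    and ess: "R \<subseteq> Obj T" "small TYPE('x) R" "\<forall>X\<in>R. \<forall>Y\<in>R. small TYPE('x) (Mor T X Y)" "\<forall>X\<in>Obj T. \<exists>Y\<in>R. \<exists>f. iso_mor T X Y f"
    and X: "X \<in> Obj T" "Y \<in> Obj T"
  shows "small TYPE('x) (Mor V X Y)"
proof (rule small_subset[OF small_image])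
  have "small TYPE('x) (Mor T Z A)" if "Z \<in> R" "A \<in> Obj T" for Z A using small_Mor[OF ess(1,3,4)] that ess(1) by blast
  then show "small TYPE('x) (SIGMA Z:R. Mor T Z X \<times> Mor T Z Y)"
    by (intro small_Sigma inf ess(2)) (use X in auto)
  show "Mor V X Y \<subseteq> (\<lambda>(Z, s, f). roof_cls X Y Z s f) ` (SIGMA Z:R. Mor T Z X \<times> Mor T Z Y)"
  proof
    fix a assume "a \<in> Mor V X Y"
    then obtain Z s f where a: "roof X Y Z s f" "a = roof_cls X Y Z s f" by (rule verdier_cases)
    obtain Z0 k k' where Z0: "Z0 \<in> R" "inverse_mors T Z Z0 k k'" using ess(4) a unfolding iso_mor_def by blast
    have o: "Z0 \<in> Obj T" using Z0 ess(1) by blast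
    have s: "s \<in> Mor T Z X" using cov_typed a by blast
    have "k' \<in> cov Z0 Z" using cov_iso[OF o _ inverse_mors_sym[OF Z0(2)]] a by blast
    then have "Cmp T Z0 Z X s k' \<in> cov Z0 X" using cov_cmp a by blast
    then have "a = roof_cls X Y Z0 (Cmp T Z0 Z X s k') (Cmp T Z0 Z Y f k')"
      unfolding a(2) by (intro roof_cls_refine) (use a X o inverse_mors_in[OF Z0(2)] in auto)
    then show "a \<in> (\<lambda>(Z, s, f). roof_cls X Y Z s f) ` (SIGMA Z:R. Mor T Z X \<times> Mor T Z Y)"
      using a X o s inverse_mors_in[OF Z0(2)] Z0(1)
      by (intro image_eqI[of _ _ "(Z0, Cmp T Z0 Z X s k', Cmp T Z0 Z Y f k')"]) auto
  qed
qed

section \<open>Functors on cohomological functors\<close>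

lemma Coh_simps [simp]:
  "carrier (Hom (Coh T) F G) = transf T F G"
  "Idt (Coh T) F = (\<lambda>X\<in>Obj T. \<lambda>x\<in>carrier (val F X). x)"
  "Cmp (Coh T) F G H \<beta> \<alpha> = transf_comp T F \<beta> \<alpha>"
  "\<one>\<^bsub>Hom (Coh T) F G\<^esub> = (\<lambda>X\<in>Obj T. \<lambda>x\<in>carrier (val F X). \<one>\<^bsub>val G X\<^esub>)"
  by (simp_all add: Coh_def)

lemma Coh_mult:
  "\<lbrakk>X \<in> Obj T; x \<in> carrier (val F X)\<rbrakk> \<Longrightarrow> (\<alpha> \<otimes>\<^bsub>Hom (Coh T) F G\<^esub> \<beta>) X x = \<alpha> X x \<otimes>\<^bsub>val G X\<^esub> \<beta> X x"
  by (simp add: Coh_def)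

lemma transf_comp_apply [simp]:
  "\<lbrakk>X \<in> Obj C; x \<in> carrier (val F X)\<rbrakk> \<Longrightarrow> transf_comp C F \<beta> \<alpha> X x = \<beta> X (\<alpha> X x)"
  by (simp add: transf_comp_def)

lemma transf_in: "\<lbrakk>\<alpha> \<in> transf C F G; X \<in> Obj C; x \<in> carrier (val F X)\<rbrakk> \<Longrightarrow> \<alpha> X x \<in> carrier (val G X)"
  by (rule hom_in_carrier[OF transfD(1)])

lemma transf_mult: "\<lbrakk>\<alpha> \<in> transf C F G; X \<in> Obj C; x \<in> carrier (val F X); y \<in> carrier (val F X)\<rbrakk> \<Longrightarrow>
    \<alpha> X (x \<otimes>\<^bsub>val F X\<^esub> y) = \<alpha> X x \<otimes>\<^bsub>val G X\<^esub> \<alpha> X y"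
  by (rule hom_mult[OF transfD(1)])

lemma transf_comp_in:
  assumes "psh C F" "\<alpha> \<in> transf C F G" "\<beta> \<in> transf C G H" shows "transf_comp C F \<beta> \<alpha> \<in> transf C F H"
proof -
  interpret psh C F by fact
  show ?thesis
    by (rule transfI) (use assms in \<open>auto simp: transf_in transf_mult transfD(4) transf_comp_def\<close>)
qed

lemma transf_idt: "psh C F \<Longrightarrow> (\<lambda>X\<in>Obj C. \<lambda>x\<in>carrier (val F X). x) \<in> transf C F F"
proof -
  assume "psh C F"
  then interpret psh C F .
  show ?thesis by (rule transfI) auto
qed

context triangulated_category
begin

lemma Coh_mult_in:
  assumes "psh T F" "psh T G" "\<alpha> \<in> transf T F G" "\<beta> \<in> transf T F G"
  shows "\<alpha> \<otimes>\<^bsub>Hom (Coh T) F G\<^esub> \<beta> \<in> transf T F G"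
proof -
  interpret F: psh T F by fact
  interpret G: psh T G by fact
  have e: "(\<alpha> \<otimes>\<^bsub>Hom (Coh T) F G\<^esub> \<beta>) = (\<lambda>X\<in>Obj T. \<lambda>x\<in>carrier (val F X). \<alpha> X x \<otimes>\<^bsub>val G X\<^esub> \<beta> X x)"
    by (simp add: Coh_def)
  show ?thesis unfolding e
  proof (rule transfI)
    fix X x y assume X: "X \<in> Obj T" "x \<in> carrier (val F X)" "y \<in> carrier (val F X)"
    interpret GX: comm_group "val G X" using X G.val_comm_group by simp
    show "(\<lambda>X\<in>Obj T. \<lambda>x\<in>carrier (val F X). \<alpha> X x \<otimes>\<^bsub>val G X\<^esub> \<beta> X x) X (x \<otimes>\<^bsub>val F X\<^esub> y)
      = (\<lambda>X\<in>Obj T. \<lambda>x\<in>carrier (val F X). \<alpha> X x \<otimes>\<^bsub>val G X\<^esub> \<beta> X x) X x \<otimes>\<^bsub>val G X\<^esub>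
        (\<lambda>X\<in>Obj T. \<lambda>x\<in>carrier (val F X). \<alpha> X x \<otimes>\<^bsub>val G X\<^esub> \<beta> X x) X y"
      using X assms by (simp add: transf_mult transf_in GX.mult_mult_swap)
  qed (use assms in \<open>auto simp: transf_in transfD(4) G.act_mult\<close>)
qed

lemma Coh_preadditive: "preadditive_category (Coh T :: (('o, 'm, 'x) presheaf, 'o \<Rightarrow> 'x \<Rightarrow> 'x) acat)"
proof (rule preadditive_category.intro)
  fix F G :: "('o, 'm, 'x) presheaf" assume FG: "F \<in> Obj (Coh T)" "G \<in> Obj (Coh T)"
  then interpret F: coh T F by unfold_locales (simp add: coh_Obj_iff)
  from FG interpret G: coh T G by unfold_locales (simp add: coh_Obj_iff)
  note p = F.psh_axioms G.psh_axioms
  have one: "\<one>\<^bsub>Hom (Coh T) F G\<^esub> \<in> transf T F G"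
    by (rule transfI) (auto simp: monoid.l_one group.is_monoid)
  show "comm_group (Hom (Coh T) F G)"
  proof (rule comm_groupI)
    fix \<alpha> \<beta> assume "\<alpha> \<in> Mor (Coh T) F G" "\<beta> \<in> Mor (Coh T) F G"
    then have ab: "\<alpha> \<in> transf T F G" "\<beta> \<in> transf T F G" by auto
    show "\<alpha> \<otimes>\<^bsub>Hom (Coh T) F G\<^esub> \<beta> \<in> Mor (Coh T) F G" using ab p by (simp add: Coh_mult_in)
    show "\<alpha> \<otimes>\<^bsub>Hom (Coh T) F G\<^esub> \<beta> = \<beta> \<otimes>\<^bsub>Hom (Coh T) F G\<^esub> \<alpha>"
    proof (rule transf_eqI[of _ T F G])
      fix X x assume X: "X \<in> Obj T" "x \<in> carrier (val F X)"
      interpret GX: comm_group "val G X" using X G.val_comm_group by simp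
      show "(\<alpha> \<otimes>\<^bsub>Hom (Coh T) F G\<^esub> \<beta>) X x = (\<beta> \<otimes>\<^bsub>Hom (Coh T) F G\<^esub> \<alpha>) X x"
        using X ab by (simp add: Coh_mult transf_in GX.m_comm)
    qed (use ab p in \<open>simp_all add: Coh_mult_in\<close>)
  next
    fix \<alpha> \<beta> \<gamma> assume "\<alpha> \<in> Mor (Coh T) F G" "\<beta> \<in> Mor (Coh T) F G" "\<gamma> \<in> Mor (Coh T) F G"
    then have ab: "\<alpha> \<in> transf T F G" "\<beta> \<in> transf T F G" "\<gamma> \<in> transf T F G" by auto
    show "\<alpha> \<otimes>\<^bsub>Hom (Coh T) F G\<^esub> \<beta> \<otimes>\<^bsub>Hom (Coh T) F G\<^esub> \<gamma> = \<alpha> \<otimes>\<^bsub>Hom (Coh T) F G\<^esub> (\<beta> \<otimes>\<^bsub>Hom (Coh T) F G\<^esub> \<gamma>)"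
    proof (rule transf_eqI[of _ T F G])
      fix X x assume X: "X \<in> Obj T" "x \<in> carrier (val F X)"
      interpret GX: comm_group "val G X" using X G.val_comm_group by simp
      show "(\<alpha> \<otimes>\<^bsub>Hom (Coh T) F G\<^esub> \<beta> \<otimes>\<^bsub>Hom (Coh T) F G\<^esub> \<gamma>) X x = (\<alpha> \<otimes>\<^bsub>Hom (Coh T) F G\<^esub> (\<beta> \<otimes>\<^bsub>Hom (Coh T) F G\<^esub> \<gamma>)) X x"
        using X ab by (simp add: Coh_mult transf_in GX.m_assoc)
    qed (use ab p in \<open>simp_all add: Coh_mult_in\<close>)
  next
    show "\<one>\<^bsub>Hom (Coh T) F G\<^esub> \<in> Mor (Coh T) F G" using one by (simp only: Coh_simps)
  next
    fix \<alpha> assume "\<alpha> \<in> Mor (Coh T) F G"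
    then have ab: "\<alpha> \<in> transf T F G" by auto
    show "\<one>\<^bsub>Hom (Coh T) F G\<^esub> \<otimes>\<^bsub>Hom (Coh T) F G\<^esub> \<alpha> = \<alpha>"
    proof (rule transf_eqI[OF Coh_mult_in[OF p one ab] ab])
      fix X x assume X: "X \<in> Obj T" "x \<in> carrier (val F X)"
      interpret GX: comm_group "val G X" using X G.val_comm_group by simp
      show "(\<one>\<^bsub>Hom (Coh T) F G\<^esub> \<otimes>\<^bsub>Hom (Coh T) F G\<^esub> \<alpha>) X x = \<alpha> X x"
        using X ab by (simp add: Coh_mult transf_in)
    qed
    interpret \<alpha>: pstr T F G \<alpha> by unfold_locales (rule ab)
    let ?i = "\<lambda>X\<in>Obj T. \<lambda>x\<in>carrier (val F X). inv\<^bsub>val G X\<^esub> \<alpha> X x"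
    have i: "?i \<in> transf T F G"
    proof (rule transfI)
      fix X x y assume X: "X \<in> Obj T" "x \<in> carrier (val F X)" "y \<in> carrier (val F X)"
      interpret GX: comm_group "val G X" using X G.val_comm_group by simp
      show "?i X (x \<otimes>\<^bsub>val F X\<^esub> y) = ?i X x \<otimes>\<^bsub>val G X\<^esub> ?i X y"
        using X by (simp add: \<alpha>.tr_mult GX.inv_mult)
    qed (use G.act_inv \<alpha>.tr_act in \<open>auto\<close>)
    have "?i \<otimes>\<^bsub>Hom (Coh T) F G\<^esub> \<alpha> = \<one>\<^bsub>Hom (Coh T) F G\<^esub>"
    proof (rule transf_eqI[OF Coh_mult_in[OF p i ab] one])
      fix X x assume X: "X \<in> Obj T" "x \<in> carrier (val F X)"
      interpret GX: comm_group "val G X" using X G.val_comm_group by simp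
      show "(?i \<otimes>\<^bsub>Hom (Coh T) F G\<^esub> \<alpha>) X x = \<one>\<^bsub>Hom (Coh T) F G\<^esub> X x"
        using X ab by (simp add: Coh_mult transf_in)
    qed
    with i show "\<exists>\<beta>\<in>Mor (Coh T) F G. \<beta> \<otimes>\<^bsub>Hom (Coh T) F G\<^esub> \<alpha> = \<one>\<^bsub>Hom (Coh T) F G\<^esub>"
      by (intro bexI[of _ ?i]) simp_all
  qed
next
  fix F assume "F \<in> Obj (Coh T)"
  then interpret F: coh T F by unfold_locales (simp add: coh_Obj_iff)
  show "Idt (Coh T) F \<in> Mor (Coh T) F F" using transf_idt[OF F.psh_axioms] by simp
next
  fix F G H :: "('o, 'm, 'x) presheaf" and \<alpha> \<beta>
  assume FG: "F \<in> Obj (Coh T)" "G \<in> Obj (Coh T)" "H \<in> Obj (Coh T)" and ab: "\<alpha> \<in> Mor (Coh T) F G" "\<beta> \<in> Mor (Coh T) G H"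
  then interpret F: coh T F by unfold_locales (simp add: coh_Obj_iff)
  show "Cmp (Coh T) F G H \<beta> \<alpha> \<in> Mor (Coh T) F H" using transf_comp_in[OF F.psh_axioms] ab by simp
next
  fix F G :: "('o, 'm, 'x) presheaf" and \<alpha>
  assume FG: "F \<in> Obj (Coh T)" "G \<in> Obj (Coh T)" and ab: "\<alpha> \<in> Mor (Coh T) F G"
  then interpret F: coh T F by unfold_locales (simp add: coh_Obj_iff)
  from FG interpret G: coh T G by unfold_locales (simp add: coh_Obj_iff)
  have a: "\<alpha> \<in> transf T F G" using ab by simp
  show "Cmp (Coh T) F G G (Idt (Coh T) G) \<alpha> = \<alpha>"
    by (rule transf_eqI[of _ T F G]) (use a transf_comp_in[OF F.psh_axioms a transf_idt[OF G.psh_axioms]] in \<open>auto simp: transf_in\<close>)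
  show "Cmp (Coh T) F F G \<alpha> (Idt (Coh T) F) = \<alpha>"
    by (rule transf_eqI[of _ T F G]) (use a transf_comp_in[OF F.psh_axioms transf_idt[OF F.psh_axioms] a] in \<open>auto simp: transf_in\<close>)
next
  fix F G H K :: "('o, 'm, 'x) presheaf" and \<alpha> \<beta> \<gamma>
  assume "F \<in> Obj (Coh T)" "\<alpha> \<in> Mor (Coh T) F G" "\<beta> \<in> Mor (Coh T) G H" "\<gamma> \<in> Mor (Coh T) H K"
  then show "Cmp (Coh T) F G K (Cmp (Coh T) G H K \<gamma> \<beta>) \<alpha> = Cmp (Coh T) F H K \<gamma> (Cmp (Coh T) F G H \<beta> \<alpha>)"
    by (auto simp: transf_comp_def transf_in intro!: restrict_ext)
next
  fix F G H :: "('o, 'm, 'x) presheaf" and \<alpha> \<beta> \<gamma>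
  assume FG: "F \<in> Obj (Coh T)" "G \<in> Obj (Coh T)" "H \<in> Obj (Coh T)" and a: "\<alpha> \<in> Mor (Coh T) F G" "\<beta> \<in> Mor (Coh T) G H" "\<gamma> \<in> Mor (Coh T) G H"
  then show "Cmp (Coh T) F G H (\<beta> \<otimes>\<^bsub>Hom (Coh T) G H\<^esub> \<gamma>) \<alpha> = Cmp (Coh T) F G H \<beta> \<alpha> \<otimes>\<^bsub>Hom (Coh T) F H\<^esub> Cmp (Coh T) F G H \<gamma> \<alpha>"
    by (auto simp: Coh_def transf_comp_def transf_in intro!: restrict_ext)
next
  fix F G H :: "('o, 'm, 'x) presheaf" and \<alpha> \<beta> \<gamma>
  assume FG: "F \<in> Obj (Coh T)" "G \<in> Obj (Coh T)" "H \<in> Obj (Coh T)" and a: "\<alpha> \<in> Mor (Coh T) F G" "\<beta> \<in> Mor (Coh T) F G" "\<gamma> \<in> Mor (Coh T) G H"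
  then show "Cmp (Coh T) F G H \<gamma> (\<alpha> \<otimes>\<^bsub>Hom (Coh T) F G\<^esub> \<beta>) = Cmp (Coh T) F G H \<gamma> \<alpha> \<otimes>\<^bsub>Hom (Coh T) F H\<^esub> Cmp (Coh T) F G H \<gamma> \<beta>"
    by (auto simp: Coh_def transf_comp_def transf_in transf_mult intro!: restrict_ext)
qed

text \<open>Functoriality on \<open>Coh T\<close> is reduced to equations between elements;
  extensionality turns these into equalities of natural transformations.\<close>

lemma coh_functorI:
  fixes E :: "('o, 'm, 'x) coh_endo"
  assumes ob: "\<And>F. coh T F \<Longrightarrow> coh T (fob E F)"
    and mor: "\<And>F G \<alpha>. \<lbrakk>coh T F; coh T G; \<alpha> \<in> transf T F G\<rbrakk> \<Longrightarrow> fmor E F G \<alpha> \<in> transf T (fob E F) (fob E G)"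
    and idt: "\<And>F Y e. \<lbrakk>coh T F; Y \<in> Obj T; e \<in> carrier (val (fob E F) Y)\<rbrakk> \<Longrightarrow> fmor E F F (Idt (Coh T) F) Y e = e"
    and cmp: "\<And>F G H \<alpha> \<beta> Y e. \<lbrakk>coh T F; coh T G; coh T H; \<alpha> \<in> transf T F G; \<beta> \<in> transf T G H; Y \<in> Obj T; e \<in> carrier (val (fob E F) Y)\<rbrakk>
      \<Longrightarrow> fmor E F H (transf_comp T F \<beta> \<alpha>) Y e = fmor E G H \<beta> Y (fmor E F G \<alpha> Y e)"
    and add: "\<And>F G \<alpha> \<beta> Y e. \<lbrakk>coh T F; coh T G; \<alpha> \<in> transf T F G; \<beta> \<in> transf T F G; Y \<in> Obj T; e \<in> carrier (val (fob E F) Y)\<rbrakk>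
      \<Longrightarrow> fmor E F G (\<alpha> \<otimes>\<^bsub>Hom (Coh T) F G\<^esub> \<beta>) Y e = fmor E F G \<alpha> Y e \<otimes>\<^bsub>val (fob E G) Y\<^esub> fmor E F G \<beta> Y e"
  shows "additive_functor (Coh T) (Coh T) E"
proof -
  have c: "coh T F \<longleftrightarrow> F \<in> Obj (Coh T)" for F :: "('o, 'm, 'x) presheaf"
    by (metis coh.coh coh_Obj_iff coh.intro coh_axioms.intro triangulated_category_axioms)
  have p: "psh T F" if "coh T F" for F :: "('o, 'm, 'x) presheaf"
    using that coh.coh[OF that] by (auto simp: psh_def psh_axioms_def cohomological_def preadditive_category_axioms)
  show ?thesis
  proof (intro additive_functor.intro additive_functor_axioms.intro Coh_preadditive)
    fix F :: "('o, 'm, 'x) presheaf" assume "F \<in> Obj (Coh T)"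
    then have F: "coh T F" by (simp add: c)
    then show "fob E F \<in> Obj (Coh T)" using ob c by blast
    have i: "Idt (Coh T) F \<in> transf T F F" using transf_idt[OF p[OF F]] by simp
    show "fmor E F F (Idt (Coh T) F) = Idt (Coh T) (fob E F)"
    proof (rule transf_eqI[OF mor[OF F F i]])
      show "Idt (Coh T) (fob E F) \<in> transf T (fob E F) (fob E F)" using transf_idt[OF p[OF ob[OF F]]] by simp
      fix Y e assume "Y \<in> Obj T" "e \<in> carrier (val (fob E F) Y)"
      then show "fmor E F F (Idt (Coh T) F) Y e = Idt (Coh T) (fob E F) Y e" using idt[OF F] by simp
    qed
  next
    fix F G :: "('o, 'm, 'x) presheaf" assume "F \<in> Obj (Coh T)" "G \<in> Obj (Coh T)"
    then have F: "coh T F" "coh T G" by (simp_all add: c)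
    show "fmor E F G \<in> hom (Hom (Coh T) F G) (Hom (Coh T) (fob E F) (fob E G))"
    proof (rule homI)
      fix \<alpha> assume "\<alpha> \<in> Mor (Coh T) F G" then show "fmor E F G \<alpha> \<in> Mor (Coh T) (fob E F) (fob E G)" using mor[OF F] by simp
    next
      fix \<alpha> \<beta> assume "\<alpha> \<in> Mor (Coh T) F G" "\<beta> \<in> Mor (Coh T) F G"
      then have a: "\<alpha> \<in> transf T F G" "\<beta> \<in> transf T F G" by auto
      show "fmor E F G (\<alpha> \<otimes>\<^bsub>Hom (Coh T) F G\<^esub> \<beta>) = fmor E F G \<alpha> \<otimes>\<^bsub>Hom (Coh T) (fob E F) (fob E G)\<^esub> fmor E F G \<beta>"
        by (rule transf_eqI[OF mor[OF F Coh_mult_in[OF p[OF F(1)] p[OF F(2)] a]]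
             Coh_mult_in[OF p[OF ob[OF F(1)]] p[OF ob[OF F(2)]] mor[OF F a(1)] mor[OF F a(2)]]])
          (simp add: Coh_mult add[OF F a])
    qed
  next
    fix F G H :: "('o, 'm, 'x) presheaf" and \<alpha> \<beta>
    assume "F \<in> Obj (Coh T)" "G \<in> Obj (Coh T)" "H \<in> Obj (Coh T)" "\<alpha> \<in> Mor (Coh T) F G" "\<beta> \<in> Mor (Coh T) G H"
    then have F: "coh T F" "coh T G" "coh T H" and a: "\<alpha> \<in> transf T F G" "\<beta> \<in> transf T G H" by (simp_all add: c)
    show "fmor E F H (Cmp (Coh T) F G H \<beta> \<alpha>) = Cmp (Coh T) (fob E F) (fob E G) (fob E H) (fmor E G H \<beta>) (fmor E F G \<alpha>)"
      unfolding Coh_simps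
      by (rule transf_eqI[OF mor[OF F(1,3) transf_comp_in[OF p[OF F(1)] a]]
           transf_comp_in[OF p[OF ob[OF F(1)]] mor[OF F(1,2) a(1)] mor[OF F(2,3) a(2)]]])
        (simp add: cmp[OF F a])
  qed
qed

lemma coh_iff: "F \<in> Obj (Coh T) \<longleftrightarrow> coh T F"
  by (metis coh.coh coh_Obj_iff coh.intro coh_axioms.intro triangulated_category_axioms)

lemma coh_functorD:
  fixes E :: "('o, 'm, 'x) coh_endo"
  assumes E: "additive_functor (Coh T) (Coh T) E"
  shows "coh T F \<Longrightarrow> coh T (fob E F)"
    and "\<lbrakk>coh T F; coh T G; \<alpha> \<in> transf T F G\<rbrakk> \<Longrightarrow> fmor E F G \<alpha> \<in> transf T (fob E F) (fob E G)"
    and "\<lbrakk>coh T F; Y \<in> Obj T; e \<in> carrier (val (fob E F) Y)\<rbrakk> \<Longrightarrow> fmor E F F (Idt (Coh T) F) Y e = e"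
    and "\<lbrakk>coh T F; coh T G; coh T H; \<alpha> \<in> transf T F G; \<beta> \<in> transf T G H; Y \<in> Obj T; e \<in> carrier (val (fob E F) Y)\<rbrakk>
      \<Longrightarrow> fmor E F H (transf_comp T F \<beta> \<alpha>) Y e = fmor E G H \<beta> Y (fmor E F G \<alpha> Y e)"
    and "\<lbrakk>coh T F; coh T G; \<alpha> \<in> transf T F G; \<beta> \<in> transf T F G; Y \<in> Obj T; e \<in> carrier (val (fob E F) Y)\<rbrakk>
      \<Longrightarrow> fmor E F G (\<alpha> \<otimes>\<^bsub>Hom (Coh T) F G\<^esub> \<beta>) Y e = fmor E F G \<alpha> Y e \<otimes>\<^bsub>val (fob E G) Y\<^esub> fmor E F G \<beta> Y e"
proof -
  interpret E: additive_functor "Coh T" "Coh T" E by fact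
  show "coh T F \<Longrightarrow> coh T (fob E F)" using E.fob_in[of F] by (simp only: coh_iff)
  show "\<lbrakk>coh T F; coh T G; \<alpha> \<in> transf T F G\<rbrakk> \<Longrightarrow> fmor E F G \<alpha> \<in> transf T (fob E F) (fob E G)"
    using E.fmor_in[of F G \<alpha>] by (simp only: coh_iff Coh_simps)
  show "\<lbrakk>coh T F; Y \<in> Obj T; e \<in> carrier (val (fob E F) Y)\<rbrakk> \<Longrightarrow> fmor E F F (Idt (Coh T) F) Y e = e"
    using E.fmor_idt[of F] by (simp add: coh_iff)
  show "\<lbrakk>coh T F; coh T G; coh T H; \<alpha> \<in> transf T F G; \<beta> \<in> transf T G H; Y \<in> Obj T; e \<in> carrier (val (fob E F) Y)\<rbrakk>
      \<Longrightarrow> fmor E F H (transf_comp T F \<beta> \<alpha>) Y e = fmor E G H \<beta> Y (fmor E F G \<alpha> Y e)"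
    using E.fmor_cmp[of F G H \<alpha> \<beta>] by (simp add: coh_iff)
  show "\<lbrakk>coh T F; coh T G; \<alpha> \<in> transf T F G; \<beta> \<in> transf T F G; Y \<in> Obj T; e \<in> carrier (val (fob E F) Y)\<rbrakk>
      \<Longrightarrow> fmor E F G (\<alpha> \<otimes>\<^bsub>Hom (Coh T) F G\<^esub> \<beta>) Y e = fmor E F G \<alpha> Y e \<otimes>\<^bsub>val (fob E G) Y\<^esub> fmor E F G \<beta> Y e"
    using E.fmor_mult[of F G \<alpha> \<beta>] by (simp add: coh_iff Coh_mult)
qed

lemma coh_nat_transfI:
  fixes A B :: "('o, 'm, 'x) coh_endo"
  assumes "additive_functor (Coh T) (Coh T) A" "additive_functor (Coh T) (Coh T) B"
    and "\<And>F. coh T F \<Longrightarrow> \<tau> F \<in> transf T (fob A F) (fob B F)"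
    and "\<And>F G \<alpha> Y e. \<lbrakk>coh T F; coh T G; \<alpha> \<in> transf T F G; Y \<in> Obj T; e \<in> carrier (val (fob A F) Y)\<rbrakk> \<Longrightarrow>
      \<tau> G Y (fmor A F G \<alpha> Y e) = fmor B F G \<alpha> Y (\<tau> F Y e)"
  shows "nat_transf (Coh T) (Coh T) A B \<tau>"
proof -
  have "transf_comp T (fob A F) (\<tau> G) (fmor A F G \<alpha>) = transf_comp T (fob A F) (fmor B F G \<alpha>) (\<tau> F)"
    if "coh T F" "coh T G" "\<alpha> \<in> transf T F G" for F G \<alpha>
    using assms(4)[OF that] by (auto simp: transf_comp_def intro!: restrict_ext)
  then show ?thesis using assms(1-3) by (simp add: nat_transf_def coh_iff)
qed

lemma coh_nat_transfD:
  fixes A B :: "('o, 'm, 'x) coh_endo"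
  assumes "nat_transf (Coh T) (Coh T) A B \<tau>"
  shows "additive_functor (Coh T) (Coh T) A" "additive_functor (Coh T) (Coh T) B"
    and "coh T F \<Longrightarrow> \<tau> F \<in> transf T (fob A F) (fob B F)"
    and "\<lbrakk>coh T F; coh T G; \<alpha> \<in> transf T F G; Y \<in> Obj T; e \<in> carrier (val (fob A F) Y)\<rbrakk> \<Longrightarrow>
      \<tau> G Y (fmor A F G \<alpha> Y e) = fmor B F G \<alpha> Y (\<tau> F Y e)"
proof -
  show "additive_functor (Coh T) (Coh T) A" "additive_functor (Coh T) (Coh T) B"
    "coh T F \<Longrightarrow> \<tau> F \<in> transf T (fob A F) (fob B F)"
    using assms by (simp_all add: nat_transf_def coh_iff)
  assume *: "coh T F" "coh T G" "\<alpha> \<in> transf T F G" "Y \<in> Obj T" "e \<in> carrier (val (fob A F) Y)"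
  then have "transf_comp T (fob A F) (\<tau> G) (fmor A F G \<alpha>) = transf_comp T (fob A F) (fmor B F G \<alpha>) (\<tau> F)"
    using assms by (simp add: nat_transf_def coh_iff)
  from fun_cong[OF fun_cong[OF this], of Y e] show "\<tau> G Y (fmor A F G \<alpha> Y e) = fmor B F G \<alpha> Y (\<tau> F Y e)"
    using * by simp
qed

section \<open>Shifted triangles and precomposition functors\<close>

lemma sus_triangle:
  assumes t: "(X, Y, Z, f, g, h) \<in> Tri T"
  shows "(Sg X, Sg Y, Sg Z, inv\<^bsub>Hom T (Sg X) (Sg Y)\<^esub> (sg X Y f), inv\<^bsub>Hom T (Sg Y) (Sg Z)\<^esub> (sg Y Z g),
    inv\<^bsub>Hom T (Sg Z) (Sg (Sg X))\<^esub> (sg Z (Sg X) h)) \<in> Tri T"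
  by (rule tri_rot[OF tri_rot[OF tri_rot[OF t]]])

text \<open>A second left rotation produces some morphism \<open>Dg Y \<rightarrow> Dg Z\<close>.
  Naturality of the counit identifies its suspension, and hence the morphism itself, with the
  negative of \<open>Des g\<close>.\<close>

lemma left_rot_des:
  assumes t: "(Dg Z, X, Y, a, f, Cmp T Y Z (Sg (Dg Z)) (counit_inv Z) g) \<in> Tri T"
    and o: "Y \<in> Obj T" "Z \<in> Obj T" "g \<in> Mor T Y Z"
  shows "(Dg Y, Dg Z, X, inv\<^bsub>Hom T (Dg Y) (Dg Z)\<^esub> (dg Y Z g), a, Cmp T X Y (Sg (Dg Y)) (counit_inv Y) f) \<in> Tri T"
proof -
  obtain b where b: "b \<in> Mor T (Dg Y) (Dg Z)" "(Dg Y, Dg Z, X, b, a, Cmp T X Y (Sg (Dg Y)) (counit_inv Y) f) \<in> Tri T"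
    "sg (Dg Y) (Dg Z) b = inv\<^bsub>Hom T (Sg (Dg Y)) (Sg (Dg Z))\<^esub> (Cmp T (Sg (Dg Y)) Y (Sg (Dg Z)) (Cmp T Y Z (Sg (Dg Z)) (counit_inv Z) g) (Counit T Y))"
    using left_rot[OF t] by blast
  have "Cmp T (Sg (Dg Y)) Y (Sg (Dg Z)) (Cmp T Y Z (Sg (Dg Z)) (counit_inv Z) g) (Counit T Y)
      = Cmp T (Sg (Dg Y)) Z (Sg (Dg Z)) (counit_inv Z) (Cmp T (Sg (Dg Y)) (Sg (Dg Z)) Z (Counit T Z) (sg (Dg Y) (Dg Z) (dg Y Z g)))"
    using o counit_natural[OF o] by (simp add: cmp_assoc)
  also have "\<dots> = sg (Dg Y) (Dg Z) (dg Y Z g)"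
    by (rule inverse_mors_cancel[OF counit_inverse]) (use o in auto)
  finally have "sg (Dg Y) (Dg Z) b = sg (Dg Y) (Dg Z) (inv\<^bsub>Hom T (Dg Y) (Dg Z)\<^esub> (dg Y Z g))"
    using b o by (simp add: S.fmor_inv)
  then have "b = inv\<^bsub>Hom T (Dg Y) (Dg Z)\<^esub> (dg Y Z g)" by (rule sus_faithful[rotated -1]) (use b o in auto)
  with b show ?thesis by simp
qed

text \<open>Rotate left three times. The third morphism stays unnamed, because exactness at the
  middle object involves the first two only.\<close>

lemma des_triangle:
  assumes t: "(X, Y, Z, f, g, h) \<in> Tri T"
  obtains k where "(Dg X, Dg Y, Dg Z, inv\<^bsub>Hom T (Dg X) (Dg Y)\<^esub> (dg X Y f), inv\<^bsub>Hom T (Dg Y) (Dg Z)\<^esub> (dg Y Z g), k) \<in> Tri T"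
proof -
  note ty = Tri_typed[OF t]
  obtain a where a: "(Dg Z, X, Y, a, f, Cmp T Y Z (Sg (Dg Z)) (counit_inv Z) g) \<in> Tri T"
    using left_rot[OF t] by blast
  have "(Dg Y, Dg Z, X, inv\<^bsub>Hom T (Dg Y) (Dg Z)\<^esub> (dg Y Z g), a, Cmp T X Y (Sg (Dg Y)) (counit_inv Y) f) \<in> Tri T"
    by (rule left_rot_des[OF a]) (use ty in auto)
  from left_rot_des[OF this] ty that show ?thesis by blast
qed

lemma psh_push:
  assumes "additive_functor A B f" "psh B G" shows "psh A (fob (push A f) G)"
proof -
  interpret f: additive_functor A B f by fact
  interpret G: psh B G by fact
  show ?thesis
    by unfold_locales
      (auto simp: additive_presheaf_def push_def G.val_comm_group G.act_hom G.act_cmp f.fmor_cmp f.fmor_mult G.act_add)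
qed

lemma push_simps [simp]:
  "val (fob (push A f) G) X = val G (fob f X)" "act (fob (push A f) G) X Y u = act G (fob f X) (fob f Y) (fmor f X Y u)"
  by (simp_all add: push_def)

lemma push_mor_apply: "X \<in> Obj A \<Longrightarrow> fmor (push A f) F G \<alpha> X = \<alpha> (fob f X)"
  by (simp add: push_def)

lemma push_mor:
  assumes "additive_functor A B f" "\<alpha> \<in> transf B F G"
  shows "fmor (push A f) F G \<alpha> \<in> transf A (fob (push A f) F) (fob (push A f) G)"
proof -
  interpret f: additive_functor A B f by fact
  show ?thesis
    by (rule transfI) (use transfD(2)[OF assms(2)] in \<open>auto simp: push_def transf_in[OF assms(2)] transf_mult[OF assms(2)] transfD(4)[OF assms(2)]\<close>)
qed

text \<open>Signs on the morphisms of the image triangle change neither kernels nor images, so they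
  are allowed; they are absorbed by inverting the lifted element.\<close>

lemma push_functor:
  assumes f: "additive_functor T T f"
    and tri: "\<And>X Y Z u v w. (X, Y, Z, u, v, w) \<in> Tri T \<Longrightarrow> \<exists>k. (fob f X, fob f Y, fob f Z,
      inv\<^bsub>Hom T (fob f X) (fob f Y)\<^esub> (fmor f X Y u), inv\<^bsub>Hom T (fob f Y) (fob f Z)\<^esub> (fmor f Y Z v), k) \<in> Tri T"
  shows "additive_functor (Coh T) (Coh T) (push T f :: ('o, 'm, 'x) coh_endo)"
proof (rule coh_functorI)
  interpret f: additive_functor T T f by fact
  fix F :: "('o, 'm, 'x) presheaf" assume "coh T F"
  then interpret F: coh T F .
  show "coh T (fob (push T f) F)"
  proof (rule cohI[OF psh_push[OF f F.psh_axioms]])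
    fix X Y Z u v w y assume t: "(X, Y, Z, u, v, w) \<in> Tri T" and y: "y \<in> carrier (val (fob (push T f) F) Y)"
      "act (fob (push T f) F) X Y u y = \<one>\<^bsub>val (fob (push T f) F) X\<^esub>"
    note ty = Tri_typed[OF t]
    obtain k where k: "(fob f X, fob f Y, fob f Z,
      inv\<^bsub>Hom T (fob f X) (fob f Y)\<^esub> (fmor f X Y u), inv\<^bsub>Hom T (fob f Y) (fob f Z)\<^esub> (fmor f Y Z v), k) \<in> Tri T"
      using tri[OF t] by blast
    have "act F (fob f X) (fob f Y) (inv\<^bsub>Hom T (fob f X) (fob f Y)\<^esub> (fmor f X Y u)) y = \<one>\<^bsub>val F (fob f X)\<^esub>"
      using y ty by (simp add: F.act_neg monoid.inv_one group.is_monoid)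
    then obtain z where z: "z \<in> carrier (val F (fob f Z))" "act F (fob f Y) (fob f Z) (inv\<^bsub>Hom T (fob f Y) (fob f Z)\<^esub> (fmor f Y Z v)) z = y"
      using F.exact[OF k, of y] y by auto
    then show "\<exists>z\<in>carrier (val (fob (push T f) F) Z). act (fob (push T f) F) Y Z v z = y"
      using ty by (intro bexI[of _ "inv\<^bsub>val F (fob f Z)\<^esub> z"]) (simp_all add: F.act_neg F.act_inv)
  qed
next
  interpret f: additive_functor T T f by fact
  fix F G :: "('o, 'm, 'x) presheaf" and \<alpha> assume "coh T F" "coh T G" "\<alpha> \<in> transf T F G"
  then show "fmor (push T f) F G \<alpha> \<in> transf T (fob (push T f) F) (fob (push T f) G)" by (intro push_mor[OF f])
qed (simp_all add: push_def additive_functor.fob_in[OF f] Coh_mult)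

lemma push_Des: "additive_functor (Coh T) (Coh T) (push T (Des T) :: ('o, 'm, 'x) coh_endo)"
  by (rule push_functor[OF Des_functor]) (use des_triangle in blast)

lemma fcomp_functor:
  fixes A B :: "('o, 'm, 'x) coh_endo"
  assumes A: "additive_functor (Coh T) (Coh T) A" and B: "additive_functor (Coh T) (Coh T) B"
  shows "additive_functor (Coh T) (Coh T) (fcomp B A)"
proof (rule coh_functorI)
  fix F G :: "('o, 'm, 'x) presheaf" and \<alpha> \<beta> Y e
  assume F: "coh T F" "coh T G" and a: "\<alpha> \<in> transf T F G" "\<beta> \<in> transf T F G"
    and Y: "Y \<in> Obj T" "e \<in> carrier (val (fob (fcomp B A) F) Y)"
  interpret A: additive_functor "Coh T" "Coh T" A by fact
  have "fmor A F G (\<alpha> \<otimes>\<^bsub>Hom (Coh T) F G\<^esub> \<beta>) = fmor A F G \<alpha> \<otimes>\<^bsub>Hom (Coh T) (fob A F) (fob A G)\<^esub> fmor A F G \<beta>"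
    using A.fmor_mult F a by (simp add: coh_iff)
  then show "fmor (fcomp B A) F G (\<alpha> \<otimes>\<^bsub>Hom (Coh T) F G\<^esub> \<beta>) Y e =
      fmor (fcomp B A) F G \<alpha> Y e \<otimes>\<^bsub>val (fob (fcomp B A) G) Y\<^esub> fmor (fcomp B A) F G \<beta> Y e"
    using coh_functorD(5)[OF B coh_functorD(1)[OF A F(1)] coh_functorD(1)[OF A F(2)]
        coh_functorD(2)[OF A F a(1)] coh_functorD(2)[OF A F a(2)] Y(1)] Y(2)
    by (simp add: fcomp_def)
next
  fix F G H :: "('o, 'm, 'x) presheaf" and \<alpha> \<beta> Y e
  assume F: "coh T F" "coh T G" "coh T H" and a: "\<alpha> \<in> transf T F G" "\<beta> \<in> transf T G H"
    and Y: "Y \<in> Obj T" "e \<in> carrier (val (fob (fcomp B A) F) Y)"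
  interpret A: additive_functor "Coh T" "Coh T" A by fact
  have "fmor A F H (transf_comp T F \<beta> \<alpha>) = transf_comp T (fob A F) (fmor A G H \<beta>) (fmor A F G \<alpha>)"
    using A.fmor_cmp[of F G H \<alpha> \<beta>] F a by (simp add: coh_iff)
  then show "fmor (fcomp B A) F H (transf_comp T F \<beta> \<alpha>) Y e = fmor (fcomp B A) G H \<beta> Y (fmor (fcomp B A) F G \<alpha> Y e)"
    using coh_functorD(4)[OF B coh_functorD(1)[OF A F(1)] coh_functorD(1)[OF A F(2)] coh_functorD(1)[OF A F(3)]
        coh_functorD(2)[OF A F(1,2) a(1)] coh_functorD(2)[OF A F(2,3) a(2)] Y(1)] Y(2)
    by (simp add: fcomp_def)
next
  fix F :: "('o, 'm, 'x) presheaf" and Y e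
  assume F: "coh T F" and Y: "Y \<in> Obj T" "e \<in> carrier (val (fob (fcomp B A) F) Y)"
  interpret A: additive_functor "Coh T" "Coh T" A by fact
  have "fmor A F F (Idt (Coh T) F) = Idt (Coh T) (fob A F)" using A.fmor_idt F by (simp add: coh_iff)
  then show "fmor (fcomp B A) F F (Idt (Coh T) F) Y e = e"
    using coh_functorD(3)[OF B coh_functorD(1)[OF A F] Y(1)] Y(2) by (simp add: fcomp_def del: Coh_simps)
qed (simp_all add: fcomp_def coh_functorD[OF A] coh_functorD[OF B])

end

section \<open>The functors \<open>\<Gamma>\<close> and \<open>L\<close>\<close>

locale ess_small_triangulated = triangulated_category T for T :: "('o, 'm) tcat" +
  fixes univ :: "'x itself"
  assumes inf: "infinite (UNIV :: 'x set)" and ess: "essentially_small TYPE('x) T"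
begin

lemma small_reps:
  obtains R where "R \<subseteq> Obj T" "small TYPE('x) R" "\<forall>X\<in>R. \<forall>Y\<in>R. small TYPE('x) (Mor T X Y)"
    "\<forall>X\<in>Obj T. \<exists>Y\<in>R. \<exists>f. iso_mor T X Y f"
  using ess unfolding essentially_small_def by blast

end

locale ess_sub = ess_small_triangulated T univ + tri_sub T S
  for T :: "('o, 'm) tcat" and univ :: "'x itself" and S :: "'o set"

lemma full_sub_simps [simp]:
  "Obj (full_sub C S) = S" "Hom (full_sub C S) = Hom C" "Idt (full_sub C S) = Idt C" "Cmp (full_sub C S) = Cmp C"
  by (simp_all add: full_sub_def)

lemma biproduct_full_sub: "biproduct (full_sub C S) A B P i j p q = biproduct C A B P i j p q"
  by (simp add: biproduct_def)

lemma incl_simps [simp]: "fob incl X = X" "fmor incl X Y u = u"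
  by (simp_all add: incl_def fid_def)

lemma push_incl [simp]: "fob (push A incl) (F :: ('o, 'm, 'x) presheaf) = F"
  by (rule presheaf.equality) (auto simp: push_def)

text \<open>The element of \<open>\<Gamma> F(Y)\<close> given by
  \<open>g : Y \<rightarrow> X\<close> with \<open>X\<close> in \<open>S\<close> and
  \<open>x\<close> in \<open>F(X)\<close>.\<close>

definition gam ::
  "('o, 'm) tcat \<Rightarrow> 'o set \<Rightarrow> ('o, 'm, 'x) presheaf \<Rightarrow> 'o \<Rightarrow> 'o \<Rightarrow> 'm \<Rightarrow> 'x \<Rightarrow> 'x" where
  "gam T S F Y X g x = pull_el (full_sub T S) T incl F Y X x g"

text \<open>The element of \<open>L F(Y)\<close> given by a morphism \<open>s : Z \<rightarrow> Y\<close> with cone in \<open>S\<close> and \<open>x \<in> F(Z)\<close>.\<close>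

definition rho ::
  "('o, 'm) tcat \<Rightarrow> 'o set \<Rightarrow> ('o, 'm, 'x) presheaf \<Rightarrow> 'o \<Rightarrow> 'o \<Rightarrow> 'm \<Rightarrow> 'x \<Rightarrow> 'x" where
  "rho T S F Y Z s x = pull_el T (verdier T S) (quot T S) F Y Z x (roof_rel T S Y Z `` {(Z, s, Idt T Z)})"

context ess_sub
begin

section \<open>Gamma: elements, functoriality and the counit\<close>

lemma full_sub_preadditive: "preadditive_category (full_sub T S)"
  by (rule preadditive_category.intro) (auto simp: hom_group cmp_assoc cmp_add_left cmp_add_right)

lemma incl_functor: "additive_functor (full_sub T S) T incl"
  by (intro additive_functor.intro additive_functor_axioms.intro full_sub_preadditive preadditive_category_axioms)
    (auto simp: hom_def)

text \<open>\<open>S\<close> contains the cones of its morphisms, so the category of elements of the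
  restriction of \<open>F\<close> to \<open>S\<close> is filtered as well. Since \<open>S\<close> is
  closed under isomorphism, \<open>R \<inter> S\<close> is still a small set of
  representatives.\<close>

lemma gam_pull: assumes "coh T F" shows "small_pull (full_sub T S) (F :: ('o, 'm, 'x) presheaf) T incl"
proof -
  interpret F: coh T F by fact
  interpret fs: preadditive_category "full_sub T S" by (rule full_sub_preadditive)
  interpret i: additive_functor "full_sub T S" T incl by (rule incl_functor)
  have psh: "psh (full_sub T S) F"
    by unfold_locales (use F.additive in \<open>auto simp: additive_presheaf_def\<close>)
  interpret p: psh "full_sub T S" F by (rule psh)
  have flat: "flat_presheaf (full_sub T S) F"
  proof unfold_locales
    fix X X' assume X: "X \<in> Obj (full_sub T S)" "X' \<in> Obj (full_sub T S)"
    then obtain P i j p q where "P \<in> Obj T" "biproduct T X X' P i j p q"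
      using biproduct_ex[of X X'] by auto
    moreover from this X have "P \<in> S" using sub_biproduct[of X X' P i j p q] by simp
    ultimately show "\<exists>P\<in>Obj (full_sub T S). \<exists>i j p q. biproduct (full_sub T S) X X' P i j p q"
      unfolding full_sub_simps biproduct_full_sub by blast
  next
    fix X Y u y assume X: "X \<in> Obj (full_sub T S)" "Y \<in> Obj (full_sub T S)" "u \<in> Mor (full_sub T S) X Y"
      "y \<in> carrier (val F Y)" "act F X Y u y = \<one>\<^bsub>val F X\<^esub>"
    then obtain Z w h where t: "(X, Y, Z, u, w, h) \<in> Tri T" using TR1_cone[of X Y u] by auto
    then obtain z where "z \<in> carrier (val F Z)" "act F Y Z w z = y" using F.exact X by blast
    moreover have "Z \<in> S" using sub_tri(1)[OF t] X by simp
    ultimately show "\<exists>Z\<in>Obj (full_sub T S). \<exists>w\<in>Mor (full_sub T S) Y Z. \<exists>z\<in>carrier (val F Z).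
        Cmp (full_sub T S) X Y Z w u = \<one>\<^bsub>Hom (full_sub T S) X Z\<^esub> \<and> act F Y Z w z = y"
      using tri_zero[OF t] Tri_typed[OF t] by auto
  qed
  interpret pull_data "full_sub T S" F T incl
    by (intro pull_data.intro flat incl_functor)
  obtain R where R: "R \<subseteq> Obj T" "small TYPE('x) R" "\<forall>X\<in>R. \<forall>Y\<in>R. small TYPE('x) (Mor T X Y)"
    "\<forall>X\<in>Obj T. \<exists>Y\<in>R. \<exists>f. iso_mor T X Y f" by (rule small_reps)
  show ?thesis
  proof unfold_locales
    show "Obj (full_sub T S) \<noteq> {}" using sub by (auto simp: triangulated_sub_def)
    fix Y assume Y: "Y \<in> Obj T"
    show "small TYPE('x) (carrier (pull_val (full_sub T S) T incl F Y))"
    proof (rule small_pull_val[OF inf Y])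
      show "R \<inter> S \<subseteq> Obj (full_sub T S)" by simp
      show "small TYPE('x) (R \<inter> S)" using R(2) by (rule small_subset) simp
      show "\<exists>X'\<in>R \<inter> S. \<exists>u. iso_mor (full_sub T S) X X' u" if "X \<in> Obj (full_sub T S)" for X
      proof -
        have X: "X \<in> S" using that by simp
        then obtain X' f g where X': "X' \<in> R" "inverse_mors T X X' f g" using R(4) unfolding iso_mor_def by blast
        then have "X' \<in> S" using sub_iso[OF X] R(1) by blast
        with X' show ?thesis by (auto simp: iso_mor_def inverse_mors_def)
      qed
      show "small TYPE('x) (Mor T Y (fob incl X))" if "X \<in> R \<inter> S" for X
        using small_Mor[OF R(1,3,4) Y] that by simp
    qed
  qed
qed

lemma Gam_fob: "fob (Gam T S) F = fob (pull (full_sub T S) T incl) F"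
  by (simp add: Gam_def fcomp_def)

lemma Gam_mor: "fmor (Gam T S) F G \<alpha> = fmor (pull (full_sub T S) T incl) F G (restrict \<alpha> S)"
  by (simp add: Gam_def fcomp_def) (simp add: push_def)

lemma restrict_transf: assumes "psh T F" "\<alpha> \<in> transf T F G" shows "restrict \<alpha> S \<in> transf (full_sub T S) F G"
proof (rule transfI)
  interpret psh T F by fact
  fix X Y f x assume "X \<in> Obj (full_sub T S)" "Y \<in> Obj (full_sub T S)" "f \<in> Mor (full_sub T S) X Y" "x \<in> carrier (val F Y)"
  then show "restrict \<alpha> S X (act F X Y f x) = act G X Y f (restrict \<alpha> S Y x)" using assms(2) by (simp add: transfD(4))
qed (use assms in \<open>auto simp: transf_in transf_mult transfD(2)\<close>)

lemma gam_pull_mor: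
  assumes "coh T F" "coh T G" "\<alpha> \<in> transf T F (G :: ('o, 'm, 'x) presheaf)"
  shows "pull_mor (full_sub T S) F G T incl (restrict \<alpha> S)"
proof -
  interpret F: coh T F by fact
  interpret GF: small_pull "full_sub T S" F T incl by (rule gam_pull) fact
  interpret GG: small_pull "full_sub T S" G T incl by (rule gam_pull) fact
  show ?thesis by unfold_locales (rule restrict_transf[OF F.psh_axioms assms(3)])
qed

lemma gam_in [intro]: "\<lbrakk>coh T F; Y \<in> Obj T; X \<in> S; g \<in> Mor T Y X; x \<in> carrier (val F X)\<rbrakk> \<Longrightarrow> gam T S F Y X g (x :: 'x) \<in> carrier (val (fob (Gam T S) F) Y)"
  using small_pull.el_in[OF gam_pull] by (simp add: gam_def Gam_fob)

lemma gam_ex: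
  assumes "coh T F" "e \<in> carrier (val (fob (Gam T S) F) Y)"
  obtains X g x where "X \<in> S" "g \<in> Mor T Y X" "x \<in> carrier (val F X)" "e = gam T S F Y X g (x :: 'x)"
proof -
  interpret small_pull "full_sub T S" F T incl by (rule gam_pull) fact
  have "e \<in> carrier (val P Y)" using assms(2) by (simp add: Gam_fob)
  then show ?thesis by (rule el_ex) (use that in \<open>simp add: gam_def\<close>)
qed

lemma gam_mult: "\<lbrakk>coh T F; Y \<in> Obj T; X \<in> S; g \<in> Mor T Y X; h \<in> Mor T Y X; x \<in> carrier (val F X)\<rbrakk> \<Longrightarrow>
    gam T S F Y X g x \<otimes>\<^bsub>val (fob (Gam T S) F) Y\<^esub> gam T S F Y X h x = gam T S F Y X (g \<otimes>\<^bsub>Hom T Y X\<^esub> h) (x :: 'x)"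
  using small_pull.el_mult[OF gam_pull] by (simp add: gam_def Gam_fob)

lemma gam_add: "\<lbrakk>coh T F; Y \<in> Obj T; X \<in> S; g \<in> Mor T Y X; x \<in> carrier (val F X); x' \<in> carrier (val F X)\<rbrakk> \<Longrightarrow>
    gam T S F Y X g (x \<otimes>\<^bsub>val F X\<^esub> x') = gam T S F Y X g x \<otimes>\<^bsub>val (fob (Gam T S) F) Y\<^esub> gam T S F Y X g (x' :: 'x)"
  using small_pull.el_add[OF gam_pull] by (simp add: gam_def Gam_fob)

lemma gam_push:
  assumes "coh T F" "Y \<in> Obj T" "X \<in> S" "Z \<in> S" "u \<in> Mor T X Z" "g \<in> Mor T Y X" "z \<in> carrier (val F Z)"
  shows "gam T S F Y X g (act F X Z u z) = gam T S F Y Z (Cmp T Y X Z u g) (z :: 'x)"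
proof -
  interpret small_pull "full_sub T S" F T incl by (rule gam_pull) fact
  show ?thesis using el_push[of Y X Z u z g] assms by (simp add: gam_def)
qed

lemma gam_eq_one_iff:
  assumes "coh T F" "Y \<in> Obj T" "X \<in> S" "g \<in> Mor T Y X" "x \<in> carrier (val F X)"
  shows "gam T S F Y X g (x :: 'x) = \<one>\<^bsub>val (fob (Gam T S) F) Y\<^esub> \<longleftrightarrow>
    (\<exists>Z\<in>S. \<exists>u\<in>Mor T X Z. \<exists>z\<in>carrier (val F Z). act F X Z u z = x \<and> Cmp T Y X Z u g = \<one>\<^bsub>Hom T Y Z\<^esub>)"
proof -
  interpret small_pull "full_sub T S" F T incl by (rule gam_pull) fact
  show ?thesis using el_eq_one_iff[of Y X x g] assms by (simp add: gam_def Gam_fob)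
qed

lemma gam_act:
  assumes "coh T F" "Y \<in> Obj T" "Y' \<in> Obj T" "X \<in> S" "m \<in> Mor T Y Y'" "g \<in> Mor T Y' X" "x \<in> carrier (val F X)"
  shows "act (fob (Gam T S) F) Y Y' m (gam T S F Y' X g (x :: 'x)) = gam T S F Y X (Cmp T Y Y' X g m) x"
proof -
  interpret small_pull "full_sub T S" F T incl by (rule gam_pull) fact
  show ?thesis using el_act[of Y Y' m X x g] assms by (simp add: gam_def Gam_fob)
qed

lemma gam_mor:
  assumes "coh T F" "coh T G" "\<alpha> \<in> transf T F G" "Y \<in> Obj T" "X \<in> S" "g \<in> Mor T Y X" "x \<in> carrier (val F X)"
  shows "fmor (Gam T S) F G \<alpha> Y (gam T S F Y X g (x :: 'x)) = gam T S G Y X g (\<alpha> X x)"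
proof -
  interpret pull_mor "full_sub T S" F G T incl "restrict \<alpha> S" by (rule gam_pull_mor) fact+
  show ?thesis using mor_el[of Y X x g] assms by (simp add: gam_def Gam_mor)
qed

lemma psh_Gam: assumes "coh T F" shows "psh T (fob (Gam T S) (F :: ('o, 'm, 'x) presheaf))"
  using small_pull.psh_P[OF gam_pull[OF assms]] by (simp add: Gam_fob)

lemma gam_common:
  assumes "coh T F" "Y \<in> Obj T" "e \<in> carrier (val (fob (Gam T S) F) Y)" "e' \<in> carrier (val (fob (Gam T S) F) Y)"
  obtains X g h x where "X \<in> S" "g \<in> Mor T Y X" "h \<in> Mor T Y X" "x \<in> carrier (val F X)"
    "e = gam T S F Y X g (x :: 'x)" "e' = gam T S F Y X h x"
proof -
  interpret small_pull "full_sub T S" F T incl by (rule gam_pull) fact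
  show ?thesis
    by (rule el_common[of Y e e']) (use assms that in \<open>auto simp: gam_def Gam_fob\<close>)
qed

text \<open>Vanishing in the colimit is witnessed at some later index \<open>Z\<close>, where the
  composite of the representative with \<open>f\<close> is zero. The representative then extends
  over the weak cokernel \<open>Z1\<close>, with the same element \<open>z\<close>.\<close>

lemma coh_Gam: assumes F: "coh T F" shows "coh T (fob (Gam T S) (F :: ('o, 'm, 'x) presheaf))"
proof (rule cohI[OF psh_Gam[OF F]])
  interpret F: coh T F by fact
  fix X1 Y1 Z1 f k l e assume t: "(X1, Y1, Z1, f, k, l) \<in> Tri T" and e: "e \<in> carrier (val (fob (Gam T S) F) Y1)"
    and a: "act (fob (Gam T S) F) X1 Y1 f e = \<one>\<^bsub>val (fob (Gam T S) F) X1\<^esub>"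
  have ty: "X1 \<in> Obj T" "Y1 \<in> Obj T" "Z1 \<in> Obj T" "f \<in> Mor T X1 Y1" "k \<in> Mor T Y1 Z1" using Tri_typed[OF t] by auto
  obtain X g x where X: "X \<in> S" "g \<in> Mor T Y1 X" "x \<in> carrier (val F X)" "e = gam T S F Y1 X g x"
    using gam_ex[OF F e] .
  obtain Z u z where Z: "Z \<in> S" "u \<in> Mor T X Z" "z \<in> carrier (val F Z)" "act F X Z u z = x"
     "Cmp T X1 X Z u (Cmp T X1 Y1 X g f) = \<one>\<^bsub>Hom T X1 Z\<^esub>"
    using a X ty F by (auto simp: gam_act gam_eq_one_iff)
  have "Cmp T X1 Y1 Z (Cmp T Y1 X Z u g) f = \<one>\<^bsub>Hom T X1 Z\<^esub>" using Z X ty by (simp add: cmp_assoc)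
  then obtain h where h: "h \<in> Mor T Z1 Z" "Cmp T Y1 Z1 Z h k = Cmp T Y1 X Z u g"
    using weak_cokernel[OF t, of Z "Cmp T Y1 X Z u g"] Z X ty by auto
  have "e = gam T S F Y1 Z (Cmp T Y1 Z1 Z h k) z"
    unfolding X(4) h(2) using gam_push[OF F ty(2) X(1) Z(1,2) X(2) Z(3)] Z(4) by simp
  then have "act (fob (Gam T S) F) Y1 Z1 k (gam T S F Z1 Z h z) = e" using gam_act F ty Z h by simp
  then show "\<exists>z\<in>carrier (val (fob (Gam T S) F) Z1). act (fob (Gam T S) F) Y1 Z1 k z = e"
    using F ty Z h by (intro bexI[of _ "gam T S F Z1 Z h z"] gam_in) auto
qed

lemma Gam_functor: "additive_functor (Coh T) (Coh T) (Gam T S :: ('o, 'm, 'x) coh_endo)"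
proof (rule coh_functorI)
  fix F :: "('o, 'm, 'x) presheaf" assume "coh T F" then show "coh T (fob (Gam T S) F)" by (rule coh_Gam)
next
  fix F G :: "('o, 'm, 'x) presheaf" and \<alpha> assume F: "coh T F" "coh T G" "\<alpha> \<in> transf T F G"
  then interpret pull_mor "full_sub T S" F G T incl "restrict \<alpha> S" by (rule gam_pull_mor)
  show "fmor (Gam T S) F G \<alpha> \<in> transf T (fob (Gam T S) F) (fob (Gam T S) G)"
    using mor_transf by (simp add: Gam_mor Gam_fob)
next
  fix F :: "('o, 'm, 'x) presheaf" and Y e assume F: "coh T F" and Y: "Y \<in> Obj T" "e \<in> carrier (val (fob (Gam T S) F) Y)"
  interpret F: coh T F by fact
  have i: "Idt (Coh T) F \<in> transf T F F" using transf_idt[OF F.psh_axioms] by simp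
  show "fmor (Gam T S) F F (Idt (Coh T) F) Y e = e"
    by (rule gam_ex[OF F Y(2)]) (use gam_mor[OF F F i Y(1)] in simp)
next
  fix F G H :: "('o, 'm, 'x) presheaf" and \<alpha> \<beta> Y e
  assume F: "coh T F" "coh T G" "coh T H" and a: "\<alpha> \<in> transf T F G" "\<beta> \<in> transf T G H" and Y: "Y \<in> Obj T" "e \<in> carrier (val (fob (Gam T S) F) Y)"
  interpret F: coh T F by fact
  have c: "transf_comp T F \<beta> \<alpha> \<in> transf T F H" using transf_comp_in[OF F.psh_axioms a] .
  show "fmor (Gam T S) F H (transf_comp T F \<beta> \<alpha>) Y e = fmor (Gam T S) G H \<beta> Y (fmor (Gam T S) F G \<alpha> Y e)"
    using F(1) Y(2) by (rule gam_ex) (use F a c Y in \<open>simp add: gam_mor transf_in\<close>)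
next
  fix F G :: "('o, 'm, 'x) presheaf" and \<alpha> \<beta> Y e
  assume F: "coh T F" "coh T G" and a: "\<alpha> \<in> transf T F G" "\<beta> \<in> transf T F G" and Y: "Y \<in> Obj T" "e \<in> carrier (val (fob (Gam T S) F) Y)"
  interpret F: coh T F by fact
  interpret G: coh T G by fact
  have c: "\<alpha> \<otimes>\<^bsub>Hom (Coh T) F G\<^esub> \<beta> \<in> transf T F G" using Coh_mult_in[OF F.psh_axioms G.psh_axioms a] .
  show "fmor (Gam T S) F G (\<alpha> \<otimes>\<^bsub>Hom (Coh T) F G\<^esub> \<beta>) Y e = fmor (Gam T S) F G \<alpha> Y e \<otimes>\<^bsub>val (fob (Gam T S) G) Y\<^esub> fmor (Gam T S) F G \<beta> Y e"
    using F(1) Y(2) by (rule gam_ex) (use F a c Y in \<open>simp add: gam_mor transf_in Coh_mult gam_add\<close>)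
qed

text \<open>The class of \<open>g\<close> at \<open>x\<close> is to be sent to
  \<open>F(g)(x)\<close>. The choice ranges over all presentations of \<open>e\<close>, and
  \<open>counit_gam\<close> shows that they give one value.\<close>

definition counit where
  "counit F = (\<lambda>Y\<in>Obj T. \<lambda>e\<in>carrier (val (fob (Gam T S) F) Y).
     SOME v. \<exists>X\<in>S. \<exists>g\<in>Mor T Y X. \<exists>x\<in>carrier (val F X). e = gam T S F Y X g (x :: 'x) \<and> v = act F Y X g x)"

lemma counit_gam:
  assumes F: "coh T F" and Y: "Y \<in> Obj T" "X \<in> S" "g \<in> Mor T Y X" "x \<in> carrier (val F X)"
  shows "counit F Y (gam T S F Y X g x) = act F Y X g x"
proof -
  interpret F: coh T F by fact
  interpret small_pull "full_sub T S" F T incl by (rule gam_pull) fact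
  have u: "act F Y X' g' x' = act F Y X g x"
    if X': "X' \<in> S" "g' \<in> Mor T Y X'" "x' \<in> carrier (val F X')" "gam T S F Y X g x = gam T S F Y X' g' x'" for X' g' x'
  proof -
    have "el_rel Y X x g X' x' g'" using el_eq_iff[of Y X x g X' x' g'] X' Y by (simp add: gam_def)
    then obtain Z u v z where Z: "Z \<in> S" "u \<in> Mor T X Z" "v \<in> Mor T X' Z" "z \<in> carrier (val F Z)"
      "act F X Z u z = x" "act F X' Z v z = x'" "Cmp T Y X Z u g = Cmp T Y X' Z v g'" by (auto simp: el_rel_def)
    show ?thesis unfolding Z(5,6)[symmetric] by (rule F.act_square[OF Z(7)[symmetric]]) (use Z(1-4) X'(1-3) Y in auto)
  qed
  let ?P = "\<lambda>v. \<exists>X'\<in>S. \<exists>g'\<in>Mor T Y X'. \<exists>x'\<in>carrier (val F X'). gam T S F Y X g x = gam T S F Y X' g' x' \<and> v = act F Y X' g' x'"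
  define w where "w = (SOME v. ?P v)"
  have "?P (act F Y X g x)" using Y by blast
  from someI[of ?P, OF this] have "?P w" unfolding w_def .
  then have "w = act F Y X g x" using u by blast
  then show ?thesis using gam_in[OF F Y] Y by (simp add: counit_def w_def)
qed

lemma counit_transf: assumes F: "coh T F" shows "counit F \<in> transf T (fob (Gam T S) F) F"
proof (rule transfI)
  interpret F: coh T F by fact
  fix Y e assume Y: "Y \<in> Obj T" "e \<in> carrier (val (fob (Gam T S) F) Y)"
  show "counit F Y e \<in> carrier (val F Y)" using F Y(2) by (rule gam_ex) (use F Y in \<open>auto simp: counit_gam\<close>)
next
  interpret F: coh T F by fact
  fix Y e e' assume Y: "Y \<in> Obj T" "e \<in> carrier (val (fob (Gam T S) F) Y)" "e' \<in> carrier (val (fob (Gam T S) F) Y)"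
  show "counit F Y (e \<otimes>\<^bsub>val (fob (Gam T S) F) Y\<^esub> e') = counit F Y e \<otimes>\<^bsub>val F Y\<^esub> counit F Y e'"
    using F Y by (rule gam_common) (use F Y in \<open>auto simp: counit_gam gam_mult F.act_add\<close>)
next
  interpret F: coh T F by fact
  fix Y Y' m e assume Y: "Y \<in> Obj T" "Y' \<in> Obj T" "m \<in> Mor T Y Y'" "e \<in> carrier (val (fob (Gam T S) F) Y')"
  show "counit F Y (act (fob (Gam T S) F) Y Y' m e) = act F Y Y' m (counit F Y' e)"
    using F Y(4) by (rule gam_ex) (use F Y in \<open>auto simp: counit_gam gam_act F.act_cmp\<close>)
qed (auto simp: counit_def)

text \<open>On \<open>S\<close> the counit is an isomorphism.\<close>

lemma gam_idt:
  assumes F: "coh T F" and c: "c \<in> S" "e \<in> carrier (val (fob (Gam T S) F) c)"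
  shows "gam T S F c c (Idt T c) (counit F c e) = e"
proof -
  interpret F: coh T F by fact
  obtain X g x where X: "X \<in> S" "g \<in> Mor T c X" "x \<in> carrier (val F X)" "e = gam T S F c X g x" using gam_ex[OF F c(2)] .
  then show ?thesis using gam_push[OF F _ c(1) X(1,2) _ X(3), of c "Idt T c"] c F by (simp add: counit_gam)
qed


section \<open>L: elements as sections over coverings\<close>

lemma loc_pull: assumes "coh T F" shows "small_pull T (F :: ('o, 'm, 'x) presheaf) V (quot T S)"
proof -
  interpret F: coh T F by fact
  have flat: "flat_presheaf T F"
  proof unfold_locales
    show "\<exists>P\<in>Obj T. \<exists>i j p q. biproduct T X X' P i j p q" if "X \<in> Obj T" "X' \<in> Obj T" for X X'
      using that by (rule biproduct_ex)
    fix X Y u y assume X: "X \<in> Obj T" "Y \<in> Obj T" "u \<in> Mor T X Y" "y \<in> carrier (val F Y)" "act F X Y u y = \<one>\<^bsub>val F X\<^esub>"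
    then obtain Z w h where t: "(X, Y, Z, u, w, h) \<in> Tri T" using TR1_cone[of X Y u] by auto
    then obtain z where "z \<in> carrier (val F Z)" "act F Y Z w z = y" using F.exact X by blast
    then show "\<exists>Z\<in>Obj T. \<exists>w\<in>Mor T Y Z. \<exists>z\<in>carrier (val F Z). Cmp T X Y Z w u = \<one>\<^bsub>Hom T X Z\<^esub> \<and> act F Y Z w z = y"
      using tri_zero[OF t] Tri_typed[OF t] by auto
  qed
  interpret pull_data T F V "quot T S"
    by (intro pull_data.intro flat quot.additive_functor_axioms)
  obtain R where R: "R \<subseteq> Obj T" "small TYPE('x) R" "\<forall>X\<in>R. \<forall>Y\<in>R. small TYPE('x) (Mor T X Y)"
    "\<forall>X\<in>Obj T. \<exists>Y\<in>R. \<exists>f. iso_mor T X Y f" by (rule small_reps)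
  show ?thesis
  proof unfold_locales
    show "Obj T \<noteq> {}" using zero_ex by (auto simp: zero_object_def)
    fix Y assume Y: "Y \<in> Obj V"
    show "small TYPE('x) (carrier (pull_val T V (quot T S) F Y))"
      by (rule small_pull_val[OF inf Y R(1,2)]) (use R Y small_verdier[OF inf R] in auto)
  qed
qed

lemma Loc_val [simp]: "val (fob (Loc T S) F) Y = val (fob (pull T V (quot T S)) F) Y"
  by (simp add: Loc_def fcomp_def)

lemma Loc_act: "act (fob (Loc T S) F) Y Y' m = act (fob (pull T V (quot T S)) F) Y Y' (roof_cls Y Y' Y (Idt T Y) m)"
  by (simp add: Loc_def fcomp_def)

lemma Loc_mor: "Y \<in> Obj T \<Longrightarrow> fmor (Loc T S) F G \<alpha> Y = fmor (pull T V (quot T S)) F G \<alpha> Y"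
  by (simp add: Loc_def fcomp_def push_mor_apply)

lemma rho_conv: "rho T S F Y Z s x = pull_el T V (quot T S) F Y Z x (roof_cls Y Z Z s (Idt T Z))"
  by (simp add: rho_def roof_cls_def)

lemma rho_roof: "s \<in> cov Z Y \<Longrightarrow> roof Y Z Z s (Idt T Z)"
  using cov_typed(1) by auto

lemma rho_in [intro]: "\<lbrakk>coh T F; s \<in> cov Z Y; x \<in> carrier (val F Z)\<rbrakk> \<Longrightarrow> rho T S F Y Z s (x :: 'x) \<in> carrier (val (fob (Loc T S) F) Y)"
proof -
  assume a: "coh T F" "s \<in> cov Z Y" "x \<in> carrier (val F Z)"
  interpret small_pull T F V "quot T S" by (rule loc_pull) fact
  show ?thesis using a el_in[of Y Z x "roof_cls Y Z Z s (Idt T Z)"] roof_cls_in[OF rho_roof[OF a(2)]] cov_typed[OF a(2)]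
    by (simp add: rho_conv)
qed

text \<open>A class at \<open>X\<close> given by a roof with apex \<open>Z\<close> can be moved to
  the index \<open>Z\<close> by restricting \<open>x\<close> along \<open>f\<close>. Hence the
  colimit over all morphisms \<open>H_X \<rightarrow> F\<close> reduces to a colimit of
  \<open>F(Z)\<close> over the coverings \<open>Z \<rightarrow> Y\<close>.\<close>

lemma el_rho:
  assumes "coh T F" "Y \<in> Obj T" "X \<in> Obj T" "x \<in> carrier (val F X)" "roof Y X Z s f"
  shows "pull_el T V (quot T S) F Y X (x :: 'x) (roof_cls Y X Z s f) = rho T S F Y Z s (act F Z X f x)"
proof -
  interpret small_pull T F V "quot T S" by (rule loc_pull) fact
  show ?thesis
    using el_push[of Y Z X f x "roof_cls Y Z Z s (Idt T Z)"] assms roof_cls_in[OF rho_roof[of s Z Y]]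
      quot_cmp_cls[where X=Y and Y=Z and X'=Z and s=s and f="Idt T Z" and Z=X and u=f]
    by (simp add: rho_conv)
qed

lemma rho_ex:
  assumes F: "coh T F" and Y: "Y \<in> Obj T" and e: "e \<in> carrier (val (fob (Loc T S) F) Y)"
  obtains Z s x where "s \<in> cov Z Y" "x \<in> carrier (val F Z)" "e = rho T S F Y Z s (x :: 'x)"
proof -
  interpret F: coh T F by fact
  interpret small_pull T F V "quot T S" by (rule loc_pull) fact
  from e have "e \<in> carrier (val P Y)" by simp
  then obtain X x g where X: "X \<in> Obj T" "x \<in> carrier (val F X)" "g \<in> Mor V Y X" "e = pull_el T V (quot T S) F Y X x g"
    by (rule el_ex) simp
  obtain Z s f where "roof Y X Z s f" "g = roof_cls Y X Z s f" using verdier_cases[OF X(3)] .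
  then show ?thesis using X Y el_rho[where F=F and Y=Y and X=X and x=x and Z=Z and s=s and f=f] F
    by (intro that[where Z=Z and s=s and x="act F Z X f x"]) auto
qed

lemma rho_refine:
  assumes F: "coh T F" and s: "s \<in> cov Z Y" "x \<in> carrier (val F Z)" and u: "W \<in> Obj T" "u \<in> Mor T W Z" "Cmp T W Z Y s u \<in> cov W Y"
  shows "rho T S F Y Z s (x :: 'x) = rho T S F Y W (Cmp T W Z Y s u) (act F W Z u x)"
proof -
  interpret small_pull T F V "quot T S" by (rule loc_pull) fact
  note ty = cov_typed[OF s(1)]
  have "rho T S F Y Z s x = pull_el T V (quot T S) F Y Z x (roof_cls Y Z W (Cmp T W Z Y s u) u)"
    unfolding rho_conv using roof_cls_refine[OF rho_roof[OF s(1)] ty(1) u] u ty by simp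
  also have "\<dots> = rho T S F Y W (Cmp T W Z Y s u) (act F W Z u x)"
    by (rule el_rho) (use F s u ty in auto)
  finally show ?thesis .
qed

text \<open>Equality in the colimit gives equal roofs into some \<open>X\<close> carrying an element
  from which \<open>x\<close> and \<open>x'\<close> are both restricted. A refinement identifying
  the roofs then identifies the restrictions of \<open>x\<close> and \<open>x'\<close>.\<close>

lemma rho_eqD:
  assumes F: "coh T F" and s: "s \<in> cov Z Y" "x \<in> carrier (val F Z)" and s': "s' \<in> cov Z' Y" "x' \<in> carrier (val F Z')"
    and e: "rho T S F Y Z s (x :: 'x) = rho T S F Y Z' s' x'"
  obtains W u v where "W \<in> Obj T" "u \<in> Mor T W Z" "v \<in> Mor T W Z'" "Cmp T W Z Y s u \<in> cov W Y"
    "Cmp T W Z Y s u = Cmp T W Z' Y s' v" "act F W Z u x = act F W Z' v x'"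
proof -
  interpret F: coh T F by fact
  interpret small_pull T F V "quot T S" by (rule loc_pull) fact
  note ty = cov_typed[OF s(1)] cov_typed[OF s'(1)]
  have "el_rel Y Z x (roof_cls Y Z Z s (Idt T Z)) Z' x' (roof_cls Y Z' Z' s' (Idt T Z'))"
    using e el_eq_iff[of Y Z x "roof_cls Y Z Z s (Idt T Z)" Z' x' "roof_cls Y Z' Z' s' (Idt T Z')"]
      s s' ty rho_roof[OF s(1)] rho_roof[OF s'(1)] by (auto simp: rho_conv roof_cls_in)
  then obtain X u v z where X: "X \<in> Obj T" "u \<in> Mor T Z X" "v \<in> Mor T Z' X" "z \<in> carrier (val F X)"
    "act F Z X u z = x" "act F Z' X v z = x'"
    "Cmp V Y Z X (roof_cls Z X Z (Idt T Z) u) (roof_cls Y Z Z s (Idt T Z)) =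
     Cmp V Y Z' X (roof_cls Z' X Z' (Idt T Z') v) (roof_cls Y Z' Z' s' (Idt T Z'))"
    by (auto simp: el_rel_def)
  have "roof_cls Y X Z s u = roof_cls Y X Z' s' v"
    using X(7) quot_cmp_cls[OF ty(1) X(1) rho_roof[OF s(1)] X(2)] quot_cmp_cls[OF ty(4) X(1) rho_roof[OF s'(1)] X(3)] X(1-3) ty by simp
  then have "roof_eq Y X Z s u Z' s' v" using roof_cls_eq_iff[where X=Y and Y=X and Z=Z and s=s and f=u and Z'=Z' and s'=s' and f'=v] X(1-3) ty s s' by simp
  then obtain W a b where W: "W \<in> Obj T" "a \<in> Mor T W Z" "b \<in> Mor T W Z'" "Cmp T W Z Y s a \<in> cov W Y"
    "Cmp T W Z Y s a = Cmp T W Z' Y s' b" "Cmp T W Z X u a = Cmp T W Z' X v b" by (rule roof_eqE)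
  have "act F W Z a x = act F W Z' b x'" unfolding X(5,6)[symmetric]
    by (rule F.act_square[OF W(6)]) (use W(1-3) X(1-4) ty in auto)
  with that W show ?thesis by blast
qed

lemma rho_mult: "\<lbrakk>coh T F; s \<in> cov Z Y; x \<in> carrier (val F Z); y \<in> carrier (val F Z)\<rbrakk> \<Longrightarrow>
    rho T S F Y Z s x \<otimes>\<^bsub>val (fob (Loc T S) F) Y\<^esub> rho T S F Y Z s y = rho T S F Y Z s (x \<otimes>\<^bsub>val F Z\<^esub> (y :: 'x))"
  using small_pull.el_add[OF loc_pull, of F Y Z x y "roof_cls Y Z Z s (Idt T Z)"] rho_roof[of s Z Y] cov_typed[of s Z Y]
  by (simp add: rho_conv roof_cls_in)

lemma psh_Loc: assumes "coh T F" shows "psh T (fob (Loc T S) (F :: ('o, 'm, 'x) presheaf))"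
  using psh_push[OF quot.additive_functor_axioms small_pull.psh_P[OF loc_pull[OF assms]]] by (simp add: Loc_def fcomp_def)

lemma rho_one: assumes "coh T F" "s \<in> cov Z Y" shows "rho T S F Y Z s \<one>\<^bsub>val F Z\<^esub> = \<one>\<^bsub>val (fob (Loc T S) (F :: ('o, 'm, 'x) presheaf)) Y\<^esub>"
proof -
  interpret F: coh T F by fact
  interpret L: psh T "fob (Loc T S) F" by (rule psh_Loc) fact
  have Y: "Z \<in> Obj T" "Y \<in> Obj T" using cov_typed[OF assms(2)] by auto
  have "rho T S F Y Z s \<in> hom (val F Z) (val (fob (Loc T S) F) Y)"
    using assms rho_mult rho_in by (auto simp: hom_def simp del: Loc_val)
  then show ?thesis using hom_one[of "rho T S F Y Z s" "val F Z" "val (fob (Loc T S) F) Y"] F.val_group[OF Y(1)] L.val_group[OF Y(2)]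
    by blast
qed

lemma rho_eq_one_iff:
  assumes F: "coh T F" and s: "s \<in> cov Z Y" "x \<in> carrier (val F Z)"
  shows "rho T S F Y Z s (x :: 'x) = \<one>\<^bsub>val (fob (Loc T S) F) Y\<^esub> \<longleftrightarrow>
    (\<exists>W\<in>Obj T. \<exists>u\<in>Mor T W Z. Cmp T W Z Y s u \<in> cov W Y \<and> act F W Z u x = \<one>\<^bsub>val F W\<^esub>)"
proof
  interpret F: coh T F by fact
  have ty: "Z \<in> Obj T" using cov_typed[OF s(1)] by auto
  assume "rho T S F Y Z s x = \<one>\<^bsub>val (fob (Loc T S) F) Y\<^esub>"
  then have "rho T S F Y Z s x = rho T S F Y Z s \<one>\<^bsub>val F Z\<^esub>" using rho_one[OF F s(1)] by simp
  from rho_eqD[OF F s s(1) F.val_one[OF ty] this] obtain W u v where "W \<in> Obj T" "u \<in> Mor T W Z" "v \<in> Mor T W Z" "Cmp T W Z Y s u \<in> cov W Y"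
    "act F W Z u x = act F W Z v \<one>\<^bsub>val F Z\<^esub>" by metis
  with ty show "\<exists>W\<in>Obj T. \<exists>u\<in>Mor T W Z. Cmp T W Z Y s u \<in> cov W Y \<and> act F W Z u x = \<one>\<^bsub>val F W\<^esub>" by auto
next
  assume "\<exists>W\<in>Obj T. \<exists>u\<in>Mor T W Z. Cmp T W Z Y s u \<in> cov W Y \<and> act F W Z u x = \<one>\<^bsub>val F W\<^esub>"
  then obtain W u where "W \<in> Obj T" "u \<in> Mor T W Z" "Cmp T W Z Y s u \<in> cov W Y" "act F W Z u x = \<one>\<^bsub>val F W\<^esub>" by blast
  then show "rho T S F Y Z s x = \<one>\<^bsub>val (fob (Loc T S) F) Y\<^esub>"
    using rho_refine[OF F s, of W u] rho_one[OF F, of _ W Y] by simp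
qed

lemma rho_act:
  assumes F: "coh T F" and s: "s \<in> cov Z Y" "x \<in> carrier (val F Z)" and m: "Y' \<in> Obj T" "m \<in> Mor T Y' Y"
    and W: "s' \<in> cov W Y'" "m' \<in> Mor T W Z" "Cmp T W Y' Y m s' = Cmp T W Z Y s m'"
  shows "act (fob (Loc T S) F) Y' Y m (rho T S F Y Z s (x :: 'x)) = rho T S F Y' W s' (act F W Z m' x)"
proof -
  interpret small_pull T F V "quot T S" by (rule loc_pull) fact
  note ty = cov_typed[OF s(1)] cov_typed[OF W(1)]
  have "Cmp V Y' Y Z (roof_cls Y Z Z s (Idt T Z)) (roof_cls Y' Y Y' (Idt T Y') m) = roof_cls Y' Z W s' m'"
    using cls_cmp_quot[OF m(1) ty(2,1) rho_roof[OF s(1)] m(2) ty(4) W] W ty by simp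
  then have "act (fob (Loc T S) F) Y' Y m (rho T S F Y Z s x) = pull_el T V (quot T S) F Y' Z x (roof_cls Y' Z W s' m')"
    unfolding Loc_act rho_conv
    using el_act[of Y' Y "roof_cls Y' Y Y' (Idt T Y') m" Z x "roof_cls Y Z Z s (Idt T Z)"] s m ty rho_roof[OF s(1)] quot_roof[OF m]
    by (auto simp: roof_cls_in)
  also have "\<dots> = rho T S F Y' W s' (act F W Z m' x)" by (rule el_rho) (use F s m W ty in auto)
  finally show ?thesis .
qed

lemma rho_act':
  assumes F: "coh T F" and s: "s \<in> cov Z Y" "x \<in> carrier (val F Z)" and m: "Y' \<in> Obj T" "m \<in> Mor T Y' Y"
  obtains W s' m' where "s' \<in> cov W Y'" "m' \<in> Mor T W Z" "Cmp T W Z Y s m' = Cmp T W Y' Y m s'"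
    "act (fob (Loc T S) F) Y' Y m (rho T S F Y Z s (x :: 'x)) = rho T S F Y' W s' (act F W Z m' x)"
proof -
  obtain W s' m' where "W \<in> Obj T" "s' \<in> cov W Y'" "s' \<in> Mor T W Y'" "m' \<in> Mor T W Z" "Cmp T W Z Y s m' = Cmp T W Y' Y m s'"
    using cov_pull[OF s(1) m(2,1)] .
  with that rho_act[OF F s m] show ?thesis by metis
qed

lemma rho_mor:
  assumes "coh T F" "coh T G" "\<alpha> \<in> transf T F G" "s \<in> cov Z Y" "x \<in> carrier (val F Z)"
  shows "fmor (Loc T S) F G \<alpha> Y (rho T S F Y Z s (x :: 'x)) = rho T S G Y Z s (\<alpha> Z x)"
proof -
  interpret F: small_pull T F V "quot T S" by (rule loc_pull) fact
  interpret G: small_pull T G V "quot T S" by (rule loc_pull) fact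
  interpret pull_mor T F G V "quot T S" \<alpha> by unfold_locales fact
  show ?thesis
    using mor_el[of Y Z x "roof_cls Y Z Z s (Idt T Z)"] assms rho_roof[OF assms(4)] cov_typed[OF assms(4)]
    by (simp add: rho_conv Loc_mor roof_cls_in)
qed

lemma rho_common:
  assumes F: "coh T F" and Y: "Y \<in> Obj T" and e: "e \<in> carrier (val (fob (Loc T S) F) Y)" "e' \<in> carrier (val (fob (Loc T S) F) Y)"
  obtains Z s x x' where "s \<in> cov Z Y" "x \<in> carrier (val F Z)" "x' \<in> carrier (val F Z)"
    "e = rho T S F Y Z s (x :: 'x)" "e' = rho T S F Y Z s x'"
proof -
  interpret F: coh T F by fact
  obtain Z s x where Z: "s \<in> cov Z Y" "x \<in> carrier (val F Z)" "e = rho T S F Y Z s x" using rho_ex[OF F Y e(1)] .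
  obtain Z' s' x' where Z': "s' \<in> cov Z' Y" "x' \<in> carrier (val F Z')" "e' = rho T S F Y Z' s' x'" using rho_ex[OF F Y e(2)] .
  obtain M a b where M: "M \<in> Obj T" "a \<in> Mor T M Z" "a \<in> cov M Z" "b \<in> Mor T M Z'" "Cmp T M Z Y s a = Cmp T M Z' Y s' b" "Cmp T M Z Y s a \<in> cov M Y"
    using cov_common[OF Z(1) Z'(1)] .
  note ty = cov_typed[OF Z(1)] cov_typed[OF Z'(1)]
  show ?thesis
  proof (rule that[OF M(6)])
    show "e = rho T S F Y M (Cmp T M Z Y s a) (act F M Z a x)" unfolding Z(3) by (rule rho_refine[OF F Z(1,2) M(1,2,6)])
    show "e' = rho T S F Y M (Cmp T M Z Y s a) (act F M Z' b x')" unfolding Z'(3) M(5) by (rule rho_refine[OF F Z'(1,2) M(1,4) M(6)[unfolded M(5)]])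
  qed (use Z Z' M ty in auto)
qed

text \<open>Both the section and its vanishing along \<open>f\<close> live on coverings, which point
  the wrong way for an extension to \<open>Z1\<close>. The section is therefore extended to a cone
  over \<open>Y'\<close>, and this cone is pushed forward until it receives a morphism from
  \<open>Z1\<close>.\<close>

lemma coh_Loc: assumes F: "coh T F" shows "coh T (fob (Loc T S) (F :: ('o, 'm, 'x) presheaf))"
proof (rule cohI[OF psh_Loc[OF F]])
  interpret F: coh T F by fact
  interpret L: psh T "fob (Loc T S) F" by (rule psh_Loc) fact
  fix X1 Y1 Z1 f k l e assume t: "(X1, Y1, Z1, f, k, l) \<in> Tri T" and e: "e \<in> carrier (val (fob (Loc T S) F) Y1)"
    and a: "act (fob (Loc T S) F) X1 Y1 f e = \<one>\<^bsub>val (fob (Loc T S) F) X1\<^esub>"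
  have ty: "X1 \<in> Obj T" "Y1 \<in> Obj T" "Z1 \<in> Obj T" "f \<in> Mor T X1 Y1" "k \<in> Mor T Y1 Z1" using Tri_typed[OF t] by auto
  obtain Y' s x where s: "s \<in> cov Y' Y1" "x \<in> carrier (val F Y')" "e = rho T S F Y1 Y' s x" using rho_ex[OF F ty(2) e] .
  obtain X' s' f' where s': "s' \<in> cov X' X1" "f' \<in> Mor T X' Y'" "Cmp T X' Y' Y1 s f' = Cmp T X' X1 Y1 f s'"
    "act (fob (Loc T S) F) X1 Y1 f e = rho T S F X1 X' s' (act F X' Y' f' x)"
    using rho_act'[OF F s(1,2) ty(1,4)] s(3) by metis
  have o: "Y' \<in> Obj T" "s \<in> Mor T Y' Y1" "X' \<in> Obj T" "s' \<in> Mor T X' X1" using cov_typed[OF s(1)] cov_typed[OF s'(1)] by auto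
  have fx: "act F X' Y' f' x \<in> carrier (val F X')" using s' s o by auto
  obtain W u where W: "W \<in> Obj T" "u \<in> Mor T W X'" "Cmp T W X' X1 s' u \<in> cov W X1" "act F W X' u (act F X' Y' f' x) = \<one>\<^bsub>val F W\<^esub>"
    using a rho_eq_one_iff[OF F s'(1) fx] unfolding s'(4) by auto
  let ?s = "Cmp T W X' X1 s' u" and ?f = "Cmp T W X' Y' f' u"
  note [simp] = ty o W(1,2) s'(2)
  have sf: "Cmp T W Y' Y1 s ?f = Cmp T W X1 Y1 f ?s"
    by (rule square_pre[OF s'(3)]) auto
  \<comment> \<open>\<open>x\<close> vanishes on \<open>W\<close>, so it extends to an element
    \<open>x''\<close> on the cone \<open>X''\<close> of \<open>W \<rightarrow> Y'\<close>.\<close>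
  obtain X'' g m where g: "(W, Y', X'', ?f, g, m) \<in> Tri T" using TR1_cone[of W Y' ?f] by auto
  have tg: "X'' \<in> Obj T" "g \<in> Mor T Y' X''" using Tri_typed[OF g] by auto
  obtain x'' where x'': "x'' \<in> carrier (val F X'')" "act F Y' X'' g x'' = x"
    using F.exact[OF g s(2)] W(4) s(2) by (auto simp: F.act_cmp)
  \<comment> \<open>Pushing the covering \<open>s\<close> out along \<open>g\<close> replaces
    \<open>X''\<close> by an object \<open>X3\<close> that receives a morphism from
    \<open>Y1\<close> itself.\<close>
  obtain X3 s3 g3 where X3: "X3 \<in> Obj T" "s3 \<in> cov X'' X3" "s3 \<in> Mor T X'' X3" "g3 \<in> Mor T Y1 X3" "Cmp T Y' Y1 X3 g3 s = Cmp T Y' X'' X3 s3 g"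
    using cov_push[OF s(1) tg(2,1)] .
  note [simp] = tg X3(1,3,4)
  have "Cmp T W X1 X3 (Cmp T X1 Y1 X3 g3 f) ?s = Cmp T W Y1 X3 g3 (Cmp T W Y' Y1 s ?f)"
    unfolding sf by (rule cmp_assoc) auto
  also have "\<dots> = Cmp T W X'' X3 s3 (Cmp T W Y' X'' g ?f)" by (rule square_pre[OF X3(5)]) auto
  finally have z: "Cmp T W X1 X3 (Cmp T X1 Y1 X3 g3 f) ?s = \<one>\<^bsub>Hom T W X3\<^esub>" using tri_zero[OF g] by simp
  \<comment> \<open>The morphism from \<open>X1\<close> to \<open>X3\<close> vanishes only after the
    covering \<open>W\<close>, hence it factors through the cone \<open>c\<close> of that covering.
    Passing on to \<open>X4\<close>, the cone of \<open>c \<rightarrow> X3\<close>, kills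
    it.\<close>
  obtain c n m where c: "c \<in> S" "(W, X1, c, ?s, m, n) \<in> Tri T" using W(3) by (rule covE)
  have tm: "m \<in> Mor T X1 c" "c \<in> Obj T" using Tri_typed[OF c(2)] by auto
  obtain n where n: "n \<in> Mor T c X3" "Cmp T X1 c X3 n m = Cmp T X1 Y1 X3 g3 f"
    using weak_cokernel[OF c(2) _ _ z] by auto
  obtain X4 t4 q where X4: "(c, X3, X4, n, t4, q) \<in> Tri T" using TR1_cone[of c X3 n] n c(1) by auto
  have t4: "t4 \<in> cov X3 X4" "X4 \<in> Obj T" "t4 \<in> Mor T X3 X4" using cov_cotri[OF X4 c(1)] Tri_typed[OF X4] by auto
  note [simp] = tm t4(2,3) n(1)
  have "Cmp T X1 Y1 X4 (Cmp T Y1 X3 X4 t4 g3) f = Cmp T X1 X3 X4 t4 (Cmp T X1 c X3 n m)"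
    unfolding n(2) by (rule cmp_assoc) auto
  also have "\<dots> = Cmp T X1 c X4 (Cmp T c X3 X4 t4 n) m" by (rule cmp_assoc[symmetric]) auto
  finally have "Cmp T X1 Y1 X4 (Cmp T Y1 X3 X4 t4 g3) f = \<one>\<^bsub>Hom T X1 X4\<^esub>" using tri_zero[OF X4] by simp
  \<comment> \<open>The composite from \<open>X1\<close> is now zero, so the morphism from
    \<open>Y1\<close> factors over \<open>Z1\<close>.\<close>
  then obtain h where h: "h \<in> Mor T Z1 X4" "Cmp T Y1 Z1 X4 h k = Cmp T Y1 X3 X4 t4 g3"
    using weak_cokernel[OF t, of X4 "Cmp T Y1 X3 X4 t4 g3"] by auto
  have ts: "Cmp T X'' X3 X4 t4 s3 \<in> cov X'' X4" using cov_cmp X3(2) t4(1) by blast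
  let ?e = "rho T S F X4 X'' (Cmp T X'' X3 X4 t4 s3) x''"
  have e4: "?e \<in> carrier (val (fob (Loc T S) F) X4)" using rho_in[OF F ts x''(1)] .
  have "Cmp T Y' Y1 X4 (Cmp T Y1 X3 X4 t4 g3) s = Cmp T Y' X'' X4 (Cmp T X'' X3 X4 t4 s3) g"
    using X3(5) by (simp add: cmp_assoc)
  then have "act (fob (Loc T S) F) Y1 X4 (Cmp T Y1 X3 X4 t4 g3) ?e = rho T S F Y1 Y' s (act F Y' X'' g x'')"
    by (intro rho_act[OF F ts x''(1)]) (use s in auto)
  also have "\<dots> = e" using x''(2) s(3) by simp
  finally have "act (fob (Loc T S) F) Y1 Z1 k (act (fob (Loc T S) F) Z1 X4 h ?e) = e"
    unfolding h(2)[symmetric] using h(1) e4 by (simp add: L.act_cmp del: Loc_val)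
  then show "\<exists>z\<in>carrier (val (fob (Loc T S) F) Z1). act (fob (Loc T S) F) Y1 Z1 k z = e"
    using h(1) e4 L.act_in[of Z1 X4 h ?e] by auto
qed

lemma Loc_mor_transf:
  assumes F: "coh T F" "coh T G" "\<alpha> \<in> transf T F (G :: ('o, 'm, 'x) presheaf)"
  shows "fmor (Loc T S) F G \<alpha> \<in> transf T (fob (Loc T S) F) (fob (Loc T S) G)"
proof -
  interpret F: small_pull T F V "quot T S" by (rule loc_pull) fact
  interpret G: small_pull T G V "quot T S" by (rule loc_pull) fact
  interpret pull_mor T F G V "quot T S" \<alpha> by unfold_locales fact
  show ?thesis using push_mor[OF quot.additive_functor_axioms mor_transf] by (simp add: Loc_def fcomp_def)
qed

lemma Loc_functor: "additive_functor (Coh T) (Coh T) (Loc T S :: ('o, 'm, 'x) coh_endo)"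
proof (rule coh_functorI)
  fix F :: "('o, 'm, 'x) presheaf" assume "coh T F" then show "coh T (fob (Loc T S) F)" by (rule coh_Loc)
next
  fix F G :: "('o, 'm, 'x) presheaf" and \<alpha> assume F: "coh T F" "coh T G" "\<alpha> \<in> transf T F G"
  then show "fmor (Loc T S) F G \<alpha> \<in> transf T (fob (Loc T S) F) (fob (Loc T S) G)" by (rule Loc_mor_transf)
next
  fix F :: "('o, 'm, 'x) presheaf" and Y e assume F: "coh T F" and Y: "Y \<in> Obj T" "e \<in> carrier (val (fob (Loc T S) F) Y)"
  interpret F: coh T F by fact
  have i: "Idt (Coh T) F \<in> transf T F F" using transf_idt[OF F.psh_axioms] by simp
  show "fmor (Loc T S) F F (Idt (Coh T) F) Y e = e"
    by (rule rho_ex[OF F Y]) (use rho_mor[OF F F i] cov_typed(1) in auto)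
next
  fix F G H :: "('o, 'm, 'x) presheaf" and \<alpha> \<beta> Y e
  assume F: "coh T F" "coh T G" "coh T H" and a: "\<alpha> \<in> transf T F G" "\<beta> \<in> transf T G H" and Y: "Y \<in> Obj T" "e \<in> carrier (val (fob (Loc T S) F) Y)"
  interpret F: coh T F by fact
  have c: "transf_comp T F \<beta> \<alpha> \<in> transf T F H" using transf_comp_in[OF F.psh_axioms a] .
  obtain Z s x where Z: "s \<in> cov Z Y" "x \<in> carrier (val F Z)" "e = rho T S F Y Z s x" using rho_ex[OF F(1) Y] .
  then show "fmor (Loc T S) F H (transf_comp T F \<beta> \<alpha>) Y e = fmor (Loc T S) G H \<beta> Y (fmor (Loc T S) F G \<alpha> Y e)"
    using F a c Y cov_typed[OF Z(1)] by (simp add: rho_mor transf_in)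
next
  fix F G :: "('o, 'm, 'x) presheaf" and \<alpha> \<beta> Y e
  assume F: "coh T F" "coh T G" and a: "\<alpha> \<in> transf T F G" "\<beta> \<in> transf T F G" and Y: "Y \<in> Obj T" "e \<in> carrier (val (fob (Loc T S) F) Y)"
  interpret F: coh T F by fact
  interpret G: coh T G by fact
  have c: "\<alpha> \<otimes>\<^bsub>Hom (Coh T) F G\<^esub> \<beta> \<in> transf T F G" using Coh_mult_in[OF F.psh_axioms G.psh_axioms a] .
  obtain Z s x where Z: "s \<in> cov Z Y" "x \<in> carrier (val F Z)" "e = rho T S F Y Z s x" using rho_ex[OF F(1) Y] .
  then show "fmor (Loc T S) F G (\<alpha> \<otimes>\<^bsub>Hom (Coh T) F G\<^esub> \<beta>) Y e = fmor (Loc T S) F G \<alpha> Y e \<otimes>\<^bsub>val (fob (Loc T S) G) Y\<^esub> fmor (Loc T S) F G \<beta> Y e"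
    using F a c Y cov_typed[OF Z(1)] by (simp add: rho_mor transf_in Coh_mult rho_mult[symmetric] del: Loc_val)
qed

text \<open>A covering of an object of \<open>S\<close> has its source in \<open>S\<close>; there
  the identity, and with it every element, is killed by a further covering.\<close>

lemma Loc_trivial:
  assumes F: "coh T F" and z: "z \<in> S" "e \<in> carrier (val (fob (Loc T S) F) z)"
  shows "e = \<one>\<^bsub>val (fob (Loc T S) (F :: ('o, 'm, 'x) presheaf)) z\<^esub>"
proof -
  interpret F: coh T F by fact
  obtain Z s x where s: "s \<in> cov Z z" "x \<in> carrier (val F Z)" "e = rho T S F z Z s x" using rho_ex[OF F sub_Obj[OF z(1)] z(2)] .
  have Z: "Z \<in> S" "Z \<in> Obj T" "s \<in> Mor T Z z" using cov_src[OF s(1) z(1)] cov_typed[OF s(1)] by auto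
  obtain X t where X: "t \<in> cov X Z" "X \<in> Obj T" "t \<in> Mor T X Z" "Cmp T X Z Z (Idt T Z) t = \<one>\<^bsub>Hom T X Z\<^esub>"
    by (rule cov_kill[of "Idt T Z" Z Z]) (use Z in auto)
  have "act F X Z t x = act F X Z (Cmp T X Z Z (Idt T Z) t) x" using X(2,3) Z s(2) by simp
  then have "act F X Z t x = \<one>\<^bsub>val F X\<^esub>" unfolding X(4) using X Z s(2) by simp
  then show ?thesis unfolding s(3) using X cov_cmp[OF X(1) s(1)] rho_eq_one_iff[OF F s(1,2)] by blast
qed

end

section \<open>The canonical morphisms\<close>

locale ess_sub_pair = ess_small_triangulated T univ + A: ess_sub T univ S1 + B: ess_sub T univ S2
  for T :: "('o, 'm) tcat" and univ :: "'x itself" and S1 S2 +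
  assumes S12: "S1 \<subseteq> S2"
begin

text \<open>Restricting a Yoneda transformation from \<open>S2\<close> to \<open>S1\<close> gives
  the Yoneda transformation of the same element. So the index \<open>(X, x)\<close> is unchanged,
  and a witness of equality in \<open>S1\<close> is also one in \<open>S2\<close>.\<close>

lemma Gam_can_gam:
  assumes F: "coh T F" and Y: "Y \<in> Obj T" "X \<in> S1" "g \<in> Mor T Y X" "x \<in> carrier (val F X)"
  shows "Gam_can T S1 S2 F Y (gam T S1 F Y X g (x :: 'x)) = gam T S2 F Y X g x"
proof -
  interpret F: coh T F by fact
  interpret P1: small_pull "full_sub T S1" F T incl by (rule A.gam_pull) fact
  interpret P2: small_pull "full_sub T S2" F T incl by (rule B.gam_pull) fact
  let ?S = "\<lambda>c. {((X, \<eta>), g) | X \<eta> g. (X, \<eta>) \<in> slice_ob (full_sub T S2) F \<and> ((X, restrict \<eta> S1), g) \<in> c}"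
  let ?t = "P1.el_cls Y X x g"
  have X2: "X \<in> S2" using S12 Y by blast
  have ok: "P1.el_ok Y X x g" using Y by simp
  have r: "restrict (yo (full_sub T S2) F X' x') S1 = yo (full_sub T S1) F X' x'" for X' x'
    by (simp add: yo_def Int_absorb1[OF S12])
  have "pull_rel (full_sub T S2) T incl F Y `` ?S ?t = P2.el_cls Y X x g"
  proof (rule P2.Image_el_cls)
    have "((X, yo (full_sub T S2) F X x), g) \<in> ?S ?t"
      using P1.el_cls_self[of Y X x g] Y X2 by (auto simp: r P2.slice_ob_eq)
    then show "?S ?t \<noteq> {}" by blast
    fix a assume "a \<in> ?S ?t"
    then obtain X' \<eta> g' where a: "a = ((X', \<eta>), g')" "(X', \<eta>) \<in> slice_ob (full_sub T S2) F" "((X', restrict \<eta> S1), g') \<in> ?t"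
      by blast
    obtain x' where x': "\<eta> = yo (full_sub T S2) F X' x'" "x' \<in> carrier (val F X')" "X' \<in> S2"
      using a(2) by (auto simp: P2.slice_ob_eq)
    obtain X1 x1 g1 where 1: "((X', restrict \<eta> S1), g') = ((X1, yo (full_sub T S1) F X1 x1), g1)" "P1.el_ok Y X1 x1 g1" "P1.el_rel Y X x g X1 x1 g1"
      using P1.in_el_cls[OF a(3) ok] .
    have X1: "X1 = X'" "g1 = g'" using 1(1) by simp_all
    have "yo (full_sub T S1) F X' x1 = yo (full_sub T S1) F X' x'" using 1(1) unfolding x'(1) r X1 by simp
    then have "x1 = x'" by (rule P1.yo_inj) (use 1(2) x' X1 in simp_all)
    with 1 X1 have "P1.el_rel Y X x g X' x' g'" "P1.el_ok Y X' x' g'" by simp_all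
    moreover from this have "P2.el_rel Y X x g X' x' g'" using S12 by (auto simp: P1.el_rel_def P2.el_rel_def)
    ultimately show "\<exists>X' x' g'. a = ((X', yo (full_sub T S2) F X' x'), g') \<and> P2.el_ok Y X' x' g' \<and> P2.el_rel Y X x g X' x' g'"
      using a(1) x' by auto
  qed (use Y X2 in auto)
  then show ?thesis
    using lift_map_encode[OF P1.small[OF Y(1)] P1.el_cls_in, of X x g "pull_val (full_sub T S2) T incl F Y"
        "\<lambda>c. pull_rel (full_sub T S2) T incl F Y `` ?S c"] Y
    by (simp add: Gam_can_def gam_def P1.el_conv P2.el_conv)
qed

lemma Gam_can_transf:
  assumes F: "coh T F" shows "Gam_can T S1 S2 F \<in> transf T (fob (Gam T S1) F) (fob (Gam T S2) (F :: ('o, 'm, 'x) presheaf))"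
proof (rule transfI)
  interpret F: coh T F by fact
  note m = Gam_can_gam[OF F] and i = B.gam_in[OF F] and s = subsetD[OF S12]
  {
    fix Y e assume Y: "Y \<in> Obj T" "e \<in> carrier (val (fob (Gam T S1) F) Y)"
    show "Gam_can T S1 S2 F Y e \<in> carrier (val (fob (Gam T S2) F) Y)" using F Y(2) by (rule A.gam_ex) (use F Y in \<open>auto simp: m intro: i s\<close>)
  next
    fix Y e e' assume Y: "Y \<in> Obj T" "e \<in> carrier (val (fob (Gam T S1) F) Y)" "e' \<in> carrier (val (fob (Gam T S1) F) Y)"
    show "Gam_can T S1 S2 F Y (e \<otimes>\<^bsub>val (fob (Gam T S1) F) Y\<^esub> e') = Gam_can T S1 S2 F Y e \<otimes>\<^bsub>val (fob (Gam T S2) F) Y\<^esub> Gam_can T S1 S2 F Y e'"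
      using F Y by (rule A.gam_common) (use F Y in \<open>auto simp: m A.gam_mult B.gam_mult s\<close>)
  next
    fix Y Y' u e assume Y: "Y \<in> Obj T" "Y' \<in> Obj T" "u \<in> Mor T Y Y'" "e \<in> carrier (val (fob (Gam T S1) F) Y')"
    show "Gam_can T S1 S2 F Y (act (fob (Gam T S1) F) Y Y' u e) = act (fob (Gam T S2) F) Y Y' u (Gam_can T S1 S2 F Y' e)"
      using F Y(4) by (rule A.gam_ex) (use F Y in \<open>auto simp: m A.gam_act B.gam_act s\<close>)
  }
  show "Gam_can T S1 S2 F \<in> extensional (Obj T)" by (simp add: Gam_can_def)
  show "Gam_can T S1 S2 F Y \<in> extensional (carrier (val (fob (Gam T S1) F) Y))" if "Y \<in> Obj T" for Y
  proof -
    interpret P1: small_pull "full_sub T S1" F T incl by (rule A.gam_pull) fact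
    show ?thesis using that by (simp add: Gam_can_def A.Gam_fob P1.val_P lift_map_def)
  qed
qed

lemma Gam_can_nat: "nat_transf (Coh T) (Coh T) (Gam T S1) (Gam T S2) (Gam_can T S1 S2 :: ('o, 'm, 'x) coh_transf)"
proof (rule coh_nat_transfI[OF A.Gam_functor B.Gam_functor Gam_can_transf])
  fix F G :: "('o, 'm, 'x) presheaf" and \<alpha> Y e
  assume F: "coh T F" "coh T G" "\<alpha> \<in> transf T F G" "Y \<in> Obj T" "e \<in> carrier (val (fob (Gam T S1) F) Y)"
  show "Gam_can T S1 S2 G Y (fmor (Gam T S1) F G \<alpha> Y e) = fmor (Gam T S2) F G \<alpha> Y (Gam_can T S1 S2 F Y e)"
    using F(1,5) by (rule A.gam_ex) (use F subsetD[OF S12] in \<open>simp add: A.gam_mor B.gam_mor Gam_can_gam transf_in\<close>)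
qed

lemma counit_Gam_can:
  assumes F: "coh T F" and Y: "Y \<in> Obj T" "e \<in> carrier (val (fob (Gam T S1) F) Y)"
  shows "B.counit F Y (Gam_can T S1 S2 F Y e) = A.counit F Y e"
  using F Y(2) by (rule A.gam_ex) (use F Y subsetD[OF S12] in \<open>simp add: Gam_can_gam A.counit_gam B.counit_gam\<close>)

lemma cov_mono: "s \<in> A.cov X Y \<Longrightarrow> s \<in> B.cov X Y"
  by (rule subsetD[OF cone_in_mono[OF S12]])

lemma roof_eq_mono: "A.roof_eq X Y Z s f Z' s' f' \<Longrightarrow> B.roof_eq X Y Z s f Z' s' f'"
  unfolding A.roof_eq_def B.roof_eq_def using cov_mono by blast

lemma roof_cls_mono:
  assumes Y: "Y \<in> Obj T" and r: "A.roof X Y Z s f"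
  shows "roof_rel T S2 X Y `` A.roof_cls X Y Z s f = B.roof_cls X Y Z s f"
proof (rule B.Image_roof_cls[OF Y])
  show "A.roof_cls X Y Z s f \<noteq> {}" using A.in_roof_cls[of Z s f X Y Z s f] A.roof_eq_refl[OF r Y] r by auto
  show "(Z', s', f') \<in> B.roof_cls X Y Z s f" if "(Z', s', f') \<in> A.roof_cls X Y Z s f" for Z' s' f'
    using that by (auto simp: A.in_roof_cls B.in_roof_cls cov_mono roof_eq_mono)
qed

text \<open>A covering for \<open>S1\<close> is one for \<open>S2\<close>, and equivalent roofs stay
  equivalent by the same refinement; so the section \<open>x\<close> over \<open>s\<close> is not
  altered.\<close>

lemma Loc_can_rho:
  assumes F: "coh T F" and s: "s \<in> A.cov Z Y" "x \<in> carrier (val F Z)"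
  shows "Loc_can T S1 S2 F Y (rho T S1 F Y Z s (x :: 'x)) = rho T S2 F Y Z s x"
proof -
  interpret F: coh T F by fact
  interpret P1: small_pull T F A.V "quot T S1" by (rule A.loc_pull) fact
  interpret P2: small_pull T F B.V "quot T S2" by (rule B.loc_pull) fact
  note ty = A.cov_typed[OF s(1)]
  let ?c = "A.roof_cls Y Z Z s (Idt T Z)" and ?d = "B.roof_cls Y Z Z s (Idt T Z)"
  let ?S = "\<lambda>c. {((X, \<eta>), roof_rel T S2 Y X `` r) | X \<eta> r. ((X, \<eta>), r) \<in> c}"
  let ?t = "P1.el_cls Y Z x ?c"
  have c: "?c \<in> Mor A.V Y Z" and d: "?d \<in> Mor B.V Y Z"
    using A.roof_cls_in[OF A.rho_roof[OF s(1)]] B.roof_cls_in[OF B.rho_roof[OF cov_mono[OF s(1)]]] by auto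
  have "pull_rel T B.V (quot T S2) F Y `` ?S ?t = P2.el_cls Y Z x ?d"
  proof (rule P2.Image_el_cls)
    show "?S ?t \<noteq> {}" using P1.el_cls_self[of Y Z x ?c] ty s c by auto
    fix a assume "a \<in> ?S ?t"
    then obtain X \<eta> r where a: "a = ((X, \<eta>), roof_rel T S2 Y X `` r)" "((X, \<eta>), r) \<in> ?t" by blast
    obtain x' where x': "\<eta> = yo T F X x'" "P1.el_ok Y X x' r" "P1.el_rel Y Z x ?c X x' r"
      using P1.in_el_cls[OF a(2)] ty s c by auto
    obtain Z' s' f' where r: "A.roof Y X Z' s' f'" "r = A.roof_cls Y X Z' s' f'" using A.verdier_cases[of r Y X] x'(2) by auto
    obtain Q u v z where Q: "Q \<in> Obj T" "u \<in> Mor T Z Q" "v \<in> Mor T X Q" "z \<in> carrier (val F Q)"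
      "act F Z Q u z = x" "act F X Q v z = x'"
      "Cmp A.V Y Z Q (A.roof_cls Z Q Z (Idt T Z) u) ?c = Cmp A.V Y X Q (A.roof_cls X Q X (Idt T X) v) r"
      using x'(3) by (auto simp: P1.el_rel_def)
    have Xo: "X \<in> Obj T" "Z' \<in> Obj T" "s' \<in> Mor T Z' Y" using x'(2) r(1) A.cov_typed by auto
    have "A.roof_cls Y Q Z s u = A.roof_cls Y Q Z' s' (Cmp T Z' X Q v f')"
      using Q(7) A.quot_cmp_cls[OF ty(1) Q(1) A.rho_roof[OF s(1)] Q(2)] A.quot_cmp_cls[OF Xo(1) Q(1) r(1) Q(3)] Q(1-3) ty
      unfolding r(2) by simp
    then have "A.roof_eq Y Q Z s u Z' s' (Cmp T Z' X Q v f')"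
      using A.roof_cls_eq_iff[where X=Y and Y=Q and Z=Z and s=s and f=u and Z'=Z' and s'=s' and f'="Cmp T Z' X Q v f'"] Q(1-3) ty s Xo r(1) by simp
    then have "B.roof_eq Y Q Z s u Z' s' (Cmp T Z' X Q v f')" by (rule roof_eq_mono)
    then have "B.roof_cls Y Q Z s u = B.roof_cls Y Q Z' s' (Cmp T Z' X Q v f')"
      using B.roof_cls_eq_iff[where X=Y and Y=Q and Z=Z and s=s and f=u and Z'=Z' and s'=s' and f'="Cmp T Z' X Q v f'"] Q(1-3) ty
        cov_mono[OF s(1)] Xo r(1) cov_mono[of s' Z' Y] by simp
    moreover have rB: "B.roof Y X Z' s' f'" using r(1) cov_mono by blast
    ultimately have "Cmp B.V Y Z Q (B.roof_cls Z Q Z (Idt T Z) u) ?d = Cmp B.V Y X Q (B.roof_cls X Q X (Idt T X) v) (B.roof_cls Y X Z' s' f')"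
      using B.quot_cmp_cls[OF ty(1) Q(1) B.rho_roof[OF cov_mono[OF s(1)]] Q(2)] B.quot_cmp_cls[OF Xo(1) Q(1) rB Q(3)] Q(1-3) ty by simp
    then have "P2.el_rel Y Z x ?d X x' (B.roof_cls Y X Z' s' f')" unfolding P2.el_rel_def using Q(1-6) by auto
    moreover have "roof_rel T S2 Y X `` r = B.roof_cls Y X Z' s' f'" unfolding r(2) by (rule roof_cls_mono[OF Xo(1) r(1)])
    ultimately show "\<exists>X' x' g'. a = ((X', yo T F X' x'), g') \<and> P2.el_ok Y X' x' g' \<and> P2.el_rel Y Z x ?d X' x' g'"
      using a(1) x' B.roof_cls_in[OF rB] by auto
  qed (use ty s d in auto)
  then show ?thesis
    using lift_map_encode[OF P1.small[of Y] P1.el_cls_in[of Y Z x ?c], of "pull_val T B.V (quot T S2) F Y"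
        "\<lambda>c. pull_rel T B.V (quot T S2) F Y `` ?S c"] ty s c
    by (simp add: Loc_can_def A.rho_conv B.rho_conv P1.el_conv P2.el_conv)
qed

lemma Loc_can_transf:
  assumes F: "coh T F" shows "Loc_can T S1 S2 F \<in> transf T (fob (Loc T S1) F) (fob (Loc T S2) (F :: ('o, 'm, 'x) presheaf))"
proof (rule transfI)
  interpret F: coh T F by fact
  note m = Loc_can_rho[OF F]
  {
    fix Y e assume Y: "Y \<in> Obj T" "e \<in> carrier (val (fob (Loc T S1) F) Y)"
    obtain Z s x where Z: "s \<in> A.cov Z Y" "x \<in> carrier (val F Z)" "e = rho T S1 F Y Z s x" using A.rho_ex[OF F Y] .
    then show "Loc_can T S1 S2 F Y e \<in> carrier (val (fob (Loc T S2) F) Y)"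
      using B.rho_in[OF F cov_mono[OF Z(1)] Z(2)] by (simp add: m del: B.Loc_val)
  next
    fix Y e e' assume Y: "Y \<in> Obj T" "e \<in> carrier (val (fob (Loc T S1) F) Y)" "e' \<in> carrier (val (fob (Loc T S1) F) Y)"
    obtain Z s x x' where Z: "s \<in> A.cov Z Y" "x \<in> carrier (val F Z)" "x' \<in> carrier (val F Z)" "e = rho T S1 F Y Z s x" "e' = rho T S1 F Y Z s x'"
      using A.rho_common[OF F Y] .
    then show "Loc_can T S1 S2 F Y (e \<otimes>\<^bsub>val (fob (Loc T S1) F) Y\<^esub> e') = Loc_can T S1 S2 F Y e \<otimes>\<^bsub>val (fob (Loc T S2) F) Y\<^esub> Loc_can T S1 S2 F Y e'"
      using F A.cov_typed[OF Z(1)] by (simp add: m A.rho_mult B.rho_mult cov_mono del: A.Loc_val B.Loc_val)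
  next
    fix Y Y' u e assume Y: "Y \<in> Obj T" "Y' \<in> Obj T" "u \<in> Mor T Y Y'" "e \<in> carrier (val (fob (Loc T S1) F) Y')"
    obtain Z s x where Z: "s \<in> A.cov Z Y'" "x \<in> carrier (val F Z)" "e = rho T S1 F Y' Z s x" using A.rho_ex[OF F Y(2,4)] .
    obtain W s' m' where W: "s' \<in> A.cov W Y" "m' \<in> Mor T W Z" "Cmp T W Z Y' s m' = Cmp T W Y Y' u s'"
      "act (fob (Loc T S1) F) Y Y' u e = rho T S1 F Y W s' (act F W Z m' x)" using A.rho_act'[OF F Z(1,2) Y(1,3)] Z(3) by metis
    have "act (fob (Loc T S2) F) Y Y' u (rho T S2 F Y' Z s x) = rho T S2 F Y W s' (act F W Z m' x)"
      by (rule B.rho_act[OF F cov_mono[OF Z(1)] Z(2) Y(1,3) cov_mono[OF W(1)] W(2) W(3)[symmetric]])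
    then show "Loc_can T S1 S2 F Y (act (fob (Loc T S1) F) Y Y' u e) = act (fob (Loc T S2) F) Y Y' u (Loc_can T S1 S2 F Y' e)"
      unfolding W(4) using Z W A.cov_typed[OF W(1)] A.cov_typed[OF Z(1)] by (simp add: m)
  }
  show "Loc_can T S1 S2 F \<in> extensional (Obj T)" by (simp add: Loc_can_def)
  show "Loc_can T S1 S2 F Y \<in> extensional (carrier (val (fob (Loc T S1) F) Y))" if "Y \<in> Obj T" for Y
  proof -
    interpret P1: small_pull T F A.V "quot T S1" by (rule A.loc_pull) fact
    show ?thesis using that by (simp add: Loc_can_def P1.val_P lift_map_def)
  qed
qed

lemma Loc_can_nat: "nat_transf (Coh T) (Coh T) (Loc T S1) (Loc T S2) (Loc_can T S1 S2 :: ('o, 'm, 'x) coh_transf)"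
proof (rule coh_nat_transfI[OF A.Loc_functor B.Loc_functor Loc_can_transf])
  fix F G :: "('o, 'm, 'x) presheaf" and \<alpha> Y e
  assume F: "coh T F" "coh T G" "\<alpha> \<in> transf T F G" "Y \<in> Obj T" "e \<in> carrier (val (fob (Loc T S1) F) Y)"
  obtain Z s x where Z: "s \<in> A.cov Z Y" "x \<in> carrier (val F Z)" "e = rho T S1 F Y Z s x" using A.rho_ex[OF F(1,4,5)] .
  then show "Loc_can T S1 S2 G Y (fmor (Loc T S1) F G \<alpha> Y e) = fmor (Loc T S2) F G \<alpha> Y (Loc_can T S1 S2 F Y e)"
    using F A.cov_typed[OF Z(1)] by (simp add: A.rho_mor B.rho_mor Loc_can_rho transf_in cov_mono)
qed

end

section \<open>Direct sums\<close>

definition sum_el ::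
  "('o, 'm, 'x) presheaf \<Rightarrow> ('o, 'm, 'x) presheaf \<Rightarrow> 'o \<Rightarrow> 'x \<times> 'x \<Rightarrow> 'x" where
  "sum_el F G Y p = encode (carrier (val F Y \<times>\<times> val G Y)) p"

context ess_small_triangulated
begin

lemma small_sum: "small TYPE('x) (carrier (val F Y \<times>\<times> val G Y))"
  for F G :: "('o, 'm, 'x) presheaf"
  unfolding DirProd_def by (simp add: small_Sigma inf small_self)

lemma sum_val: "carrier (val (sum_presheaf F G) Y) = (\<lambda>(x, y). sum_el F G Y (x, y)) ` (carrier (val F Y) \<times> carrier (val G Y))"
  by (auto simp: sum_presheaf_def sum_el_def)

lemma sum_in [intro]: "\<lbrakk>x \<in> carrier (val F Y); y \<in> carrier (val G Y)\<rbrakk> \<Longrightarrow> sum_el F G Y (x, y) \<in> carrier (val (sum_presheaf F G) Y)"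
  by (auto simp: sum_val)

lemma sum_ex:
  assumes "e \<in> carrier (val (sum_presheaf F G) Y)"
  obtains x y where "x \<in> carrier (val F Y)" "y \<in> carrier (val G Y)" "e = sum_el F G Y (x, y)"
  using assms by (auto simp: sum_val)

lemma sum_eq_iff: "\<lbrakk>x \<in> carrier (val F Y); y \<in> carrier (val G Y); x' \<in> carrier (val F Y); y' \<in> carrier (val G Y)\<rbrakk> \<Longrightarrow>
    sum_el F G Y (x, y) = sum_el F G Y (x', y') \<longleftrightarrow> x = x' \<and> y = y'"
  for F G :: "('o, 'm, 'x) presheaf"
  using inj_on_eq_iff[OF inj_on_encode[OF small_sum[of F Y G]], of "(x, y)" "(x', y')"] by (simp add: sum_el_def)

lemma sum_mult: "\<lbrakk>x \<in> carrier (val F Y); y \<in> carrier (val G Y); x' \<in> carrier (val F Y); y' \<in> carrier (val G Y)\<rbrakk> \<Longrightarrow>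
    sum_el F G Y (x, y) \<otimes>\<^bsub>val (sum_presheaf F G) Y\<^esub> sum_el F G Y (x', y') = sum_el F G Y (x \<otimes>\<^bsub>val F Y\<^esub> x', y \<otimes>\<^bsub>val G Y\<^esub> y')"
  for F G :: "('o, 'm, 'x) presheaf"
  using shrink_mult[OF small_sum[of F Y G], of "(x, y)" "(x', y')"] by (simp add: sum_presheaf_def sum_el_def)

lemma sum_one: "\<one>\<^bsub>val (sum_presheaf F G) Y\<^esub> = sum_el F G Y (\<one>\<^bsub>val F Y\<^esub>, \<one>\<^bsub>val G Y\<^esub>)"
  by (simp add: sum_presheaf_def sum_el_def)

lemma sum_act: "\<lbrakk>x \<in> carrier (val F Y'); y \<in> carrier (val G Y')\<rbrakk> \<Longrightarrow>
    act (sum_presheaf F G) Y Y' m (sum_el F G Y' (x, y)) = sum_el F G Y (act F Y Y' m x, act G Y Y' m y)"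
  for F G :: "('o, 'm, 'x) presheaf"
  using lift_map_encode[OF small_sum[of F Y' G], of "(x, y)" "val F Y \<times>\<times> val G Y" "\<lambda>(x, y). (act F Y Y' m x, act G Y Y' m y)"] by (simp add: sum_presheaf_def sum_el_def)

lemma decode_sum_el: "\<lbrakk>x \<in> carrier (val F Y); y \<in> carrier (val G Y)\<rbrakk> \<Longrightarrow>
    decode (carrier (val F Y \<times>\<times> val G Y)) (sum_el F G Y (x, y)) = (x, y)"
  for F G :: "('o, 'm, 'x) presheaf"
  using decode_encode[OF small_sum[of F Y G], of "(x, y)"] by (simp add: sum_el_def)

lemma psh_sum: assumes "psh T F" "psh T (G :: ('o, 'm, 'x) presheaf)" shows "psh T (sum_presheaf F G)"
proof -
  interpret F: psh T F by fact
  interpret G: psh T G by fact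
  have cg: "comm_group (val (sum_presheaf F G) X)" if "X \<in> Obj T" for X
  proof -
    interpret FX: comm_group "val F X" using F.val_comm_group that by simp
    interpret GX: comm_group "val G X" using G.val_comm_group that by simp
    have "comm_group (val F X \<times>\<times> val G X)"
      by (intro group.group_comm_groupI DirProd_group FX.is_group GX.is_group) (auto simp: FX.m_comm GX.m_comm)
    then show ?thesis using comm_group_shrink[OF small_sum[of F X G]] by (simp add: sum_presheaf_def)
  qed
  show ?thesis
  proof unfold_locales
    show "additive_presheaf T (sum_presheaf F G)" unfolding additive_presheaf_def
    proof (intro conjI ballI)
      show "comm_group (val (sum_presheaf F G) X)" if "X \<in> Obj T" for X using cg that .
    qed (auto elim!: sum_ex simp: hom_def sum_act sum_mult F.act_mult G.act_mult F.act_cmp G.act_cmp F.act_add G.act_add intro!: sum_in)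
  qed
qed

lemma coh_sum: assumes F: "coh T F" "coh T (G :: ('o, 'm, 'x) presheaf)" shows "coh T (sum_presheaf F G)"
proof -
  interpret F: coh T F by fact
  interpret G: coh T G by fact
  show ?thesis
  proof (rule cohI[OF psh_sum[OF F.psh_axioms G.psh_axioms]])
    fix X Y Z f g h e assume t: "(X, Y, Z, f, g, h) \<in> Tri T" and e: "e \<in> carrier (val (sum_presheaf F G) Y)"
      "act (sum_presheaf F G) X Y f e = \<one>\<^bsub>val (sum_presheaf F G) X\<^esub>"
    note ty = Tri_typed[OF t]
    obtain x y where xy: "x \<in> carrier (val F Y)" "y \<in> carrier (val G Y)" "e = sum_el F G Y (x, y)" using e(1) by (rule sum_ex)
    then have 1: "act F X Y f x = \<one>\<^bsub>val F X\<^esub>" "act G X Y f y = \<one>\<^bsub>val G X\<^esub>"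
      using e(2) ty by (auto simp: sum_act sum_one sum_eq_iff)
    obtain x' where x': "x' \<in> carrier (val F Z)" "act F Y Z g x' = x" using F.exact[OF t xy(1) 1(1)] .
    obtain y' where y': "y' \<in> carrier (val G Z)" "act G Y Z g y' = y" using G.exact[OF t xy(2) 1(2)] .
    show "\<exists>z\<in>carrier (val (sum_presheaf F G) Z). act (sum_presheaf F G) Y Z g z = e"
      using x' y' xy by (intro bexI[of _ "sum_el F G Z (x', y')"]) (auto simp: sum_act)
  qed
qed

lemma sum_func_fob [simp]: "fob (sum_func T A B) F = sum_presheaf (fob A F) (fob B F)"
  by (simp add: sum_func_def)

lemma sum_func_mor:
  "\<lbrakk>Y \<in> Obj T; x \<in> carrier (val (fob A F) Y); y \<in> carrier (val (fob B F) Y)\<rbrakk> \<Longrightarrow>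
    fmor (sum_func T A B) F G \<alpha> Y (sum_el (fob A F) (fob B F) Y (x, y)) = sum_el (fob A G) (fob B G) Y (fmor A F G \<alpha> Y x, fmor B F G \<alpha> Y y)"
  for F G :: "('o, 'm, 'x) presheaf"
  using lift_map_encode[OF small_sum[of "fob A F" Y "fob B F"], of "(x, y)" "val (fob A G) Y \<times>\<times> val (fob B G) Y"
      "\<lambda>(x, y). (fmor A F G \<alpha> Y x, fmor B F G \<alpha> Y y)"] by (simp add: sum_func_def sum_el_def)

lemma sum_functor:
  fixes A B :: "('o, 'm, 'x) coh_endo"
  assumes A: "additive_functor (Coh T) (Coh T) A" and B: "additive_functor (Coh T) (Coh T) B"
  shows "additive_functor (Coh T) (Coh T) (sum_func T A B)"
proof (rule coh_functorI)
  fix F :: "('o, 'm, 'x) presheaf" assume "coh T F"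
  then show "coh T (fob (sum_func T A B) F)" using coh_sum coh_functorD(1)[OF A] coh_functorD(1)[OF B] by simp
next
  fix F G :: "('o, 'm, 'x) presheaf" and \<alpha> assume F: "coh T F" "coh T G" "\<alpha> \<in> transf T F G"
  interpret AF: coh T "fob A F" by (rule coh_functorD(1)[OF A F(1)])
  interpret AG: coh T "fob A G" by (rule coh_functorD(1)[OF A F(2)])
  interpret BF: coh T "fob B F" by (rule coh_functorD(1)[OF B F(1)])
  interpret BG: coh T "fob B G" by (rule coh_functorD(1)[OF B F(2)])
  interpret a: pstr T "fob A F" "fob A G" "fmor A F G \<alpha>" by unfold_locales (rule coh_functorD(2)[OF A F])
  interpret b: pstr T "fob B F" "fob B G" "fmor B F G \<alpha>" by unfold_locales (rule coh_functorD(2)[OF B F])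
  show "fmor (sum_func T A B) F G \<alpha> \<in> transf T (fob (sum_func T A B) F) (fob (sum_func T A B) G)"
  proof (rule transfI)
    show "fmor (sum_func T A B) F G \<alpha> \<in> extensional (Obj T)" by (simp add: sum_func_def)
    show "fmor (sum_func T A B) F G \<alpha> Y \<in> extensional (carrier (val (fob (sum_func T A B) F) Y))" if "Y \<in> Obj T" for Y
      using that by (simp add: sum_func_def sum_presheaf_def lift_map_def)
  qed (auto elim!: sum_ex simp: sum_func_mor sum_mult sum_act a.tr_mult b.tr_mult a.tr_act b.tr_act intro!: sum_in)
next
  fix F :: "('o, 'm, 'x) presheaf" and Y e assume "coh T F" "Y \<in> Obj T" "e \<in> carrier (val (fob (sum_func T A B) F) Y)"
  then show "fmor (sum_func T A B) F F (Idt (Coh T) F) Y e = e"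
    by (auto elim!: sum_ex simp: sum_func_mor coh_functorD(3)[OF A] coh_functorD(3)[OF B] simp del: Coh_simps)
next
  fix F G H :: "('o, 'm, 'x) presheaf" and \<alpha> \<beta> Y e
  assume F: "coh T F" "coh T G" "coh T H" "\<alpha> \<in> transf T F G" "\<beta> \<in> transf T G H" "Y \<in> Obj T" "e \<in> carrier (val (fob (sum_func T A B) F) Y)"
  then show "fmor (sum_func T A B) F H (transf_comp T F \<beta> \<alpha>) Y e = fmor (sum_func T A B) G H \<beta> Y (fmor (sum_func T A B) F G \<alpha> Y e)"
    using transf_in[OF coh_functorD(2)[OF A F(1,2,4)] F(6)] transf_in[OF coh_functorD(2)[OF B F(1,2,4)] F(6)]
    by (auto elim!: sum_ex simp: sum_func_mor coh_functorD(4)[OF A F(1-5)] coh_functorD(4)[OF B F(1-5)])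
next
  fix F G :: "('o, 'm, 'x) presheaf" and \<alpha> \<beta> Y e
  assume F: "coh T F" "coh T G" "\<alpha> \<in> transf T F G" "\<beta> \<in> transf T F G" "Y \<in> Obj T" "e \<in> carrier (val (fob (sum_func T A B) F) Y)"
  then show "fmor (sum_func T A B) F G (\<alpha> \<otimes>\<^bsub>Hom (Coh T) F G\<^esub> \<beta>) Y e
      = fmor (sum_func T A B) F G \<alpha> Y e \<otimes>\<^bsub>val (fob (sum_func T A B) G) Y\<^esub> fmor (sum_func T A B) F G \<beta> Y e"
    using transf_in[OF coh_functorD(2)[OF A F(1,2,3)] F(5)] transf_in[OF coh_functorD(2)[OF B F(1,2,3)] F(5)]
      transf_in[OF coh_functorD(2)[OF A F(1,2,4)] F(5)] transf_in[OF coh_functorD(2)[OF B F(1,2,4)] F(5)]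
    by (auto elim!: sum_ex simp: sum_func_mor coh_functorD(5)[OF A F(1-5)] coh_functorD(5)[OF B F(1-5)] sum_mult)
qed

lemma pair_apply: "\<lbrakk>Y \<in> Obj T; e \<in> carrier (val (fob E F) Y)\<rbrakk> \<Longrightarrow>
    pair_transf T E A B \<sigma> \<tau> F Y e = sum_el (fob A F) (fob B F) Y (\<sigma> F Y e, \<tau> F Y e)"
  by (simp add: pair_transf_def sum_el_def)

lemma diff_apply: "\<lbrakk>Y \<in> Obj T; x \<in> carrier (val (fob A F) Y); y \<in> carrier (val (fob B F) Y)\<rbrakk> \<Longrightarrow>
    diff_transf T A B E \<sigma> \<tau> F Y (sum_el (fob A F) (fob B F) Y (x, y)) = \<sigma> F Y x \<otimes>\<^bsub>val (fob E F) Y\<^esub> inv\<^bsub>val (fob E F) Y\<^esub> (\<tau> F Y y)"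
  for F :: "('o, 'm, 'x) presheaf"
  using decode_sum_el[of x "fob A F" Y y "fob B F"] by (simp add: diff_transf_def sum_in)

lemma pair_nat:
  fixes A B E :: "('o, 'm, 'x) coh_endo"
  assumes s: "nat_transf (Coh T) (Coh T) E A \<sigma>" and t: "nat_transf (Coh T) (Coh T) E B \<tau>"
  shows "nat_transf (Coh T) (Coh T) E (sum_func T A B) (pair_transf T E A B \<sigma> \<tau>)"
proof (rule coh_nat_transfI[OF coh_nat_transfD(1)[OF s] sum_functor[OF coh_nat_transfD(2)[OF s] coh_nat_transfD(2)[OF t]]])
  fix F :: "('o, 'm, 'x) presheaf" assume F: "coh T F"
  interpret EF: coh T "fob E F" by (rule coh_functorD(1)[OF coh_nat_transfD(1)[OF s] F])
  note a = coh_nat_transfD(3)[OF s F] and b = coh_nat_transfD(3)[OF t F]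
  show "pair_transf T E A B \<sigma> \<tau> F \<in> transf T (fob E F) (fob (sum_func T A B) F)"
  proof (rule transfI)
    show "pair_transf T E A B \<sigma> \<tau> F \<in> extensional (Obj T)"
      "\<And>Y. Y \<in> Obj T \<Longrightarrow> pair_transf T E A B \<sigma> \<tau> F Y \<in> extensional (carrier (val (fob E F) Y))" by (simp_all add: pair_transf_def)
  qed (auto simp: pair_apply transf_in[OF a] transf_in[OF b] transf_mult[OF a] transf_mult[OF b] transfD(4)[OF a] transfD(4)[OF b] sum_mult sum_act)
next
  fix F G :: "('o, 'm, 'x) presheaf" and \<alpha> Y e
  assume F: "coh T F" "coh T G" "\<alpha> \<in> transf T F G" "Y \<in> Obj T" "e \<in> carrier (val (fob E F) Y)"
  then show "pair_transf T E A B \<sigma> \<tau> G Y (fmor E F G \<alpha> Y e) = fmor (sum_func T A B) F G \<alpha> Y (pair_transf T E A B \<sigma> \<tau> F Y e)"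
    using transf_in[OF coh_functorD(2)[OF coh_nat_transfD(1)[OF s] F(1-3)] F(4,5)]
      transf_in[OF coh_nat_transfD(3)[OF s F(1)] F(4,5)] transf_in[OF coh_nat_transfD(3)[OF t F(1)] F(4,5)]
    by (simp add: pair_apply sum_func_mor coh_nat_transfD(4)[OF s] coh_nat_transfD(4)[OF t])
qed

lemma diff_nat:
  fixes A B E :: "('o, 'm, 'x) coh_endo"
  assumes s: "nat_transf (Coh T) (Coh T) A E \<sigma>" and t: "nat_transf (Coh T) (Coh T) B E \<tau>"
  shows "nat_transf (Coh T) (Coh T) (sum_func T A B) E (diff_transf T A B E \<sigma> \<tau>)"
proof (rule coh_nat_transfI[OF sum_functor[OF coh_nat_transfD(1)[OF s] coh_nat_transfD(1)[OF t]] coh_nat_transfD(2)[OF s]])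
  fix F :: "('o, 'm, 'x) presheaf" assume F: "coh T F"
  interpret AF: coh T "fob A F" by (rule coh_functorD(1)[OF coh_nat_transfD(1)[OF s] F])
  interpret BF: coh T "fob B F" by (rule coh_functorD(1)[OF coh_nat_transfD(1)[OF t] F])
  interpret EF: coh T "fob E F" by (rule coh_functorD(1)[OF coh_nat_transfD(2)[OF s] F])
  interpret s: pstr T "fob A F" "fob E F" "\<sigma> F" by unfold_locales (rule coh_nat_transfD(3)[OF s F])
  interpret t: pstr T "fob B F" "fob E F" "\<tau> F" by unfold_locales (rule coh_nat_transfD(3)[OF t F])
  show "diff_transf T A B E \<sigma> \<tau> F \<in> transf T (fob (sum_func T A B) F) (fob E F)"
  proof (rule transfI)
    fix Y x y assume Y: "Y \<in> Obj T" "x \<in> carrier (val (fob (sum_func T A B) F) Y)" "y \<in> carrier (val (fob (sum_func T A B) F) Y)"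
    interpret EY: comm_group "val (fob E F) Y" using EF.val_comm_group Y by simp
    obtain a b where a: "a \<in> carrier (val (fob A F) Y)" "b \<in> carrier (val (fob B F) Y)" "x = sum_el (fob A F) (fob B F) Y (a, b)"
      using Y(2) unfolding sum_func_fob by (rule sum_ex)
    obtain a' b' where a': "a' \<in> carrier (val (fob A F) Y)" "b' \<in> carrier (val (fob B F) Y)" "y = sum_el (fob A F) (fob B F) Y (a', b')"
      using Y(3) unfolding sum_func_fob by (rule sum_ex)
    show "diff_transf T A B E \<sigma> \<tau> F Y (x \<otimes>\<^bsub>val (fob (sum_func T A B) F) Y\<^esub> y) =
        diff_transf T A B E \<sigma> \<tau> F Y x \<otimes>\<^bsub>val (fob E F) Y\<^esub> diff_transf T A B E \<sigma> \<tau> F Y y"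
      using a a' Y by (simp add: sum_mult diff_apply s.tr_mult t.tr_mult EY.inv_mult EY.mult_mult_swap)
  next
    show "diff_transf T A B E \<sigma> \<tau> F \<in> extensional (Obj T)"
      "\<And>Y. Y \<in> Obj T \<Longrightarrow> diff_transf T A B E \<sigma> \<tau> F Y \<in> extensional (carrier (val (fob (sum_func T A B) F) Y))" by (simp_all add: diff_transf_def)
  qed (auto elim!: sum_ex simp: diff_apply sum_act s.tr_act t.tr_act EF.act_mult EF.act_inv)
next
  fix F G :: "('o, 'm, 'x) presheaf" and \<alpha> Y e
  assume F: "coh T F" "coh T G" "\<alpha> \<in> transf T F G" "Y \<in> Obj T" "e \<in> carrier (val (fob (sum_func T A B) F) Y)"
  interpret EF: coh T "fob E F" by (rule coh_functorD(1)[OF coh_nat_transfD(2)[OF s] F(1)])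
  interpret EG: coh T "fob E G" by (rule coh_functorD(1)[OF coh_nat_transfD(2)[OF s] F(2)])
  interpret E: pstr T "fob E F" "fob E G" "fmor E F G \<alpha>" by unfold_locales (rule coh_functorD(2)[OF coh_nat_transfD(2)[OF s] F(1-3)])
  obtain a b where a: "a \<in> carrier (val (fob A F) Y)" "b \<in> carrier (val (fob B F) Y)" "e = sum_el (fob A F) (fob B F) Y (a, b)"
    using F(5) unfolding sum_func_fob by (rule sum_ex)
  then show "diff_transf T A B E \<sigma> \<tau> G Y (fmor (sum_func T A B) F G \<alpha> Y e) = fmor E F G \<alpha> Y (diff_transf T A B E \<sigma> \<tau> F Y e)"
    using F transf_in[OF coh_functorD(2)[OF coh_nat_transfD(1)[OF s] F(1-3)] F(4)] transf_in[OF coh_functorD(2)[OF coh_nat_transfD(1)[OF t] F(1-3)] F(4)]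
      transf_in[OF coh_nat_transfD(3)[OF s F(1)] F(4)] transf_in[OF coh_nat_transfD(3)[OF t F(1)] F(4)]
    by (simp add: diff_apply sum_func_mor coh_nat_transfD(4)[OF s] coh_nat_transfD(4)[OF t] E.tr_mult E.tr_inv)
qed

end

lemma (in psh) val_unit_simps [simp]:
  "\<lbrakk>X \<in> Obj C; x \<in> carrier (val F X)\<rbrakk> \<Longrightarrow> x \<otimes>\<^bsub>val F X\<^esub> \<one>\<^bsub>val F X\<^esub> = x"
  "\<lbrakk>X \<in> Obj C; x \<in> carrier (val F X)\<rbrakk> \<Longrightarrow> \<one>\<^bsub>val F X\<^esub> \<otimes>\<^bsub>val F X\<^esub> x = x"
  "X \<in> Obj C \<Longrightarrow> inv\<^bsub>val F X\<^esub> \<one>\<^bsub>val F X\<^esub> = \<one>\<^bsub>val F X\<^esub>"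
  by (simp_all add: monoid.r_one monoid.l_one monoid.inv_one group.is_monoid)

section \<open>A connecting homomorphism\<close>

text \<open>
  A complex \<open>K \<rightarrow> N \<rightarrow> P\<close> of cohomological functors that is short exact on \<open>S\<close> and short exact
  locally, that is, after restriction along suitable morphisms with cone in \<open>S\<close>.
\<close>

locale snake = tri_sub T S + K: coh T K + N: coh T N + P: coh T P + a: pstr T K N a + b: pstr T N P b
  for T :: "('o, 'm) tcat" and S and K N P :: "('o, 'm, 'x) presheaf" and a b +
  assumes ba: "\<lbrakk>X \<in> Obj T; k \<in> carrier (val K X)\<rbrakk> \<Longrightarrow> b X (a X k) = \<one>\<^bsub>val P X\<^esub>"
    and inj_on_S: "\<lbrakk>c \<in> S; k \<in> carrier (val K c); a c k = \<one>\<^bsub>val N c\<^esub>\<rbrakk> \<Longrightarrow> k = \<one>\<^bsub>val K c\<^esub>"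
    and mid_on_S: "\<lbrakk>c \<in> S; n \<in> carrier (val N c); b c n = \<one>\<^bsub>val P c\<^esub>\<rbrakk> \<Longrightarrow> \<exists>k\<in>carrier (val K c). a c k = n"
    and surj_on_S: "\<lbrakk>c \<in> S; p \<in> carrier (val P c)\<rbrakk> \<Longrightarrow> \<exists>n\<in>carrier (val N c). b c n = p"
    and inj_loc: "\<lbrakk>X \<in> Obj T; k \<in> carrier (val K X); a X k = \<one>\<^bsub>val N X\<^esub>\<rbrakk> \<Longrightarrow>
      \<exists>X'. \<exists>s\<in>cov X' X. act K X' X s k = \<one>\<^bsub>val K X'\<^esub>"
    and mid_loc: "\<lbrakk>X \<in> Obj T; n \<in> carrier (val N X); b X n = \<one>\<^bsub>val P X\<^esub>\<rbrakk> \<Longrightarrow>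
      \<exists>X'. \<exists>s\<in>cov X' X. \<exists>k\<in>carrier (val K X'). a X' k = act N X' X s n"
    and surj_loc: "\<lbrakk>X \<in> Obj T; p \<in> carrier (val P X)\<rbrakk> \<Longrightarrow>
      \<exists>X'. \<exists>s\<in>cov X' X. \<exists>n\<in>carrier (val N X'). b X' n = act P X' X s p"
begin

lemma inj_on_S': "\<lbrakk>c \<in> S; k \<in> carrier (val K c); k' \<in> carrier (val K c); a c k = a c k'\<rbrakk> \<Longrightarrow> k = k'"
  using inj_on_S[of c "k \<otimes>\<^bsub>val K c\<^esub> inv\<^bsub>val K c\<^esub> k'"]
  by (simp add: a.tr_div N.val_div_eq_one_iff K.val_div_eq_one_iff)

text \<open>The local lift of \<open>n\<close> extends to \<open>Y\<close>, but its difference from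
  \<open>n\<close> is an element \<open>m\<close> coming from the cone of the covering. The cone
  lies in \<open>S\<close>, yet \<open>b\<close> need not kill \<open>m\<close> there, only its
  restriction to \<open>Y\<close>. The discrepancy is an element on \<open>Sg Y'\<close>, which is
  lifted locally and then removed.\<close>

lemma exact_mid:
  assumes Y: "Y \<in> Obj T" and n: "n \<in> carrier (val N Y)" "b Y n = \<one>\<^bsub>val P Y\<^esub>"
  shows "\<exists>k\<in>carrier (val K Y). a Y k = n"
proof -
  interpret NY: comm_group "val N Y" using N.val_comm_group Y by simp
  obtain Y' s k where s: "s \<in> cov Y' Y" "k \<in> carrier (val K Y')" "a Y' k = act N Y' Y s n" using mid_loc[OF Y n] by blast
  have Y': "Y' \<in> Obj T" "s \<in> Mor T Y' Y" using cov_typed[OF s(1)] by auto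
  obtain C c h where C: "C \<in> S" "(Y', Y, C, s, c, h) \<in> Tri T" using s(1) by (rule covE)
  have tC: "c \<in> Mor T Y C" "h \<in> Mor T C (Sg Y')" "C \<in> Obj T" using Tri_typed[OF C(2)] by auto
  obtain D d l where D: "D \<in> S" "d \<in> Mor T D Y'" "(D, Y', Y, d, s, l) \<in> Tri T" using cov_fibre[OF s(1)] by blast
  \<comment> \<open>On the fibre \<open>D\<close> of the covering \<open>n\<close> vanishes, hence
    so does \<open>a k\<close>; injectivity on \<open>S\<close> lets \<open>k\<close> extend to
    \<open>k1\<close> on \<open>Y\<close>.\<close>
  have "a D (act K D Y' d k) = \<one>\<^bsub>val N D\<^esub>"
    using a.tr_act[of D Y' d k] N.act_cmp_zero[OF tri_zero[OF D(3)], of n] D s n Y Y' by simp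
  then have "act K D Y' d k = \<one>\<^bsub>val K D\<^esub>" using inj_on_S[of D] D s Y' by simp
  then obtain k1 where k1: "k1 \<in> carrier (val K Y)" "act K Y' Y s k1 = k" using K.exact[OF D(3) s(2)] by blast
  \<comment> \<open>The corrected element vanishes on \<open>Y'\<close>, so it comes from an element
    \<open>m\<close> on the cone \<open>C\<close>.\<close>
  let ?m = "n \<otimes>\<^bsub>val N Y\<^esub> inv\<^bsub>val N Y\<^esub> a Y k1"
  have m0: "?m \<in> carrier (val N Y)" using n k1 Y by simp
  have "act N Y' Y s (a Y k1) = act N Y' Y s n" using a.tr_act[of Y' Y s k1] k1 s Y Y' by simp
  then have "act N Y' Y s ?m = \<one>\<^bsub>val N Y'\<^esub>"
    using n k1 Y Y' by (simp add: N.act_mult N.act_inv N.val_div_eq_one_iff)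
  then obtain m where m: "m \<in> carrier (val N C)" "act N Y C c m = ?m" using N.exact[OF C(2) m0] by blast
  have "act P Y C c (b C m) = \<one>\<^bsub>val P Y\<^esub>"
    using b.tr_act[of Y C c m] m n k1 Y tC ba[OF Y k1(1)] by (simp add: b.tr_div P.val_div_eq_one_iff)
  \<comment> \<open>\<open>b m\<close> vanishes on \<open>Y\<close>, so it comes from some
    \<open>p\<close> on \<open>Sg Y'\<close>, which lifts to \<open>n'\<close> on a covering
    \<open>Z\<close>.\<close>
  then obtain p where p: "p \<in> carrier (val P (Sg Y'))" "act P C (Sg Y') h p = b C m"
    using P.exact[OF tri_rot[OF C(2)], of "b C m"] m tC by auto
  obtain Z r n' where r: "r \<in> cov Z (Sg Y')" "n' \<in> carrier (val N Z)" "b Z n' = act P Z (Sg Y') r p"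
    using surj_loc[of "Sg Y'" p] p Y' by auto
  have Z: "Z \<in> Obj T" "r \<in> Mor T Z (Sg Y')" using cov_typed[OF r(1)] by auto
  obtain E q w where E: "E \<in> S" "(Z, Sg Y', E, r, q, w) \<in> Tri T" using r(1) by (rule covE)
  have tE: "q \<in> Mor T (Sg Y') E" "E \<in> Obj T" using Tri_typed[OF E(2)] by auto
  have qh: "Cmp T C (Sg Y') E q h \<in> Mor T C E" using tC tE Y' by auto
  \<comment> \<open>\<open>C'\<close> is the fibre of
    \<open>C \<rightarrow> Sg Y' \<rightarrow> E\<close>, where \<open>E\<close> is the cone of
    \<open>r\<close>. It still lies in \<open>S\<close>, the morphism from \<open>Y\<close> still
    lifts to it, and its morphism to \<open>Sg Y'\<close> lifts to \<open>Z\<close>; so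
    \<open>m\<close> and \<open>n'\<close> can be compared on it.\<close>
  obtain C' r' v where C': "(C', C, E, r', Cmp T C (Sg Y') E q h, v) \<in> Tri T" "r' \<in> cov C' C" "C' \<in> Obj T" "r' \<in> Mor T C' C"
    "Cmp T C' C E (Cmp T C (Sg Y') E q h) r' = \<one>\<^bsub>Hom T C' E\<^esub>"
    using cov_kill[OF qh tC(3) E(1)] by blast
  note [simp] = Y Y' tC Z tE C'(3,4)
  have C'S: "C' \<in> S" using cov_src[OF C'(2) C(1)] .
  have "Cmp T Y C E (Cmp T C (Sg Y') E q h) c = \<one>\<^bsub>Hom T Y E\<^esub>"
    using tri_zero'(1)[OF C(2)] by (simp add: cmp_assoc)
  then obtain c' where c': "c' \<in> Mor T Y C'" "Cmp T Y C' C r' c' = c"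
    using weak_kernel[OF C'(1), of Y c] by auto
  obtain h' where h': "h' \<in> Mor T C' Z" "Cmp T C' Z (Sg Y') r h' = Cmp T C' C (Sg Y') h r'"
    using weak_kernel[OF E(2), of C' "Cmp T C' C (Sg Y') h r'"] C'(5) by (auto simp: cmp_assoc)
  note [simp] = c'(1) h'(1)
  interpret NC: comm_group "val N C'" using N.val_comm_group by simp
  let ?m' = "act N C' C r' m" and ?n' = "act N C' Z h' n'"
  have mn: "?m' \<in> carrier (val N C')" "?n' \<in> carrier (val N C')" using m r by auto
  have "b C' ?m' = act P C' C r' (act P C (Sg Y') h p)" using b.tr_act[of C' C r' m] m p by simp
  also have "\<dots> = act P C' Z h' (act P Z (Sg Y') r p)"
    by (rule P.act_square[OF h'(2)[symmetric]]) (use p in auto)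
  also have "\<dots> = b C' ?n'" using b.tr_act[of C' Z h' n'] r by simp
  finally have "b C' (?m' \<otimes>\<^bsub>val N C'\<^esub> inv\<^bsub>val N C'\<^esub> ?n') = \<one>\<^bsub>val P C'\<^esub>"
    using mn by (simp add: b.tr_div P.val_div_eq_one_iff)
  then obtain k2 where k2: "k2 \<in> carrier (val K C')" "a C' k2 = ?m' \<otimes>\<^bsub>val N C'\<^esub> inv\<^bsub>val N C'\<^esub> ?n'"
    using mid_on_S[OF C'S, of "?m' \<otimes>\<^bsub>val N C'\<^esub> inv\<^bsub>val N C'\<^esub> ?n'"] mn by auto
  have m'k: "?m' = ?n' \<otimes>\<^bsub>val N C'\<^esub> a C' k2" unfolding k2(2) using mn by (simp add: NC.mult_div_cancel)
  \<comment> \<open>On \<open>Y\<close> the contribution of \<open>n'\<close> comes from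
    \<open>K\<close> too: the morphism \<open>Y \<rightarrow> Z\<close> dies in
    \<open>Sg Y'\<close>, so it factors through an object \<open>D'\<close> of \<open>S\<close> on
    which \<open>b\<close> kills the restriction of \<open>n'\<close>.\<close>
  have "Cmp T Y Z (Sg Y') r (Cmp T Y C' Z h' c') = Cmp T Y C (Sg Y') h (Cmp T Y C' C r' c')"
    by (rule square_pre[OF h'(2)]) auto
  then have rz: "Cmp T Y Z (Sg Y') r (Cmp T Y C' Z h' c') = \<one>\<^bsub>Hom T Y (Sg Y')\<^esub>"
    unfolding c'(2) using tri_zero'(1)[OF C(2)] by simp
  obtain D' j e where D': "D' \<in> S" "j \<in> Mor T Y D'" "e \<in> Mor T D' Z" "Cmp T D' Z (Sg Y') r e = \<one>\<^bsub>Hom T D' (Sg Y')\<^esub>"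
    "Cmp T Y D' Z e j = Cmp T Y C' Z h' c'"
    using cov_zero_kill[OF r(1) _ _ rz] by auto
  have "b D' (act N D' Z e n') = \<one>\<^bsub>val P D'\<^esub>"
    using b.tr_act[of D' Z e n'] r D'(1,3) P.act_cmp_zero[OF D'(4)] p by simp
  then obtain k3 where k3: "k3 \<in> carrier (val K D')" "a D' k3 = act N D' Z e n'"
    using mid_on_S[OF D'(1), of "act N D' Z e n'"] r D' by auto
  have "act N Y C' c' ?n' = act N Y D' j (act N D' Z e n')"
    by (rule N.act_square[OF D'(5)[symmetric]]) (use D' r in auto)
  also have "\<dots> = a Y (act K Y D' j k3)" using a.tr_act[of Y D' j k3] k3 D' by simp
  finally have n'k: "act N Y C' c' ?n' = a Y (act K Y D' j k3)" .
  have "?m = act N Y C' c' ?m'"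
    unfolding m(2)[symmetric] using m c' by (simp add: N.act_cmp[symmetric])
  also have "\<dots> = act N Y C' c' ?n' \<otimes>\<^bsub>val N Y\<^esub> act N Y C' c' (a C' k2)"
    unfolding m'k using mn k2 by (simp add: N.act_mult)
  also have "\<dots> = a Y (act K Y D' j k3 \<otimes>\<^bsub>val K Y\<^esub> act K Y C' c' k2)"
    unfolding n'k using a.tr_act[of Y C' c' k2] k2(1) k3(1) D' by (simp add: a.tr_mult)
  finally have "a Y (k1 \<otimes>\<^bsub>val K Y\<^esub> (act K Y D' j k3 \<otimes>\<^bsub>val K Y\<^esub> act K Y C' c' k2)) = a Y k1 \<otimes>\<^bsub>val N Y\<^esub> ?m"
    using k1 k2(1) k3(1) D' by (simp add: a.tr_mult)
  also have "\<dots> = n" using k1 n by (simp add: NY.mult_div_cancel)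
  finally show ?thesis using k1 k2(1) k3(1) D'
    by (intro bexI[of _ "k1 \<otimes>\<^bsub>val K Y\<^esub> (act K Y D' j k3 \<otimes>\<^bsub>val K Y\<^esub> act K Y C' c' k2)"]) auto
qed

text \<open>
  The graph of the connecting morphism \<open>P(\<Sigma>X) \<rightarrow> K(X)\<close>: a morphism \<open>Y \<rightarrow> \<Sigma>X\<close> over which
  \<open>p\<close> lifts to \<open>N\<close> can be chosen with cone in \<open>S\<close>, hence comes from a triangle
  \<open>X \<rightarrow> c \<rightarrow> Y \<rightarrow> \<Sigma>X\<close> with \<open>c \<in> S\<close>, and on \<open>c\<close> the lift comes from \<open>K\<close>.
\<close>

definition conn where
  "conn X p k \<longleftrightarrow> (\<exists>c\<in>S. \<exists>Y f g h. (X, c, Y, f, g, h) \<in> Tri T \<and> (\<exists>n\<in>carrier (val N Y). \<exists>k'\<in>carrier (val K c).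
     b Y n = act P Y (Sg X) h p \<and> a c k' = act N c Y g n \<and> k = act K X c f k'))"

lemma connI:
  assumes "c \<in> S" "(X, c, Y, f, g, h) \<in> Tri T" "n \<in> carrier (val N Y)" "k' \<in> carrier (val K c)"
    "b Y n = act P Y (Sg X) h p" "a c k' = act N c Y g n" "k = act K X c f k'"
  shows "conn X p k"
  using assms unfolding conn_def by blast

lemma connE:
  assumes "conn X p k"
  obtains c Y f g h n k' where "c \<in> S" "(X, c, Y, f, g, h) \<in> Tri T" "X \<in> Obj T" "Y \<in> Obj T" "f \<in> Mor T X c" "g \<in> Mor T c Y" "h \<in> Mor T Y (Sg X)"
    "n \<in> carrier (val N Y)" "k' \<in> carrier (val K c)"
    "b Y n = act P Y (Sg X) h p" "a c k' = act N c Y g n" "k = act K X c f k'"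
proof -
  from assms obtain c Y f g h n k' where *: "c \<in> S" "(X, c, Y, f, g, h) \<in> Tri T" "n \<in> carrier (val N Y)" "k' \<in> carrier (val K c)"
    "b Y n = act P Y (Sg X) h p" "a c k' = act N c Y g n" "k = act K X c f k'" unfolding conn_def by blast
  with that Tri_typed[OF *(2)] show ?thesis by blast
qed

lemma conn_in: "conn X p k \<Longrightarrow> k \<in> carrier (val K X)"
  by (erule connE) auto

lemma conn_total:
  assumes X: "X \<in> Obj T" and p: "p \<in> carrier (val P (Sg X))" shows "\<exists>k. conn X p k"
proof -
  obtain Y h n where h: "h \<in> cov Y (Sg X)" "n \<in> carrier (val N Y)" "b Y n = act P Y (Sg X) h p"
    using surj_loc[of "Sg X" p] X p by auto
  obtain c f g where c: "c \<in> S" "(X, c, Y, f, g, h) \<in> Tri T" using cov_shift_triangle[OF h(1) X] by blast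
  note ty = Tri_typed[OF c(2)]
  have "b c (act N c Y g n) = \<one>\<^bsub>val P c\<^esub>"
    using b.tr_act[of c Y g n] h p ty P.act_cmp_zero[OF tri_zero'(1)[OF c(2)]] by simp
  then obtain k' where "k' \<in> carrier (val K c)" "a c k' = act N c Y g n"
    using mid_on_S[OF c(1), of "act N c Y g n"] h ty by auto
  with c h show ?thesis using connI by blast
qed

text \<open>The two triangles are merged over the biproduct of \<open>c\<close> and
  \<open>c'\<close>. The third object \<open>Z\<close> of the triangle on \<open>(f, f')\<close>
  maps to \<open>Y\<close> and to \<open>Y'\<close> compatibly with the morphisms to
  \<open>Sg X\<close>, so the two lifts can be added on it.\<close>

lemma conn_mult:
  assumes r: "conn X p1 k1" "conn X p2 k2" and p: "p1 \<in> carrier (val P (Sg X))" "p2 \<in> carrier (val P (Sg X))"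
  shows "conn X (p1 \<otimes>\<^bsub>val P (Sg X)\<^esub> p2) (k1 \<otimes>\<^bsub>val K X\<^esub> k2)"
proof -
  obtain c Y f g h n k where 1: "c \<in> S" "(X, c, Y, f, g, h) \<in> Tri T" "X \<in> Obj T" "Y \<in> Obj T" "f \<in> Mor T X c" "g \<in> Mor T c Y" "h \<in> Mor T Y (Sg X)"
    "n \<in> carrier (val N Y)" "k \<in> carrier (val K c)" "b Y n = act P Y (Sg X) h p1" "a c k = act N c Y g n" "k1 = act K X c f k"
    using r(1) by (rule connE)
  obtain c' Y' f' g' h' n' k' where 2: "c' \<in> S" "(X, c', Y', f', g', h') \<in> Tri T" "X \<in> Obj T" "Y' \<in> Obj T" "f' \<in> Mor T X c'" "g' \<in> Mor T c' Y'" "h' \<in> Mor T Y' (Sg X)"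
    "n' \<in> carrier (val N Y')" "k' \<in> carrier (val K c')" "b Y' n' = act P Y' (Sg X) h' p2" "a c' k' = act N c' Y' g' n'" "k2 = act K X c' f' k'"
    using r(2) by (rule connE)
  obtain D i j u v where D: "D \<in> Obj T" "biproduct T c c' D i j u v" using biproduct_ex 1(1) 2(1) sub_Obj by metis
  have DS: "D \<in> S" using sub_biproduct[OF 1(1) 2(1) D] .
  have ij: "i \<in> Mor T c D" "j \<in> Mor T c' D" "u \<in> Mor T D c" "v \<in> Mor T D c'" "Cmp T c D c u i = Idt T c" "Cmp T c' D c' v j = Idt T c'"
    using D(2) by (auto simp: biproduct_def)
  note o = biproduct_orth[OF D(2) sub_Obj[OF 1(1)] sub_Obj[OF 2(1)] D(1)]
  let ?f = "Cmp T X c D i f \<otimes>\<^bsub>Hom T X D\<^esub> Cmp T X c' D j f'"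
  note [simp] = 1(3-7) 2(4-7) D(1) ij(1-4) sub_Obj[OF 1(1)] sub_Obj[OF 2(1)] 1(8,9) 2(8,9) p
  interpret Xc: comm_group "Hom T X c" by (rule hom_group) auto
  interpret Xc': comm_group "Hom T X c'" by (rule hom_group) auto
  have "Cmp T X D c u ?f = Cmp T X c c (Cmp T c D c u i) f \<otimes>\<^bsub>Hom T X c\<^esub> Cmp T X c' c (Cmp T c' D c u j) f'"
    by (simp add: cmp_add_right cmp_assoc)
  then have uf: "Cmp T X D c u ?f = f" unfolding ij(5) o(2) by simp
  have "Cmp T X D c' v ?f = Cmp T X c c' (Cmp T c D c' v i) f \<otimes>\<^bsub>Hom T X c'\<^esub> Cmp T X c' c' (Cmp T c' D c' v j) f'"
    by (simp add: cmp_add_right cmp_assoc)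
  then have vf: "Cmp T X D c' v ?f = f'" unfolding ij(6) o(1) by simp
  have f: "?f \<in> Mor T X D" by auto
  obtain Z g3 h3 where Z: "(X, D, Z, ?f, g3, h3) \<in> Tri T" using TR1_cone[OF 1(3) D(1) f] by blast
  have tZ: "Z \<in> Obj T" "g3 \<in> Mor T D Z" "h3 \<in> Mor T Z (Sg X)" using Tri_typed[OF Z] by auto
  note [simp] = tZ
  obtain y where y: "y \<in> Mor T Z Y" "Cmp T D Z Y y g3 = Cmp T D c Y g u" "Cmp T Z (Sg X) (Sg X) (sg X X (Idt T X)) h3 = Cmp T Z Y (Sg X) h y"
    using TR3[OF Z 1(2), of "Idt T X" u] uf by auto
  obtain y' where y': "y' \<in> Mor T Z Y'" "Cmp T D Z Y' y' g3 = Cmp T D c' Y' g' v" "Cmp T Z (Sg X) (Sg X) (sg X X (Idt T X)) h3 = Cmp T Z Y' (Sg X) h' y'"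
    using TR3[OF Z 2(2), of "Idt T X" v] vf by auto
  have i: "Cmp T Z (Sg X) (Sg X) (sg X X (Idt T X)) h3 = h3" by simp
  have h3: "Cmp T Z Y (Sg X) h y = h3" "Cmp T Z Y' (Sg X) h' y' = h3" by (rule y(3)[unfolded i, symmetric], rule y'(3)[unfolded i, symmetric])
  note [simp] = y(1) y'(1)
  let ?n = "act N Z Y y n \<otimes>\<^bsub>val N Z\<^esub> act N Z Y' y' n'" and ?k = "act K D c u k \<otimes>\<^bsub>val K D\<^esub> act K D c' v k'"
  show ?thesis
  proof (rule connI[OF DS Z])
    show "?n \<in> carrier (val N Z)" "?k \<in> carrier (val K D)" by auto
    have "b Z ?n = act P Z Y y (act P Y (Sg X) h p1) \<otimes>\<^bsub>val P Z\<^esub> act P Z Y' y' (act P Y' (Sg X) h' p2)"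
      using b.tr_act[of Z Y y n] b.tr_act[of Z Y' y' n'] 1(10) 2(10) by (simp add: b.tr_mult)
    also have "\<dots> = act P Z (Sg X) h3 (p1 \<otimes>\<^bsub>val P (Sg X)\<^esub> p2)"
      by (simp add: P.act_cmp[symmetric] h3 P.act_mult)
    finally show "b Z ?n = act P Z (Sg X) h3 (p1 \<otimes>\<^bsub>val P (Sg X)\<^esub> p2)" .
    have "a D ?k = act N D c u (act N c Y g n) \<otimes>\<^bsub>val N D\<^esub> act N D c' v (act N c' Y' g' n')"
      using a.tr_act[of D c u k] a.tr_act[of D c' v k'] 1(11) 2(11) by (simp add: a.tr_mult)
    also have "\<dots> = act N D Z g3 ?n"
      by (simp add: N.act_mult N.act_cmp[symmetric] y(2) y'(2))
    finally show "a D ?k = act N D Z g3 ?n" .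
    show "k1 \<otimes>\<^bsub>val K X\<^esub> k2 = act K X D ?f ?k"
      unfolding 1(12) 2(12) using f uf vf by (simp add: K.act_mult K.act_cmp[symmetric])
  qed
qed

lemma conn_inv:
  assumes r: "conn X p k" and p: "p \<in> carrier (val P (Sg X))"
  shows "conn X (inv\<^bsub>val P (Sg X)\<^esub> p) (inv\<^bsub>val K X\<^esub> k)"
proof -
  obtain c Y f g h n k' where 1: "c \<in> S" "(X, c, Y, f, g, h) \<in> Tri T" "X \<in> Obj T" "Y \<in> Obj T" "f \<in> Mor T X c" "g \<in> Mor T c Y" "h \<in> Mor T Y (Sg X)"
    "n \<in> carrier (val N Y)" "k' \<in> carrier (val K c)" "b Y n = act P Y (Sg X) h p" "a c k' = act N c Y g n" "k = act K X c f k'"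
    using r by (rule connE)
  show ?thesis
    by (rule connI[OF 1(1,2), of "inv\<^bsub>val N Y\<^esub> n" "inv\<^bsub>val K c\<^esub> k'"])
      (use 1 p in \<open>simp_all add: a.tr_inv b.tr_inv N.act_inv P.act_inv K.act_inv\<close>)
qed

text \<open>A lift \<open>n\<close> of zero comes from \<open>K\<close> by \<open>exact_mid\<close>.
  Then \<open>k'\<close> is restricted from \<open>Y\<close>, and the composite
  \<open>X \<rightarrow> c \<rightarrow> Y\<close> is zero. With additivity this yields uniqueness
  in general.\<close>

lemma conn_one:
  assumes r: "conn X \<one>\<^bsub>val P (Sg X)\<^esub> k" shows "k = \<one>\<^bsub>val K X\<^esub>"
proof -
  obtain c Y f g h n k' where 1: "c \<in> S" "(X, c, Y, f, g, h) \<in> Tri T" "X \<in> Obj T" "Y \<in> Obj T" "f \<in> Mor T X c" "g \<in> Mor T c Y" "h \<in> Mor T Y (Sg X)"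
    "n \<in> carrier (val N Y)" "k' \<in> carrier (val K c)" "b Y n = act P Y (Sg X) h \<one>\<^bsub>val P (Sg X)\<^esub>" "a c k' = act N c Y g n" "k = act K X c f k'"
    using r by (rule connE)
  then obtain k1 where k1: "k1 \<in> carrier (val K Y)" "a Y k1 = n" using exact_mid[of Y n] by auto
  have "a c k' = a c (act K c Y g k1)" using a.tr_act[of c Y g k1] k1 1 by simp
  then have "k' = act K c Y g k1" using inj_on_S'[OF 1(1)] 1 k1 by simp
  then show ?thesis unfolding 1(12) using K.act_cmp_zero[OF tri_zero[OF 1(2)]] 1 k1 by simp
qed

lemma conn_unique:
  assumes r: "conn X p k" "conn X p k'" and p: "p \<in> carrier (val P (Sg X))" and X: "X \<in> Obj T"
  shows "k = k'"
proof -
  interpret PX: comm_group "val P (Sg X)" using P.val_comm_group X by simp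
  have "conn X \<one>\<^bsub>val P (Sg X)\<^esub> (k \<otimes>\<^bsub>val K X\<^esub> inv\<^bsub>val K X\<^esub> k')"
    using conn_mult[OF r(1) conn_inv[OF r(2) p] p] p by simp
  then show ?thesis using conn_one K.val_div_eq_one_iff[OF X conn_in[OF r(1)] conn_in[OF r(2)]] by blast
qed

text \<open>Keep \<open>c\<close> and compose \<open>f\<close> with \<open>u\<close>; the triangle
  on the composite maps to the old one.\<close>

lemma conn_act:
  assumes r: "conn X p k" and p: "p \<in> carrier (val P (Sg X))" and u: "X1 \<in> Obj T" "u \<in> Mor T X1 X"
  shows "conn X1 (act P (Sg X1) (Sg X) (sg X1 X u) p) (act K X1 X u k)"
proof -
  obtain c Y f g h n k' where 1: "c \<in> S" "(X, c, Y, f, g, h) \<in> Tri T" "X \<in> Obj T" "Y \<in> Obj T" "f \<in> Mor T X c" "g \<in> Mor T c Y" "h \<in> Mor T Y (Sg X)"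
    "n \<in> carrier (val N Y)" "k' \<in> carrier (val K c)" "b Y n = act P Y (Sg X) h p" "a c k' = act N c Y g n" "k = act K X c f k'"
    using r by (rule connE)
  have co: "c \<in> Obj T" using 1 by simp
  have fu: "Cmp T X1 X c f u \<in> Mor T X1 c" using 1 u by auto
  obtain Y1 g1 h1 where Y1: "(X1, c, Y1, Cmp T X1 X c f u, g1, h1) \<in> Tri T" using TR1_cone[OF u(1) co fu] by blast
  have t1: "Y1 \<in> Obj T" "g1 \<in> Mor T c Y1" "h1 \<in> Mor T Y1 (Sg X1)" using Tri_typed[OF Y1] by auto
  obtain y where y: "y \<in> Mor T Y1 Y" "Cmp T c Y1 Y y g1 = g" "Cmp T Y1 (Sg X1) (Sg X) (sg X1 X u) h1 = Cmp T Y1 Y (Sg X) h y"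
    using TR3[OF Y1 1(2), of u "Idt T c"] u 1 co by auto
  show ?thesis
  proof (rule connI[OF 1(1) Y1])
    show "act N Y1 Y y n \<in> carrier (val N Y1)" "k' \<in> carrier (val K c)" using y 1 t1 by auto
    have "b Y1 (act N Y1 Y y n) = act P Y1 Y y (act P Y (Sg X) h p)" using b.tr_act[of Y1 Y y n] y 1 t1 by simp
    also have "\<dots> = act P Y1 (Sg X1) h1 (act P (Sg X1) (Sg X) (sg X1 X u) p)"
      by (rule P.act_square[OF y(3)[symmetric]]) (use y 1 t1 u p in auto)
    finally show "b Y1 (act N Y1 Y y n) = act P Y1 (Sg X1) h1 (act P (Sg X1) (Sg X) (sg X1 X u) p)" .
    show "a c k' = act N c Y1 g1 (act N Y1 Y y n)" using y t1 1 co by (simp add: N.act_cmp[symmetric])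
    show "act K X1 X u k = act K X1 c (Cmp T X1 X c f u) k'" unfolding 1(12) using 1 u by (simp add: K.act_cmp)
  qed
qed

lemma conn_b:
  assumes X: "X \<in> Obj T" and n: "n \<in> carrier (val N (Sg X))" shows "conn X (b (Sg X) n) \<one>\<^bsub>val K X\<^esub>"
proof -
  \<comment> \<open>A lift exists over \<open>Sg X\<close> itself, so \<open>c\<close> can be taken
    to be a zero object.\<close>
  obtain Z where Z: "zero_object T Z" using zero_ex by blast
  have ZS: "Z \<in> S" using sub_zero[OF Z] .
  obtain Y g h where Y: "(X, Z, Y, \<one>\<^bsub>Hom T X Z\<^esub>, g, h) \<in> Tri T" using TR1_cone[of X Z "\<one>\<^bsub>Hom T X Z\<^esub>"] X ZS by auto
  note ty = Tri_typed[OF Y]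
  show ?thesis
  proof (rule connI[OF ZS Y])
    show "act N Y (Sg X) h n \<in> carrier (val N Y)" "\<one>\<^bsub>val K Z\<^esub> \<in> carrier (val K Z)" using ty n by auto
    show "b Y (act N Y (Sg X) h n) = act P Y (Sg X) h (b (Sg X) n)" using b.tr_act ty n by simp
    show "a Z \<one>\<^bsub>val K Z\<^esub> = act N Z Y g (act N Y (Sg X) h n)" using ty n N.act_cmp_zero[OF tri_zero'(1)[OF Y]] by simp
    show "\<one>\<^bsub>val K X\<^esub> = act K X Z \<one>\<^bsub>Hom T X Z\<^esub> \<one>\<^bsub>val K Z\<^esub>" using ty by simp
  qed
qed

text \<open>The element on \<open>c\<close> vanishes on \<open>X\<close>, so it comes from
  \<open>k1\<close> on \<open>Y\<close>, and \<open>n - a k1\<close> comes from \<open>n0\<close> on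
  \<open>Sg X\<close>. The remaining error in \<open>p\<close> comes from \<open>Sg c\<close>, an
  object of \<open>S\<close>, where \<open>b\<close> is onto.\<close>

lemma conn_exact_P:
  assumes r: "conn X p \<one>\<^bsub>val K X\<^esub>" and p: "p \<in> carrier (val P (Sg X))"
  shows "\<exists>n\<in>carrier (val N (Sg X)). b (Sg X) n = p"
proof -
  obtain c Y f g h n k where 1: "c \<in> S" "(X, c, Y, f, g, h) \<in> Tri T" "X \<in> Obj T" "Y \<in> Obj T" "f \<in> Mor T X c" "g \<in> Mor T c Y" "h \<in> Mor T Y (Sg X)"
    "n \<in> carrier (val N Y)" "k \<in> carrier (val K c)" "b Y n = act P Y (Sg X) h p" "a c k = act N c Y g n" "\<one>\<^bsub>val K X\<^esub> = act K X c f k"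
    using r by (rule connE)
  note r1 = tri_rot[OF 1(2)]
  note r2 = tri_rot[OF r1]
  obtain k1 where k1: "k1 \<in> carrier (val K Y)" "act K c Y g k1 = k" using K.exact[OF 1(2,9) 1(12)[symmetric]] .
  interpret PX: comm_group "val P (Sg X)" using P.val_comm_group 1(3) by simp
  let ?n = "n \<otimes>\<^bsub>val N Y\<^esub> inv\<^bsub>val N Y\<^esub> a Y k1"
  have nin: "?n \<in> carrier (val N Y)" using 1 k1 by simp
  have "act N c Y g (a Y k1) = act N c Y g n" using a.tr_act[of c Y g k1] k1 1 by simp
  then have "act N c Y g ?n = \<one>\<^bsub>val N c\<^esub>" using 1 k1 by (simp add: N.act_mult N.act_inv N.val_div_eq_one_iff)
  then obtain n0 where n0: "n0 \<in> carrier (val N (Sg X))" "act N Y (Sg X) h n0 = ?n" using N.exact[OF r1 nin] by blast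
  let ?p = "p \<otimes>\<^bsub>val P (Sg X)\<^esub> inv\<^bsub>val P (Sg X)\<^esub> b (Sg X) n0"
  have pin: "?p \<in> carrier (val P (Sg X))" using p n0 1 by simp
  have "act P Y (Sg X) h (b (Sg X) n0) = b Y ?n" using b.tr_act[of Y "Sg X" h n0] n0 1 by simp
  also have "\<dots> = b Y n" using 1 k1 p ba[of Y k1] by (simp add: b.tr_div)
  finally have "act P Y (Sg X) h ?p = \<one>\<^bsub>val P Y\<^esub>" using p n0 1 by (simp add: P.act_mult P.act_inv P.val_div_eq_one_iff)
  then obtain p1 where p1: "p1 \<in> carrier (val P (Sg c))" "act P (Sg X) (Sg c) (inv\<^bsub>Hom T (Sg X) (Sg c)\<^esub> (sg X c f)) p1 = ?p"
    using P.exact[OF r2 pin] by blast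
  obtain n1 where n1: "n1 \<in> carrier (val N (Sg c))" "b (Sg c) n1 = p1" using surj_on_S[of "Sg c" p1] p1 1 by auto
  let ?w = "inv\<^bsub>Hom T (Sg X) (Sg c)\<^esub> (sg X c f)"
  have w: "?w \<in> Mor T (Sg X) (Sg c)" using 1 by simp
  have "b (Sg X) (n0 \<otimes>\<^bsub>val N (Sg X)\<^esub> act N (Sg X) (Sg c) ?w n1) = b (Sg X) n0 \<otimes>\<^bsub>val P (Sg X)\<^esub> ?p"
    using b.tr_act[of "Sg X" "Sg c" ?w n1] n0 n1 p1 1 w by (simp add: b.tr_mult)
  also have "\<dots> = p" using p n0 1 by (simp add: PX.mult_div_cancel)
  finally show ?thesis using n0 n1 w 1 by (intro bexI[of _ "n0 \<otimes>\<^bsub>val N (Sg X)\<^esub> act N (Sg X) (Sg c) ?w n1"]) auto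
qed

lemma conn_a: assumes r: "conn X p k" shows "a X k = \<one>\<^bsub>val N X\<^esub>"
proof -
  obtain c Y f g h n k' where 1: "c \<in> S" "(X, c, Y, f, g, h) \<in> Tri T" "X \<in> Obj T" "Y \<in> Obj T" "f \<in> Mor T X c" "g \<in> Mor T c Y" "h \<in> Mor T Y (Sg X)"
    "n \<in> carrier (val N Y)" "k' \<in> carrier (val K c)" "b Y n = act P Y (Sg X) h p" "a c k' = act N c Y g n" "k = act K X c f k'"
    using r by (rule connE)
  show ?thesis unfolding 1(12) using a.tr_act[of X c f k'] N.act_cmp_zero[OF tri_zero[OF 1(2)]] 1 by simp
qed

text \<open>\<open>k\<close> vanishes on a covering, so it comes from the cone \<open>c\<close> of
  that covering. In the triangle on \<open>X \<rightarrow> c\<close>, exactness of \<open>N\<close>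
  and then of \<open>P\<close> produces \<open>n\<close> on \<open>Y\<close> and \<open>p\<close> on
  \<open>Sg X\<close>.\<close>

lemma conn_exact_K:
  assumes X: "X \<in> Obj T" and k: "k \<in> carrier (val K X)" "a X k = \<one>\<^bsub>val N X\<^esub>"
  shows "\<exists>p\<in>carrier (val P (Sg X)). conn X p k"
proof -
  obtain X' s where s: "s \<in> cov X' X" "act K X' X s k = \<one>\<^bsub>val K X'\<^esub>" using inj_loc[OF X k] by blast
  obtain c f w where c: "c \<in> S" "(X', X, c, s, f, w) \<in> Tri T" using s(1) by (rule covE)
  have f: "f \<in> Mor T X c" "c \<in> Obj T" using Tri_typed[OF c(2)] by auto
  obtain k' where k': "k' \<in> carrier (val K c)" "act K X c f k' = k" using K.exact[OF c(2) k(1) s(2)] .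
  obtain Y g h where Y: "(X, c, Y, f, g, h) \<in> Tri T" using TR1_cone[OF X f(2,1)] by blast
  note ty = Tri_typed[OF Y]
  have "act N X c f (a c k') = \<one>\<^bsub>val N X\<^esub>" using a.tr_act[of X c f k'] k' k f X by simp
  then obtain n where n: "n \<in> carrier (val N Y)" "act N c Y g n = a c k'" using N.exact[OF Y, of "a c k'"] k' f by auto
  have "act P c Y g (b Y n) = \<one>\<^bsub>val P c\<^esub>" using b.tr_act[of c Y g n] n ty ba[of c k'] k' by simp
  then obtain p where p: "p \<in> carrier (val P (Sg X))" "act P Y (Sg X) h p = b Y n" using P.exact[OF tri_rot[OF Y], of "b Y n"] n ty by auto
  have "conn X p k" by (rule connI[OF c(1) Y n(1) k'(1)]) (use p n k' in simp_all)
  with p show ?thesis by blast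
qed

text \<open>\<open>conn\<close> describes a map from \<open>P (Sg X)\<close> to \<open>K X\<close>.
  For \<open>X = Dg Y\<close> the counit identifies its source with the value of \<open>P\<close> at
  \<open>Y\<close>.\<close>

definition del where
  "del = (\<lambda>Y\<in>Obj T. \<lambda>p\<in>carrier (val P Y). THE k. conn (Dg Y) (act P (Sg (Dg Y)) Y (Counit T Y) p) k)"

lemma del_conn:
  assumes Y: "Y \<in> Obj T" "p \<in> carrier (val P Y)"
  shows "conn (Dg Y) (act P (Sg (Dg Y)) Y (Counit T Y) p) (del Y p)"
proof -
  have p: "act P (Sg (Dg Y)) Y (Counit T Y) p \<in> carrier (val P (Sg (Dg Y)))" using Y by auto
  obtain k where k: "conn (Dg Y) (act P (Sg (Dg Y)) Y (Counit T Y) p) k" using conn_total[OF _ p] Y by auto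
  then have "(THE k. conn (Dg Y) (act P (Sg (Dg Y)) Y (Counit T Y) p) k) = k"
    using conn_unique[OF _ _ p] Y by blast
  with k Y show ?thesis by (simp add: del_def)
qed

lemma del_eqI:
  assumes "conn (Dg Y) (act P (Sg (Dg Y)) Y (Counit T Y) p) k" "Y \<in> Obj T" "p \<in> carrier (val P Y)"
  shows "del Y p = k"
  by (rule conn_unique[OF del_conn[OF assms(2,3)] assms(1)]) (use assms in auto)

lemma del_transf: "del \<in> transf T P (fob (push T (Des T)) K)"
proof (rule transfI)
  fix Y p assume Y: "Y \<in> Obj T" "p \<in> carrier (val P Y)"
  show "del Y p \<in> carrier (val (fob (push T (Des T)) K) Y)" using conn_in[OF del_conn[OF Y]] by simp
next
  fix Y p q assume Y: "Y \<in> Obj T" "p \<in> carrier (val P Y)" "q \<in> carrier (val P Y)"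
  have "conn (Dg Y) (act P (Sg (Dg Y)) Y (Counit T Y) (p \<otimes>\<^bsub>val P Y\<^esub> q)) (del Y p \<otimes>\<^bsub>val K (Dg Y)\<^esub> del Y q)"
    using conn_mult[OF del_conn[OF Y(1,2)] del_conn[OF Y(1,3)]] Y by (simp add: P.act_mult)
  then show "del Y (p \<otimes>\<^bsub>val P Y\<^esub> q) = del Y p \<otimes>\<^bsub>val (fob (push T (Des T)) K) Y\<^esub> del Y q"
    using Y by (simp add: del_eqI)
next
  fix X Y f p assume Y: "X \<in> Obj T" "Y \<in> Obj T" "f \<in> Mor T X Y" "p \<in> carrier (val P Y)"
  have "act P (Sg (Dg X)) (Sg (Dg Y)) (sg (Dg X) (Dg Y) (dg X Y f)) (act P (Sg (Dg Y)) Y (Counit T Y) p)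
      = act P (Sg (Dg X)) X (Counit T X) (act P X Y f p)"
    by (rule P.act_square[OF counit_natural[OF Y(1-3)]]) (use Y in auto)
  then have "conn (Dg X) (act P (Sg (Dg X)) X (Counit T X) (act P X Y f p)) (act K (Dg X) (Dg Y) (dg X Y f) (del Y p))"
    using conn_act[OF del_conn[OF Y(2,4)], of "Dg X" "dg X Y f"] Y by simp
  then show "del X (act P X Y f p) = act (fob (push T (Des T)) K) X Y f (del Y p)" using Y by (simp add: del_eqI)
qed (auto simp: del_def)

lemma ex_at_mid: "Y \<in> Obj T \<Longrightarrow> exact_at (val K Y) (val N Y) (val P Y) (a Y) (b Y)"
  unfolding exact_at_def kernel_def using exact_mid a.tr_hom b.tr_hom ba by fastforce

lemma del_iff:
  assumes Y: "Y \<in> Obj T" "p \<in> carrier (val P Y)"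
  shows "del Y p = \<one>\<^bsub>val K (Dg Y)\<^esub> \<longleftrightarrow> (\<exists>n\<in>carrier (val N Y). b Y n = p)"
proof
  assume "del Y p = \<one>\<^bsub>val K (Dg Y)\<^esub>"
  then have c: "conn (Dg Y) (act P (Sg (Dg Y)) Y (Counit T Y) p) \<one>\<^bsub>val K (Dg Y)\<^esub>" using del_conn[OF Y] by simp
  obtain n where n: "n \<in> carrier (val N (Sg (Dg Y)))" "b (Sg (Dg Y)) n = act P (Sg (Dg Y)) Y (Counit T Y) p"
    using conn_exact_P[OF c] Y by auto
  have "b Y (act N Y (Sg (Dg Y)) (counit_inv Y) n) = act P Y (Sg (Dg Y)) (counit_inv Y) (act P (Sg (Dg Y)) Y (Counit T Y) p)"
    using b.tr_act[of Y "Sg (Dg Y)" "counit_inv Y" n] n Y by simp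
  also have "\<dots> = p" by (rule P.act_inverse[OF inverse_mors_sym[OF counit_inverse]]) (use Y in auto)
  finally show "\<exists>n\<in>carrier (val N Y). b Y n = p" using n Y by (intro bexI[of _ "act N Y (Sg (Dg Y)) (counit_inv Y) n"]) auto
next
  assume "\<exists>n\<in>carrier (val N Y). b Y n = p"
  then obtain n where n: "n \<in> carrier (val N Y)" "b Y n = p" by blast
  have "conn (Dg Y) (b (Sg (Dg Y)) (act N (Sg (Dg Y)) Y (Counit T Y) n)) \<one>\<^bsub>val K (Dg Y)\<^esub>" using n Y by (intro conn_b) auto
  then show "del Y p = \<one>\<^bsub>val K (Dg Y)\<^esub>" using b.tr_act[of "Sg (Dg Y)" Y "Counit T Y" n] n Y by (intro del_eqI) auto
qed

lemma ex_at_right: assumes Y: "Y \<in> Obj T" shows "exact_at (val N Y) (val P Y) (val K (Dg Y)) (b Y) (del Y)"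
proof -
  have "del Y \<in> hom (val P Y) (val K (Dg Y))" using transfD(1)[OF del_transf Y] by simp
  moreover have "b Y ` carrier (val N Y) = kernel (val P Y) (val K (Dg Y)) (del Y)"
  proof
    show "b Y ` carrier (val N Y) \<subseteq> kernel (val P Y) (val K (Dg Y)) (del Y)"
    proof
      fix p assume "p \<in> b Y ` carrier (val N Y)"
      then obtain n where "n \<in> carrier (val N Y)" "b Y n = p" by blast
      moreover from this have "p \<in> carrier (val P Y)" using Y by auto
      ultimately show "p \<in> kernel (val P Y) (val K (Dg Y)) (del Y)" using del_iff[OF Y] by (auto simp: kernel_def)
    qed
    show "kernel (val P Y) (val K (Dg Y)) (del Y) \<subseteq> b Y ` carrier (val N Y)"
    proof
      fix p assume "p \<in> kernel (val P Y) (val K (Dg Y)) (del Y)"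
      then have "p \<in> carrier (val P Y)" "del Y p = \<one>\<^bsub>val K (Dg Y)\<^esub>" by (auto simp: kernel_def)
      then show "p \<in> b Y ` carrier (val N Y)" using del_iff[OF Y] by auto
    qed
  qed
  ultimately show ?thesis unfolding exact_at_def using b.tr_hom[OF Y] by simp
qed

lemma ex_at_left: assumes Y: "Y \<in> Obj T" shows "exact_at (val P Y) (val K (Dg Y)) (val N (Dg Y)) (del Y) (a (Dg Y))"
proof -
  have h: "del Y \<in> hom (val P Y) (val K (Dg Y))" using transfD(1)[OF del_transf Y] by simp
  have "del Y ` carrier (val P Y) = kernel (val K (Dg Y)) (val N (Dg Y)) (a (Dg Y))"
  proof
    show "del Y ` carrier (val P Y) \<subseteq> kernel (val K (Dg Y)) (val N (Dg Y)) (a (Dg Y))"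
      using conn_a[OF del_conn[OF Y]] conn_in[OF del_conn[OF Y]] by (auto simp: kernel_def)
    show "kernel (val K (Dg Y)) (val N (Dg Y)) (a (Dg Y)) \<subseteq> del Y ` carrier (val P Y)"
    proof
      fix k assume "k \<in> kernel (val K (Dg Y)) (val N (Dg Y)) (a (Dg Y))"
      then obtain p where p: "p \<in> carrier (val P (Sg (Dg Y)))" "conn (Dg Y) p k"
        using conn_exact_K[of "Dg Y" k] Y by (auto simp: kernel_def)
      let ?p = "act P Y (Sg (Dg Y)) (counit_inv Y) p"
      have "act P (Sg (Dg Y)) Y (Counit T Y) ?p = p" by (rule P.act_inverse[OF counit_inverse]) (use Y p in auto)
      then have "del Y ?p = k" using p Y by (intro del_eqI) auto
      then show "k \<in> del Y ` carrier (val P Y)" using p Y by (intro image_eqI[of _ _ ?p]) auto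
    qed
  qed
  then show ?thesis unfolding exact_at_def using h a.tr_hom[of "Dg Y"] Y by simp
qed

end

text \<open>Applying the transformations to the two elements that witness \<open>conn\<close> gives
  witnesses over the same triangle.\<close>

lemma del_natural:
  assumes 1: "snake T S K N P a b" and 2: "snake T S K' N' P' a' b'"
    and k: "\<kappa> \<in> transf T K K'" and n: "\<nu> \<in> transf T N N'" and p: "\<pi> \<in> transf T P P'"
    and c1: "\<And>X x. X \<in> Obj T \<Longrightarrow> x \<in> carrier (val K X) \<Longrightarrow> a' X (\<kappa> X x) = \<nu> X (a X x)"
    and c2: "\<And>X x. X \<in> Obj T \<Longrightarrow> x \<in> carrier (val N X) \<Longrightarrow> b' X (\<nu> X x) = \<pi> X (b X x)"
    and Y: "Y \<in> Obj T" "y \<in> carrier (val P Y)"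
  shows "snake.del T S K' N' P' a' b' Y (\<pi> Y y) = \<kappa> (fob (Des T) Y) (snake.del T S K N P a b Y y)"
proof -
  interpret A: snake T S K N P a b by fact
  interpret B: snake T S K' N' P' a' b' by fact
  have "B.conn X (\<pi> (A.Sg X) x) (\<kappa> X z)" if r: "A.conn X x z" and x: "x \<in> carrier (val P (A.Sg X))" for X x z
  proof -
    obtain c Y f g h m k' where 1: "c \<in> S" "(X, c, Y, f, g, h) \<in> Tri T" "X \<in> Obj T" "Y \<in> Obj T" "f \<in> Mor T X c" "g \<in> Mor T c Y" "h \<in> Mor T Y (A.Sg X)"
      "m \<in> carrier (val N Y)" "k' \<in> carrier (val K c)" "b Y m = act P Y (A.Sg X) h x" "a c k' = act N c Y g m" "z = act K X c f k'"
      using r by (rule A.connE)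
    show ?thesis
      by (rule B.connI[OF 1(1,2), of "\<nu> Y m" "\<kappa> c k'"])
        (use 1 x in \<open>simp_all add: transf_in[OF k] transf_in[OF n] c1 c2 transfD(4)[OF k] transfD(4)[OF n] transfD(4)[OF p]\<close>)
  qed
  from this[OF A.del_conn[OF Y]] show ?thesis
    using Y transfD(4)[OF p, of "A.Sg (A.Dg Y)" Y "Counit T Y" y] transf_in[OF p Y] by (intro B.del_eqI) auto
qed

section \<open>Long exact sequences\<close>

lemma fcomp_fid: "fcomp fid f = (f :: ('a, 'm, 'b, 'n) func)"
  by (simp add: fcomp_def fid_def)

lemma Sigma_coh_pos: "Sigma_coh T (int k) = fpow k (push T (Des T))"
  by (simp add: Sigma_coh_def)

lemma Sigma_coh_neg: "Sigma_coh T (- int k) = fpow k (push T (Sus T))"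
  by (cases "k = 0") (simp_all add: Sigma_coh_def)

lemma Sigma_coh_one: "Sigma_coh T 1 = push T (Des T)"
  using Sigma_coh_pos[of T 1] by (simp add: fcomp_fid)

lemma fpow_push_val: "val (fob (fpow k (push T f)) G) Y = val G ((fob f ^^ k) Y)"
  by (induction k arbitrary: G) (simp_all add: fid_def fcomp_def push_def)

lemma fpow_push_mor:
  assumes "\<And>X. X \<in> Obj T \<Longrightarrow> fob f X \<in> Obj T" "Y \<in> Obj T"
  shows "fmor (fpow k (push T f)) F G \<phi> Y = \<phi> ((fob f ^^ k) Y)"
proof -
  have "(fob f ^^ k) Y \<in> Obj T" for k using assms by (induction k) auto
  then show ?thesis by (induction k arbitrary: F G \<phi>) (simp_all add: fid_def fcomp_def push_def)
qed

text \<open>The connecting maps in \<open>long_exact\<close> are compared with \<open>del\<close> on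
  carriers only, which is all that exactness sees.\<close>

lemma exact_at_cong:
  assumes "exact_at A B C f g" "\<And>x. x \<in> carrier A \<Longrightarrow> f x = f' x" "\<And>x. x \<in> carrier B \<Longrightarrow> g x = g' x"
    "group A" "group B"
  shows "exact_at A B C f' g'"
proof -
  have "f' ` carrier A = f ` carrier A" using assms(2) by auto
  moreover have "kernel B C g' = kernel B C g" using assms(3) by (auto simp: kernel_def)
  moreover have "f' \<in> hom A B" using assms(1,2,4)
    by (auto simp: exact_at_def hom_def Pi_def group.is_monoid monoid.m_closed)
  moreover have "g' \<in> hom B C" using assms(1,3,5)
    by (auto simp: exact_at_def hom_def Pi_def group.is_monoid monoid.m_closed)
  ultimately show ?thesis using assms(1) by (simp add: exact_at_def)
qed

text \<open>The sequence for \<open>\<Sigma>^n\<close> at \<open>Y\<close> is the one for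
  \<open>n = 0\<close> at a shifted object: \<open>Dg\<close> is applied \<open>n\<close> times if
  \<open>n\<close> is nonnegative, and \<open>Sg\<close> is applied \<open>-n\<close> times
  otherwise. In the second case the target of the connecting map is corrected by a unit
  isomorphism.\<close>

lemma (in tri_sub) long_exactI:
  fixes A B E :: "('o, 'm, 'x) coh_endo"
  assumes al: "nat_transf (Coh T) (Coh T) A B \<alpha>" and be: "nat_transf (Coh T) (Coh T) B E \<beta>"
    and sn: "\<And>F. coh T F \<Longrightarrow> snake T S (fob A F) (fob B F) (fob E F) (\<alpha> F) (\<beta> F)"
  shows "\<exists>\<delta>. long_exact T A B E \<alpha> \<beta> \<delta>"
proof
  let ?\<delta> = "\<lambda>F. snake.del T S (fob A F) (fob B F) (fob E F) (\<alpha> F) (\<beta> F)"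
  note fA = coh_nat_transfD(1)[OF al] and fB = coh_nat_transfD(1)[OF be] and fE = coh_nat_transfD(2)[OF be]
  have de: "nat_transf (Coh T) (Coh T) E (fcomp (Sigma_coh T 1) A) ?\<delta>"
    unfolding Sigma_coh_one
  proof (rule coh_nat_transfI[OF fE fcomp_functor[OF fA push_Des]])
    fix F :: "('o, 'm, 'x) presheaf" assume "coh T F"
    then interpret snake T S "fob A F" "fob B F" "fob E F" "\<alpha> F" "\<beta> F" by (rule sn)
    show "?\<delta> F \<in> transf T (fob E F) (fob (fcomp (push T (Des T)) A) F)" using del_transf by (simp add: fcomp_def)
  next
    fix F G :: "('o, 'm, 'x) presheaf" and \<phi> Y e
    assume F: "coh T F" "coh T G" "\<phi> \<in> transf T F G" "Y \<in> Obj T" "e \<in> carrier (val (fob E F) Y)"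
    have "?\<delta> G Y (fmor E F G \<phi> Y e) = fmor A F G \<phi> (Dg Y) (?\<delta> F Y e)"
      by (rule del_natural[OF sn[OF F(1)] sn[OF F(2)] coh_functorD(2)[OF fA F(1-3)] coh_functorD(2)[OF fB F(1-3)]
            coh_functorD(2)[OF fE F(1-3)] coh_nat_transfD(4)[OF al F(1-3)] coh_nat_transfD(4)[OF be F(1-3)] F(4,5)])
    then show "?\<delta> G Y (fmor E F G \<phi> Y e) = fmor (fcomp (push T (Des T)) A) F G \<phi> Y (?\<delta> F Y e)"
      using F(4) by (simp add: fcomp_def push_mor_apply)
  qed
  show "long_exact T A B E \<alpha> \<beta> ?\<delta>"
    unfolding long_exact_def Let_def
  proof (intro conjI allI ballI al be de)
    fix n F Y assume "F \<in> Obj (Coh T :: (('o, 'm, 'x) presheaf, 'o \<Rightarrow> 'x \<Rightarrow> 'x) acat)" and Y: "Y \<in> Obj T"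
    then have F: "coh T F" by (simp add: coh_iff)
    interpret s: snake T S "fob A F" "fob B F" "fob E F" "\<alpha> F" "\<beta> F" using F by (rule sn)
    have DO: "(Dg ^^ k) Y \<in> Obj T" for k using Y by (induction k) auto
    have SO: "(Sg ^^ k) Y \<in> Obj T" for k using Y by (induction k) auto
    note pD = fpow_push_val fpow_push_mor[of T "Des T" Y, OF Ds.fob_in Y] and pS = fpow_push_val fpow_push_mor[of T "Sus T" Y, OF S.fob_in Y]
    let ?A = "\<lambda>k. val (fob (Sigma_coh T k) (fob A F)) Y" and ?B = "\<lambda>k. val (fob (Sigma_coh T k) (fob B F)) Y"
      and ?E = "\<lambda>k. val (fob (Sigma_coh T k) (fob E F)) Y"
    let ?a = "\<lambda>k. fmor (Sigma_coh T k) (fob A F) (fob B F) (\<alpha> F) Y" and ?b = "\<lambda>k. fmor (Sigma_coh T k) (fob B F) (fob E F) (\<beta> F) Y"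
    let ?d = "Cmp (Coh T) (fob (Sigma_coh T n) (fob E F)) (fob (Sigma_coh T n) (fob (Sigma_coh T 1) (fob A F))) (fob (Sigma_coh T (n + 1)) (fob A F))
      (shift_iso T n (fob A F)) (fmor (Sigma_coh T n) (fob E F) (fob (Sigma_coh T 1) (fob A F)) (?\<delta> F)) Y"
    have "exact_at (?A n) (?B n) (?E n) (?a n) (?b n) \<and> exact_at (?B n) (?E n) (?A (n + 1)) (?b n) ?d \<and> exact_at (?E n) (?A (n + 1)) (?B (n + 1)) ?d (?a (n + 1))"
    proof (cases "0 \<le> n")
      case True
      then obtain k where k: "n = int k" using nonneg_int_cases by blast
      have k1: "n + 1 = int (Suc k)" using k by simp
      let ?Y = "(Dg ^^ k) Y"
      have d: "?d x = s.del ?Y x" if "x \<in> carrier (val (fob E F) ?Y)" for x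
        using that True Y DO[of k] transf_in[OF s.del_transf DO[of k] that]
        by (simp add: shift_iso_def k1 Sigma_coh_pos pD del: fpow.simps of_nat_Suc) (simp add: k Sigma_coh_pos pD del: fpow.simps)
      have vals: "?A n = val (fob A F) ?Y" "?B n = val (fob B F) ?Y" "?E n = val (fob E F) ?Y" "?a n = \<alpha> F ?Y" "?b n = \<beta> F ?Y"
        unfolding k Sigma_coh_pos by (simp_all add: pD)
      have vals1: "?A (n + 1) = val (fob A F) (Dg ?Y)" "?B (n + 1) = val (fob B F) (Dg ?Y)" "?a (n + 1) = \<alpha> F (Dg ?Y)"
        unfolding k1 Sigma_coh_pos by (simp_all add: pD del: fpow.simps)
      show ?thesis unfolding vals vals1
      proof (intro conjI)
        show "exact_at (val (fob A F) ?Y) (val (fob B F) ?Y) (val (fob E F) ?Y) (\<alpha> F ?Y) (\<beta> F ?Y)" by (rule s.ex_at_mid[OF DO])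
        show "exact_at (val (fob B F) ?Y) (val (fob E F) ?Y) (val (fob A F) (Dg ?Y)) (\<beta> F ?Y) ?d"
          by (rule exact_at_cong[OF s.ex_at_right[OF DO]]) (use d DO in auto)
        show "exact_at (val (fob E F) ?Y) (val (fob A F) (Dg ?Y)) (val (fob B F) (Dg ?Y)) ?d (\<alpha> F (Dg ?Y))"
          by (rule exact_at_cong[OF s.ex_at_left[OF DO]]) (use d DO in auto)
      qed
    next
      case False
      \<comment> \<open>Writing \<open>n = -(m + 1)\<close> exhibits the object as
        \<open>Sg ?Z\<close>. The connecting morphism then ends in the value of
        \<open>fob A F\<close> at \<open>Dg (Sg ?Z)\<close>, and the unit isomorphism
        \<open>?u\<close>, with inverse \<open>?v\<close>, moves it to the value at
        \<open>?Z\<close>.\<close>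
      then obtain m where m: "n = - int (Suc m)" by (metis negD not_le)
      have m1: "n + 1 = - int m" using m by simp
      let ?Z = "(Sg ^^ m) Y"
      have Z: "?Z \<in> Obj T" by (rule SO)
      let ?u = "act (fob A F) ?Z (Dg (Sg ?Z)) (Unit T ?Z)" and ?v = "act (fob A F) (Dg (Sg ?Z)) ?Z (unit_inv ?Z)"
      have uv: "?v (?u x) = x" if "x \<in> carrier (val (fob A F) (Dg (Sg ?Z)))" for x
        by (rule s.K.act_inverse[OF inverse_mors_sym[OF unit_inverse]]) (use Z that in auto)
      have vu: "?u (?v x) = x" if "x \<in> carrier (val (fob A F) ?Z)" for x
        by (rule s.K.act_inverse[OF unit_inverse]) (use Z that in auto)
      have vals: "?A n = val (fob A F) (Sg ?Z)" "?B n = val (fob B F) (Sg ?Z)" "?E n = val (fob E F) (Sg ?Z)" "?a n = \<alpha> F (Sg ?Z)" "?b n = \<beta> F (Sg ?Z)"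
        unfolding m Sigma_coh_neg by (simp_all add: pS del: fpow.simps)
      have vals1: "?A (n + 1) = val (fob A F) ?Z" "?B (n + 1) = val (fob B F) ?Z" "?a (n + 1) = \<alpha> F ?Z"
        unfolding m1 Sigma_coh_neg by (simp_all add: pS)
      have dl: "s.del (Sg ?Z) x \<in> carrier (val (fob A F) (Dg (Sg ?Z)))" if "x \<in> carrier (val (fob E F) (Sg ?Z))" for x
        using transf_in[OF s.del_transf _ that] Z by simp
      have d: "?d x = ?u (s.del (Sg ?Z) x)" if x: "x \<in> carrier (val (fob E F) (Sg ?Z))" for x
      proof -
        have "fmor (Sigma_coh T n) (fob E F) (fob (Sigma_coh T 1) (fob A F)) (?\<delta> F) Y = s.del (Sg ?Z)"
          unfolding m Sigma_coh_neg by (simp add: pS del: fpow.simps)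
        moreover have "shift_iso T n (fob A F) Y y = ?u y" if "y \<in> carrier (val (fob A F) (Dg (Sg ?Z)))" for y
          using False that Z unfolding shift_iso_def m1 Sigma_coh_neg by (simp add: pS)
        moreover have "x \<in> carrier (val (fob (Sigma_coh T n) (fob E F)) Y)" using x vals by simp
        ultimately show ?thesis using Y dl[OF x] by simp
      qed
      have uh: "?u \<in> hom (val (fob A F) (Dg (Sg ?Z))) (val (fob A F) ?Z)" using Z by (intro s.K.act_hom) auto
      have dh: "?d \<in> hom (val (fob E F) (Sg ?Z)) (val (fob A F) ?Z)"
        using Z by (auto simp: hom_def d dl transf_mult[OF s.del_transf] s.K.act_mult simp del: Coh_simps)
      have ex: "exact_at (val (fob B F) (Sg ?Z)) (val (fob E F) (Sg ?Z)) (val (fob A F) (Dg (Sg ?Z))) (\<beta> F (Sg ?Z)) (s.del (Sg ?Z))"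
        "exact_at (val (fob E F) (Sg ?Z)) (val (fob A F) (Dg (Sg ?Z))) (val (fob B F) (Dg (Sg ?Z))) (s.del (Sg ?Z)) (\<alpha> F (Dg (Sg ?Z)))"
        using s.ex_at_right[of "Sg ?Z"] s.ex_at_left[of "Sg ?Z"] Z by auto
      have u1: "?u x = \<one>\<^bsub>val (fob A F) ?Z\<^esub> \<longleftrightarrow> x = \<one>\<^bsub>val (fob A F) (Dg (Sg ?Z))\<^esub>" if "x \<in> carrier (val (fob A F) (Dg (Sg ?Z)))" for x
        using uv[OF that] s.K.act_one[of "Dg (Sg ?Z)" ?Z "unit_inv ?Z"] s.K.act_one[of ?Z "Dg (Sg ?Z)" "Unit T ?Z"] Z by auto
      have k1: "kernel (val (fob E F) (Sg ?Z)) (val (fob A F) ?Z) ?d = kernel (val (fob E F) (Sg ?Z)) (val (fob A F) (Dg (Sg ?Z))) (s.del (Sg ?Z))"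
        using u1[OF dl] Z by (auto simp: kernel_def d simp del: Coh_simps)
      have im: "?d ` carrier (val (fob E F) (Sg ?Z)) = kernel (val (fob A F) ?Z) (val (fob B F) ?Z) (\<alpha> F ?Z)"
      proof
        show "?d ` carrier (val (fob E F) (Sg ?Z)) \<subseteq> kernel (val (fob A F) ?Z) (val (fob B F) ?Z) (\<alpha> F ?Z)"
        proof
          fix y assume "y \<in> ?d ` carrier (val (fob E F) (Sg ?Z))"
          then obtain x where x: "x \<in> carrier (val (fob E F) (Sg ?Z))" "y = ?u (s.del (Sg ?Z) x)" using d by auto
          have "\<alpha> F (Dg (Sg ?Z)) (s.del (Sg ?Z) x) = \<one>\<^bsub>val (fob B F) (Dg (Sg ?Z))\<^esub>"
            using ex(2) x(1) unfolding exact_at_def kernel_def by blast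
          then show "y \<in> kernel (val (fob A F) ?Z) (val (fob B F) ?Z) (\<alpha> F ?Z)"
            using x dl[OF x(1)] Z s.a.tr_act[of ?Z "Dg (Sg ?Z)" "Unit T ?Z" "s.del (Sg ?Z) x"] by (simp add: kernel_def)
        qed
        show "kernel (val (fob A F) ?Z) (val (fob B F) ?Z) (\<alpha> F ?Z) \<subseteq> ?d ` carrier (val (fob E F) (Sg ?Z))"
        proof
          fix y assume "y \<in> kernel (val (fob A F) ?Z) (val (fob B F) ?Z) (\<alpha> F ?Z)"
          then have y: "y \<in> carrier (val (fob A F) ?Z)" "\<alpha> F ?Z y = \<one>\<^bsub>val (fob B F) ?Z\<^esub>" by (auto simp: kernel_def)
          have "?v y \<in> kernel (val (fob A F) (Dg (Sg ?Z))) (val (fob B F) (Dg (Sg ?Z))) (\<alpha> F (Dg (Sg ?Z)))"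
            using y Z s.a.tr_act[of "Dg (Sg ?Z)" ?Z "unit_inv ?Z" y] by (simp add: kernel_def)
          then have "?v y \<in> s.del (Sg ?Z) ` carrier (val (fob E F) (Sg ?Z))" using ex(2) by (simp add: exact_at_def)
          then obtain x where x: "x \<in> carrier (val (fob E F) (Sg ?Z))" "s.del (Sg ?Z) x = ?v y" by auto
          then have "?d x = y" using d[OF x(1)] vu[OF y(1)] by simp
          with x show "y \<in> ?d ` carrier (val (fob E F) (Sg ?Z))" by blast
        qed
      qed
      show ?thesis unfolding vals vals1
        using s.ex_at_mid[of "Sg ?Z"] Z ex k1 im dh s.a.tr_hom[OF Z] by (auto simp: exact_at_def)
    qed
    then show "exact_at (?A n) (?B n) (?E n) (?a n) (?b n)" "exact_at (?B n) (?E n) (?A (n + 1)) (?b n) ?d"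
      "exact_at (?E n) (?A (n + 1)) (?B (n + 1)) ?d (?a (n + 1))" by blast+
  qed
qed

section \<open>Isomorphism loci\<close>

locale coh_mor = triangulated_category T + G: coh T G + H: coh T H + pstr T G H \<phi>
  for T :: "('o, 'm) tcat" and G H :: "('o, 'm, 'x) presheaf" and \<phi>
begin

definition iso_at where
  "iso_at X \<longleftrightarrow> (\<forall>g\<in>carrier (val G X). \<phi> X g = \<one>\<^bsub>val H X\<^esub> \<longrightarrow> g = \<one>\<^bsub>val G X\<^esub>) \<and> (\<forall>h\<in>carrier (val H X). \<exists>g\<in>carrier (val G X). \<phi> X g = h)"

lemma iso_atD:
  assumes "iso_at X"
  shows "g \<in> carrier (val G X) \<Longrightarrow> \<phi> X g = \<one>\<^bsub>val H X\<^esub> \<Longrightarrow> g = \<one>\<^bsub>val G X\<^esub>"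
    and "h \<in> carrier (val H X) \<Longrightarrow> \<exists>g\<in>carrier (val G X). \<phi> X g = h"
  using assms by (auto simp: iso_at_def)

lemma iso_at_inj: "\<lbrakk>iso_at X; X \<in> Obj T; g \<in> carrier (val G X); g' \<in> carrier (val G X); \<phi> X g = \<phi> X g'\<rbrakk> \<Longrightarrow> g = g'"
  using iso_atD(1)[of X "g \<otimes>\<^bsub>val G X\<^esub> inv\<^bsub>val G X\<^esub> g'"] by (simp add: tr_div H.val_div_eq_one_iff G.val_div_eq_one_iff)

lemma iso_at_retract:
  assumes P: "iso_at P" "P \<in> Obj T" and X: "X \<in> Obj T" "i \<in> Mor T X P" "p \<in> Mor T P X" "Cmp T X P X p i = Idt T X"
  shows "iso_at X"
  unfolding iso_at_def
proof (intro conjI ballI impI)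
  fix g assume g: "g \<in> carrier (val G X)" "\<phi> X g = \<one>\<^bsub>val H X\<^esub>"
  then have "act G P X p g = \<one>\<^bsub>val G P\<^esub>" using iso_atD(1)[OF P(1)] tr_act[of P X p g] P X by simp
  moreover have "act G X P i (act G P X p g) = g" using X P g by (simp add: G.act_cmp[symmetric])
  ultimately show "g = \<one>\<^bsub>val G X\<^esub>" using X P by simp
next
  fix h assume h: "h \<in> carrier (val H X)"
  then obtain g where g: "g \<in> carrier (val G P)" "\<phi> P g = act H P X p h" using iso_atD(2)[OF P(1), of "act H P X p h"] P X by auto
  have "\<phi> X (act G X P i g) = h" using tr_act[of X P i g] g X P h by (simp add: H.act_cmp[symmetric])
  then show "\<exists>g\<in>carrier (val G X). \<phi> X g = h" using g X P by (intro bexI[of _ "act G X P i g"]) auto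
qed

text \<open>The five lemma for the values at \<open>Sg Y\<close>, \<open>Sg X\<close>,
  \<open>Z\<close>, \<open>Y\<close> and \<open>X\<close>, in this order.\<close>

lemma five:
  assumes t: "(X, Y, Z, f, g, h) \<in> Tri T" and i: "iso_at X" "iso_at Y" "iso_at (Sg X)" "iso_at (Sg Y)"
  shows "iso_at Z"
  unfolding iso_at_def
proof (intro conjI ballI impI)
  have ty: "X \<in> Obj T" "Y \<in> Obj T" "Z \<in> Obj T" "f \<in> Mor T X Y" "g \<in> Mor T Y Z" "h \<in> Mor T Z (Sg X)" using Tri_typed[OF t] by auto
  let ?f = "inv\<^bsub>Hom T (Sg X) (Sg Y)\<^esub> (sg X Y f)"
  have f: "?f \<in> Mor T (Sg X) (Sg Y)" using ty by simp
  note r1 = tri_rot[OF t]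
  note r2 = tri_rot[OF r1]
  note [simp] = ty f
  {
    fix z assume z: "z \<in> carrier (val G Z)" "\<phi> Z z = \<one>\<^bsub>val H Z\<^esub>"
    then have "act G Y Z g z = \<one>\<^bsub>val G Y\<^esub>" using iso_atD(1)[OF i(2)] tr_act[of Y Z g z] by simp
    then obtain w where w: "w \<in> carrier (val G (Sg X))" "act G Z (Sg X) h w = z" using G.exact[OF r1 z(1)] by blast
    have "act H Z (Sg X) h (\<phi> (Sg X) w) = \<one>\<^bsub>val H Z\<^esub>" using tr_act[of Z "Sg X" h w] w z by simp
    then obtain v where v: "v \<in> carrier (val H (Sg Y))" "act H (Sg X) (Sg Y) ?f v = \<phi> (Sg X) w"
      using H.exact[OF r2, of "\<phi> (Sg X) w"] w by auto
    obtain v' where v': "v' \<in> carrier (val G (Sg Y))" "\<phi> (Sg Y) v' = v" using iso_atD(2)[OF i(4) v(1)] by blast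
    have "\<phi> (Sg X) (act G (Sg X) (Sg Y) ?f v') = \<phi> (Sg X) w" using tr_act[of "Sg X" "Sg Y" ?f v'] v v' by simp
    then have "w = act G (Sg X) (Sg Y) ?f v'" using iso_at_inj[OF i(3)] w v' by simp
    then show "z = \<one>\<^bsub>val G Z\<^esub>" using w(2) G.act_cmp_zero[OF tri_zero[OF r2]] v' by simp
  next
    fix y assume y: "y \<in> carrier (val H Z)"
    obtain b where b: "b \<in> carrier (val G Y)" "\<phi> Y b = act H Y Z g y" using iso_atD(2)[OF i(2), of "act H Y Z g y"] y by auto
    have "\<phi> X (act G X Y f b) = \<one>\<^bsub>val H X\<^esub>" using tr_act[of X Y f b] b y H.act_cmp_zero[OF tri_zero[OF t]] by simp
    then have "act G X Y f b = \<one>\<^bsub>val G X\<^esub>" using iso_atD(1)[OF i(1)] b by simp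
    then obtain z where z: "z \<in> carrier (val G Z)" "act G Y Z g z = b" using G.exact[OF t b(1)] by blast
    let ?y = "y \<otimes>\<^bsub>val H Z\<^esub> inv\<^bsub>val H Z\<^esub> \<phi> Z z"
    have yin: "?y \<in> carrier (val H Z)" using y z by simp
    have "act H Y Z g ?y = \<one>\<^bsub>val H Y\<^esub>" using y z b tr_act[of Y Z g z] by (simp add: H.act_mult H.act_inv H.val_div_eq_one_iff)
    then obtain w where w: "w \<in> carrier (val H (Sg X))" "act H Z (Sg X) h w = ?y" using H.exact[OF r1 yin] by blast
    obtain w' where w': "w' \<in> carrier (val G (Sg X))" "\<phi> (Sg X) w' = w" using iso_atD(2)[OF i(3) w(1)] by blast
    interpret HZ: comm_group "val H Z" using H.val_comm_group by simp
    have "\<phi> Z (z \<otimes>\<^bsub>val G Z\<^esub> act G Z (Sg X) h w') = y"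
      using tr_act[of Z "Sg X" h w'] w w' z y by (simp add: tr_mult HZ.mult_div_cancel)
    then show "\<exists>g\<in>carrier (val G Z). \<phi> Z g = y" using z w' by (intro bexI[of _ "z \<otimes>\<^bsub>val G Z\<^esub> act G Z (Sg X) h w'"]) auto
  }
qed

text \<open>The five lemma at a cone uses suspensions of the other two vertices, so the property is
  demanded for all shifts. They form two families of powers, because \<open>Sg\<close> and
  \<open>Dg\<close> are inverse to each other only up to isomorphism.\<close>

definition locus where
  "locus = {X \<in> Obj T. \<forall>n. iso_at ((Sg ^^ n) X) \<and> iso_at ((Dg ^^ n) X)}"

lemma pow_retract:
  assumes F: "additive_functor T T F"
    and X: "X \<in> Obj T" "P \<in> Obj T" "i \<in> Mor T X P" "p \<in> Mor T P X" "Cmp T X P X p i = Idt T X"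
  shows "\<exists>j q. (fob F ^^ n) X \<in> Obj T \<and> (fob F ^^ n) P \<in> Obj T \<and> j \<in> Mor T ((fob F ^^ n) X) ((fob F ^^ n) P) \<and> q \<in> Mor T ((fob F ^^ n) P) ((fob F ^^ n) X) \<and>
    Cmp T ((fob F ^^ n) X) ((fob F ^^ n) P) ((fob F ^^ n) X) q j = Idt T ((fob F ^^ n) X)"
proof (induction n)
  case 0
  show ?case using X by auto
next
  case (Suc n)
  interpret F: additive_functor T T F by fact
  let ?X = "(fob F ^^ n) X" and ?P = "(fob F ^^ n) P"
  from Suc obtain j q where o: "?X \<in> Obj T" "?P \<in> Obj T" and "j \<in> Mor T ?X ?P" "q \<in> Mor T ?P ?X" "Cmp T ?X ?P ?X q j = Idt T ?X" by blast
  then show ?case using F.fmor_cmp[of ?X ?P ?X j q]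
    by (intro exI[of _ "fmor F ?X ?P j"] exI[of _ "fmor F ?P ?X q"]) simp
qed

lemma locus_retract:
  assumes "P \<in> locus" "X \<in> Obj T" "i \<in> Mor T X P" "p \<in> Mor T P X" "Cmp T X P X p i = Idt T X"
  shows "X \<in> locus"
proof -
  have P: "P \<in> Obj T" using assms(1) by (simp add: locus_def)
  have "iso_at ((Sg ^^ n) X)" "iso_at ((Dg ^^ n) X)" for n
    using pow_retract[OF Sus_functor assms(2) P assms(3-5), of n] pow_retract[OF Des_functor assms(2) P assms(3-5), of n]
      iso_at_retract[of "(Sg ^^ n) P" "(Sg ^^ n) X"] iso_at_retract[of "(Dg ^^ n) P" "(Dg ^^ n) X"] assms(1)
    by (auto simp: locus_def)
  then show ?thesis using assms(2) by (simp add: locus_def)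
qed

lemma locus_iso: "\<lbrakk>P \<in> locus; X \<in> Obj T; inverse_mors T X P f g\<rbrakk> \<Longrightarrow> X \<in> locus"
  using locus_retract[of P X f g] by (auto simp: inverse_mors_def)

lemma locus_iso_at: "X \<in> locus \<Longrightarrow> X \<in> Obj T \<and> iso_at X"
  unfolding locus_def using funpow_0 by (metis (mono_tags, lifting) mem_Collect_eq)

text \<open>\<open>Dg (Sg X)\<close> and \<open>Sg (Dg X)\<close> are merely isomorphic to
  \<open>X\<close>, so mixed shifts are brought back by closure under isomorphism.\<close>

lemma locus_shift:
  assumes X: "X \<in> locus" shows "Sg X \<in> locus" "Dg X \<in> locus"
proof -
  have o: "X \<in> Obj T" and i: "iso_at ((Sg ^^ n) X)" "iso_at ((Dg ^^ n) X)" for n using X by (auto simp: locus_def)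
  have "iso_at ((Sg ^^ n) (Sg X))" for n using i(1)[of "Suc n"] by (simp add: funpow_swap1)
  moreover have "iso_at ((Dg ^^ n) (Sg X))" for n
  proof (cases n)
    case 0 then show ?thesis using i(1)[of 1] by simp
  next
    case (Suc m)
    have "Dg (Sg X) \<in> locus"
      by (rule locus_iso[OF X _ inverse_mors_sym[OF unit_inverse]]) (use o in auto)
    then have "iso_at ((Dg ^^ m) (Dg (Sg X)))" by (simp add: locus_def)
    then show ?thesis using Suc by (simp add: funpow_swap1)
  qed
  ultimately show "Sg X \<in> locus" using o by (simp add: locus_def)
  have "iso_at ((Dg ^^ n) (Dg X))" for n using i(2)[of "Suc n"] by (simp add: funpow_swap1)
  moreover have "iso_at ((Sg ^^ n) (Dg X))" for n
  proof (cases n)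
    case 0 then show ?thesis using i(2)[of 1] by simp
  next
    case (Suc m)
    have "Sg (Dg X) \<in> locus"
      by (rule locus_iso[OF X _ counit_inverse]) (use o in auto)
    then have "iso_at ((Sg ^^ m) (Sg (Dg X)))" by (simp add: locus_def)
    then show ?thesis using Suc by (simp add: funpow_swap1)
  qed
  ultimately show "Dg X \<in> locus" using o by (simp add: locus_def)
qed

lemma pow_triangle:
  assumes F: "\<And>X Y Z f g h. (X, Y, Z, f, g, h) \<in> Tri T \<Longrightarrow> \<exists>f g h. (F X, F Y, F Z, f, g, h) \<in> Tri T"
    and t: "(X, Y, Z, f, g, h) \<in> Tri T"
  shows "\<exists>f g h. ((F ^^ n) X, (F ^^ n) Y, (F ^^ n) Z, f, g, h) \<in> Tri T"
proof (induction n)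
  case 0 show ?case using t by auto
next
  case (Suc n) then show ?case using F by (simp, blast)
qed

lemma Sg_pow_triangle: "(X, Y, Z, f, g, h) \<in> Tri T \<Longrightarrow> \<exists>f g h. ((Sg ^^ n) X, (Sg ^^ n) Y, (Sg ^^ n) Z, f, g, h) \<in> Tri T"
  by (rule pow_triangle) (blast intro: sus_triangle)

lemma Dg_pow_triangle: "(X, Y, Z, f, g, h) \<in> Tri T \<Longrightarrow> \<exists>f g h. ((Dg ^^ n) X, (Dg ^^ n) Y, (Dg ^^ n) Z, f, g, h) \<in> Tri T"
  by (rule pow_triangle) (blast elim: des_triangle)

lemma locus_cone:
  assumes t: "(X, Y, Z, f, g, h) \<in> Tri T" and X: "X \<in> locus" "Y \<in> locus" shows "Z \<in> locus"
proof -
  have o: "X \<in> Obj T" "Y \<in> Obj T" "Z \<in> Obj T" using Tri_typed[OF t] by auto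
  have i: "iso_at ((Sg ^^ n) X)" "iso_at ((Dg ^^ n) X)" "iso_at ((Sg ^^ n) Y)" "iso_at ((Dg ^^ n) Y)" for n
    using X by (auto simp: locus_def)
  have j: "iso_at (Sg ((Dg ^^ n) X))" "iso_at (Sg ((Dg ^^ n) Y))" for n
  proof -
    have "Sg ((Dg ^^ n) P) \<in> locus" if "P \<in> locus" for P n
    proof -
      have "(Dg ^^ n) P \<in> locus" using that by (induction n) (auto intro: locus_shift)
      then show ?thesis by (rule locus_shift)
    qed
    then show "iso_at (Sg ((Dg ^^ n) X))" "iso_at (Sg ((Dg ^^ n) Y))" using X locus_iso_at by blast+
  qed
  have "iso_at ((Sg ^^ n) Z)" "iso_at ((Dg ^^ n) Z)" for n
  proof -
    obtain f g h where "((Sg ^^ n) X, (Sg ^^ n) Y, (Sg ^^ n) Z, f, g, h) \<in> Tri T" using Sg_pow_triangle[OF t] by blast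
    then show "iso_at ((Sg ^^ n) Z)" using five i i(1)[of "Suc n"] i(3)[of "Suc n"] by simp
    obtain f g h where "((Dg ^^ n) X, (Dg ^^ n) Y, (Dg ^^ n) Z, f, g, h) \<in> Tri T" using Dg_pow_triangle[OF t] by blast
    then show "iso_at ((Dg ^^ n) Z)" using five i j by simp
  qed
  then show ?thesis using o by (simp add: locus_def)
qed

text \<open>Up to isomorphism the fibre is a desuspended cone.\<close>

lemma locus_fibre:
  assumes t: "(X, Y, Z, f, g, h) \<in> Tri T" and X: "Y \<in> locus" "Z \<in> locus" shows "X \<in> locus"
proof -
  have o: "X \<in> Obj T" using Tri_typed[OF t] by auto
  have "Dg (Sg X) \<in> locus" using locus_cone[OF tri_rot[OF t] X] by (rule locus_shift)
  then show ?thesis using locus_iso[OF _ o unit_inverse[OF o]] by blast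
qed

lemma thick_locus: assumes "X \<in> locus" shows "thick T locus"
  unfolding thick_def triangulated_sub_def
proof (intro conjI ballI allI impI)
  show "locus \<subseteq> Obj T" by (auto simp: locus_def)
  show "locus \<noteq> {}" using assms by blast
  show "Sg X \<in> locus" "Dg X \<in> locus" if "X \<in> locus" for X using locus_shift[OF that] by auto
  fix X Y Z f g h assume t: "(X, Y, Z, f, g, h) \<in> Tri T"
  show "Z \<in> locus" if "X \<in> locus \<and> Y \<in> locus" using locus_cone[OF t] that by blast
  show "X \<in> locus" if "Y \<in> locus \<and> Z \<in> locus" using locus_fibre[OF t] that by blast
  show "Y \<in> locus" if "X \<in> locus \<and> Z \<in> locus" using locus_fibre[OF tri_rot[OF t]] locus_shift that by blast
next
  fix A B P assume "A \<in> Obj T" "P \<in> locus" "\<exists>i j p q. biproduct T A B P i j p q"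
  then show "A \<in> locus" using locus_retract[of P A] by (auto simp: biproduct_def)
qed

text \<open>The join is used through its minimality alone: \<open>U\<close> and \<open>V\<close> are
  closed under shifts, so they lie in \<open>locus\<close>, which is thick and therefore contains
  the join.\<close>

lemma iso_at_join:
  assumes U: "thick T U" "\<And>X. X \<in> U \<Longrightarrow> iso_at X" and V: "thick T V" "\<And>X. X \<in> V \<Longrightarrow> iso_at X"
    and X: "X \<in> thick_join T U V"
  shows "iso_at X"
proof -
  have sub: "W \<subseteq> locus" if W: "thick T W" "\<And>X. X \<in> W \<Longrightarrow> iso_at X" for W
  proof
    fix X assume X: "X \<in> W"
    have c: "Sg X \<in> W" "Dg X \<in> W" "X \<in> Obj T" if "X \<in> W" for X using W(1) that by (auto simp: thick_def triangulated_sub_def)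
    have "(Sg ^^ n) X \<in> W" "(Dg ^^ n) X \<in> W" for n using X c by (induction n) auto
    then show "X \<in> locus" using c(3)[OF X] W(2) by (simp add: locus_def)
  qed
  obtain Z where "Z \<in> U" using U(1) by (auto simp: thick_def triangulated_sub_def)
  then have "thick T locus" using sub[OF U] thick_locus by blast
  then have "X \<in> locus" using X sub[OF U] sub[OF V] by (auto simp: thick_join_def)
  then show ?thesis using locus_iso_at by blast
qed

end

section \<open>Commuting pairs\<close>

context triangulated_category
begin

lemma thick_Obj: "thick T (Obj T)"
  unfolding thick_def triangulated_sub_def using zero_ex Tri_typed by (auto simp: zero_object_def)

section \<open>Meet and join as triangulated subcategories\<close>

lemma triangulated_meet:
  assumes "thick T U" "thick T V" shows "triangulated_sub T (thick_meet T U V)"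
proof -
  obtain Z where Z: "zero_object T Z" using zero_ex by blast
  interpret U: tri_sub T U by unfold_locales (use assms in \<open>simp add: thick_def\<close>)
  interpret V: tri_sub T V by unfold_locales (use assms in \<open>simp add: thick_def\<close>)
  have "thick_meet T U V \<subseteq> Obj T" "thick_meet T U V \<noteq> {}"
    using U.sub_Obj U.sub_zero[OF Z] V.sub_zero[OF Z] by (auto simp: thick_meet_def)
  moreover have "Sg X \<in> thick_meet T U V \<and> Dg X \<in> thick_meet T U V" if "X \<in> thick_meet T U V" for X
    using that by (simp add: thick_meet_def)
  moreover have "(X \<in> thick_meet T U V \<and> Y \<in> thick_meet T U V \<longrightarrow> Z \<in> thick_meet T U V) \<and>
      (Y \<in> thick_meet T U V \<and> Z \<in> thick_meet T U V \<longrightarrow> X \<in> thick_meet T U V) \<and>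
      (X \<in> thick_meet T U V \<and> Z \<in> thick_meet T U V \<longrightarrow> Y \<in> thick_meet T U V)" if "(X, Y, Z, f, g, h) \<in> Tri T" for X Y Z f g h
    using U.sub_tri[OF that] V.sub_tri[OF that] by (simp add: thick_meet_def)
  ultimately show ?thesis unfolding triangulated_sub_def by blast
qed

lemma triangulated_join:
  assumes "thick T U" "thick T V" shows "triangulated_sub T (thick_join T U V)"
proof -
  let ?J = "thick_join T U V"
  interpret U: tri_sub T U by unfold_locales (use assms in \<open>simp add: thick_def\<close>)
  interpret V: tri_sub T V by unfold_locales (use assms in \<open>simp add: thick_def\<close>)
  have J: "X \<in> ?J \<longleftrightarrow> (\<forall>W. thick T W \<and> U \<subseteq> W \<and> V \<subseteq> W \<longrightarrow> X \<in> W)" for X by (auto simp: thick_join_def)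
  have "?J \<subseteq> Obj T" using thick_Obj U.sub_Obj V.sub_Obj unfolding thick_join_def by blast
  moreover have "U \<subseteq> ?J" by (auto simp: thick_join_def)
  then have "?J \<noteq> {}" using assms(1) by (auto simp: thick_def triangulated_sub_def)
  moreover have "Sg X \<in> ?J \<and> Dg X \<in> ?J" if "X \<in> ?J" for X
  proof -
    have "X \<in> W \<Longrightarrow> Sg X \<in> W \<and> Dg X \<in> W" if "thick T W" for W using that unfolding thick_def triangulated_sub_def by blast
    then show ?thesis using that unfolding J by meson
  qed
  moreover have "(X \<in> ?J \<and> Y \<in> ?J \<longrightarrow> Z \<in> ?J) \<and> (Y \<in> ?J \<and> Z \<in> ?J \<longrightarrow> X \<in> ?J) \<and> (X \<in> ?J \<and> Z \<in> ?J \<longrightarrow> Y \<in> ?J)"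
    if t: "(X, Y, Z, f, g, h) \<in> Tri T" for X Y Z f g h
  proof -
    have "(X \<in> W \<and> Y \<in> W \<longrightarrow> Z \<in> W) \<and> (Y \<in> W \<and> Z \<in> W \<longrightarrow> X \<in> W) \<and> (X \<in> W \<and> Z \<in> W \<longrightarrow> Y \<in> W)" if "thick T W" for W
    proof -
      interpret tri_sub T W by unfold_locales (use that in \<open>simp add: thick_def\<close>)
      show ?thesis using sub_tri[OF t] by simp
    qed
    then show ?thesis unfolding J by meson
  qed
  ultimately show ?thesis unfolding triangulated_sub_def by blast
qed

end

context ess_sub
begin

lemma gam_zero: "\<lbrakk>coh T F; Y \<in> Obj T; X \<in> S; x \<in> carrier (val F X)\<rbrakk> \<Longrightarrow>
    gam T S F Y X \<one>\<^bsub>Hom T Y X\<^esub> (x :: 'x) = \<one>\<^bsub>val (fob (Gam T S) F) Y\<^esub>"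
proof -
  assume *: "coh T F" "Y \<in> Obj T" "X \<in> S" "x \<in> carrier (val F X)"
  then interpret coh T F by simp
  have "act F X X (Idt T X) x = x" "Cmp T Y X X (Idt T X) \<one>\<^bsub>Hom T Y X\<^esub> = \<one>\<^bsub>Hom T Y X\<^esub>" using * by simp_all
  then have "\<exists>Z\<in>S. \<exists>u\<in>Mor T X Z. \<exists>z\<in>carrier (val F Z). act F X Z u z = x \<and> Cmp T Y X Z u \<one>\<^bsub>Hom T Y X\<^esub> = \<one>\<^bsub>Hom T Y Z\<^esub>"
    using * by (intro bexI[of _ X] bexI[of _ "Idt T X"] bexI[of _ x]) auto
  then show ?thesis using gam_eq_one_iff[of F Y X "\<one>\<^bsub>Hom T Y X\<^esub>" x] * by simp
qed

lemma counit_inj: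
  assumes F: "coh T F" and c: "c \<in> S" "e \<in> carrier (val (fob (Gam T S) F) c)" "counit F c e = \<one>\<^bsub>val F c\<^esub>"
  shows "e = \<one>\<^bsub>val (fob (Gam T S) F) c\<^esub>"
proof -
  interpret F: coh T F by fact
  interpret G: coh T "fob (Gam T S) F" by (rule coh_Gam[OF F])
  interpret pstr T "fob (Gam T S) F" F "counit F" by unfold_locales (rule counit_transf[OF F])
  show ?thesis using gam_idt[OF F c(1,2)] gam_idt[OF F c(1) G.val_one] c by simp
qed

text \<open>Localisation forgets what dies on coverings. On a class \<open>Q\<close> of objects
  closed under passing to coverings, a morphism that is onto and whose kernel is locally zero
  becomes an isomorphism. The class will be \<open>U\<close> or \<open>V\<close>.\<close>

lemma Loc_mor_iso:
  assumes "coh T G" "coh T H" and \<phi>: "\<phi> \<in> transf T G (H :: ('o, 'm, 'x) presheaf)"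
    and Q: "\<And>z z' t. z \<in> Q \<Longrightarrow> t \<in> cov z' z \<Longrightarrow> z' \<in> Q"
    and surj: "\<And>z y. z \<in> Q \<Longrightarrow> y \<in> carrier (val H z) \<Longrightarrow> \<exists>g\<in>carrier (val G z). \<phi> z g = y"
    and inj: "\<And>z g. z \<in> Q \<Longrightarrow> g \<in> carrier (val G z) \<Longrightarrow> \<phi> z g = \<one>\<^bsub>val H z\<^esub> \<Longrightarrow>
      \<exists>z'. \<exists>t\<in>cov z' z. act G z' z t g = \<one>\<^bsub>val G z'\<^esub>"
    and z: "z \<in> Q" "z \<in> Obj T"
  shows "coh_mor.iso_at (fob (Loc T S) G) (fob (Loc T S) H) (fmor (Loc T S) G H \<phi>) z"
proof -
  interpret G: coh T G by fact
  interpret H: coh T H by fact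
  interpret f: pstr T G H \<phi> by unfold_locales fact
  interpret LG: coh T "fob (Loc T S) G" by (rule coh_Loc) fact
  interpret LH: coh T "fob (Loc T S) H" by (rule coh_Loc) fact
  interpret coh_mor T "fob (Loc T S) G" "fob (Loc T S) H" "fmor (Loc T S) G H \<phi>"
    by unfold_locales (rule Loc_mor_transf, fact+)
  note m = rho_mor[OF assms(1-3)]
  show ?thesis unfolding iso_at_def
  proof (intro conjI ballI impI)
    fix e assume e: "e \<in> carrier (val (fob (Loc T S) G) z)" "fmor (Loc T S) G H \<phi> z e = \<one>\<^bsub>val (fob (Loc T S) H) z\<^esub>"
    obtain Z s g where s: "s \<in> cov Z z" "g \<in> carrier (val G Z)" "e = rho T S G z Z s g" using rho_ex[OF assms(1) z(2) e(1)] .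
    have ty: "Z \<in> Obj T" "s \<in> Mor T Z z" using cov_typed[OF s(1)] by auto
    have pg: "\<phi> Z g \<in> carrier (val H Z)" using s ty by simp
    have "rho T S H z Z s (\<phi> Z g) = \<one>\<^bsub>val (fob (Loc T S) H) z\<^esub>" using e(2) m[OF s(1,2)] s(3) by metis
    then obtain Q1 u where u: "Q1 \<in> Obj T" "u \<in> Mor T Q1 Z" "Cmp T Q1 Z z s u \<in> cov Q1 z" "act H Q1 Z u (\<phi> Z g) = \<one>\<^bsub>val H Q1\<^esub>"
      using rho_eq_one_iff[OF assms(2) s(1) pg] by blast
    have gu: "act G Q1 Z u g \<in> carrier (val G Q1)" using s u ty by simp
    have "\<phi> Q1 (act G Q1 Z u g) = \<one>\<^bsub>val H Q1\<^esub>" using f.tr_act[of Q1 Z u g] s u ty by simp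
    then obtain Q2 t where t: "t \<in> cov Q2 Q1" "act G Q2 Q1 t (act G Q1 Z u g) = \<one>\<^bsub>val G Q2\<^esub>"
      using inj[OF Q[OF z(1) u(3)] gu] by blast
    have ty2: "Q2 \<in> Obj T" "t \<in> Mor T Q2 Q1" using cov_typed[OF t(1)] by auto
    have "Cmp T Q2 Z z s (Cmp T Q2 Q1 Z u t) \<in> cov Q2 z"
      using cov_cmp[OF t(1) u(3)] ty ty2 u(1,2) z by (simp add: cmp_assoc)
    moreover have "act G Q2 Z (Cmp T Q2 Q1 Z u t) g = \<one>\<^bsub>val G Q2\<^esub>" using t(2) ty ty2 u(1,2) s(2) by (simp add: G.act_cmp)
    moreover have "Cmp T Q2 Q1 Z u t \<in> Mor T Q2 Z" using ty ty2 u(1,2) by simp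
    ultimately show "e = \<one>\<^bsub>val (fob (Loc T S) G) z\<^esub>"
      using rho_eq_one_iff[OF assms(1) s(1,2)] ty2(1) s(3) by blast
  next
    fix h assume "h \<in> carrier (val (fob (Loc T S) H) z)"
    from rho_ex[OF assms(2) z(2) this] obtain Z s y where s: "s \<in> cov Z z" "y \<in> carrier (val H Z)" "h = rho T S H z Z s y" .
    obtain g where "g \<in> carrier (val G Z)" "\<phi> Z g = y" using surj[OF Q[OF z(1) s(1)] s(2)] by blast
    then show "\<exists>g\<in>carrier (val (fob (Loc T S) G) z). fmor (Loc T S) G H \<phi> z g = h"
      using m[OF s(1)] rho_in[OF assms(1) s(1)] s(3) by (intro bexI[of _ "rho T S G z Z s g"]) auto
  qed
qed

end

context ess_sub_pair
begin

text \<open>The form in which the commuting hypothesis enters: with \<open>S1\<close> the meet and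
  \<open>S2 = V\<close> it holds for every \<open>z\<close> in \<open>U\<close>, and
  symmetrically.\<close>

definition factors where
  "factors z \<longleftrightarrow> z \<in> Obj T \<and> (\<forall>Y\<in>S2. \<forall>f\<in>Mor T z Y. \<exists>W\<in>S1. \<exists>g\<in>Mor T z W. \<exists>h\<in>Mor T W Y. f = Cmp T z W Y h g)"

text \<open>Kill the first half of the factorisation, whose target lies in
  \<open>S1\<close>.\<close>

lemma factors_kill:
  assumes z: "factors z" and Y: "Y \<in> S2" "f \<in> Mor T z Y"
  obtains Z t where "t \<in> A.cov Z z" "Cmp T Z z Y f t = \<one>\<^bsub>Hom T Z Y\<^esub>"
proof -
  obtain W g h where W: "W \<in> S1" "g \<in> Mor T z W" "h \<in> Mor T W Y" "f = Cmp T z W Y h g" and zo: "z \<in> Obj T"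
    using z Y unfolding factors_def by blast
  obtain Z t k where t: "(Z, z, W, t, g, k) \<in> Tri T" "t \<in> A.cov Z z" "Z \<in> Obj T" "t \<in> Mor T Z z" "Cmp T Z z W g t = \<one>\<^bsub>Hom T Z W\<^esub>"
    using A.cov_kill[OF W(2) zo W(1)] .
  have "Cmp T Z z Y f t = \<one>\<^bsub>Hom T Z Y\<^esub>" unfolding W(4) using W(1-3) t zo Y(1) by (simp add: cmp_assoc)
  with t(2) that show ?thesis by blast
qed

text \<open>Over \<open>z\<close> the coverings for \<open>S1\<close> are cofinal among those for
  \<open>S2\<close>: the morphism from \<open>z\<close> to the cone of \<open>t\<close> dies on a
  covering for \<open>S1\<close>, which therefore lifts through \<open>t\<close>. So the two
  localisations have the same value at \<open>z\<close>.\<close>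

lemma factors_refine:
  assumes z: "factors z" and t: "t \<in> B.cov Y z"
  obtains Z q where "Z \<in> Obj T" "q \<in> Mor T Z Y" "Cmp T Z Y z t q \<in> A.cov Z z"
proof -
  obtain c k h where c: "c \<in> S2" "(Y, z, c, t, k, h) \<in> Tri T" using t by (rule B.covE)
  have k: "k \<in> Mor T z c" using Tri_typed[OF c(2)] by simp
  obtain Z r where r: "r \<in> A.cov Z z" "Cmp T Z z c k r = \<one>\<^bsub>Hom T Z c\<^esub>" using factors_kill[OF z c(1) k] .
  have Z: "Z \<in> Obj T" "r \<in> Mor T Z z" using A.cov_typed[OF r(1)] by auto
  obtain q where "q \<in> Mor T Z Y" "Cmp T Z Y z t q = r" using weak_kernel[OF c(2) Z r(2)] by blast
  with that Z r show ?thesis by blast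
qed

lemma Loc_can_inj:
  assumes F: "coh T F" and z: "factors z" "e \<in> carrier (val (fob (Loc T S1) F) z)" "Loc_can T S1 S2 F z e = \<one>\<^bsub>val (fob (Loc T S2) F) z\<^esub>"
  shows "e = \<one>\<^bsub>val (fob (Loc T S1) (F :: ('o, 'm, 'x) presheaf)) z\<^esub>"
proof -
  interpret F: coh T F by fact
  have zo: "z \<in> Obj T" using z by (simp add: factors_def)
  obtain Z s x where s: "s \<in> A.cov Z z" "x \<in> carrier (val F Z)" "e = rho T S1 F z Z s x" using A.rho_ex[OF F zo z(2)] .
  have ty: "Z \<in> Obj T" "s \<in> Mor T Z z" using A.cov_typed[OF s(1)] by auto
  have "rho T S2 F z Z s x = \<one>\<^bsub>val (fob (Loc T S2) F) z\<^esub>" using z(3) Loc_can_rho[OF F s(1,2)] s(3) by metis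
  then obtain Q u where u: "Q \<in> Obj T" "u \<in> Mor T Q Z" "Cmp T Q Z z s u \<in> B.cov Q z" "act F Q Z u x = \<one>\<^bsub>val F Q\<^esub>"
    using B.rho_eq_one_iff[OF F cov_mono[OF s(1)] s(2)] by blast
  obtain Z1 q where q: "Z1 \<in> Obj T" "q \<in> Mor T Z1 Q" "Cmp T Z1 Q z (Cmp T Q Z z s u) q \<in> A.cov Z1 z"
    using factors_refine[OF z(1) u(3)] .
  have "Cmp T Z1 Z z s (Cmp T Z1 Q Z u q) \<in> A.cov Z1 z" using q ty u(1,2) zo by (simp add: cmp_assoc)
  moreover have "act F Z1 Z (Cmp T Z1 Q Z u q) x = \<one>\<^bsub>val F Z1\<^esub>" using q ty u s(2) by (simp add: F.act_cmp)
  moreover have "Cmp T Z1 Q Z u q \<in> Mor T Z1 Z" using q ty u by simp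
  ultimately show ?thesis using A.rho_eq_one_iff[OF F s(1,2)] q(1) s(3) by blast
qed

lemma Loc_can_surj:
  assumes F: "coh T F" and z: "factors z" "e \<in> carrier (val (fob (Loc T S2) F) z)"
  shows "\<exists>d\<in>carrier (val (fob (Loc T S1) (F :: ('o, 'm, 'x) presheaf)) z). Loc_can T S1 S2 F z d = e"
proof -
  interpret F: coh T F by fact
  have zo: "z \<in> Obj T" using z by (simp add: factors_def)
  obtain Z s x where s: "s \<in> B.cov Z z" "x \<in> carrier (val F Z)" "e = rho T S2 F z Z s x" using B.rho_ex[OF F zo z(2)] .
  have ty: "Z \<in> Obj T" using B.cov_typed[OF s(1)] by auto
  obtain Y q where q: "Y \<in> Obj T" "q \<in> Mor T Y Z" "Cmp T Y Z z s q \<in> A.cov Y z" using factors_refine[OF z(1) s(1)] .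
  have x: "act F Y Z q x \<in> carrier (val F Y)" using q ty s by simp
  have "Loc_can T S1 S2 F z (rho T S1 F z Y (Cmp T Y Z z s q) (act F Y Z q x)) = e"
    unfolding Loc_can_rho[OF F q(3) x] s(3) by (rule B.rho_refine[OF F s(1,2) q(1,2) cov_mono[OF q(3)], symmetric])
  then show ?thesis using A.rho_in[OF F q(3) x] by blast
qed

text \<open>Every element is represented by a morphism from \<open>z\<close> into an object of
  \<open>S2\<close>, and such a morphism is killed on a covering for \<open>S1\<close>.\<close>

lemma Gam_locally_zero:
  assumes F: "coh T F" and z: "factors z" "e \<in> carrier (val (fob (Gam T S2) F) z)"
  obtains Z t where "t \<in> A.cov Z z" "act (fob (Gam T S2) F) Z z t e = \<one>\<^bsub>val (fob (Gam T S2) (F :: ('o, 'm, 'x) presheaf)) Z\<^esub>"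
proof -
  have zo: "z \<in> Obj T" using z by (simp add: factors_def)
  obtain Y g x where g: "Y \<in> S2" "g \<in> Mor T z Y" "x \<in> carrier (val F Y)" "e = gam T S2 F z Y g x" using B.gam_ex[OF F z(2)] .
  obtain Z t where t: "t \<in> A.cov Z z" "Cmp T Z z Y g t = \<one>\<^bsub>Hom T Z Y\<^esub>" using factors_kill[OF z(1) g(1,2)] .
  have ty: "Z \<in> Obj T" "t \<in> Mor T Z z" using A.cov_typed[OF t(1)] by auto
  have "act (fob (Gam T S2) F) Z z t e = gam T S2 F Z Y \<one>\<^bsub>Hom T Z Y\<^esub> x" unfolding g(4) using B.gam_act[OF F ty(1) zo g(1) ty(2) g(2,3)] t(2) by simp
  with that[OF t(1)] B.gam_zero[OF F ty(1) g(1,3)] show ?thesis by simp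
qed

end

locale commuting = ess_small_triangulated T univ for T :: "('o, 'm) tcat" and univ :: "'x itself" +
  fixes U V
  assumes thick_U: "thick T U" and thick_V: "thick T V" and commuting: "commuting_pair T U V"
begin

abbreviation W where "W \<equiv> thick_meet T U V"
abbreviation J where "J \<equiv> thick_join T U V"

sublocale W: ess_sub T univ W by unfold_locales (rule triangulated_meet[OF thick_U thick_V])
sublocale U: ess_sub T univ U by unfold_locales (use thick_U in \<open>simp add: thick_def\<close>)
sublocale V: ess_sub T univ V by unfold_locales (use thick_V in \<open>simp add: thick_def\<close>)
sublocale J: ess_sub T univ J by unfold_locales (rule triangulated_join[OF thick_U thick_V])
sublocale WU: ess_sub_pair T univ W U by unfold_locales (auto simp: thick_meet_def)
sublocale WV: ess_sub_pair T univ W V by unfold_locales (auto simp: thick_meet_def)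
sublocale UJ: ess_sub_pair T univ U J by unfold_locales (auto simp: thick_join_def)
sublocale VJ: ess_sub_pair T univ V J by unfold_locales (auto simp: thick_join_def)

declare W.Loc_val [simp del] U.Loc_val [simp del] V.Loc_val [simp del] J.Loc_val [simp del]

lemma factors_V: "z \<in> U \<Longrightarrow> WV.factors z" and factors_U: "z \<in> V \<Longrightarrow> WU.factors z"
  using commuting unfolding WV.factors_def WU.factors_def commuting_pair_def by blast+

end

locale commuting_coh = commuting T univ U V + F: coh T F
  for T :: "('o, 'm) tcat" and univ :: "'x itself" and U V and F :: "('o, 'm, 'x) presheaf"
begin

lemmas F_coh = F.coh_axioms

section \<open>The complex of localisations\<close>

abbreviation LW where "LW \<equiv> fob (Loc T W) F"
abbreviation LU where "LU \<equiv> fob (Loc T U) F"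
abbreviation LV where "LV \<equiv> fob (Loc T V) F"
abbreviation LJ where "LJ \<equiv> fob (Loc T J) F"
abbreviation LN where "LN \<equiv> sum_presheaf LU LV"
abbreviation La where "La \<equiv> pair_transf T (Loc T W) (Loc T U) (Loc T V) (Loc_can T W U) (Loc_can T W V) F"
abbreviation Lb where "Lb \<equiv> diff_transf T (Loc T U) (Loc T V) (Loc T J) (Loc_can T U J) (Loc_can T V J) F"

sublocale LW: coh T LW by (rule W.coh_Loc[OF F_coh])
sublocale LU: coh T LU by (rule U.coh_Loc[OF F_coh])
sublocale LV: coh T LV by (rule V.coh_Loc[OF F_coh])
sublocale LJ: coh T LJ by (rule J.coh_Loc[OF F_coh])
sublocale LN: coh T LN by (rule coh_sum[OF LU.coh_axioms LV.coh_axioms])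
sublocale LWU: pstr T LW LU "Loc_can T W U F" by unfold_locales (rule WU.Loc_can_transf[OF F_coh])
sublocale LWV: pstr T LW LV "Loc_can T W V F" by unfold_locales (rule WV.Loc_can_transf[OF F_coh])
sublocale LUJ: pstr T LU LJ "Loc_can T U J F" by unfold_locales (rule UJ.Loc_can_transf[OF F_coh])
sublocale LVJ: pstr T LV LJ "Loc_can T V J F" by unfold_locales (rule VJ.Loc_can_transf[OF F_coh])
sublocale La: coh_mor T LW LN La
  by unfold_locales (use coh_nat_transfD(3)[OF pair_nat[OF WU.Loc_can_nat WV.Loc_can_nat] F_coh] in simp)
sublocale Lb: coh_mor T LN LJ Lb
  by unfold_locales (use coh_nat_transfD(3)[OF diff_nat[OF UJ.Loc_can_nat VJ.Loc_can_nat] F_coh] in simp)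

lemma La_iso: assumes z: "z \<in> J" shows "La.iso_at z"
proof (rule La.iso_at_join[OF thick_U _ thick_V _ z])
  fix z assume z: "z \<in> U"
  then have zo: "z \<in> Obj T" by simp
  show "La.iso_at z" unfolding La.iso_at_def
  proof (intro conjI ballI impI)
    fix e assume "e \<in> carrier (val LW z)" "La z e = \<one>\<^bsub>val LN z\<^esub>"
    then show "e = \<one>\<^bsub>val LW z\<^esub>" using zo by (intro WV.Loc_can_inj[OF F_coh factors_V[OF z]]) (auto simp: pair_apply sum_one sum_eq_iff)
  next
    fix h assume "h \<in> carrier (val LN z)"
    then obtain x y where h: "x \<in> carrier (val LU z)" "y \<in> carrier (val LV z)" "h = sum_el LU LV z (x, y)" by (rule sum_ex)
    obtain d where d: "d \<in> carrier (val LW z)" "Loc_can T W V F z d = y" using WV.Loc_can_surj[OF F_coh factors_V[OF z] h(2)] by blast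
    have "Loc_can T W U F z d = x" using U.Loc_trivial[OF F_coh z h(1)] U.Loc_trivial[OF F_coh z LWU.tr_in[OF zo d(1)]] by simp
    then show "\<exists>g\<in>carrier (val LW z). La z g = h" using d h zo by (intro bexI[of _ d]) (auto simp: pair_apply)
  qed
next
  fix z assume z: "z \<in> V"
  then have zo: "z \<in> Obj T" by simp
  show "La.iso_at z" unfolding La.iso_at_def
  proof (intro conjI ballI impI)
    fix e assume "e \<in> carrier (val LW z)" "La z e = \<one>\<^bsub>val LN z\<^esub>"
    then show "e = \<one>\<^bsub>val LW z\<^esub>" using zo by (intro WU.Loc_can_inj[OF F_coh factors_U[OF z]]) (auto simp: pair_apply sum_one sum_eq_iff)
  next
    fix h assume "h \<in> carrier (val LN z)"
    then obtain x y where h: "x \<in> carrier (val LU z)" "y \<in> carrier (val LV z)" "h = sum_el LU LV z (x, y)" by (rule sum_ex)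
    obtain d where d: "d \<in> carrier (val LW z)" "Loc_can T W U F z d = x" using WU.Loc_can_surj[OF F_coh factors_U[OF z] h(1)] by blast
    have "Loc_can T W V F z d = y" using V.Loc_trivial[OF F_coh z h(2)] V.Loc_trivial[OF F_coh z LWV.tr_in[OF zo d(1)]] by simp
    then show "\<exists>g\<in>carrier (val LW z). La z g = h" using d h zo by (intro bexI[of _ d]) (auto simp: pair_apply)
  qed
qed

text \<open>The local conditions are checked by representing elements by sections of
  \<open>F\<close> on coverings, since the canonical morphisms leave such sections
  unchanged.\<close>

lemma snake_Loc: "snake T J LW LN LJ La Lb"
proof unfold_locales
  fix X k assume k: "X \<in> Obj T" "k \<in> carrier (val LW X)"
  obtain Z s x where s: "s \<in> W.cov Z X" "x \<in> carrier (val F Z)" "k = rho T W F X Z s x" using W.rho_ex[OF F_coh k] .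
  have "Loc_can T U J F X (Loc_can T W U F X k) = Loc_can T V J F X (Loc_can T W V F X k)"
    unfolding s(3) WU.Loc_can_rho[OF F_coh s(1,2)] WV.Loc_can_rho[OF F_coh s(1,2)]
      UJ.Loc_can_rho[OF F_coh WU.cov_mono[OF s(1)] s(2)] VJ.Loc_can_rho[OF F_coh WV.cov_mono[OF s(1)] s(2)] ..
  then show "Lb X (La X k) = \<one>\<^bsub>val LJ X\<^esub>" using k by (simp add: pair_apply diff_apply LJ.val_div_eq_one_iff)
next
  fix c k assume "c \<in> J" "k \<in> carrier (val LW c)" "La c k = \<one>\<^bsub>val LN c\<^esub>"
  then show "k = \<one>\<^bsub>val LW c\<^esub>" using La.iso_atD(1)[OF La_iso] by blast
next
  fix c n assume "c \<in> J" "n \<in> carrier (val LN c)"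
  then show "\<exists>k\<in>carrier (val LW c). La c k = n" using La.iso_atD(2)[OF La_iso] by blast
next
  fix c p assume c: "c \<in> J" "p \<in> carrier (val LJ c)"
  \<comment> \<open>\<open>L_J F\<close> is trivial on \<open>J\<close>, so the unit is a
    preimage.\<close>
  then show "\<exists>n\<in>carrier (val LN c). Lb c n = p"
    using J.Loc_trivial[OF F_coh c] by (intro bexI[of _ "\<one>\<^bsub>val LN c\<^esub>"]) auto
next
  fix X k assume k: "X \<in> Obj T" "k \<in> carrier (val LW X)" "La X k = \<one>\<^bsub>val LN X\<^esub>"
  obtain Z s x where s: "s \<in> W.cov Z X" "x \<in> carrier (val F Z)" "k = rho T W F X Z s x" using W.rho_ex[OF F_coh k(1,2)] .
  have ty: "Z \<in> Obj T" "s \<in> Mor T Z X" using W.cov_typed[OF s(1)] by auto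
  have "Loc_can T W U F X k = \<one>\<^bsub>val LU X\<^esub>" using k by (simp add: pair_apply sum_one sum_eq_iff)
  then have "rho T U F X Z s x = \<one>\<^bsub>val LU X\<^esub>" using WU.Loc_can_rho[OF F_coh s(1,2)] s(3) by metis
  then obtain Q u where u: "Q \<in> Obj T" "u \<in> Mor T Q Z" "Cmp T Q Z X s u \<in> U.cov Q X" "act F Q Z u x = \<one>\<^bsub>val F Q\<^esub>"
    using U.rho_eq_one_iff[OF F_coh WU.cov_mono[OF s(1)] s(2)] by blast
  \<comment> \<open>The covering for \<open>U\<close> on which \<open>x\<close> vanishes is also one
    for \<open>J\<close>. Restricted to it, \<open>k\<close> becomes the class of the restriction of
    \<open>x\<close> over the identity covering, which is zero.\<close>
  have "act LW Q X (Cmp T Q Z X s u) k = rho T W F Q Q (Idt T Q) (act F Q Z u x)" unfolding s(3)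
    by (rule W.rho_act[OF F_coh s(1,2) u(1) _ W.cov_idt[OF u(1)] u(2)]) (use u ty k in auto)
  also have "\<dots> = \<one>\<^bsub>val LW Q\<^esub>" unfolding u(4) by (rule W.rho_one[OF F_coh W.cov_idt[OF u(1)]])
  finally show "\<exists>X'. \<exists>s\<in>J.cov X' X. act LW X' X s k = \<one>\<^bsub>val LW X'\<^esub>" using UJ.cov_mono[OF u(3)] by blast
next
  fix X n assume n: "X \<in> Obj T" "n \<in> carrier (val LN X)" "Lb X n = \<one>\<^bsub>val LJ X\<^esub>"
  obtain e d where e: "e \<in> carrier (val LU X)" "d \<in> carrier (val LV X)" "n = sum_el LU LV X (e, d)" using n(2) by (rule sum_ex)
  obtain Z s x where s: "s \<in> U.cov Z X" "x \<in> carrier (val F Z)" "e = rho T U F X Z s x" using U.rho_ex[OF F_coh n(1) e(1)] .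
  obtain Z' s' x' where s': "s' \<in> V.cov Z' X" "x' \<in> carrier (val F Z')" "d = rho T V F X Z' s' x'" using V.rho_ex[OF F_coh n(1) e(2)] .
  have ty: "Z \<in> Obj T" "s \<in> Mor T Z X" "Z' \<in> Obj T" "s' \<in> Mor T Z' X" using U.cov_typed[OF s(1)] V.cov_typed[OF s'(1)] by auto
  have "Loc_can T U J F X e = Loc_can T V J F X d" using n e by (simp add: diff_apply LJ.val_div_eq_one_iff)
  then have "rho T J F X Z s x = rho T J F X Z' s' x'"
    unfolding s(3) s'(3) UJ.Loc_can_rho[OF F_coh s(1,2)] VJ.Loc_can_rho[OF F_coh s'(1,2)] .
  \<comment> \<open>Equal images in \<open>L_J F\<close> mean that \<open>x\<close> and
    \<open>x'\<close> coincide on a covering \<open>Q\<close> for \<open>J\<close>. Their common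
    restriction, taken over the identity covering of \<open>Q\<close>, defines the required element
    of \<open>L_W F(Q)\<close>.\<close>
  from J.rho_eqD[OF F_coh UJ.cov_mono[OF s(1)] s(2) VJ.cov_mono[OF s'(1)] s'(2) this]
  obtain Q u v where u: "Q \<in> Obj T" "u \<in> Mor T Q Z" "v \<in> Mor T Q Z'" "Cmp T Q Z X s u \<in> J.cov Q X"
    "Cmp T Q Z X s u = Cmp T Q Z' X s' v" "act F Q Z u x = act F Q Z' v x'" .
  let ?r = "Cmp T Q Z X s u" and ?x = "act F Q Z u x"
  have x: "?x \<in> carrier (val F Q)" using u(1,2) ty s by simp
  have r: "?r \<in> Mor T Q X" using u(1,2) ty n by simp
  have 1: "act LU Q X ?r e = rho T U F Q Q (Idt T Q) ?x" unfolding s(3)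
    by (rule U.rho_act[OF F_coh s(1,2) u(1) r U.cov_idt[OF u(1)] u(2)]) (use u(1,2) ty n in auto)
  have 2: "act LV Q X ?r d = rho T V F Q Q (Idt T Q) ?x" unfolding s'(3) u(6)
    by (rule V.rho_act[OF F_coh s'(1,2) u(1) r V.cov_idt[OF u(1)] u(3)]) (use u(1,3) ty n u(5) r in \<open>simp add: u(5)[symmetric]\<close>)
  have "La Q (rho T W F Q Q (Idt T Q) ?x) = act LN Q X ?r n"
    unfolding e(3) sum_act[OF e(1,2)] 1 2 pair_apply[OF u(1) W.rho_in[OF F_coh W.cov_idt[OF u(1)] x]]
      WU.Loc_can_rho[OF F_coh W.cov_idt[OF u(1)] x] WV.Loc_can_rho[OF F_coh W.cov_idt[OF u(1)] x] ..
  then show "\<exists>X'. \<exists>s\<in>J.cov X' X. \<exists>k\<in>carrier (val LW X'). La X' k = act LN X' X s n"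
    using u(4) W.rho_in[OF F_coh W.cov_idt[OF u(1)] x] by blast
next
  fix X p assume p: "X \<in> Obj T" "p \<in> carrier (val LJ X)"
  obtain Z s x where s: "s \<in> J.cov Z X" "x \<in> carrier (val F Z)" "p = rho T J F X Z s x" using J.rho_ex[OF F_coh p] .
  have ty: "Z \<in> Obj T" "s \<in> Mor T Z X" using J.cov_typed[OF s(1)] by auto
  have e: "rho T U F Z Z (Idt T Z) x \<in> carrier (val LU Z)" by (rule U.rho_in[OF F_coh U.cov_idt[OF ty(1)] s(2)])
  \<comment> \<open>Restricted to its own covering, \<open>p\<close> is represented over the
    identity, which is a covering for \<open>U\<close> as well.\<close>
  have "act LJ Z X s p = rho T J F Z Z (Idt T Z) (act F Z Z (Idt T Z) x)" unfolding s(3)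
    by (rule J.rho_act[OF F_coh s(1,2) ty J.cov_idt[OF ty(1)]]) (use ty p in auto)
  then have "Lb Z (sum_el LU LV Z (rho T U F Z Z (Idt T Z) x, \<one>\<^bsub>val LV Z\<^esub>)) = act LJ Z X s p"
    using ty s(2) e UJ.Loc_can_rho[OF F_coh U.cov_idt[OF ty(1)] s(2)] J.rho_in[OF F_coh J.cov_idt[OF ty(1)] s(2)] by (simp add: diff_apply)
  then show "\<exists>X'. \<exists>s\<in>J.cov X' X. \<exists>n\<in>carrier (val LN X'). Lb X' n = act LJ X' X s p"
    using s(1) e ty sum_in[OF e, of "\<one>\<^bsub>val LV Z\<^esub>" LV] by blast
qed


section \<open>The complex of colocalisations\<close>

abbreviation GW where "GW \<equiv> fob (Gam T W) F"
abbreviation GU where "GU \<equiv> fob (Gam T U) F"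
abbreviation GV where "GV \<equiv> fob (Gam T V) F"
abbreviation GJ where "GJ \<equiv> fob (Gam T J) F"
abbreviation GN where "GN \<equiv> sum_presheaf GU GV"
abbreviation Ga where "Ga \<equiv> pair_transf T (Gam T W) (Gam T U) (Gam T V) (Gam_can T W U) (Gam_can T W V) F"
abbreviation Gb where "Gb \<equiv> diff_transf T (Gam T U) (Gam T V) (Gam T J) (Gam_can T U J) (Gam_can T V J) F"

sublocale GW: coh T GW by (rule W.coh_Gam[OF F_coh])
sublocale GU: coh T GU by (rule U.coh_Gam[OF F_coh])
sublocale GV: coh T GV by (rule V.coh_Gam[OF F_coh])
sublocale GJ: coh T GJ by (rule J.coh_Gam[OF F_coh])
sublocale GN: coh T GN by (rule coh_sum[OF GU.coh_axioms GV.coh_axioms])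
sublocale GWU: pstr T GW GU "Gam_can T W U F" by unfold_locales (rule WU.Gam_can_transf[OF F_coh])
sublocale GWV: pstr T GW GV "Gam_can T W V F" by unfold_locales (rule WV.Gam_can_transf[OF F_coh])
sublocale GUJ: pstr T GU GJ "Gam_can T U J F" by unfold_locales (rule UJ.Gam_can_transf[OF F_coh])
sublocale GVJ: pstr T GV GJ "Gam_can T V J F" by unfold_locales (rule VJ.Gam_can_transf[OF F_coh])
sublocale CU: pstr T GU F "U.counit F" by unfold_locales (rule U.counit_transf[OF F_coh])
sublocale CV: pstr T GV F "V.counit F" by unfold_locales (rule V.counit_transf[OF F_coh])
sublocale CJ: pstr T GJ F "J.counit F" by unfold_locales (rule J.counit_transf[OF F_coh])
sublocale Ga: pstr T GW GN Ga
  by unfold_locales (use coh_nat_transfD(3)[OF pair_nat[OF WU.Gam_can_nat WV.Gam_can_nat] F_coh] in simp)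
sublocale Gb: pstr T GN GJ Gb
  by unfold_locales (use coh_nat_transfD(3)[OF diff_nat[OF UJ.Gam_can_nat VJ.Gam_can_nat] F_coh] in simp)

text \<open>The difference of the counits of \<open>U\<close> and \<open>V\<close>, with values in
  \<open>F\<close> instead of \<open>\<Gamma>_J F\<close>. The two targets agree on
  \<open>J\<close>, and in \<open>F\<close> the statements can be tested on elements
  directly.\<close>

definition eps where "eps = transf_comp T GN (J.counit F) Gb"

lemma eps_conv [simp]: "\<lbrakk>Y \<in> Obj T; n \<in> carrier (val GN Y)\<rbrakk> \<Longrightarrow> eps Y n = J.counit F Y (Gb Y n)"
  by (simp add: eps_def)

sublocale eps: pstr T GN F eps
  by unfold_locales (simp only: eps_def transf_comp_in[OF GN.psh_axioms Gb.transf CJ.transf])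

lemma eps_sum:
  "\<lbrakk>Y \<in> Obj T; p \<in> carrier (val GU Y); q \<in> carrier (val GV Y)\<rbrakk> \<Longrightarrow>
    eps Y (sum_el GU GV Y (p, q)) = U.counit F Y p \<otimes>\<^bsub>val F Y\<^esub> inv\<^bsub>val F Y\<^esub> (V.counit F Y q)"
  by (simp add: sum_in diff_apply CJ.tr_div UJ.counit_Gam_can[OF F_coh] VJ.counit_Gam_can[OF F_coh])

text \<open>At \<open>z\<close> in \<open>U\<close> the counit identifies
  \<open>\<Gamma>_U F(z)\<close> with \<open>F(z)\<close>, so \<open>eps\<close> is onto. Its kernel
  need not be zero, because of the summand \<open>\<Gamma>_V F(z)\<close>; but that summand is
  locally zero for the meet, and localisation removes it.\<close>

lemma Loc_eps_iso:
  assumes z: "z \<in> J" shows "coh_mor.iso_at (fob (Loc T W) GN) (fob (Loc T W) F) (fmor (Loc T W) GN F eps) z"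
proof -
  interpret LG: coh T "fob (Loc T W) GN" by (rule W.coh_Loc[OF GN.coh_axioms])
  interpret m: coh_mor T "fob (Loc T W) GN" "fob (Loc T W) F" "fmor (Loc T W) GN F eps"
    by unfold_locales (rule W.Loc_mor_transf[OF GN.coh_axioms F_coh eps.transf])
  note iso = W.Loc_mor_iso[OF GN.coh_axioms F_coh eps.transf]
  show ?thesis
  proof (rule m.iso_at_join[OF thick_U _ thick_V _ z])
    fix z assume z: "z \<in> U"
    show "m.iso_at z"
    proof (rule iso[where Q = U, OF U.cov_src _ _ z])
      show "t \<in> W.cov z' z \<Longrightarrow> t \<in> U.cov z' z" for z z' t by (rule WU.cov_mono)
      show "z \<in> Obj T" using z by simp
    next
      fix z y assume z: "z \<in> U" "y \<in> carrier (val F z)"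
      let ?p = "gam T U F z z (Idt T z) y"
      have p: "?p \<in> carrier (val GU z)" using z by (intro U.gam_in[OF F_coh]) auto
      have "eps z (sum_el GU GV z (?p, \<one>\<^bsub>val GV z\<^esub>)) = y"
        using z p by (simp add: eps_sum U.counit_gam[OF F_coh] del: eps_conv)
      then show "\<exists>g\<in>carrier (val GN z). eps z g = y" using p z by (meson sum_in GV.val_one U.sub_Obj)
    next
      fix z n assume z: "z \<in> U" and n: "n \<in> carrier (val GN z)" "eps z n = \<one>\<^bsub>val F z\<^esub>"
      obtain p q where pq: "p \<in> carrier (val GU z)" "q \<in> carrier (val GV z)" "n = sum_el GU GV z (p, q)" using n(1) by (rule sum_ex)
      \<comment> \<open>On a covering the second component vanishes. The first one is then killed by
        the counit, which is injective there because the covering stays inside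
        \<open>U\<close>.\<close>
      obtain Z t where t: "t \<in> W.cov Z z" "act GV Z z t q = \<one>\<^bsub>val GV Z\<^esub>"
        using WV.Gam_locally_zero[OF F_coh factors_V[OF z] pq(2)] .
      have ty: "Z \<in> Obj T" "t \<in> Mor T Z z" "z \<in> Obj T" using W.cov_typed[OF t(1)] by auto
      have tn: "act GN Z z t n = sum_el GU GV Z (act GU Z z t p, \<one>\<^bsub>val GV Z\<^esub>)" unfolding pq(3) sum_act[OF pq(1,2)] t(2) ..
      have "eps Z (act GN Z z t n) = \<one>\<^bsub>val F Z\<^esub>" using eps.tr_act[OF ty(1,3,2) n(1)] n(2) ty by simp
      then have "U.counit F Z (act GU Z z t p) = \<one>\<^bsub>val F Z\<^esub>"
        unfolding tn using pq(1) ty by (simp add: eps_sum del: eps_conv)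
      then have "act GU Z z t p = \<one>\<^bsub>val GU Z\<^esub>"
        using U.counit_inj[OF F_coh U.cov_src[OF WU.cov_mono[OF t(1)] z]] pq(1) ty by simp
      then show "\<exists>z'. \<exists>t\<in>W.cov z' z. act GN z' z t n = \<one>\<^bsub>val GN z'\<^esub>" using t(1) tn by (auto simp: sum_one)
    qed
  next
    fix z assume z: "z \<in> V"
    show "m.iso_at z"
    proof (rule iso[where Q = V, OF V.cov_src _ _ z])
      show "t \<in> W.cov z' z \<Longrightarrow> t \<in> V.cov z' z" for z z' t by (rule WV.cov_mono)
      show "z \<in> Obj T" using z by simp
    next
      fix z y assume z: "z \<in> V" "y \<in> carrier (val F z)"
      \<comment> \<open>\<open>eps\<close> subtracts the second component, hence the
        inverse.\<close>
      let ?q = "gam T V F z z (Idt T z) (inv\<^bsub>val F z\<^esub> y)"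
      have q: "?q \<in> carrier (val GV z)" using z by (intro V.gam_in[OF F_coh]) auto
      have "eps z (sum_el GU GV z (\<one>\<^bsub>val GU z\<^esub>, ?q)) = y"
        using z q by (simp add: eps_sum V.counit_gam[OF F_coh] group.inv_inv del: eps_conv)
      then show "\<exists>g\<in>carrier (val GN z). eps z g = y" using q z by (meson sum_in GU.val_one V.sub_Obj)
    next
      fix z n assume z: "z \<in> V" and n: "n \<in> carrier (val GN z)" "eps z n = \<one>\<^bsub>val F z\<^esub>"
      obtain p q where pq: "p \<in> carrier (val GU z)" "q \<in> carrier (val GV z)" "n = sum_el GU GV z (p, q)" using n(1) by (rule sum_ex)
      obtain Z t where t: "t \<in> W.cov Z z" "act GU Z z t p = \<one>\<^bsub>val GU Z\<^esub>"
        using WU.Gam_locally_zero[OF F_coh factors_U[OF z] pq(1)] .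
      have ty: "Z \<in> Obj T" "t \<in> Mor T Z z" "z \<in> Obj T" using W.cov_typed[OF t(1)] by auto
      have tn: "act GN Z z t n = sum_el GU GV Z (\<one>\<^bsub>val GU Z\<^esub>, act GV Z z t q)" unfolding pq(3) sum_act[OF pq(1,2)] t(2) ..
      have "eps Z (act GN Z z t n) = \<one>\<^bsub>val F Z\<^esub>" using eps.tr_act[OF ty(1,3,2) n(1)] n(2) ty by simp
      then have "\<one>\<^bsub>val F Z\<^esub> = V.counit F Z (act GV Z z t q)"
        unfolding tn using pq(2) ty F.val_div_eq_one_iff[of Z "\<one>\<^bsub>val F Z\<^esub>" "V.counit F Z (act GV Z z t q)"] by (simp add: eps_sum del: eps_conv)
      then have "act GV Z z t q = \<one>\<^bsub>val GV Z\<^esub>"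
        using V.counit_inj[OF F_coh V.cov_src[OF WV.cov_mono[OF t(1)] z]] pq(2) ty by simp
      then show "\<exists>z'. \<exists>t\<in>W.cov z' z. act GN z' z t n = \<one>\<^bsub>val GN z'\<^esub>" using t(1) tn by (auto simp: sum_one)
    qed
  qed
qed

text \<open>Surjectivity of the localised \<open>eps\<close> is read off at the class of
  \<open>x\<close> over the identity covering: the equality of classes holds on a common refinement
  \<open>Q\<close>.\<close>

lemma eps_local_surj:
  assumes z: "z \<in> J" and x: "x \<in> carrier (val F z)"
  obtains Z t n where "t \<in> W.cov Z z" "n \<in> carrier (val GN Z)" "eps Z n = act F Z z t x"
proof -
  interpret LG: coh T "fob (Loc T W) GN" by (rule W.coh_Loc[OF GN.coh_axioms])
  interpret m: coh_mor T "fob (Loc T W) GN" "fob (Loc T W) F" "fmor (Loc T W) GN F eps"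
    by unfold_locales (rule W.Loc_mor_transf[OF GN.coh_axioms F_coh eps.transf])
  have zo: "z \<in> Obj T" using z by simp
  note i = W.cov_idt[OF zo]
  obtain e where e: "e \<in> carrier (val (fob (Loc T W) GN) z)" "fmor (Loc T W) GN F eps z e = rho T W F z z (Idt T z) x"
    using m.iso_atD(2)[OF Loc_eps_iso[OF z] W.rho_in[OF F_coh i x]] by blast
  obtain Z s n where s: "s \<in> W.cov Z z" "n \<in> carrier (val GN Z)" "e = rho T W GN z Z s n" using W.rho_ex[OF GN.coh_axioms zo e(1)] .
  have ty: "Z \<in> Obj T" "s \<in> Mor T Z z" using W.cov_typed[OF s(1)] by auto
  have "rho T W F z Z s (eps Z n) = rho T W F z z (Idt T z) x"
    using W.rho_mor[OF GN.coh_axioms F_coh eps.transf s(1,2)] e(2) s(3) by metis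
  from W.rho_eqD[OF F_coh s(1) eps.tr_in[OF ty(1) s(2)] i x this]
  obtain Q u v where u: "Q \<in> Obj T" "u \<in> Mor T Q Z" "v \<in> Mor T Q z" "Cmp T Q Z z s u \<in> W.cov Q z"
    "Cmp T Q Z z s u = Cmp T Q z z (Idt T z) v" "act F Q Z u (eps Z n) = act F Q z v x" .
  have v: "v \<in> W.cov Q z" using u(1,3,4,5) zo by simp
  show ?thesis
    by (rule that[OF v, of "act GN Q Z u n"]) (use u(1,2,6) ty s(2) eps.tr_act[of Q Z u n] in auto)
qed

lemma eps_local_inj:
  assumes z: "z \<in> J" and n: "n \<in> carrier (val GN z)" "eps z n = \<one>\<^bsub>val F z\<^esub>"
  obtains Z t where "t \<in> W.cov Z z" "act GN Z z t n = \<one>\<^bsub>val GN Z\<^esub>"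
proof -
  interpret LG: coh T "fob (Loc T W) GN" by (rule W.coh_Loc[OF GN.coh_axioms])
  interpret m: coh_mor T "fob (Loc T W) GN" "fob (Loc T W) F" "fmor (Loc T W) GN F eps"
    by unfold_locales (rule W.Loc_mor_transf[OF GN.coh_axioms F_coh eps.transf])
  have zo: "z \<in> Obj T" using z by simp
  note i = W.cov_idt[OF zo]
  have "fmor (Loc T W) GN F eps z (rho T W GN z z (Idt T z) n) = \<one>\<^bsub>val LW z\<^esub>"
    unfolding W.rho_mor[OF GN.coh_axioms F_coh eps.transf i n(1)] n(2) by (rule W.rho_one[OF F_coh i])
  then have "rho T W GN z z (Idt T z) n = \<one>\<^bsub>val (fob (Loc T W) GN) z\<^esub>"
    by (rule m.iso_atD(1)[OF Loc_eps_iso[OF z] W.rho_in[OF GN.coh_axioms i n(1)]])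
  then obtain Q u where u: "Q \<in> Obj T" "u \<in> Mor T Q z" "Cmp T Q z z (Idt T z) u \<in> W.cov Q z" "act GN Q z u n = \<one>\<^bsub>val GN Q\<^esub>"
    using W.rho_eq_one_iff[OF GN.coh_axioms i n(1)] by blast
  show ?thesis by (rule that[OF _ u(4)]) (use u(1-3) zo in simp)
qed

text \<open>At objects of \<open>W\<close> all counits are bijective. Locally, \<open>X\<close> is
  arbitrary, but elements are represented by morphisms into objects of \<open>J\<close>, where
  \<open>eps\<close> is locally bijective; the coverings found there are pulled back to
  \<open>X\<close>.\<close>

lemma snake_Gam: "snake T W GW GN GJ Ga Gb"
proof unfold_locales
  fix X k assume k: "X \<in> Obj T" "k \<in> carrier (val GW X)"
  obtain Z g x where g: "Z \<in> W" "g \<in> Mor T X Z" "x \<in> carrier (val F Z)" "k = gam T W F X Z g x" using W.gam_ex[OF F_coh k(2)] .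
  have UV: "Z \<in> U" "Z \<in> V" using g(1) by (auto simp: thick_meet_def)
  have "Gam_can T U J F X (Gam_can T W U F X k) = Gam_can T V J F X (Gam_can T W V F X k)"
    unfolding g(4) WU.Gam_can_gam[OF F_coh k(1) g(1-3)] WV.Gam_can_gam[OF F_coh k(1) g(1-3)]
      UJ.Gam_can_gam[OF F_coh k(1) UV(1) g(2,3)] VJ.Gam_can_gam[OF F_coh k(1) UV(2) g(2,3)] ..
  then show "Gb X (Ga X k) = \<one>\<^bsub>val GJ X\<^esub>" using k by (simp add: pair_apply diff_apply GJ.val_div_eq_one_iff)
next
  fix c k assume c: "c \<in> W" and k: "k \<in> carrier (val GW c)" "Ga c k = \<one>\<^bsub>val GN c\<^esub>"
  have co: "c \<in> Obj T" using c by simp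
  have "Gam_can T W U F c k = \<one>\<^bsub>val GU c\<^esub>" using k co by (simp add: pair_apply sum_one sum_eq_iff)
  then have "W.counit F c k = \<one>\<^bsub>val F c\<^esub>" using WU.counit_Gam_can[OF F_coh co k(1)] co by simp
  then show "k = \<one>\<^bsub>val GW c\<^esub>" by (rule W.counit_inj[OF F_coh c k(1)])
next
  fix c n assume c: "c \<in> W" and n: "n \<in> carrier (val GN c)" "Gb c n = \<one>\<^bsub>val GJ c\<^esub>"
  have co: "c \<in> Obj T" "c \<in> U" "c \<in> V" using c by (auto simp: thick_meet_def)
  obtain p q where pq: "p \<in> carrier (val GU c)" "q \<in> carrier (val GV c)" "n = sum_el GU GV c (p, q)" using n(1) by (rule sum_ex)
  have "Gam_can T U J F c p = Gam_can T V J F c q" using n co pq by (simp add: diff_apply GJ.val_div_eq_one_iff)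
  \<comment> \<open>\<open>p\<close> and \<open>q\<close> correspond to one and the same element of
    \<open>F(c)\<close>, and the class of that element in \<open>\<Gamma>_W F(c)\<close> maps to
    both.\<close>
  then have e: "U.counit F c p = V.counit F c q"
    using UJ.counit_Gam_can[OF F_coh co(1) pq(1)] VJ.counit_Gam_can[OF F_coh co(1) pq(2)] by simp
  let ?x = "U.counit F c p"
  let ?k = "gam T W F c c (Idt T c) ?x"
  have x: "?x \<in> carrier (val F c)" using co pq by simp
  have i: "Idt T c \<in> Mor T c c" using co by simp
  have k: "?k \<in> carrier (val GW c)" by (rule W.gam_in[OF F_coh co(1) c i x])
  have "Ga c ?k = n"
    unfolding pair_apply[OF co(1) k] WU.Gam_can_gam[OF F_coh co(1) c i x] WV.Gam_can_gam[OF F_coh co(1) c i x] pq(3)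
      U.gam_idt[OF F_coh co(2) pq(1)] unfolding e V.gam_idt[OF F_coh co(3) pq(2)] ..
  then show "\<exists>k\<in>carrier (val GW c). Ga c k = n" using k by blast
next
  fix c p assume c: "c \<in> W" and p: "p \<in> carrier (val GJ c)"
  have co: "c \<in> Obj T" "c \<in> U" "c \<in> J" using c by (auto simp: thick_meet_def thick_join_def)
  have i: "Idt T c \<in> Mor T c c" using co by simp
  have x: "J.counit F c p \<in> carrier (val F c)" using p co by simp
  let ?p = "gam T U F c c (Idt T c) (J.counit F c p)"
  have p': "?p \<in> carrier (val GU c)" by (rule U.gam_in[OF F_coh co(1,2) i x])
  have "Gam_can T U J F c ?p = p" unfolding UJ.Gam_can_gam[OF F_coh co(1,2) i x] by (rule J.gam_idt[OF F_coh co(3) p])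
  then have "Gb c (sum_el GU GV c (?p, \<one>\<^bsub>val GV c\<^esub>)) = p" using p' co p by (simp add: diff_apply)
  then show "\<exists>n\<in>carrier (val GN c). Gb c n = p" using sum_in[OF p' GV.val_one[OF co(1)]] by blast
next
  fix X k assume k: "X \<in> Obj T" "k \<in> carrier (val GW X)" "Ga X k = \<one>\<^bsub>val GN X\<^esub>"
  obtain Z g x where g: "Z \<in> W" "g \<in> Mor T X Z" "x \<in> carrier (val F Z)" "k = gam T W F X Z g x" using W.gam_ex[OF F_coh k(2)] .
  \<comment> \<open>Restriction to the fibre of \<open>g\<close> kills every element represented by
    \<open>g\<close>.\<close>
  obtain X' t h where t: "(X', X, Z, t, g, h) \<in> Tri T" "t \<in> W.cov X' X" "X' \<in> Obj T" "t \<in> Mor T X' X" "Cmp T X' X Z g t = \<one>\<^bsub>Hom T X' Z\<^esub>"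
    using W.cov_kill[OF g(2) k(1) g(1)] .
  have "act GW X' X t k = \<one>\<^bsub>val GW X'\<^esub>" unfolding g(4) W.gam_act[OF F_coh t(3) k(1) g(1) t(4) g(2,3)] t(5)
    by (rule W.gam_zero[OF F_coh t(3) g(1,3)])
  then show "\<exists>X'. \<exists>s\<in>W.cov X' X. act GW X' X s k = \<one>\<^bsub>val GW X'\<^esub>" using t(2) by blast
next
  fix X n assume X: "X \<in> Obj T" and n: "n \<in> carrier (val GN X)" "Gb X n = \<one>\<^bsub>val GJ X\<^esub>"
  obtain p1 p2 where p12: "p1 \<in> carrier (val GU X)" "p2 \<in> carrier (val GV X)" "n = sum_el GU GV X (p1, p2)" using n(1) by (rule sum_ex)
  obtain A f x where A: "A \<in> U" "f \<in> Mor T X A" "x \<in> carrier (val F A)" "p1 = gam T U F X A f x" using U.gam_ex[OF F_coh p12(1)] .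
  obtain B g y where B: "B \<in> V" "g \<in> Mor T X B" "y \<in> carrier (val F B)" "p2 = gam T V F X B g y" using V.gam_ex[OF F_coh p12(2)] .
  have AB: "A \<in> J" "B \<in> J" "A \<in> Obj T" "B \<in> Obj T" using A(1) B(1) by (auto simp: thick_join_def)
  \<comment> \<open>\<open>n\<close> will be the restriction, along the morphism \<open>?m\<close>
    with components \<open>f\<close> and \<open>g\<close>, of an element \<open>?n\<close> on the
    biproduct \<open>P\<close>. As \<open>P\<close> lies in \<open>J\<close>, \<open>eps\<close> can
    be used there.\<close>
  obtain P i j p q where P: "P \<in> Obj T" "biproduct T A B P i j p q" using biproduct_ex[OF AB(3,4)] by blast
  have PJ: "P \<in> J" using J.sub_biproduct[OF AB(1,2) P] .
  have P': "i \<in> Mor T A P" "j \<in> Mor T B P" "p \<in> Mor T P A" "q \<in> Mor T P B" "Cmp T A P A p i = Idt T A" "Cmp T B P B q j = Idt T B"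
    using P(2) by (auto simp: biproduct_def)
  note orth = biproduct_orth[OF P(2) AB(3,4) P(1)]
  let ?m = "Cmp T X A P i f \<otimes>\<^bsub>Hom T X P\<^esub> Cmp T X B P j g"
  note [simp] = X AB(3,4) P(1) P'(1-4) A(2) B(2)
  have m: "?m \<in> Mor T X P" by simp
  have pm: "Cmp T X P A p ?m = f" "Cmp T X P B q ?m = g"
    using P'(5,6) orth by (simp_all add: cmp_add_right cmp_assoc[symmetric] monoid.l_one monoid.r_one group.is_monoid)
  let ?n = "sum_el GU GV P (gam T U F P A p x, gam T V F P B q y)"
  have n0: "gam T U F P A p x \<in> carrier (val GU P)" "gam T V F P B q y \<in> carrier (val GV P)"
    using U.gam_in[OF F_coh P(1) A(1) _ A(3)] V.gam_in[OF F_coh P(1) B(1) _ B(3)] by simp_all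
  then have n1: "?n \<in> carrier (val GN P)" by (rule sum_in)
  have mn: "act GN X P ?m ?n = n"
    unfolding sum_act[OF n0] U.gam_act[OF F_coh X P(1) A(1) m P'(3) A(3)] V.gam_act[OF F_coh X P(1) B(1) m P'(4) B(3)] pm
      p12(3) A(4) B(4) ..
  have bn: "Gb P ?n \<in> carrier (val GJ P)" using n1 by simp
  let ?y = "J.counit F P (Gb P ?n)"
  have y: "?y \<in> carrier (val F P)" using bn by simp
  \<comment> \<open>The vanishing of \<open>Gb n\<close> is rewritten as the vanishing of the class
    of \<open>?m\<close> at \<open>?y\<close>. The resulting \<open>u\<close> kills
    \<open>?m\<close>, while \<open>?y\<close> comes from its target; so \<open>X\<close> maps to
    the fibre \<open>H\<close> of \<open>u\<close>, on which \<open>?y\<close> vanishes.\<close>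
  have "gam T J F X P ?m ?y = act GJ X P ?m (gam T J F P P (Idt T P) ?y)"
    using J.gam_act[OF F_coh X P(1) PJ m idt_in[OF P(1)] y] m by simp
  also have "\<dots> = act GJ X P ?m (Gb P ?n)" unfolding J.gam_idt[OF F_coh PJ bn] ..
  also have "\<dots> = Gb X (act GN X P ?m ?n)" using Gb.tr_act[OF X P(1) m n1] by simp
  also have "\<dots> = \<one>\<^bsub>val GJ X\<^esub>" unfolding mn n(2) ..
  finally obtain Z u z where u: "Z \<in> J" "u \<in> Mor T P Z" "z \<in> carrier (val F Z)" "act F P Z u z = ?y" "Cmp T X P Z u ?m = \<one>\<^bsub>Hom T X Z\<^esub>"
    using J.gam_eq_one_iff[OF F_coh X PJ m y] by blast
  have Zo: "Z \<in> Obj T" using u(1) by simp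
  obtain H h w where H: "(H, P, Z, h, u, w) \<in> Tri T" using fibre_ex[OF P(1) Zo u(2)] by blast
  have HJ: "H \<in> J" "H \<in> Obj T" "h \<in> Mor T H P" using J.sub_tri(2)[OF H PJ u(1)] Tri_typed[OF H] by auto
  obtain m1 where m1: "m1 \<in> Mor T X H" "Cmp T X H P h m1 = ?m" using weak_kernel[OF H X m u(5)] by blast
  let ?h = "act GN H P h ?n"
  have hn: "?h \<in> carrier (val GN H)" using n1 HJ by simp
  have "eps H ?h = act F H P h ?y" using eps.tr_act[OF HJ(2) P(1) HJ(3) n1] n1 by simp
  also have "\<dots> = \<one>\<^bsub>val F H\<^esub>" unfolding u(4)[symmetric] by (rule F.act_cmp_zero[OF tri_zero[OF H]]) (use HJ Zo u in auto)
  finally obtain H' t where t: "t \<in> W.cov H' H" "act GN H' H t ?h = \<one>\<^bsub>val GN H'\<^esub>" using eps_local_inj[OF HJ(1) hn] by blast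
  obtain X' s f' where s: "X' \<in> Obj T" "s \<in> W.cov X' X" "s \<in> Mor T X' X" "f' \<in> Mor T X' H'" "Cmp T X' H' H t f' = Cmp T X' X H m1 s"
    using W.cov_pull[OF t(1) m1(1) X] .
  have t': "H' \<in> Obj T" "t \<in> Mor T H' H" using W.cov_typed[OF t(1)] by auto
  \<comment> \<open>So \<open>n\<close> itself becomes zero on a covering: \<open>Gb\<close> is
    locally injective, and the preimage in \<open>\<Gamma>_W F\<close> is the unit.\<close>
  have "act GN X' X s n = act GN X' X s (act GN X H m1 ?h)"
    unfolding mn[symmetric] m1(2)[symmetric] using m1(1) HJ n1 by (simp add: GN.act_cmp del: sum_in)
  also have "\<dots> = act GN X' H' f' (act GN H' H t ?h)"
    by (rule GN.act_square[OF s(5)[symmetric]]) (use s m1 t' HJ hn in auto)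
  also have "\<dots> = \<one>\<^bsub>val GN X'\<^esub>" unfolding t(2) using s t' by simp
  finally have "Ga X' \<one>\<^bsub>val GW X'\<^esub> = act GN X' X s n" using s by simp
  then show "\<exists>X'. \<exists>s\<in>W.cov X' X. \<exists>k\<in>carrier (val GW X'). Ga X' k = act GN X' X s n" using s(1,2) GW.val_one by blast
next
  fix X p assume X: "X \<in> Obj T" and p: "p \<in> carrier (val GJ X)"
  obtain Z g x where g: "Z \<in> J" "g \<in> Mor T X Z" "x \<in> carrier (val F Z)" "p = gam T J F X Z g x" using J.gam_ex[OF F_coh p] .
  \<comment> \<open>The representing object \<open>Z\<close> lies in \<open>J\<close>, so
    \<open>x\<close> lifts along \<open>eps\<close> on a covering of \<open>Z\<close>, which is then
    pulled back to \<open>X\<close>.\<close>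
  obtain Z' t n where t: "t \<in> W.cov Z' Z" "n \<in> carrier (val GN Z')" "eps Z' n = act F Z' Z t x" using eps_local_surj[OF g(1,3)] .
  obtain X' s g' where s: "X' \<in> Obj T" "s \<in> W.cov X' X" "s \<in> Mor T X' X" "g' \<in> Mor T X' Z'" "Cmp T X' Z' Z t g' = Cmp T X' X Z g s"
    using W.cov_pull[OF t(1) g(2) X] .
  have Z': "Z' \<in> Obj T" "t \<in> Mor T Z' Z" "Z \<in> Obj T" using W.cov_typed[OF t(1)] by auto
  have Z'J: "Z' \<in> J" using J.cov_src[OF UJ.cov_mono[OF WU.cov_mono[OF t(1)]] g(1)] .
  have bn: "Gb Z' n \<in> carrier (val GJ Z')" using t(2) Z' by simp
  have tx: "act F Z' Z t x \<in> carrier (val F Z')" using Z' g by simp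
  \<comment> \<open>On \<open>J\<close> an element of \<open>\<Gamma>_J F\<close> is recovered from
    its counit, so the value of \<open>eps\<close> determines that of \<open>Gb\<close>.\<close>
  have "Gb Z' n = gam T J F Z' Z' (Idt T Z') (act F Z' Z t x)"
    using J.gam_idt[OF F_coh Z'J bn] t(2,3) Z' by simp
  then have "Gb X' (act GN X' Z' g' n) = act GJ X' Z' g' (gam T J F Z' Z' (Idt T Z') (act F Z' Z t x))"
    using Gb.tr_act[OF s(1) Z'(1) s(4) t(2)] by simp
  also have "\<dots> = gam T J F X' Z' g' (act F Z' Z t x)"
    using J.gam_act[OF F_coh s(1) Z'(1) Z'J s(4) idt_in[OF Z'(1)] tx] s Z' by simp
  also have "\<dots> = gam T J F X' Z (Cmp T X' Z' Z t g') x" by (rule J.gam_push[OF F_coh s(1) Z'J g(1) Z'(2) s(4) g(3)])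
  also have "\<dots> = act GJ X' X s p" unfolding s(5) g(4) by (rule J.gam_act[OF F_coh s(1) X g(1) s(3) g(2,3), symmetric])
  finally show "\<exists>X'. \<exists>s\<in>W.cov X' X. \<exists>n\<in>carrier (val GN X'). Gb X' n = act GJ X' X s p"
    using s(1,2,4) t(2) Z'(1) GN.act_in by blast
qed

end

theorem proposition3p7:
  fixes T :: "('o, 'm) tcat" and U V :: "'o set"
  assumes "triangulated_category T"
    and "infinite (UNIV :: 'x set)"
    and "essentially_small TYPE('x) T"
    and "thick T U" and "thick T V"
    and "commuting_pair T U V"
  shows "(\<exists>\<delta> :: ('o, 'm, 'x) coh_transf.
            long_exact T (Loc T (thick_meet T U V)) (sum_func T (Loc T U) (Loc T V)) (Loc T (thick_join T U V))
              (pair_transf T (Loc T (thick_meet T U V)) (Loc T U) (Loc T V)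
                 (Loc_can T (thick_meet T U V) U) (Loc_can T (thick_meet T U V) V))
              (diff_transf T (Loc T U) (Loc T V) (Loc T (thick_join T U V))
                 (Loc_can T U (thick_join T U V)) (Loc_can T V (thick_join T U V)))
              \<delta>) \<and>
         (\<exists>\<delta> :: ('o, 'm, 'x) coh_transf.
            long_exact T (Gam T (thick_meet T U V)) (sum_func T (Gam T U) (Gam T V)) (Gam T (thick_join T U V))
              (pair_transf T (Gam T (thick_meet T U V)) (Gam T U) (Gam T V)
                 (Gam_can T (thick_meet T U V) U) (Gam_can T (thick_meet T U V) V))
              (diff_transf T (Gam T U) (Gam T V) (Gam T (thick_join T U V))
                 (Gam_can T U (thick_join T U V)) (Gam_can T V (thick_join T U V)))
              \<delta>)"
proof -
  interpret triangulated_category T by fact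
  interpret commuting T "TYPE('x)" U V by unfold_locales (fact+)
  have Loc: "snake T J (fob (Loc T W) F) (fob (sum_func T (Loc T U) (Loc T V)) F) (fob (Loc T J) F)
      (pair_transf T (Loc T W) (Loc T U) (Loc T V) (Loc_can T W U) (Loc_can T W V) F)
      (diff_transf T (Loc T U) (Loc T V) (Loc T J) (Loc_can T U J) (Loc_can T V J) F)" (is "?L F")
    and Gam: "snake T W (fob (Gam T W) F) (fob (sum_func T (Gam T U) (Gam T V)) F) (fob (Gam T J) F)
      (pair_transf T (Gam T W) (Gam T U) (Gam T V) (Gam_can T W U) (Gam_can T W V) F)
      (diff_transf T (Gam T U) (Gam T V) (Gam T J) (Gam_can T U J) (Gam_can T V J) F)" (is "?G F")
    if "coh T F" for F :: "('o, 'm, 'x) presheaf"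
  proof -
    interpret commuting_coh T "TYPE('x)" U V F by (intro commuting_coh.intro commuting_axioms that)
    show "?L F" "?G F" unfolding sum_func_fob by (rule snake_Loc, rule snake_Gam)
  qed
  show ?thesis
    using J.long_exactI[OF pair_nat[OF WU.Loc_can_nat WV.Loc_can_nat] diff_nat[OF UJ.Loc_can_nat VJ.Loc_can_nat] Loc]
      W.long_exactI[OF pair_nat[OF WU.Gam_can_nat WV.Gam_can_nat] diff_nat[OF UJ.Gam_can_nat VJ.Gam_can_nat] Gam]
    by (rule conjI)
qed

end
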